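(* Every model structure on $\mathrm{DblCat}$ whose trivial fibrations are exactly the canonical trivial fibrations is left proper.
   Context: All double categories are small and strict (internal categories in $\mathrm{Cat}$): they have objects, horizontal morphisms, vertical morphisms, and squares. $\mathrm{DblCat}$ is the category of double categories and double functors. A double functor is a *canonical trivial fibration* if it is surjective on objects, full on horizontal morphisms, full on vertical morphisms, and fully faithful on squares (bijective on squares with any given boundary in the source). *)

theory Defs
  imports Main "HOL-Library.FuncSet"
begin

unbundle cardinal_syntax

section \<open>Categories\<close>

text \<open>The fields are only meaningful on the carriers: \<open>Comp C g f\<close> is the composite
  ``\<open>f\<close> then \<open>g\<close>'' and is unconstrained unless \<open>Cod C f = Dom C g\<close>.\<close>

record ('o, 'm) cat =
  Obj :: "'o set"
  Arr :: "'m set"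
  Dom :: "'m \<Rightarrow> 'o"
  Cod :: "'m \<Rightarrow> 'o"
  Idt :: "'o \<Rightarrow> 'm"
  Comp :: "'m \<Rightarrow> 'm \<Rightarrow> 'm"

definition category :: "('o, 'm) cat \<Rightarrow> bool" where
  "category C \<longleftrightarrow>
     (\<forall>f\<in>Arr C. Dom C f \<in> Obj C \<and> Cod C f \<in> Obj C) \<and>
     (\<forall>x\<in>Obj C. Idt C x \<in> Arr C \<and> Dom C (Idt C x) = x \<and> Cod C (Idt C x) = x) \<and>
     (\<forall>f\<in>Arr C. \<forall>g\<in>Arr C. Cod C f = Dom C g \<longrightarrow>
        Comp C g f \<in> Arr C \<and> Dom C (Comp C g f) = Dom C f \<and> Cod C (Comp C g f) = Cod C g) \<and>
     (\<forall>f\<in>Arr C. Comp C f (Idt C (Dom C f)) = f \<and> Comp C (Idt C (Cod C f)) f = f) \<and>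
     (\<forall>f\<in>Arr C. \<forall>g\<in>Arr C. \<forall>h\<in>Arr C. Cod C f = Dom C g \<longrightarrow> Cod C g = Dom C h \<longrightarrow>
        Comp C h (Comp C g f) = Comp C (Comp C h g) f)"

definition is_functor ::
  "('o, 'm) cat \<Rightarrow> ('p, 'n) cat \<Rightarrow> ('o \<Rightarrow> 'p) \<Rightarrow> ('m \<Rightarrow> 'n) \<Rightarrow> bool" where
  "is_functor C D Fo Fa \<longleftrightarrow>
     (\<forall>x\<in>Obj C. Fo x \<in> Obj D \<and> Fa (Idt C x) = Idt D (Fo x)) \<and>
     (\<forall>f\<in>Arr C. Fa f \<in> Arr D \<and> Dom D (Fa f) = Fo (Dom C f) \<and> Cod D (Fa f) = Fo (Cod C f)) \<and>
     (\<forall>f\<in>Arr C. \<forall>g\<in>Arr C. Cod C f = Dom C g \<longrightarrow> Fa (Comp C g f) = Comp D (Fa g) (Fa f))"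

definition arr_betw :: "('o, 'm) cat \<Rightarrow> 'o \<Rightarrow> 'o \<Rightarrow> 'm set" where
  "arr_betw C x y = {f \<in> Arr C. Dom C f = x \<and> Cod C f = y}"

section \<open>Model structures\<close>

text \<open>Commutative squares
  \<^verbatim>\<open>
      A --f--> B
      |        |
      g        h
      v        v
      C --k--> D
  \<close>\<close>

definition commutative_square :: "('o, 'm) cat \<Rightarrow> 'm \<Rightarrow> 'm \<Rightarrow> 'm \<Rightarrow> 'm \<Rightarrow> bool" where
  "commutative_square C f g h k \<longleftrightarrow>
     f \<in> Arr C \<and> g \<in> Arr C \<and> h \<in> Arr C \<and> k \<in> Arr C \<and>
     Dom C f = Dom C g \<and> Cod C f = Dom C h \<and> Cod C g = Dom C k \<and> Cod C h = Cod C k \<and>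
     Comp C h f = Comp C k g"

definition pushout_square :: "('o, 'm) cat \<Rightarrow> 'm \<Rightarrow> 'm \<Rightarrow> 'm \<Rightarrow> 'm \<Rightarrow> bool" where
  "pushout_square C f g h k \<longleftrightarrow>
     commutative_square C f g h k \<and>
     (\<forall>h' k'. commutative_square C f g h' k' \<longrightarrow>
        (\<exists>!u. u \<in> arr_betw C (Cod C h) (Cod C h') \<and> Comp C u h = h' \<and> Comp C u k = k'))"

definition has_lifting :: "('o, 'm) cat \<Rightarrow> 'm \<Rightarrow> 'm \<Rightarrow> bool" where
  "has_lifting C i p \<longleftrightarrow>
     (\<forall>u v. commutative_square C u i p v \<longrightarrow>
        (\<exists>l \<in> arr_betw C (Cod C i) (Dom C p). Comp C l i = u \<and> Comp C p l = v))"

definition retract_of :: "('o, 'm) cat \<Rightarrow> 'm \<Rightarrow> 'm \<Rightarrow> bool" where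
  "retract_of C f g \<longleftrightarrow>
     (\<exists>s r s' r'. commutative_square C s f g s' \<and> commutative_square C r g f r' \<and>
        Comp C r s = Idt C (Dom C f) \<and> Comp C r' s' = Idt C (Cod C f))"

definition closed_under_retracts :: "('o, 'm) cat \<Rightarrow> 'm set \<Rightarrow> bool" where
  "closed_under_retracts C X \<longleftrightarrow> (\<forall>f g. retract_of C f g \<longrightarrow> g \<in> X \<longrightarrow> f \<in> X)"

definition two_of_three :: "('o, 'm) cat \<Rightarrow> 'm set \<Rightarrow> bool" where
  "two_of_three C X \<longleftrightarrow>
     (\<forall>f\<in>Arr C. \<forall>g\<in>Arr C. Cod C f = Dom C g \<longrightarrow>
        (f \<in> X \<and> g \<in> X \<longrightarrow> Comp C g f \<in> X) \<and>
        (f \<in> X \<and> Comp C g f \<in> X \<longrightarrow> g \<in> X) \<and>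
        (g \<in> X \<and> Comp C g f \<in> X \<longrightarrow> f \<in> X))"

text \<open>Quillen's axioms for classes \<open>W\<close> (weak equivalences), \<open>Cof\<close> (cofibrations) and
  \<open>Fib\<close> (fibrations). Existence of limits and colimits is a property of the category \<open>C\<close>
  and not part of the structure; factorizations need not be functorial.\<close>

definition model_structure :: "('o, 'm) cat \<Rightarrow> 'm set \<Rightarrow> 'm set \<Rightarrow> 'm set \<Rightarrow> bool" where
  "model_structure C W Cof Fib \<longleftrightarrow>
     W \<subseteq> Arr C \<and> Cof \<subseteq> Arr C \<and> Fib \<subseteq> Arr C \<and>
     two_of_three C W \<and>
     closed_under_retracts C W \<and> closed_under_retracts C Cof \<and> closed_under_retracts C Fib \<and>
     (\<forall>i \<in> Cof \<inter> W. \<forall>p \<in> Fib. has_lifting C i p) \<and>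
     (\<forall>i \<in> Cof. \<forall>p \<in> Fib \<inter> W. has_lifting C i p) \<and>
     (\<forall>f \<in> Arr C. \<exists>i \<in> Cof \<inter> W. \<exists>p \<in> Fib. Cod C i = Dom C p \<and> Comp C p i = f) \<and>
     (\<forall>f \<in> Arr C. \<exists>i \<in> Cof. \<exists>p \<in> Fib \<inter> W. Cod C i = Dom C p \<and> Comp C p i = f)"

definition left_proper :: "('o, 'm) cat \<Rightarrow> 'm set \<Rightarrow> 'm set \<Rightarrow> bool" where
  "left_proper C W Cof \<longleftrightarrow>
     (\<forall>w i j w'. pushout_square C w i j w' \<longrightarrow> w \<in> W \<longrightarrow> i \<in> Cof \<longrightarrow> w' \<in> W)"

section \<open>Double categories\<close>

text \<open>The four underlying categories of a double category:
  \<^item> \<open>HC\<close>: objects and horizontal morphisms;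
  \<^item> \<open>VC\<close>: objects and vertical morphisms;
  \<^item> \<open>HS\<close>: vertical morphisms and squares, under horizontal composition of squares,
    so \<open>Dom (HS D)\<close> and \<open>Cod (HS D)\<close> are the left and right boundaries;
  \<^item> \<open>VS\<close>: horizontal morphisms and squares, under vertical composition of squares,
    so \<open>Dom (VS D)\<close> and \<open>Cod (VS D)\<close> are the top and bottom boundaries.\<close>

record 'a dblcat =
  HC :: "('a, 'a) cat"
  VC :: "('a, 'a) cat"
  HS :: "('a, 'a) cat"
  VS :: "('a, 'a) cat"

abbreviation Ob :: "'a dblcat \<Rightarrow> 'a set" where "Ob D \<equiv> Obj (HC D)"
abbreviation Hor :: "'a dblcat \<Rightarrow> 'a set" where "Hor D \<equiv> Arr (HC D)"
abbreviation Ver :: "'a dblcat \<Rightarrow> 'a set" where "Ver D \<equiv> Arr (VC D)"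
abbreviation Sq :: "'a dblcat \<Rightarrow> 'a set" where "Sq D \<equiv> Arr (HS D)"

text \<open>An internal category in \<open>Cat\<close> with category of objects \<open>VC D\<close> and category of
  morphisms \<open>VS D\<close>: the left, right and horizontal identity maps are functors, and the last
  four lines say that horizontal composition is a functor from the category of composable
  pairs \<open>VS D \<times>\<^bsub>VC D\<^esub> VS D\<close> to \<open>VS D\<close> (preservation of tops and bottoms, of vertical
  identities, and of vertical composites, i.e. interchange). The internal category axioms
  are those of the categories \<open>HC D\<close> and \<open>HS D\<close>.\<close>

definition double_category :: "'a dblcat \<Rightarrow> bool" where
  "double_category D \<longleftrightarrow>
     category (HC D) \<and> category (VC D) \<and> category (HS D) \<and> category (VS D) \<and>
     Obj (VC D) = Ob D \<and> Obj (HS D) = Ver D \<and> Obj (VS D) = Hor D \<and> Arr (VS D) = Sq D \<and>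
     is_functor (VS D) (VC D) (Dom (HC D)) (Dom (HS D)) \<and>
     is_functor (VS D) (VC D) (Cod (HC D)) (Cod (HS D)) \<and>
     is_functor (VC D) (VS D) (Idt (HC D)) (Idt (HS D)) \<and>
     (\<forall>\<alpha>\<in>Sq D. \<forall>\<beta>\<in>Sq D. Cod (HS D) \<alpha> = Dom (HS D) \<beta> \<longrightarrow>
        Dom (VS D) (Comp (HS D) \<beta> \<alpha>) = Comp (HC D) (Dom (VS D) \<beta>) (Dom (VS D) \<alpha>) \<and>
        Cod (VS D) (Comp (HS D) \<beta> \<alpha>) = Comp (HC D) (Cod (VS D) \<beta>) (Cod (VS D) \<alpha>)) \<and>
     (\<forall>f\<in>Hor D. \<forall>g\<in>Hor D. Cod (HC D) f = Dom (HC D) g \<longrightarrow>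
        Idt (VS D) (Comp (HC D) g f) = Comp (HS D) (Idt (VS D) g) (Idt (VS D) f)) \<and>
     (\<forall>\<alpha>\<in>Sq D. \<forall>\<beta>\<in>Sq D. \<forall>\<gamma>\<in>Sq D. \<forall>\<delta>\<in>Sq D.
        Cod (HS D) \<alpha> = Dom (HS D) \<beta> \<longrightarrow> Cod (HS D) \<gamma> = Dom (HS D) \<delta> \<longrightarrow>
        Cod (VS D) \<alpha> = Dom (VS D) \<gamma> \<longrightarrow> Cod (VS D) \<beta> = Dom (VS D) \<delta> \<longrightarrow>
        Comp (VS D) (Comp (HS D) \<delta> \<gamma>) (Comp (HS D) \<beta> \<alpha>) =
        Comp (HS D) (Comp (VS D) \<delta> \<beta>) (Comp (VS D) \<gamma> \<alpha>))"

text \<open>Squares with top \<open>f\<close>, bottom \<open>g\<close>, left \<open>u\<close> and right \<open>v\<close>.\<close>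

definition squares :: "'a dblcat \<Rightarrow> 'a \<Rightarrow> 'a \<Rightarrow> 'a \<Rightarrow> 'a \<Rightarrow> 'a set" where
  "squares D f g u v = {\<alpha> \<in> Sq D. Dom (VS D) \<alpha> = f \<and> Cod (VS D) \<alpha> = g \<and>
                                  Dom (HS D) \<alpha> = u \<and> Cod (HS D) \<alpha> = v}"

definition square_boundary :: "'a dblcat \<Rightarrow> 'a \<Rightarrow> 'a \<Rightarrow> 'a \<Rightarrow> 'a \<Rightarrow> bool" where
  "square_boundary D f g u v \<longleftrightarrow>
     f \<in> Hor D \<and> g \<in> Hor D \<and> u \<in> Ver D \<and> v \<in> Ver D \<and>
     Dom (HC D) f = Dom (VC D) u \<and> Cod (HC D) f = Dom (VC D) v \<and>
     Dom (HC D) g = Cod (VC D) u \<and> Cod (HC D) g = Cod (VC D) v"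

section \<open>Double functors\<close>

record 'a dblfun =
  Src :: "'a dblcat"
  Trg :: "'a dblcat"
  onOb :: "'a \<Rightarrow> 'a"
  onHor :: "'a \<Rightarrow> 'a"
  onVer :: "'a \<Rightarrow> 'a"
  onSq :: "'a \<Rightarrow> 'a"

text \<open>The underlying maps are required to be \<open>extensional\<close>, so that equality of records is
  equality of double functors.\<close>

definition double_functor :: "'a dblfun \<Rightarrow> bool" where
  "double_functor F \<longleftrightarrow>
     double_category (Src F) \<and> double_category (Trg F) \<and>
     onOb F \<in> extensional (Ob (Src F)) \<and> onHor F \<in> extensional (Hor (Src F)) \<and>
     onVer F \<in> extensional (Ver (Src F)) \<and> onSq F \<in> extensional (Sq (Src F)) \<and>
     is_functor (HC (Src F)) (HC (Trg F)) (onOb F) (onHor F) \<and>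
     is_functor (VC (Src F)) (VC (Trg F)) (onOb F) (onVer F) \<and>
     is_functor (HS (Src F)) (HS (Trg F)) (onVer F) (onSq F) \<and>
     is_functor (VS (Src F)) (VS (Trg F)) (onHor F) (onSq F)"

definition dblfun_id :: "'a dblcat \<Rightarrow> 'a dblfun" where
  "dblfun_id D = \<lparr>Src = D, Trg = D,
     onOb = restrict id (Ob D), onHor = restrict id (Hor D),
     onVer = restrict id (Ver D), onSq = restrict id (Sq D)\<rparr>"

definition dblfun_comp :: "'a dblfun \<Rightarrow> 'a dblfun \<Rightarrow> 'a dblfun" where
  "dblfun_comp G F = \<lparr>Src = Src F, Trg = Trg G,
     onOb = compose (Ob (Src F)) (onOb G) (onOb F),
     onHor = compose (Hor (Src F)) (onHor G) (onHor F),
     onVer = compose (Ver (Src F)) (onVer G) (onVer F),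
     onSq = compose (Sq (Src F)) (onSq G) (onSq F)\<rparr>"

definition canonical_trivial_fibration :: "'a dblfun \<Rightarrow> bool" where
  "canonical_trivial_fibration F \<longleftrightarrow>
     double_functor F \<and>
     onOb F ` Ob (Src F) = Ob (Trg F) \<and>
     (\<forall>x\<in>Ob (Src F). \<forall>y\<in>Ob (Src F).
        onHor F ` arr_betw (HC (Src F)) x y = arr_betw (HC (Trg F)) (onOb F x) (onOb F y)) \<and>
     (\<forall>x\<in>Ob (Src F). \<forall>y\<in>Ob (Src F).
        onVer F ` arr_betw (VC (Src F)) x y = arr_betw (VC (Trg F)) (onOb F x) (onOb F y)) \<and>
     (\<forall>f g u v. square_boundary (Src F) f g u v \<longrightarrow>
        bij_betw (onSq F) (squares (Src F) f g u v)
          (squares (Trg F) (onHor F f) (onHor F g) (onVer F u) (onVer F v)))"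

section \<open>The category of small double categories\<close>

text \<open>Small sets are the subsets of \<open>'a\<close> of cardinality less than that of \<open>'a\<close>, where the
  cardinality of \<open>'a\<close> is uncountable and regular. The small sets of a Grothendieck universe
  are the case of an inaccessible cardinality. That \<open>'a\<close> is in addition a strong limit is
  deliberately not demanded: HOL cannot prove that such a type exists, whereas
  \<open>universe_suc\<close> below exhibits a type satisfying the present condition.\<close>

definition universe :: "'a itself \<Rightarrow> bool" where
  "universe (_ :: 'a itself) \<longleftrightarrow> natLeq <o |UNIV :: 'a set| \<and> regularCard |UNIV :: 'a set|"

definition small :: "'a set \<Rightarrow> bool" where
  "small A \<longleftrightarrow> |A| <o |UNIV :: 'a set|"

definition small_dblcat :: "'a dblcat \<Rightarrow> bool" where
  "small_dblcat D \<longleftrightarrow>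
     double_category D \<and> small (Ob D) \<and> small (Hor D) \<and> small (Ver D) \<and> small (Sq D)"

text \<open>Objects that differ only in the values of their operations off the carriers are
  isomorphic, so \<open>DblCat\<close> is the usual category up to equivalence.\<close>

definition DblCat :: "('a dblcat, 'a dblfun) cat" where
  "DblCat = \<lparr>Obj = Collect small_dblcat,
     Arr = {F. double_functor F \<and> small_dblcat (Src F) \<and> small_dblcat (Trg F)},
     Dom = Src, Cod = Trg, Idt = dblfun_id, Comp = dblfun_comp\<rparr>"

lemma is_functor_id:
  assumes "category C" "Obj C = X" "Arr C = Y"
  shows "is_functor C C (restrict id X) (restrict id Y)"
  using assms unfolding is_functor_def category_def by auto

lemma is_functor_comp:
  assumes "category C" "is_functor C D Fo Fa" "is_functor D E Go Ga" "Obj C = X" "Arr C = Y"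
  shows "is_functor C E (compose X Go Fo) (compose Y Ga Fa)"
  using assms unfolding is_functor_def category_def by (auto simp: compose_def)

lemma double_functor_id: "double_category D \<Longrightarrow> double_functor (dblfun_id D)"
  unfolding double_functor_def dblfun_id_def
  by (auto simp: double_category_def intro!: is_functor_id)

lemma double_functor_comp:
  assumes "double_functor F" "double_functor G" "Trg F = Src G"
  shows "double_functor (dblfun_comp G F)"
  using assms unfolding double_functor_def dblfun_comp_def
  by (auto simp: double_category_def intro!: is_functor_comp)

lemma double_functor_maps:
  assumes "double_functor F"
  shows "onOb F \<in> Ob (Src F) \<rightarrow>\<^sub>E Ob (Trg F)" "onHor F \<in> Hor (Src F) \<rightarrow>\<^sub>E Hor (Trg F)"
    "onVer F \<in> Ver (Src F) \<rightarrow>\<^sub>E Ver (Trg F)" "onSq F \<in> Sq (Src F) \<rightarrow>\<^sub>E Sq (Trg F)"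
  using assms by (auto simp: double_functor_def is_functor_def PiE_def)

lemma category_DblCat: "category DblCat"
proof -
  have unit: "dblfun_comp F (dblfun_id (Src F)) = F" "dblfun_comp (dblfun_id (Trg F)) F = F"
    if "double_functor F" for F :: "'a dblfun"
    using double_functor_maps[OF that]
    by (cases F; auto simp: dblfun_comp_def dblfun_id_def compose_def PiE_def
        extensional_def fun_eq_iff Pi_def)+
  have assoc: "dblfun_comp H (dblfun_comp G F) = dblfun_comp (dblfun_comp H G) F"
    if "double_functor F" "double_functor G" "Trg F = Src G" for F G H :: "'a dblfun"
    using double_functor_maps[OF that(1)] that(3)
    by (auto simp: dblfun_comp_def compose_def PiE_def fun_eq_iff Pi_def)
  show ?thesis
    unfolding category_def
    using unit assoc double_functor_id double_functor_comp
    by (auto simp: DblCat_def small_dblcat_def)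
       (auto simp: dblfun_comp_def dblfun_id_def)
qed

lemma universe_suc: "universe TYPE(nat suc)"
proof -
  let ?s = "card_suc natLeq :: nat suc rel"
  have c: "card_order ?s" using natLeq_card_order by (rule card_order_card_suc)
  have e: "|UNIV :: nat suc set| =o ?s"
    using c card_order_on_Card_order card_of_Field_ordIso by metis
  have C: "Cinfinite ?s" by (rule Cinfinite_card_suc[OF natLeq_Cinfinite natLeq_card_order])
  have "natLeq <o ?s" by (rule card_suc_greater[OF natLeq_card_order])
  then have "natLeq <o |UNIV :: nat suc set|"
    using ordLess_ordIso_trans[OF _ ordIso_symmetric[OF e]] by blast
  moreover have "regularCard |UNIV :: nat suc set|"
    by (rule regularCard_ordIso[OF ordIso_symmetric[OF e] C
          regularCard_card_suc[OF natLeq_card_order natLeq_Cinfinite]])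
  ultimately show ?thesis by (simp add: universe_def)
qed

end

theory Submission
  imports Defs
begin

text \<open>Factor a weak equivalence \<open>w = p \<circ> j\<close> into a trivial cofibration and a trivial fibration.
  The pushout of \<open>j\<close> still lifts against all fibrations, so it is a weak equivalence, and it
  remains to see that the pushout of a canonical trivial fibration \<open>p : A \<rightarrow> A'\<close> along a
  cofibration \<open>i : A \<rightarrow> B\<close> is a canonical trivial fibration. Such a \<open>p\<close> is a composite of three:
  one that only identifies horizontal morphisms, one that only identifies vertical morphisms,
  and one that is faithful on both.

  In the first case \<open>B\<close> is a retract, under \<open>A\<close> and over \<open>B\<close>, of the double category whose
  horizontal morphisms are words in those of \<open>A\<close> and in freely adjoined copies of those of \<open>B\<close>,
  with all squares pulled back from \<open>B\<close>. Replacing the letters from \<open>A\<close> by others with the same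
  image under \<open>p\<close> gives, for every morphism \<open>f\<close> of \<open>B\<close> and every \<open>g\<close> identified with it, one
  specified invertible square from \<open>f\<close> to \<open>g\<close>; uniqueness of this square makes the quotient of
  \<open>B\<close> computable by choosing representatives. The second case is the transpose of the first.
  In the third case \<open>i\<close> is injective on objects and \<open>B\<close> can be conjugated by strictly invertible
  connecting cells, which exhibits the pushout as a retract of \<open>B\<close>.\<close>

section \<open>Calculus of double categories\<close>

text \<open>Two morphisms of \<open>B\<close> that become equal in the pushout may be joined by many
  invertible squares, depending on how they are cut into pieces coming from \<open>A\<close>. The
  quotient of the squares is under control once a single one is selected compatibly with
  composition. Words record the cutting, and the lifting property of \<open>i\<close> selects one
  word for each morphism of \<open>B\<close>. Objects are treated by conjugation with connecting
  cells instead; such cells compose strictly because lifts of identities are unique, which is why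
  \<open>p\<close> is made faithful on morphisms beforehand. Nothing but lifting against canonical
  trivial fibrations is used of a cofibration, and these are all built by one recipe: prescribe the
  morphisms over \<open>B\<close> and pull back the squares. A model structure carries no colimits,
  so the pushouts between the stages are constructed, inside a universe that need not be a strong
  limit. Closure of canonical trivial fibrations under retracts is read off from \<open>Fib\<close>
  and \<open>W\<close>.\<close>

locale cate =
  fixes C :: "('o, 'm) cat"
  assumes cat: "category C"
begin

lemma dom_in [simp]: "f \<in> Arr C \<Longrightarrow> Dom C f \<in> Obj C"
  and cod_in [simp]: "f \<in> Arr C \<Longrightarrow> Cod C f \<in> Obj C"
  and idt_in [simp]: "x \<in> Obj C \<Longrightarrow> Idt C x \<in> Arr C"
  and dom_idt [simp]: "x \<in> Obj C \<Longrightarrow> Dom C (Idt C x) = x"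
  and cod_idt [simp]: "x \<in> Obj C \<Longrightarrow> Cod C (Idt C x) = x"
  and comp_in [simp]: "f \<in> Arr C \<Longrightarrow> g \<in> Arr C \<Longrightarrow> Cod C f = Dom C g \<Longrightarrow> Comp C g f \<in> Arr C"
  and dom_comp [simp]: "f \<in> Arr C \<Longrightarrow> g \<in> Arr C \<Longrightarrow> Cod C f = Dom C g \<Longrightarrow> Dom C (Comp C g f) = Dom C f"
  and cod_comp [simp]: "f \<in> Arr C \<Longrightarrow> g \<in> Arr C \<Longrightarrow> Cod C f = Dom C g \<Longrightarrow> Cod C (Comp C g f) = Cod C g"
  and comp_idt [simp]: "f \<in> Arr C \<Longrightarrow> Dom C f = x \<Longrightarrow> Comp C f (Idt C x) = f"
  and idt_comp [simp]: "f \<in> Arr C \<Longrightarrow> Cod C f = y \<Longrightarrow> Comp C (Idt C y) f = f"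
  and assoc: "f \<in> Arr C \<Longrightarrow> g \<in> Arr C \<Longrightarrow> h \<in> Arr C \<Longrightarrow> Cod C f = Dom C g \<Longrightarrow> Cod C g = Dom C h
    \<Longrightarrow> Comp C h (Comp C g f) = Comp C (Comp C h g) f"
  using cat unfolding category_def by auto

end

lemma categoryI:
  assumes "\<And>f. f \<in> Arr C \<Longrightarrow> Dom C f \<in> Obj C" "\<And>f. f \<in> Arr C \<Longrightarrow> Cod C f \<in> Obj C"
    and "\<And>x. x \<in> Obj C \<Longrightarrow> Idt C x \<in> Arr C" "\<And>x. x \<in> Obj C \<Longrightarrow> Dom C (Idt C x) = x"
      "\<And>x. x \<in> Obj C \<Longrightarrow> Cod C (Idt C x) = x"
    and "\<And>f g. f \<in> Arr C \<Longrightarrow> g \<in> Arr C \<Longrightarrow> Cod C f = Dom C g \<Longrightarrow> Comp C g f \<in> Arr C"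
      "\<And>f g. f \<in> Arr C \<Longrightarrow> g \<in> Arr C \<Longrightarrow> Cod C f = Dom C g \<Longrightarrow> Dom C (Comp C g f) = Dom C f"
      "\<And>f g. f \<in> Arr C \<Longrightarrow> g \<in> Arr C \<Longrightarrow> Cod C f = Dom C g \<Longrightarrow> Cod C (Comp C g f) = Cod C g"
    and "\<And>f. f \<in> Arr C \<Longrightarrow> Comp C f (Idt C (Dom C f)) = f"
      "\<And>f. f \<in> Arr C \<Longrightarrow> Comp C (Idt C (Cod C f)) f = f"
    and "\<And>f g h. f \<in> Arr C \<Longrightarrow> g \<in> Arr C \<Longrightarrow> h \<in> Arr C \<Longrightarrow> Cod C f = Dom C g \<Longrightarrow>
      Cod C g = Dom C h \<Longrightarrow> Comp C h (Comp C g f) = Comp C (Comp C h g) f"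
  shows "category C"
  using assms unfolding category_def by simp

lemma is_functorI:
  assumes "\<And>x. x \<in> Obj C \<Longrightarrow> Fo x \<in> Obj D" "\<And>x. x \<in> Obj C \<Longrightarrow> Fa (Idt C x) = Idt D (Fo x)"
    and "\<And>f. f \<in> Arr C \<Longrightarrow> Fa f \<in> Arr D" "\<And>f. f \<in> Arr C \<Longrightarrow> Dom D (Fa f) = Fo (Dom C f)"
      "\<And>f. f \<in> Arr C \<Longrightarrow> Cod D (Fa f) = Fo (Cod C f)"
    and "\<And>f g. f \<in> Arr C \<Longrightarrow> g \<in> Arr C \<Longrightarrow> Cod C f = Dom C g \<Longrightarrow> Fa (Comp C g f) = Comp D (Fa g) (Fa f)"
  shows "is_functor C D Fo Fa"
  using assms unfolding is_functor_def by simp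

lemma is_functorD:
  assumes "is_functor C D Fo Fa"
  shows "\<And>x. x \<in> Obj C \<Longrightarrow> Fo x \<in> Obj D" "\<And>x. x \<in> Obj C \<Longrightarrow> Fa (Idt C x) = Idt D (Fo x)"
    and "\<And>f. f \<in> Arr C \<Longrightarrow> Fa f \<in> Arr D" "\<And>f. f \<in> Arr C \<Longrightarrow> Dom D (Fa f) = Fo (Dom C f)"
      "\<And>f. f \<in> Arr C \<Longrightarrow> Cod D (Fa f) = Fo (Cod C f)"
    and "\<And>f g. f \<in> Arr C \<Longrightarrow> g \<in> Arr C \<Longrightarrow> Cod C f = Dom C g \<Longrightarrow> Fa (Comp C g f) = Comp D (Fa g) (Fa f)"
  using assms unfolding is_functor_def by simp_all

section \<open>Simplification rules for double categories and double functors\<close>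

abbreviation "tp D \<equiv> Dom (VS D)"
abbreviation "bt D \<equiv> Cod (VS D)"
abbreviation "lf D \<equiv> Dom (HS D)"
abbreviation "rt D \<equiv> Cod (HS D)"

locale dcat =
  fixes D :: "'a dblcat"
  assumes dc: "double_category D"
begin

sublocale H: cate "HC D" using dc by unfold_locales (simp add: double_category_def)
sublocale V: cate "VC D" using dc by unfold_locales (simp add: double_category_def)
sublocale HS: cate "HS D" using dc by unfold_locales (simp add: double_category_def)
sublocale VS: cate "VS D" using dc by unfold_locales (simp add: double_category_def)

lemma carriers [simp]: "Obj (VC D) = Ob D" "Obj (HS D) = Ver D" "Obj (VS D) = Hor D" "Arr (VS D) = Sq D"
  using dc by (simp_all add: double_category_def)

lemma v_rules [simp]:
  "u \<in> Ver D \<Longrightarrow> Dom (VC D) u \<in> Ob D"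
  "u \<in> Ver D \<Longrightarrow> Cod (VC D) u \<in> Ob D"
  "x \<in> Ob D \<Longrightarrow> Idt (VC D) x \<in> Ver D"
  "x \<in> Ob D \<Longrightarrow> Dom (VC D) (Idt (VC D) x) = x"
  "x \<in> Ob D \<Longrightarrow> Cod (VC D) (Idt (VC D) x) = x"
  using V.dom_in V.cod_in V.idt_in V.dom_idt V.cod_idt by simp_all

lemma sq_rules [simp]:
  "a \<in> Sq D \<Longrightarrow> lf D a \<in> Ver D"
  "a \<in> Sq D \<Longrightarrow> rt D a \<in> Ver D"
  "a \<in> Sq D \<Longrightarrow> tp D a \<in> Hor D"
  "a \<in> Sq D \<Longrightarrow> bt D a \<in> Hor D"
  "u \<in> Ver D \<Longrightarrow> Idt (HS D) u \<in> Sq D"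
  "u \<in> Ver D \<Longrightarrow> lf D (Idt (HS D) u) = u"
  "u \<in> Ver D \<Longrightarrow> rt D (Idt (HS D) u) = u"
  "f \<in> Hor D \<Longrightarrow> Idt (VS D) f \<in> Sq D"
  "f \<in> Hor D \<Longrightarrow> tp D (Idt (VS D) f) = f"
  "f \<in> Hor D \<Longrightarrow> bt D (Idt (VS D) f) = f"
  using HS.dom_in HS.cod_in HS.idt_in HS.dom_idt HS.cod_idt
    VS.dom_in VS.cod_in VS.idt_in VS.dom_idt VS.cod_idt by simp_all

lemma vs_rules [simp]:
  "a \<in> Sq D \<Longrightarrow> b \<in> Sq D \<Longrightarrow> bt D a = tp D b \<Longrightarrow> Comp (VS D) b a \<in> Sq D"
  "a \<in> Sq D \<Longrightarrow> b \<in> Sq D \<Longrightarrow> bt D a = tp D b \<Longrightarrow> tp D (Comp (VS D) b a) = tp D a"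
  "a \<in> Sq D \<Longrightarrow> b \<in> Sq D \<Longrightarrow> bt D a = tp D b \<Longrightarrow> bt D (Comp (VS D) b a) = bt D b"
  "a \<in> Sq D \<Longrightarrow> tp D a = f \<Longrightarrow> Comp (VS D) a (Idt (VS D) f) = a"
  "a \<in> Sq D \<Longrightarrow> bt D a = g \<Longrightarrow> Comp (VS D) (Idt (VS D) g) a = a"
  using VS.comp_in VS.dom_comp VS.cod_comp VS.comp_idt VS.idt_comp by simp_all

lemma vs_assoc:
  "a \<in> Sq D \<Longrightarrow> b \<in> Sq D \<Longrightarrow> c \<in> Sq D \<Longrightarrow> bt D a = tp D b \<Longrightarrow> bt D b = tp D c
    \<Longrightarrow> Comp (VS D) c (Comp (VS D) b a) = Comp (VS D) (Comp (VS D) c b) a"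
  using VS.assoc by simp

lemma functors:
  "is_functor (VS D) (VC D) (Dom (HC D)) (lf D)"
  "is_functor (VS D) (VC D) (Cod (HC D)) (rt D)"
  "is_functor (VC D) (VS D) (Idt (HC D)) (Idt (HS D))"
  using dc by (simp_all add: double_category_def)

lemmas l_functor = is_functorD[OF functors(1)]
  and r_functor = is_functorD[OF functors(2)]
  and i_functor = is_functorD[OF functors(3)]

lemma corner_rules [simp]:
  "a \<in> Sq D \<Longrightarrow> Dom (HC D) (tp D a) = Dom (VC D) (lf D a)"
  "a \<in> Sq D \<Longrightarrow> Cod (HC D) (tp D a) = Dom (VC D) (rt D a)"
  "a \<in> Sq D \<Longrightarrow> Dom (HC D) (bt D a) = Cod (VC D) (lf D a)"
  "a \<in> Sq D \<Longrightarrow> Cod (HC D) (bt D a) = Cod (VC D) (rt D a)"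
  using l_functor(4,5)[of a] r_functor(4,5)[of a] by simp_all

text \<open>As a plain equation this would have the variable \<open>b\<close> on its right side only
  and could not serve as a left-to-right rewrite rule; with \<open>= True\<close> the whole equation
  is rewritten.\<close>

lemma match_rules [simp]:
  "a \<in> Sq D \<Longrightarrow> b \<in> Sq D \<Longrightarrow> bt D a = tp D b \<Longrightarrow> (Cod (VC D) (lf D a) = Dom (VC D) (lf D b)) = True"
  "a \<in> Sq D \<Longrightarrow> b \<in> Sq D \<Longrightarrow> bt D a = tp D b \<Longrightarrow> (Cod (VC D) (rt D a) = Dom (VC D) (rt D b)) = True"
  using corner_rules(1,2)[of b] corner_rules(3,4)[of a] by (metis (full_types))+

lemma idt_rules [simp]:
  "f \<in> Hor D \<Longrightarrow> lf D (Idt (VS D) f) = Idt (VC D) (Dom (HC D) f)"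
  "f \<in> Hor D \<Longrightarrow> rt D (Idt (VS D) f) = Idt (VC D) (Cod (HC D) f)"
  "u \<in> Ver D \<Longrightarrow> tp D (Idt (HS D) u) = Idt (HC D) (Dom (VC D) u)"
  "u \<in> Ver D \<Longrightarrow> bt D (Idt (HS D) u) = Idt (HC D) (Cod (VC D) u)"
  using l_functor(2)[of f] r_functor(2)[of f] i_functor(4,5)[of u] by simp_all

lemma comp_rules [simp]:
  "a \<in> Sq D \<Longrightarrow> b \<in> Sq D \<Longrightarrow> bt D a = tp D b \<Longrightarrow>
    lf D (Comp (VS D) b a) = Comp (VC D) (lf D b) (lf D a)"
  "a \<in> Sq D \<Longrightarrow> b \<in> Sq D \<Longrightarrow> bt D a = tp D b \<Longrightarrow>
    rt D (Comp (VS D) b a) = Comp (VC D) (rt D b) (rt D a)"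
  using l_functor(6)[of a b] r_functor(6)[of a b] by simp_all

lemma hcomp_rules [simp]:
  "a \<in> Sq D \<Longrightarrow> b \<in> Sq D \<Longrightarrow> rt D a = lf D b \<Longrightarrow>
    tp D (Comp (HS D) b a) = Comp (HC D) (tp D b) (tp D a)"
  "a \<in> Sq D \<Longrightarrow> b \<in> Sq D \<Longrightarrow> rt D a = lf D b \<Longrightarrow>
    bt D (Comp (HS D) b a) = Comp (HC D) (bt D b) (bt D a)"
  using dc by (simp_all add: double_category_def)

lemma hs_idt:
  "u \<in> Ver D \<Longrightarrow> v \<in> Ver D \<Longrightarrow> Cod (VC D) u = Dom (VC D) v \<Longrightarrow>
    Idt (HS D) (Comp (VC D) v u) = Comp (VS D) (Idt (HS D) v) (Idt (HS D) u)"
  using i_functor(6)[of u v] by simp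

lemma hs_idt_idt: "x \<in> Ob D \<Longrightarrow> Idt (HS D) (Idt (VC D) x) = Idt (VS D) (Idt (HC D) x)"
  using i_functor(2)[of x] by simp

lemma vs_idt:
  "f \<in> Hor D \<Longrightarrow> g \<in> Hor D \<Longrightarrow> Cod (HC D) f = Dom (HC D) g \<Longrightarrow>
    Idt (VS D) (Comp (HC D) g f) = Comp (HS D) (Idt (VS D) g) (Idt (VS D) f)"
  using dc by (simp add: double_category_def)

lemma interchange:
  "a \<in> Sq D \<Longrightarrow> b \<in> Sq D \<Longrightarrow> c \<in> Sq D \<Longrightarrow> d \<in> Sq D \<Longrightarrow> rt D a = lf D b \<Longrightarrow> rt D c = lf D d \<Longrightarrow>
    bt D a = tp D c \<Longrightarrow> bt D b = tp D d \<Longrightarrow>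
    Comp (VS D) (Comp (HS D) d c) (Comp (HS D) b a) = Comp (HS D) (Comp (VS D) d b) (Comp (VS D) c a)"
  using dc by (simp add: double_category_def)

end

text \<open>The functor clauses of \<open>double_category\<close> are split into boundary equations,
  one per goal, so that each construction below can be verified equation by equation.\<close>

lemma double_categoryI:
  assumes "category (HC D)" "category (VC D)" "category (HS D)" "category (VS D)"
    and "Obj (VC D) = Ob D" "Obj (HS D) = Ver D" "Obj (VS D) = Hor D" "Arr (VS D) = Sq D"
    and "\<And>a. a \<in> Sq D \<Longrightarrow> Dom (HC D) (tp D a) = Dom (VC D) (lf D a)"
      "\<And>a. a \<in> Sq D \<Longrightarrow> Cod (HC D) (tp D a) = Dom (VC D) (rt D a)"
      "\<And>a. a \<in> Sq D \<Longrightarrow> Dom (HC D) (bt D a) = Cod (VC D) (lf D a)"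
      "\<And>a. a \<in> Sq D \<Longrightarrow> Cod (HC D) (bt D a) = Cod (VC D) (rt D a)"
    and "\<And>f. f \<in> Hor D \<Longrightarrow> lf D (Idt (VS D) f) = Idt (VC D) (Dom (HC D) f)"
      "\<And>f. f \<in> Hor D \<Longrightarrow> rt D (Idt (VS D) f) = Idt (VC D) (Cod (HC D) f)"
      "\<And>u. u \<in> Ver D \<Longrightarrow> tp D (Idt (HS D) u) = Idt (HC D) (Dom (VC D) u)"
      "\<And>u. u \<in> Ver D \<Longrightarrow> bt D (Idt (HS D) u) = Idt (HC D) (Cod (VC D) u)"
    and "\<And>a b. a \<in> Sq D \<Longrightarrow> b \<in> Sq D \<Longrightarrow> bt D a = tp D b \<Longrightarrow>
        lf D (Comp (VS D) b a) = Comp (VC D) (lf D b) (lf D a)"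
      "\<And>a b. a \<in> Sq D \<Longrightarrow> b \<in> Sq D \<Longrightarrow> bt D a = tp D b \<Longrightarrow>
        rt D (Comp (VS D) b a) = Comp (VC D) (rt D b) (rt D a)"
      "\<And>a b. a \<in> Sq D \<Longrightarrow> b \<in> Sq D \<Longrightarrow> rt D a = lf D b \<Longrightarrow>
        tp D (Comp (HS D) b a) = Comp (HC D) (tp D b) (tp D a)"
      "\<And>a b. a \<in> Sq D \<Longrightarrow> b \<in> Sq D \<Longrightarrow> rt D a = lf D b \<Longrightarrow>
        bt D (Comp (HS D) b a) = Comp (HC D) (bt D b) (bt D a)"
    and "\<And>u v. u \<in> Ver D \<Longrightarrow> v \<in> Ver D \<Longrightarrow> Cod (VC D) u = Dom (VC D) v \<Longrightarrow>
        Idt (HS D) (Comp (VC D) v u) = Comp (VS D) (Idt (HS D) v) (Idt (HS D) u)"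
      "\<And>x. x \<in> Ob D \<Longrightarrow> Idt (HS D) (Idt (VC D) x) = Idt (VS D) (Idt (HC D) x)"
      "\<And>f g. f \<in> Hor D \<Longrightarrow> g \<in> Hor D \<Longrightarrow> Cod (HC D) f = Dom (HC D) g \<Longrightarrow>
        Idt (VS D) (Comp (HC D) g f) = Comp (HS D) (Idt (VS D) g) (Idt (VS D) f)"
    and "\<And>a b c d. a \<in> Sq D \<Longrightarrow> b \<in> Sq D \<Longrightarrow> c \<in> Sq D \<Longrightarrow> d \<in> Sq D \<Longrightarrow>
        rt D a = lf D b \<Longrightarrow> rt D c = lf D d \<Longrightarrow> bt D a = tp D c \<Longrightarrow> bt D b = tp D d \<Longrightarrow>
        Comp (VS D) (Comp (HS D) d c) (Comp (HS D) b a) = Comp (HS D) (Comp (VS D) d b) (Comp (VS D) c a)"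
  shows "double_category D"
proof -
  interpret H: cate "HC D" by unfold_locales fact
  interpret V: cate "VC D" by unfold_locales fact
  interpret HS: cate "HS D" by unfold_locales fact
  interpret VS: cate "VS D" by unfold_locales fact
  have 1: "is_functor (VS D) (VC D) (Dom (HC D)) (lf D)"
    by (rule is_functorI) (use assms(5-8) HS.dom_in in \<open>simp_all add: assms(9-20)\<close>)
  have 2: "is_functor (VS D) (VC D) (Cod (HC D)) (rt D)"
    by (rule is_functorI) (use assms(5-8) HS.cod_in in \<open>simp_all add: assms(9-20)\<close>)
  have 3: "is_functor (VC D) (VS D) (Idt (HC D)) (Idt (HS D))"
    by (rule is_functorI) (use assms(5-8) HS.idt_in in \<open>simp_all add: assms(9-22)\<close>)
  show ?thesis
    unfolding double_category_def using 1 2 3 assms by simp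
qed

text \<open>Source and target have independent element types and the maps need not be extensional:
  products over all cocones and the double categories generated inside them do not live over the
  universe type, so maps to and from them are not arrows of \<open>DblCat\<close>.\<close>

locale dfun = D: dcat D + E: dcat E for D :: "'a dblcat" and E :: "'b dblcat" +
  fixes Fo Fh Fv Fs
  assumes fh: "is_functor (HC D) (HC E) Fo Fh" and fv: "is_functor (VC D) (VC E) Fo Fv"
    and fhs: "is_functor (HS D) (HS E) Fv Fs" and fvs: "is_functor (VS D) (VS E) Fh Fs"
begin

lemma o_in [simp]: "x \<in> Ob D \<Longrightarrow> Fo x \<in> Ob E"
  using is_functorD(1)[OF fh] by simp

lemma h_rules [simp]:
  "f \<in> Hor D \<Longrightarrow> Fh f \<in> Hor E"
  "f \<in> Hor D \<Longrightarrow> Dom (HC E) (Fh f) = Fo (Dom (HC D) f)"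
  "f \<in> Hor D \<Longrightarrow> Cod (HC E) (Fh f) = Fo (Cod (HC D) f)"
  "x \<in> Ob D \<Longrightarrow> Fh (Idt (HC D) x) = Idt (HC E) (Fo x)"
  "f \<in> Hor D \<Longrightarrow> g \<in> Hor D \<Longrightarrow> Cod (HC D) f = Dom (HC D) g \<Longrightarrow>
    Fh (Comp (HC D) g f) = Comp (HC E) (Fh g) (Fh f)"
  using is_functorD[OF fh] by simp_all

lemma v_rules [simp]:
  "f \<in> Ver D \<Longrightarrow> Fv f \<in> Ver E"
  "f \<in> Ver D \<Longrightarrow> Dom (VC E) (Fv f) = Fo (Dom (VC D) f)"
  "f \<in> Ver D \<Longrightarrow> Cod (VC E) (Fv f) = Fo (Cod (VC D) f)"
  "x \<in> Ob D \<Longrightarrow> Fv (Idt (VC D) x) = Idt (VC E) (Fo x)"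
  "f \<in> Ver D \<Longrightarrow> g \<in> Ver D \<Longrightarrow> Cod (VC D) f = Dom (VC D) g \<Longrightarrow>
    Fv (Comp (VC D) g f) = Comp (VC E) (Fv g) (Fv f)"
  using is_functorD[OF fv] by simp_all

lemma s_rules [simp]:
  "a \<in> Sq D \<Longrightarrow> Fs a \<in> Sq E"
  "a \<in> Sq D \<Longrightarrow> lf E (Fs a) = Fv (lf D a)"
  "a \<in> Sq D \<Longrightarrow> rt E (Fs a) = Fv (rt D a)"
  "a \<in> Sq D \<Longrightarrow> tp E (Fs a) = Fh (tp D a)"
  "a \<in> Sq D \<Longrightarrow> bt E (Fs a) = Fh (bt D a)"
  "u \<in> Ver D \<Longrightarrow> Fs (Idt (HS D) u) = Idt (HS E) (Fv u)"
  "f \<in> Hor D \<Longrightarrow> Fs (Idt (VS D) f) = Idt (VS E) (Fh f)"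
  "a \<in> Sq D \<Longrightarrow> b \<in> Sq D \<Longrightarrow> rt D a = lf D b \<Longrightarrow> Fs (Comp (HS D) b a) = Comp (HS E) (Fs b) (Fs a)"
  "a \<in> Sq D \<Longrightarrow> b \<in> Sq D \<Longrightarrow> bt D a = tp D b \<Longrightarrow> Fs (Comp (VS D) b a) = Comp (VS E) (Fs b) (Fs a)"
  using is_functorD[OF fhs] is_functorD[OF fvs] by simp_all

end

lemma dfun_comp:
  assumes "dfun D E Fo Fh Fv Fs" "dfun E K Go Gh Gv Gs"
  shows "dfun D K (Go \<circ> Fo) (Gh \<circ> Fh) (Gv \<circ> Fv) (Gs \<circ> Fs)"
proof -
  interpret F: dfun D E Fo Fh Fv Fs by fact
  interpret G: dfun E K Go Gh Gv Gs by fact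
  show ?thesis
    by unfold_locales (rule is_functorI; simp)+
qed

lemma dfun_cong:
  assumes "dfun D E Fo Fh Fv Fs"
    and "\<And>x. x \<in> Ob D \<Longrightarrow> Go x = Fo x" "\<And>x. x \<in> Hor D \<Longrightarrow> Gh x = Fh x"
      "\<And>x. x \<in> Ver D \<Longrightarrow> Gv x = Fv x" "\<And>x. x \<in> Sq D \<Longrightarrow> Gs x = Fs x"
  shows "dfun D E Go Gh Gv Gs"
proof -
  interpret F: dfun D E Fo Fh Fv Fs by fact
  show ?thesis
    by unfold_locales (rule is_functorI; simp add: assms)+
qed

lemma dfunI:
  assumes "double_category D" "double_category E"
    and "\<And>x. x \<in> Ob D \<Longrightarrow> Fo x \<in> Ob E"
    and "\<And>f. f \<in> Hor D \<Longrightarrow> Fh f \<in> Hor E"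
      "\<And>f. f \<in> Hor D \<Longrightarrow> Dom (HC E) (Fh f) = Fo (Dom (HC D) f)"
      "\<And>f. f \<in> Hor D \<Longrightarrow> Cod (HC E) (Fh f) = Fo (Cod (HC D) f)"
      "\<And>x. x \<in> Ob D \<Longrightarrow> Fh (Idt (HC D) x) = Idt (HC E) (Fo x)"
      "\<And>f g. f \<in> Hor D \<Longrightarrow> g \<in> Hor D \<Longrightarrow> Cod (HC D) f = Dom (HC D) g \<Longrightarrow>
        Fh (Comp (HC D) g f) = Comp (HC E) (Fh g) (Fh f)"
    and "\<And>f. f \<in> Ver D \<Longrightarrow> Fv f \<in> Ver E"
      "\<And>f. f \<in> Ver D \<Longrightarrow> Dom (VC E) (Fv f) = Fo (Dom (VC D) f)"
      "\<And>f. f \<in> Ver D \<Longrightarrow> Cod (VC E) (Fv f) = Fo (Cod (VC D) f)"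
      "\<And>x. x \<in> Ob D \<Longrightarrow> Fv (Idt (VC D) x) = Idt (VC E) (Fo x)"
      "\<And>f g. f \<in> Ver D \<Longrightarrow> g \<in> Ver D \<Longrightarrow> Cod (VC D) f = Dom (VC D) g \<Longrightarrow>
        Fv (Comp (VC D) g f) = Comp (VC E) (Fv g) (Fv f)"
    and "\<And>a. a \<in> Sq D \<Longrightarrow> Fs a \<in> Sq E"
      "\<And>a. a \<in> Sq D \<Longrightarrow> lf E (Fs a) = Fv (lf D a)"
      "\<And>a. a \<in> Sq D \<Longrightarrow> rt E (Fs a) = Fv (rt D a)"
      "\<And>a. a \<in> Sq D \<Longrightarrow> tp E (Fs a) = Fh (tp D a)"
      "\<And>a. a \<in> Sq D \<Longrightarrow> bt E (Fs a) = Fh (bt D a)"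
      "\<And>u. u \<in> Ver D \<Longrightarrow> Fs (Idt (HS D) u) = Idt (HS E) (Fv u)"
      "\<And>f. f \<in> Hor D \<Longrightarrow> Fs (Idt (VS D) f) = Idt (VS E) (Fh f)"
      "\<And>a b. a \<in> Sq D \<Longrightarrow> b \<in> Sq D \<Longrightarrow> rt D a = lf D b \<Longrightarrow>
        Fs (Comp (HS D) b a) = Comp (HS E) (Fs b) (Fs a)"
      "\<And>a b. a \<in> Sq D \<Longrightarrow> b \<in> Sq D \<Longrightarrow> bt D a = tp D b \<Longrightarrow>
        Fs (Comp (VS D) b a) = Comp (VS E) (Fs b) (Fs a)"
  shows "dfun D E Fo Fh Fv Fs"
proof -
  interpret D: dcat D by unfold_locales fact
  interpret E: dcat E by unfold_locales fact
  show ?thesis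
    by unfold_locales (rule is_functorI; simp add: assms)+
qed

section \<open>Double functors as arrows of \<open>DblCat\<close>\<close>

definition mk :: "'a dblcat \<Rightarrow> 'a dblcat \<Rightarrow> ('a \<Rightarrow> 'a) \<Rightarrow> ('a \<Rightarrow> 'a) \<Rightarrow> ('a \<Rightarrow> 'a) \<Rightarrow> ('a \<Rightarrow> 'a) \<Rightarrow> 'a dblfun" where
  "mk D E Fo Fh Fv Fs = \<lparr>Src = D, Trg = E, onOb = restrict Fo (Ob D), onHor = restrict Fh (Hor D),
     onVer = restrict Fv (Ver D), onSq = restrict Fs (Sq D)\<rparr>"

lemma mk_simps [simp]:
  "Src (mk D E Fo Fh Fv Fs) = D" "Trg (mk D E Fo Fh Fv Fs) = E"
  "x \<in> Ob D \<Longrightarrow> onOb (mk D E Fo Fh Fv Fs) x = Fo x"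
  "x \<in> Hor D \<Longrightarrow> onHor (mk D E Fo Fh Fv Fs) x = Fh x"
  "x \<in> Ver D \<Longrightarrow> onVer (mk D E Fo Fh Fv Fs) x = Fv x"
  "x \<in> Sq D \<Longrightarrow> onSq (mk D E Fo Fh Fv Fs) x = Fs x"
  by (simp_all add: mk_def)

lemma DblCat_simps [simp]:
  "Obj DblCat = Collect small_dblcat" "Dom DblCat = Src" "Cod DblCat = Trg" "Idt DblCat = dblfun_id"
  "Comp DblCat = dblfun_comp"
  by (simp_all add: DblCat_def)

lemma cate_DblCat: "cate DblCat"
  by unfold_locales (rule category_DblCat)

abbreviation DArr :: "'a dblfun set" where "DArr \<equiv> Arr DblCat"

lemma DArr_iff: "F \<in> DArr \<longleftrightarrow> double_functor F \<and> small_dblcat (Src F) \<and> small_dblcat (Trg F)"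
  by (simp add: DblCat_def)

lemma DArr_dfun: "F \<in> DArr \<Longrightarrow> dfun (Src F) (Trg F) (onOb F) (onHor F) (onVer F) (onSq F)"
  unfolding DArr_iff double_functor_def dfun_def dcat_def dfun_axioms_def by simp

lemma DArr_small [simp]: "F \<in> DArr \<Longrightarrow> small_dblcat (Src F)" "F \<in> DArr \<Longrightarrow> small_dblcat (Trg F)"
  by (simp_all add: DArr_iff)

lemma DArrI:
  assumes "dfun (Src F) (Trg F) (onOb F) (onHor F) (onVer F) (onSq F)"
    and "small_dblcat (Src F)" "small_dblcat (Trg F)"
    and "onOb F \<in> extensional (Ob (Src F))" "onHor F \<in> extensional (Hor (Src F))"
      "onVer F \<in> extensional (Ver (Src F))" "onSq F \<in> extensional (Sq (Src F))"
  shows "F \<in> DArr"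
proof -
  have "double_functor F"
    unfolding double_functor_def using assms(4-7) assms(1)[unfolded dfun_def dfun_axioms_def dcat_def]
    by (intro conjI) (elim conjE, assumption)+
  then show ?thesis unfolding DArr_iff using assms(2,3) by simp
qed

lemma mk_DArr:
  assumes "dfun D E Fo Fh Fv Fs" "small_dblcat D" "small_dblcat E"
  shows "mk D E Fo Fh Fv Fs \<in> DArr"
proof (rule DArrI)
  let ?F = "mk D E Fo Fh Fv Fs"
  have "dfun D E (onOb ?F) (onHor ?F) (onVer ?F) (onSq ?F)"
    by (rule dfun_cong[OF assms(1)]) simp_all
  then show "dfun (Src ?F) (Trg ?F) (onOb ?F) (onHor ?F) (onVer ?F) (onSq ?F)" by simp
qed (use assms(2,3) in \<open>simp_all add: mk_def\<close>)

lemma DArr_extensional: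
  assumes "F \<in> DArr"
  shows "onOb F \<in> extensional (Ob (Src F))" "onHor F \<in> extensional (Hor (Src F))"
      "onVer F \<in> extensional (Ver (Src F))" "onSq F \<in> extensional (Sq (Src F))"
  using assms unfolding DArr_iff double_functor_def by simp_all

lemma DArr_eqI:
  assumes "F \<in> DArr" "G \<in> DArr" "Src F = Src G" "Trg F = Trg G"
    and "\<And>x. x \<in> Ob (Src F) \<Longrightarrow> onOb F x = onOb G x" "\<And>x. x \<in> Hor (Src F) \<Longrightarrow> onHor F x = onHor G x"
      "\<And>x. x \<in> Ver (Src F) \<Longrightarrow> onVer F x = onVer G x" "\<And>x. x \<in> Sq (Src F) \<Longrightarrow> onSq F x = onSq G x"
  shows "F = G"
proof -
  note F = DArr_extensional[OF assms(1)] and G = DArr_extensional[OF assms(2), folded assms(3)]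
  have "onOb F = onOb G" "onHor F = onHor G" "onVer F = onVer G" "onSq F = onSq G"
    by (rule extensionalityI[OF F(1) G(1) assms(5)] extensionalityI[OF F(2) G(2) assms(6)]
        extensionalityI[OF F(3) G(3) assms(7)] extensionalityI[OF F(4) G(4) assms(8)]; assumption)+
  then show ?thesis using assms(3,4) by (intro dblfun.equality) simp_all
qed

lemma dblfun_comp_simps [simp]:
  "Src (dblfun_comp G F) = Src F" "Trg (dblfun_comp G F) = Trg G"
  "x \<in> Ob (Src F) \<Longrightarrow> onOb (dblfun_comp G F) x = onOb G (onOb F x)"
  "x \<in> Hor (Src F) \<Longrightarrow> onHor (dblfun_comp G F) x = onHor G (onHor F x)"
  "x \<in> Ver (Src F) \<Longrightarrow> onVer (dblfun_comp G F) x = onVer G (onVer F x)"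
  "x \<in> Sq (Src F) \<Longrightarrow> onSq (dblfun_comp G F) x = onSq G (onSq F x)"
  by (simp_all add: dblfun_comp_def compose_def)

lemma dblfun_id_simps [simp]:
  "Src (dblfun_id D) = D" "Trg (dblfun_id D) = D"
  "x \<in> Ob D \<Longrightarrow> onOb (dblfun_id D) x = x" "x \<in> Hor D \<Longrightarrow> onHor (dblfun_id D) x = x"
  "x \<in> Ver D \<Longrightarrow> onVer (dblfun_id D) x = x" "x \<in> Sq D \<Longrightarrow> onSq (dblfun_id D) x = x"
  by (simp_all add: dblfun_id_def)

lemma comp_DArr [simp]: "F \<in> DArr \<Longrightarrow> G \<in> DArr \<Longrightarrow> Trg F = Src G \<Longrightarrow> dblfun_comp G F \<in> DArr"
  using cate.comp_in[OF cate_DblCat, of F G] by simp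

lemma id_DArr [simp]: "small_dblcat D \<Longrightarrow> dblfun_id D \<in> DArr"
  using cate.idt_in[OF cate_DblCat, of D] by simp

lemma comp_dblfun_id [simp]:
  "F \<in> DArr \<Longrightarrow> Src F = D \<Longrightarrow> dblfun_comp F (dblfun_id D) = F"
  "F \<in> DArr \<Longrightarrow> Trg F = D \<Longrightarrow> dblfun_comp (dblfun_id D) F = F"
  using cate.comp_idt[OF cate_DblCat, of F D] cate.idt_comp[OF cate_DblCat, of F D] by simp_all

lemma comp_assoc:
  "F \<in> DArr \<Longrightarrow> G \<in> DArr \<Longrightarrow> K \<in> DArr \<Longrightarrow> Trg F = Src G \<Longrightarrow> Trg G = Src K \<Longrightarrow>
    dblfun_comp K (dblfun_comp G F) = dblfun_comp (dblfun_comp K G) F"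
  using cate.assoc[OF cate_DblCat, of F G K] by simp

lemma small_dblcatD: "small_dblcat D \<Longrightarrow> double_category D"
  by (simp add: small_dblcat_def)

section \<open>Canonical trivial fibrations\<close>

abbreviation ctf :: "'a dblfun \<Rightarrow> bool" where "ctf \<equiv> canonical_trivial_fibration"

lemma (in dcat) square_boundary_sq:
  "a \<in> Sq D \<Longrightarrow> square_boundary D (tp D a) (bt D a) (lf D a) (rt D a)"
  by (simp add: square_boundary_def)

text \<open>This clause of \<open>canonical_trivial_fibration\<close> is split off because it holds
  for all squares obtained by pullback, before anything is known about fullness on morphisms, and
  because it alone determines lifts on squares (\<open>lift_functor\<close>).\<close>

definition sq_ff :: "'a dblfun \<Rightarrow> bool" where
  "sq_ff F \<longleftrightarrow> (\<forall>f g u v. square_boundary (Src F) f g u v \<longrightarrow>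
        bij_betw (onSq F) (squares (Src F) f g u v)
          (squares (Trg F) (onHor F f) (onHor F g) (onVer F u) (onVer F v)))"

lemma sq_ffI:
  assumes "F \<in> DArr"
    and "\<And>f g u v b. square_boundary (Src F) f g u v \<Longrightarrow>
      b \<in> squares (Trg F) (onHor F f) (onHor F g) (onVer F u) (onVer F v) \<Longrightarrow>
      \<exists>a\<in>squares (Src F) f g u v. onSq F a = b"
    and "\<And>a b. a \<in> Sq (Src F) \<Longrightarrow> b \<in> Sq (Src F) \<Longrightarrow> tp (Src F) a = tp (Src F) b \<Longrightarrow>
      bt (Src F) a = bt (Src F) b \<Longrightarrow> lf (Src F) a = lf (Src F) b \<Longrightarrow> rt (Src F) a = rt (Src F) b \<Longrightarrow>
      onSq F a = onSq F b \<Longrightarrow> a = b"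
  shows "sq_ff F"
proof -
  interpret dfun "Src F" "Trg F" "onOb F" "onHor F" "onVer F" "onSq F" by (rule DArr_dfun) fact
  have "bij_betw (onSq F) (squares (Src F) f g u v)
          (squares (Trg F) (onHor F f) (onHor F g) (onVer F u) (onVer F v))"
    if b: "square_boundary (Src F) f g u v" for f g u v
    unfolding bij_betw_def
  proof (intro conjI)
    show "inj_on (onSq F) (squares (Src F) f g u v)"
      by (rule inj_onI, rule assms(3)) (simp_all add: squares_def)
    show "onSq F ` squares (Src F) f g u v =
        squares (Trg F) (onHor F f) (onHor F g) (onVer F u) (onVer F v)"
    proof (rule set_eqI, rule iffI)
      fix x assume "x \<in> onSq F ` squares (Src F) f g u v"
      then show "x \<in> squares (Trg F) (onHor F f) (onHor F g) (onVer F u) (onVer F v)"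
        using b by (auto simp: squares_def square_boundary_def)
    next
      fix x assume "x \<in> squares (Trg F) (onHor F f) (onHor F g) (onVer F u) (onVer F v)"
      from assms(2)[OF b this] show "x \<in> onSq F ` squares (Src F) f g u v" by blast
    qed
  qed
  then show ?thesis unfolding sq_ff_def by simp
qed

lemma ctfI:
  assumes "F \<in> DArr"
    and "\<And>y. y \<in> Ob (Trg F) \<Longrightarrow> \<exists>x\<in>Ob (Src F). onOb F x = y"
    and "\<And>x y f. x \<in> Ob (Src F) \<Longrightarrow> y \<in> Ob (Src F) \<Longrightarrow> f \<in> Hor (Trg F) \<Longrightarrow>
      Dom (HC (Trg F)) f = onOb F x \<Longrightarrow> Cod (HC (Trg F)) f = onOb F y \<Longrightarrow>
      \<exists>g\<in>Hor (Src F). Dom (HC (Src F)) g = x \<and> Cod (HC (Src F)) g = y \<and> onHor F g = f"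
    and "\<And>x y f. x \<in> Ob (Src F) \<Longrightarrow> y \<in> Ob (Src F) \<Longrightarrow> f \<in> Ver (Trg F) \<Longrightarrow>
      Dom (VC (Trg F)) f = onOb F x \<Longrightarrow> Cod (VC (Trg F)) f = onOb F y \<Longrightarrow>
      \<exists>g\<in>Ver (Src F). Dom (VC (Src F)) g = x \<and> Cod (VC (Src F)) g = y \<and> onVer F g = f"
    and "sq_ff F"
  shows "ctf F"
proof -
  interpret dfun "Src F" "Trg F" "onOb F" "onHor F" "onVer F" "onSq F" by (rule DArr_dfun) fact
  have 1: "onOb F ` Ob (Src F) = Ob (Trg F)"
    using assms(2) by (force simp: image_iff)
  have 2: "onHor F ` arr_betw (HC (Src F)) x y = arr_betw (HC (Trg F)) (onOb F x) (onOb F y)"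
    if "x \<in> Ob (Src F)" "y \<in> Ob (Src F)" for x y
    using assms(3)[OF that] by (force simp: arr_betw_def image_iff)
  have 3: "onVer F ` arr_betw (VC (Src F)) x y = arr_betw (VC (Trg F)) (onOb F x) (onOb F y)"
    if "x \<in> Ob (Src F)" "y \<in> Ob (Src F)" for x y
    using assms(4)[OF that] by (force simp: arr_betw_def image_iff)
  show ?thesis
    unfolding canonical_trivial_fibration_def using 1 2 3 assms(1,5) unfolding DArr_iff sq_ff_def by simp
qed

section \<open>Lifting and descent along trivial fibrations\<close>

locale sq_fib =
  fixes F :: "'a dblfun"
  assumes F_in: "F \<in> DArr" and F_ff: "sq_ff F"
begin

sublocale dfun "Src F" "Trg F" "onOb F" "onHor F" "onVer F" "onSq F"
  by (rule DArr_dfun) (rule F_in)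

lemma sq_bij: "square_boundary (Src F) f g u v \<Longrightarrow> bij_betw (onSq F) (squares (Src F) f g u v)
    (squares (Trg F) (onHor F f) (onHor F g) (onVer F u) (onVer F v))"
  using F_ff unfolding sq_ff_def by simp

lemma sq_full:
  assumes "square_boundary (Src F) f g u v" "b \<in> Sq (Trg F)" "tp (Trg F) b = onHor F f"
    "bt (Trg F) b = onHor F g" "lf (Trg F) b = onVer F u" "rt (Trg F) b = onVer F v"
  obtains a where "a \<in> Sq (Src F)" "tp (Src F) a = f" "bt (Src F) a = g" "lf (Src F) a = u"
    "rt (Src F) a = v" "onSq F a = b"
proof -
  have "b \<in> squares (Trg F) (onHor F f) (onHor F g) (onVer F u) (onVer F v)"
    using assms by (simp add: squares_def)
  then have "b \<in> onSq F ` squares (Src F) f g u v" using sq_bij[OF assms(1)] by (simp add: bij_betw_def)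
  then show thesis using that by (auto simp: squares_def)
qed

lemma sq_faithful:
  assumes "a \<in> Sq (Src F)" "b \<in> Sq (Src F)" "tp (Src F) a = tp (Src F) b"
    "bt (Src F) a = bt (Src F) b" "lf (Src F) a = lf (Src F) b" "rt (Src F) a = rt (Src F) b"
    "onSq F a = onSq F b"
  shows "a = b"
proof (rule inj_onD[OF bij_betw_imp_inj_on[OF sq_bij[OF D.square_boundary_sq[OF assms(1)]]] assms(7)])
  show "a \<in> squares (Src F) (tp (Src F) a) (bt (Src F) a) (lf (Src F) a) (rt (Src F) a)"
    using assms(1) unfolding squares_def by simp
  show "b \<in> squares (Src F) (tp (Src F) a) (bt (Src F) a) (lf (Src F) a) (rt (Src F) a)"
    using assms(2) unfolding assms(3-6) squares_def by simp
qed

end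

locale ctfib =
  fixes F :: "'a dblfun"
  assumes F_in: "F \<in> DArr" and F_ctf: "ctf F"
begin

sublocale sq_fib F
  using F_in F_ctf by unfold_locales (simp_all add: canonical_trivial_fibration_def sq_ff_def)

lemma ob_surj:
  assumes "y \<in> Ob (Trg F)" obtains x where "x \<in> Ob (Src F)" "onOb F x = y"
proof -
  have "onOb F ` Ob (Src F) = Ob (Trg F)"
    using F_ctf unfolding canonical_trivial_fibration_def by (elim conjE)
  with assms have "y \<in> onOb F ` Ob (Src F)" by simp
  then show thesis using that by auto
qed

lemma hor_full:
  assumes "x \<in> Ob (Src F)" "y \<in> Ob (Src F)" "f \<in> Hor (Trg F)"
    "Dom (HC (Trg F)) f = onOb F x" "Cod (HC (Trg F)) f = onOb F y"
  obtains g where "g \<in> Hor (Src F)" "Dom (HC (Src F)) g = x" "Cod (HC (Src F)) g = y" "onHor F g = f"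
proof -
  have "f \<in> arr_betw (HC (Trg F)) (onOb F x) (onOb F y)" using assms by (simp add: arr_betw_def)
  then have "f \<in> onHor F ` arr_betw (HC (Src F)) x y"
    using F_ctf assms(1,2) unfolding canonical_trivial_fibration_def by simp
  then show thesis using that by (auto simp: arr_betw_def)
qed

lemma ver_full:
  assumes "x \<in> Ob (Src F)" "y \<in> Ob (Src F)" "f \<in> Ver (Trg F)"
    "Dom (VC (Trg F)) f = onOb F x" "Cod (VC (Trg F)) f = onOb F y"
  obtains g where "g \<in> Ver (Src F)" "Dom (VC (Src F)) g = x" "Cod (VC (Src F)) g = y" "onVer F g = f"
proof -
  have "f \<in> arr_betw (VC (Trg F)) (onOb F x) (onOb F y)" using assms by (simp add: arr_betw_def)
  then have "f \<in> onVer F ` arr_betw (VC (Src F)) x y"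
    using F_ctf assms(1,2) unfolding canonical_trivial_fibration_def by simp
  then show thesis using that by (auto simp: arr_betw_def)
qed

text \<open>A preimage of the codomain exists by surjectivity, after which fullness applies. Lifts
  with one prescribed end turn composable pairs of the target into composable pairs of the
  source.\<close>

lemma hor_lift_dom:
  assumes "x \<in> Ob (Src F)" "f \<in> Hor (Trg F)" "Dom (HC (Trg F)) f = onOb F x"
  obtains g where "g \<in> Hor (Src F)" "Dom (HC (Src F)) g = x" "onHor F g = f"
proof -
  obtain y where "y \<in> Ob (Src F)" "onOb F y = Cod (HC (Trg F)) f"
    using ob_surj[of "Cod (HC (Trg F)) f"] assms by auto
  then show thesis using hor_full[of x y f] assms that by metis
qed

lemma ver_lift_dom:
  assumes "x \<in> Ob (Src F)" "f \<in> Ver (Trg F)" "Dom (VC (Trg F)) f = onOb F x"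
  obtains g where "g \<in> Ver (Src F)" "Dom (VC (Src F)) g = x" "onVer F g = f"
proof -
  obtain y where "y \<in> Ob (Src F)" "onOb F y = Cod (VC (Trg F)) f"
    using ob_surj[of "Cod (VC (Trg F)) f"] assms by auto
  then show thesis using ver_full[of x y f] assms that by metis
qed

lemma hor_surj:
  assumes "f \<in> Hor (Trg F)" obtains g where "g \<in> Hor (Src F)" "onHor F g = f"
  using assms ob_surj[of "Dom (HC (Trg F)) f"] hor_lift_dom[of _ f] E.H.dom_in by metis

lemma ver_surj:
  assumes "f \<in> Ver (Trg F)" obtains g where "g \<in> Ver (Src F)" "onVer F g = f"
  using assms ob_surj[of "Dom (VC (Trg F)) f"] ver_lift_dom[of _ f] E.v_rules by metis

text \<open>Top and bottom are lifted from the two ends of \<open>u\<close>; fullness then gives a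
  right side between their codomains, and only now is there a complete boundary for
  \<open>sq_full\<close>.\<close>

lemma sq_lift_left:
  assumes "u \<in> Ver (Src F)" "b \<in> Sq (Trg F)" "lf (Trg F) b = onVer F u"
  obtains a where "a \<in> Sq (Src F)" "lf (Src F) a = u" "onSq F a = b"
proof -
  obtain f where f: "f \<in> Hor (Src F)" "Dom (HC (Src F)) f = Dom (VC (Src F)) u" "onHor F f = tp (Trg F) b"
    using hor_lift_dom[of "Dom (VC (Src F)) u" "tp (Trg F) b"] assms by auto
  obtain g where g: "g \<in> Hor (Src F)" "Dom (HC (Src F)) g = Cod (VC (Src F)) u" "onHor F g = bt (Trg F) b"
    using hor_lift_dom[of "Cod (VC (Src F)) u" "bt (Trg F) b"] assms by auto
  have "Dom (VC (Trg F)) (rt (Trg F) b) = onOb F (Cod (HC (Src F)) f)"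
       "Cod (VC (Trg F)) (rt (Trg F) b) = onOb F (Cod (HC (Src F)) g)"
    using f g assms E.corner_rules h_rules(3) by metis+
  then obtain v where v: "v \<in> Ver (Src F)" "Dom (VC (Src F)) v = Cod (HC (Src F)) f"
    "Cod (VC (Src F)) v = Cod (HC (Src F)) g" "onVer F v = rt (Trg F) b"
    using ver_full[of "Cod (HC (Src F)) f" "Cod (HC (Src F)) g" "rt (Trg F) b"] f g assms by auto
  have "square_boundary (Src F) f g u v" using f g v assms by (simp add: square_boundary_def)
  from sq_full[OF this, of b] f g v assms show thesis using that by metis
qed

lemma sq_lift_top:
  assumes "f \<in> Hor (Src F)" "b \<in> Sq (Trg F)" "tp (Trg F) b = onHor F f"
  obtains a where "a \<in> Sq (Src F)" "tp (Src F) a = f" "onSq F a = b"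
proof -
  have "Dom (VC (Trg F)) (lf (Trg F) b) = onOb F (Dom (HC (Src F)) f)"
       "Dom (VC (Trg F)) (rt (Trg F) b) = onOb F (Cod (HC (Src F)) f)"
    using assms E.corner_rules h_rules(2,3) by metis+
  note d = this
  obtain u where u: "u \<in> Ver (Src F)" "Dom (VC (Src F)) u = Dom (HC (Src F)) f" "onVer F u = lf (Trg F) b"
    using ver_lift_dom[of "Dom (HC (Src F)) f" "lf (Trg F) b"] assms d by auto
  obtain v where v: "v \<in> Ver (Src F)" "Dom (VC (Src F)) v = Cod (HC (Src F)) f" "onVer F v = rt (Trg F) b"
    using ver_lift_dom[of "Cod (HC (Src F)) f" "rt (Trg F) b"] assms d by auto
  have "Dom (HC (Trg F)) (bt (Trg F) b) = onOb F (Cod (VC (Src F)) u)"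
       "Cod (HC (Trg F)) (bt (Trg F) b) = onOb F (Cod (VC (Src F)) v)"
    using u v assms E.corner_rules v_rules(3) by metis+
  then obtain g where g: "g \<in> Hor (Src F)" "Dom (HC (Src F)) g = Cod (VC (Src F)) u"
    "Cod (HC (Src F)) g = Cod (VC (Src F)) v" "onHor F g = bt (Trg F) b"
    using hor_full[of "Cod (VC (Src F)) u" "Cod (VC (Src F)) v" "bt (Trg F) b"] u v assms by auto
  have "square_boundary (Src F) f g u v" using g u v assms by (simp add: square_boundary_def)
  from sq_full[OF this, of b] g u v assms show thesis using that by metis
qed

lemma sq_surj:
  assumes "b \<in> Sq (Trg F)" obtains a where "a \<in> Sq (Src F)" "onSq F a = b"
  using assms ver_surj[of "lf (Trg F) b"] sq_lift_left[of _ b] E.sq_rules(1) by metis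

text \<open>\<open>F\<close> is surjective on all four sorts, so values of \<open>K\<close> are read
  off from arbitrary preimages. For composites the preimage of the second factor is chosen to start
  where that of the first one ends; hence \<open>F\<close> behaves as the quotient by its
  kernel.\<close>

lemma factor:
  assumes G: "G \<in> DArr" "Src G = Src F"
    and ko: "\<And>x y. x \<in> Ob (Src F) \<Longrightarrow> y \<in> Ob (Src F) \<Longrightarrow> onOb F x = onOb F y \<Longrightarrow> onOb G x = onOb G y"
    and kh: "\<And>x y. x \<in> Hor (Src F) \<Longrightarrow> y \<in> Hor (Src F) \<Longrightarrow> onHor F x = onHor F y \<Longrightarrow> onHor G x = onHor G y"
    and kv: "\<And>x y. x \<in> Ver (Src F) \<Longrightarrow> y \<in> Ver (Src F) \<Longrightarrow> onVer F x = onVer F y \<Longrightarrow> onVer G x = onVer G y"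
    and ks: "\<And>x y. x \<in> Sq (Src F) \<Longrightarrow> y \<in> Sq (Src F) \<Longrightarrow> onSq F x = onSq F y \<Longrightarrow> onSq G x = onSq G y"
  obtains K where "K \<in> DArr" "Src K = Trg F" "Trg K = Trg G" "dblfun_comp K F = G"
proof -
  interpret G: dfun "Src F" "Trg G" "onOb G" "onHor G" "onVer G" "onSq G"
    using DArr_dfun[OF G(1)] unfolding G(2) .
  define Ko where "Ko y = onOb G (SOME x. x \<in> Ob (Src F) \<and> onOb F x = y)" for y
  define Kh where "Kh y = onHor G (SOME x. x \<in> Hor (Src F) \<and> onHor F x = y)" for y
  define Kv where "Kv y = onVer G (SOME x. x \<in> Ver (Src F) \<and> onVer F x = y)" for y
  define Ks where "Ks y = onSq G (SOME x. x \<in> Sq (Src F) \<and> onSq F x = y)" for y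
  have Ko: "Ko (onOb F x) = onOb G x" if "x \<in> Ob (Src F)" for x
    unfolding Ko_def by (rule someI2[of "\<lambda>z. z \<in> Ob (Src F) \<and> onOb F z = onOb F x" x]) (simp add: that, metis ko that)
  have Kh: "Kh (onHor F x) = onHor G x" if "x \<in> Hor (Src F)" for x
    unfolding Kh_def by (rule someI2[of "\<lambda>z. z \<in> Hor (Src F) \<and> onHor F z = onHor F x" x]) (simp add: that, metis kh that)
  have Kv: "Kv (onVer F x) = onVer G x" if "x \<in> Ver (Src F)" for x
    unfolding Kv_def by (rule someI2[of "\<lambda>z. z \<in> Ver (Src F) \<and> onVer F z = onVer F x" x]) (simp add: that, metis kv that)
  have Ks: "Ks (onSq F x) = onSq G x" if "x \<in> Sq (Src F)" for x
    unfolding Ks_def by (rule someI2[of "\<lambda>z. z \<in> Sq (Src F) \<and> onSq F z = onSq F x" x]) (simp add: that, metis ks that)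
  have K: "dfun (Trg F) (Trg G) Ko Kh Kv Ks"
  proof (rule dfunI)
    show "double_category (Trg F)" "double_category (Trg G)" by (rule E.dc G.E.dc)+
  next
    fix x assume "x \<in> Ob (Trg F)"
    then obtain y where "y \<in> Ob (Src F)" "onOb F y = x" by (rule ob_surj)
    then show "Ko x \<in> Ob (Trg G)" "Kh (Idt (HC (Trg F)) x) = Idt (HC (Trg G)) (Ko x)"
      "Kv (Idt (VC (Trg F)) x) = Idt (VC (Trg G)) (Ko x)"
      using Ko[of y] Kh[of "Idt (HC (Src F)) y"] Kv[of "Idt (VC (Src F)) y"] by auto
  next
    fix x assume "x \<in> Hor (Trg F)"
    then obtain y where "y \<in> Hor (Src F)" "onHor F y = x" by (rule hor_surj)
    then show "Kh x \<in> Hor (Trg G)" "Dom (HC (Trg G)) (Kh x) = Ko (Dom (HC (Trg F)) x)"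
      "Cod (HC (Trg G)) (Kh x) = Ko (Cod (HC (Trg F)) x)"
      "Ks (Idt (VS (Trg F)) x) = Idt (VS (Trg G)) (Kh x)"
      using Kh[of y] Ks[of "Idt (VS (Src F)) y"] by (auto simp: Ko)
  next
    fix x assume "x \<in> Ver (Trg F)"
    then obtain y where "y \<in> Ver (Src F)" "onVer F y = x" by (rule ver_surj)
    then show "Kv x \<in> Ver (Trg G)" "Dom (VC (Trg G)) (Kv x) = Ko (Dom (VC (Trg F)) x)"
      "Cod (VC (Trg G)) (Kv x) = Ko (Cod (VC (Trg F)) x)"
      "Ks (Idt (HS (Trg F)) x) = Idt (HS (Trg G)) (Kv x)"
      using Kv[of y] Ks[of "Idt (HS (Src F)) y"] by (auto simp: Ko)
  next
    fix x assume "x \<in> Sq (Trg F)"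
    then obtain y where "y \<in> Sq (Src F)" "onSq F y = x" by (rule sq_surj)
    then show "Ks x \<in> Sq (Trg G)" "lf (Trg G) (Ks x) = Kv (lf (Trg F) x)"
      "rt (Trg G) (Ks x) = Kv (rt (Trg F) x)" "tp (Trg G) (Ks x) = Kh (tp (Trg F) x)"
      "bt (Trg G) (Ks x) = Kh (bt (Trg F) x)"
      using Ks[of y] by (auto simp: Kv Kh)
  next
    fix x y assume x: "x \<in> Hor (Trg F)" and y: "y \<in> Hor (Trg F)" "Cod (HC (Trg F)) x = Dom (HC (Trg F)) y"
    from x obtain a where a: "a \<in> Hor (Src F)" "onHor F a = x" by (rule hor_surj)
    have "Dom (HC (Trg F)) y = onOb F (Cod (HC (Src F)) a)" using a y(2) by (metis h_rules(3))
    then obtain b where b: "b \<in> Hor (Src F)" "Dom (HC (Src F)) b = Cod (HC (Src F)) a" "onHor F b = y"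
      using hor_lift_dom[OF D.H.cod_in[OF a(1)] y(1)] by metis
    show "Kh (Comp (HC (Trg F)) y x) = Comp (HC (Trg G)) (Kh y) (Kh x)"
      using Kh[of "Comp (HC (Src F)) b a"] Kh[of a] Kh[of b] a b by simp
  next
    fix x y assume x: "x \<in> Ver (Trg F)" and y: "y \<in> Ver (Trg F)" "Cod (VC (Trg F)) x = Dom (VC (Trg F)) y"
    from x obtain a where a: "a \<in> Ver (Src F)" "onVer F a = x" by (rule ver_surj)
    have "Dom (VC (Trg F)) y = onOb F (Cod (VC (Src F)) a)" using a y(2) by (metis v_rules(3))
    then obtain b where b: "b \<in> Ver (Src F)" "Dom (VC (Src F)) b = Cod (VC (Src F)) a" "onVer F b = y"
      using ver_lift_dom[OF D.v_rules(2)[OF a(1)] y(1)] by metis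
    have "Comp (VC (Src F)) b a \<in> Ver (Src F)" using a b by simp
    then show "Kv (Comp (VC (Trg F)) y x) = Comp (VC (Trg G)) (Kv y) (Kv x)"
      using Kv[of "Comp (VC (Src F)) b a"] Kv[of a] Kv[of b] a b by simp
  next
    fix x y assume x: "x \<in> Sq (Trg F)" and y: "y \<in> Sq (Trg F)" "rt (Trg F) x = lf (Trg F) y"
    from x obtain a where a: "a \<in> Sq (Src F)" "onSq F a = x" by (rule sq_surj)
    have "lf (Trg F) y = onVer F (rt (Src F) a)" using a y(2) by (metis s_rules(3))
    then obtain b where b: "b \<in> Sq (Src F)" "lf (Src F) b = rt (Src F) a" "onSq F b = y"
      using sq_lift_left[OF D.sq_rules(2)[OF a(1)] y(1)] by metis
    show "Ks (Comp (HS (Trg F)) y x) = Comp (HS (Trg G)) (Ks y) (Ks x)"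
      using Ks[of "Comp (HS (Src F)) b a"] Ks[of a] Ks[of b] a b by simp
  next
    fix x y assume x: "x \<in> Sq (Trg F)" and y: "y \<in> Sq (Trg F)" "bt (Trg F) x = tp (Trg F) y"
    from x obtain a where a: "a \<in> Sq (Src F)" "onSq F a = x" by (rule sq_surj)
    have "tp (Trg F) y = onHor F (bt (Src F) a)" using a y(2) by (metis s_rules(5))
    then obtain b where b: "b \<in> Sq (Src F)" "tp (Src F) b = bt (Src F) a" "onSq F b = y"
      using sq_lift_top[OF D.sq_rules(4)[OF a(1)] y(1)] by metis
    show "Ks (Comp (VS (Trg F)) y x) = Comp (VS (Trg G)) (Ks y) (Ks x)"
      using Ks[of "Comp (VS (Src F)) b a"] Ks[of a] Ks[of b] a b by simp
  qed
  let ?K = "mk (Trg F) (Trg G) Ko Kh Kv Ks"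
  have K_in: "?K \<in> DArr" using K G(1) F_in by (simp add: mk_DArr)
  have "dblfun_comp ?K F = G"
    by (rule DArr_eqI) (use K_in F_in G in \<open>simp_all add: Ko Kh Kv Ks\<close>)
  with K_in show thesis using that[of ?K] by simp
qed

lemma epi:
  assumes "K \<in> DArr" "L \<in> DArr" "Src K = Trg F" "Src L = Trg F" "dblfun_comp K F = dblfun_comp L F"
  shows "K = L"
proof (rule DArr_eqI[OF assms(1,2)])
  show "Src K = Src L" using assms by simp
  show "Trg K = Trg L" using arg_cong[OF assms(5), of Trg] by simp
next
  fix x assume "x \<in> Ob (Src K)"
  then obtain y where "y \<in> Ob (Src F)" "onOb F y = x" using ob_surj[of x] assms by auto
  then show "onOb K x = onOb L x" using arg_cong[OF assms(5), of "\<lambda>M. onOb M y"] by simp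
next
  fix x assume "x \<in> Hor (Src K)"
  then obtain y where "y \<in> Hor (Src F)" "onHor F y = x" using hor_surj[of x] assms by auto
  then show "onHor K x = onHor L x" using arg_cong[OF assms(5), of "\<lambda>M. onHor M y"] by simp
next
  fix x assume "x \<in> Ver (Src K)"
  then obtain y where "y \<in> Ver (Src F)" "onVer F y = x" using ver_surj[of x] assms by auto
  then show "onVer K x = onVer L x" using arg_cong[OF assms(5), of "\<lambda>M. onVer M y"] by simp
next
  fix x assume "x \<in> Sq (Src K)"
  then obtain y where "y \<in> Sq (Src F)" "onSq F y = x" using sq_surj[of x] assms by auto
  then show "onSq K x = onSq L x" using arg_cong[OF assms(5), of "\<lambda>M. onSq M y"] by simp
qed

end

text \<open>Containment of kernels on all four sorts, the only condition for \<open>G\<close> to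
  factor through \<open>F\<close> when \<open>F\<close> is a canonical trivial fibration.\<close>

definition ker_le :: "'a dblfun \<Rightarrow> 'a dblfun \<Rightarrow> bool" where
  "ker_le F G \<longleftrightarrow>
    (\<forall>x\<in>Ob (Src F). \<forall>y\<in>Ob (Src F). onOb F x = onOb F y \<longrightarrow> onOb G x = onOb G y) \<and>
    (\<forall>x\<in>Hor (Src F). \<forall>y\<in>Hor (Src F). onHor F x = onHor F y \<longrightarrow> onHor G x = onHor G y) \<and>
    (\<forall>x\<in>Ver (Src F). \<forall>y\<in>Ver (Src F). onVer F x = onVer F y \<longrightarrow> onVer G x = onVer G y) \<and>
    (\<forall>x\<in>Sq (Src F). \<forall>y\<in>Sq (Src F). onSq F x = onSq F y \<longrightarrow> onSq G x = onSq G y)"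

lemma (in ctfib) factor_ker:
  assumes "G \<in> DArr" "Src G = Src F" "ker_le F G"
  obtains K where "K \<in> DArr" "Src K = Trg F" "Trg K = Trg G" "dblfun_comp K F = G"
proof (rule factor[OF assms(1,2)])
  show "x \<in> Ob (Src F) \<Longrightarrow> y \<in> Ob (Src F) \<Longrightarrow> onOb F x = onOb F y \<Longrightarrow> onOb G x = onOb G y" for x y
    using assms(3) unfolding ker_le_def by metis
  show "x \<in> Hor (Src F) \<Longrightarrow> y \<in> Hor (Src F) \<Longrightarrow> onHor F x = onHor F y \<Longrightarrow> onHor G x = onHor G y" for x y
    using assms(3) unfolding ker_le_def by metis
  show "x \<in> Ver (Src F) \<Longrightarrow> y \<in> Ver (Src F) \<Longrightarrow> onVer F x = onVer F y \<Longrightarrow> onVer G x = onVer G y" for x y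
    using assms(3) unfolding ker_le_def by metis
  show "x \<in> Sq (Src F) \<Longrightarrow> y \<in> Sq (Src F) \<Longrightarrow> onSq F x = onSq F y \<Longrightarrow> onSq G x = onSq G y" for x y
    using assms(3) unfolding ker_le_def by metis
qed (rule that)

section \<open>Pushout squares in \<open>DblCat\<close>\<close>

lemma pushout_squareD:
  assumes "pushout_square DblCat f g h k"
  shows "f \<in> DArr" "g \<in> DArr" "h \<in> DArr" "k \<in> DArr" "Src f = Src g" "Trg f = Src h" "Trg g = Src k"
    "Trg h = Trg k" "dblfun_comp h f = dblfun_comp k g"
  using assms by (simp_all add: pushout_square_def commutative_square_def)

lemma pushout_square_ex:
  assumes "pushout_square DblCat f g h k" "h' \<in> DArr" "k' \<in> DArr" "Trg f = Src h'" "Trg g = Src k'"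
    "Trg h' = Trg k'" "dblfun_comp h' f = dblfun_comp k' g"
  obtains u where "u \<in> DArr" "Src u = Trg h" "Trg u = Trg h'" "dblfun_comp u h = h'" "dblfun_comp u k = k'"
proof -
  have "commutative_square DblCat f g h' k'"
    using assms(2-) pushout_squareD[OF assms(1)] by (simp add: commutative_square_def)
  then have "\<exists>!u. u \<in> arr_betw DblCat (Trg h) (Trg h') \<and> dblfun_comp u h = h' \<and> dblfun_comp u k = k'"
    using assms(1) unfolding pushout_square_def by simp
  then show thesis using that by (auto simp: arr_betw_def)
qed

lemma pushout_square_uniq:
  assumes "pushout_square DblCat f g h k" "u \<in> DArr" "v \<in> DArr" "Src u = Trg h" "Src v = Trg h"
    "Trg u = Trg v" "dblfun_comp u h = dblfun_comp v h" "dblfun_comp u k = dblfun_comp v k"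
  shows "u = v"
proof -
  note d = pushout_squareD[OF assms(1)]
  have "commutative_square DblCat f g (dblfun_comp u h) (dblfun_comp u k)"
    using assms(2-) d by (simp add: commutative_square_def comp_assoc[symmetric])
  then have "\<exists>!w. w \<in> arr_betw DblCat (Trg h) (Trg u) \<and> dblfun_comp w h = dblfun_comp u h \<and>
      dblfun_comp w k = dblfun_comp u k"
    using assms(1)[unfolded pushout_square_def, THEN conjunct2, rule_format, of "dblfun_comp u h" "dblfun_comp u k"]
    by simp
  then show ?thesis using assms(2-) by (auto simp: arr_betw_def)
qed

text \<open>The first kernel condition makes \<open>Trg r\<close> the vertex of a cocone and so
  gives \<open>u\<close> out of the pushout; the second gives \<open>t\<close> back. The composite
  \<open>t u\<close> fixes both legs of the pushout, hence is the identity, and \<open>p'\<close> is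
  a retract of \<open>r\<close> with identities on the common source.\<close>

lemma pushout_retract:
  assumes po: "pushout_square DblCat p i i' p'" and p: "ctf p"
    and r: "r \<in> DArr" "ctf r" "Src r = Trg i"
    and k1: "ker_le p (dblfun_comp r i)" and k2: "ker_le r p'"
  shows "retract_of DblCat p' r"
proof -
  note d = pushout_squareD[OF po]
  interpret p: ctfib p using d(1) p by unfold_locales
  interpret r: ctfib r using r by unfold_locales
  obtain k where k: "k \<in> DArr" "Src k = Trg p" "Trg k = Trg r" "dblfun_comp k p = dblfun_comp r i"
    using p.factor_ker[of "dblfun_comp r i"] d r k1 by auto
  obtain t where t: "t \<in> DArr" "Src t = Trg r" "Trg t = Trg p'" "dblfun_comp t r = p'"
    using r.factor_ker[of p'] d r k2 by auto
  obtain u where u: "u \<in> DArr" "Src u = Trg i'" "Trg u = Trg r" "dblfun_comp u i' = k" "dblfun_comp u p' = r"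
    using pushout_square_ex[OF po, of k r] k d r by auto
  \<comment> \<open>Precomposition with the epimorphism \<open>p\<close> reduces
    \<open>t k = i'\<close> to \<open>t r i = p' i = i' p\<close>.\<close>
  have "dblfun_comp (dblfun_comp t k) p = dblfun_comp t (dblfun_comp r i)"
    using comp_assoc[of p k t] k t d by simp
  also have "\<dots> = dblfun_comp i' p" using comp_assoc[of i r t] t r d by simp
  finally have tk: "dblfun_comp t k = i'"
    by (rule p.epi[rotated -1]) (use k t d in simp_all)
  have "dblfun_comp (dblfun_comp t u) i' = i'" "dblfun_comp (dblfun_comp t u) p' = p'"
    using comp_assoc[of i' u t] comp_assoc[of p' u t] tk u t d by simp_all
  then have "dblfun_comp t u = dblfun_id (Trg i')"
    using pushout_square_uniq[OF po, of "dblfun_comp t u" "dblfun_id (Trg i')"] u t d by simp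
  with u t d r show ?thesis
    unfolding retract_of_def commutative_square_def
    by - (rule exI[of _ "dblfun_id (Src p')"], rule exI[of _ "dblfun_id (Src p')"], rule exI[of _ u],
      rule exI[of _ t], simp)
qed

section \<open>Small sets and encodings\<close>

text \<open>Extends \<open>small\<close> to sets over any type: labels, triples and words do not
  live over \<open>'a\<close> until they are encoded there.\<close>

abbreviation sml :: "'a itself \<Rightarrow> 'b set \<Rightarrow> bool" where
  "sml (ty :: 'a itself) A \<equiv> |A| <o |UNIV :: 'a set|"

locale univ =
  fixes ty :: "'a itself"
  assumes universe: "universe ty"
begin

lemma Cinfinite_univ: "Cinfinite |UNIV :: 'a set|"
proof -
  have "natLeq \<le>o |UNIV :: 'a set|"
    using universe ordLess_imp_ordLeq unfolding universe_def by blast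
  then have "|UNIV :: nat set| \<le>o |UNIV :: 'a set|"
    using card_of_nat ordIso_ordLeq_trans by blast
  then have "infinite (UNIV :: 'a set)" using infinite_iff_card_of_nat by blast
  then show ?thesis unfolding cinfinite_def using card_of_Card_order by (simp add: Field_card_of)
qed

lemma regularCard_univ: "regularCard |UNIV :: 'a set|"
  using universe unfolding universe_def by simp

text \<open>Regularity of the cardinality enters through this bound; products, binary unions and
  unions of sequences are instances of it.\<close>

lemma sml_UNION: "sml ty I \<Longrightarrow> (\<And>i. i \<in> I \<Longrightarrow> sml ty (A i)) \<Longrightarrow> sml ty (\<Union>i\<in>I. A i)"
  by (rule regularCard_UNION_bound[OF Cinfinite_univ regularCard_univ])

lemma sml_image: "sml ty A \<Longrightarrow> sml ty (f ` A)"
  using card_of_image ordLeq_ordLess_trans by blast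

lemma sml_subset: "B \<subseteq> A \<Longrightarrow> sml ty A \<Longrightarrow> sml ty B"
  using card_of_mono1 ordLeq_ordLess_trans by blast

text \<open>Uncountability enters here. Together with regularity it keeps every construction by
  stages indexed over \<open>nat\<close> small, such as words or closure under composition.\<close>

lemma sml_nat: "sml ty (A :: nat set)"
proof -
  have "|UNIV :: nat set| <o |UNIV :: 'a set|"
    using universe card_of_nat ordIso_ordLess_trans unfolding universe_def by blast
  then show ?thesis using sml_subset[of A UNIV] by blast
qed

lemma sml_Times:
  assumes "sml ty A" "sml ty B" shows "sml ty (A \<times> B)"
proof -
  have "A \<times> B = (\<Union>a\<in>A. Pair a ` B)" by auto
  moreover have "sml ty (\<Union>a\<in>A. Pair a ` B)" by (rule sml_UNION[OF assms(1) sml_image[OF assms(2)]])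
  ultimately show ?thesis by simp
qed

lemma sml_Un:
  assumes "sml ty A" "sml ty B" shows "sml ty (A \<union> B)"
proof -
  have "sml ty (\<Union>i\<in>{0::nat, 1}. if i = 0 then A else B)"
    by (rule sml_UNION[OF sml_nat]) (use assms in auto)
  moreover have "(\<Union>i\<in>{0::nat, 1}. if i = 0 then A else B) = A \<union> B" by auto
  ultimately show ?thesis by simp
qed

lemma sml_nat_UNION: "(\<And>n::nat. sml ty (A n)) \<Longrightarrow> sml ty (\<Union>n. A n)"
  by (rule sml_UNION[OF sml_nat])

lemma sml_encode:
  assumes "sml ty (A :: 'b set)" obtains f :: "'b \<Rightarrow> 'a" where "inj_on f A"
proof -
  have "|A| \<le>o |UNIV :: 'a set|" using assms ordLess_imp_ordLeq by blast
  then have "\<exists>f :: 'b \<Rightarrow> 'a. inj_on f A \<and> f ` A \<subseteq> UNIV" by (simp only: card_of_ordLeq)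
  then show thesis using that by blast
qed

lemma small_iff_sml: "small (A :: 'a set) \<longleftrightarrow> sml ty A"
  by (rule small_def)

text \<open>Squares with a new boundary are 5-tuples that must again be elements of
  \<open>'a\<close>. Since \<open>'a\<close> is infinite, pairs over \<open>'a\<close> inject into
  \<open>'a\<close>; \<open>sqc\<close> iterates such a pairing.\<close>

definition pr :: "'a \<times> 'a \<Rightarrow> 'a" where "pr = (SOME f. inj f)"
definition un :: "'a \<Rightarrow> 'a \<times> 'a" where "un = inv pr"

lemma un_pr [simp]: "un (pr x) = x"
proof -
  have "infinite (UNIV :: 'a set)"
    using Cinfinite_univ unfolding cinfinite_def by (simp add: Field_card_of)
  then have "|(UNIV :: 'a set) \<times> (UNIV :: 'a set)| \<le>o |UNIV :: 'a set|"
    using card_of_Times_same_infinite ordIso_imp_ordLeq by blast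
  then have "\<exists>f :: 'a \<times> 'a \<Rightarrow> 'a. inj_on f (UNIV \<times> UNIV) \<and> f ` (UNIV \<times> UNIV) \<subseteq> UNIV"
    by (simp only: card_of_ordLeq)
  then have "\<exists>f :: 'a \<times> 'a \<Rightarrow> 'a. inj f" by auto
  then have "inj pr" unfolding pr_def by (rule someI_ex)
  then show ?thesis unfolding un_def by simp
qed

definition sqc :: "'a \<Rightarrow> 'a \<Rightarrow> 'a \<Rightarrow> 'a \<Rightarrow> 'a \<Rightarrow> 'a" where
  "sqc f g u v a = pr (pr (f, g), pr (pr (u, v), a))"
definition "stp s = fst (un (fst (un s)))"
definition "sbt s = snd (un (fst (un s)))"
definition "slf s = fst (un (fst (un (snd (un s)))))"
definition "srt s = snd (un (fst (un (snd (un s)))))"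
definition "sba s = snd (un (snd (un s)))"

lemma sqc_simps [simp]:
  "stp (sqc f g u v a) = f" "sbt (sqc f g u v a) = g" "slf (sqc f g u v a) = u"
  "srt (sqc f g u v a) = v" "sba (sqc f g u v a) = a"
  by (simp_all add: sqc_def stp_def sbt_def slf_def srt_def sba_def)

end

section \<open>Transport of a category along injections\<close>

definition enc_cat :: "('o, 'm) cat \<Rightarrow> ('o \<Rightarrow> 'a) \<Rightarrow> ('m \<Rightarrow> 'b) \<Rightarrow> ('a, 'b) cat" where
  "enc_cat C fo fa = (let go = inv_into (Obj C) fo; ga = inv_into (Arr C) fa in
    \<lparr>Obj = fo ` Obj C, Arr = fa ` Arr C, Dom = fo \<circ> Dom C \<circ> ga, Cod = fo \<circ> Cod C \<circ> ga,
     Idt = fa \<circ> Idt C \<circ> go, Comp = (\<lambda>g f. fa (Comp C (ga g) (ga f)))\<rparr>)"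

lemma enc_cat_simps:
  assumes "inj_on fo (Obj C)" "inj_on fa (Arr C)"
  shows "Obj (enc_cat C fo fa) = fo ` Obj C" "Arr (enc_cat C fo fa) = fa ` Arr C"
    "f \<in> Arr C \<Longrightarrow> Dom (enc_cat C fo fa) (fa f) = fo (Dom C f)"
    "f \<in> Arr C \<Longrightarrow> Cod (enc_cat C fo fa) (fa f) = fo (Cod C f)"
    "x \<in> Obj C \<Longrightarrow> Idt (enc_cat C fo fa) (fo x) = fa (Idt C x)"
    "f \<in> Arr C \<Longrightarrow> g \<in> Arr C \<Longrightarrow> Comp (enc_cat C fo fa) (fa g) (fa f) = fa (Comp C g f)"
  using assms by (simp_all add: enc_cat_def Let_def)

lemma category_enc_cat:
  assumes "category C" "inj_on fo (Obj C)" "inj_on fa (Arr C)"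
  shows "category (enc_cat C fo fa)"
proof -
  interpret cate C by unfold_locales fact
  note s [simp] = enc_cat_simps[OF assms(2,3)]
  have [simp]: "fo x = fo y \<longleftrightarrow> x = y" if "x \<in> Obj C" "y \<in> Obj C" for x y
    using assms(2) that by (meson inj_on_contraD)
  show ?thesis
    by (rule categoryI) (auto simp: assoc)
qed

lemma enc_cat_functors:
  assumes "category C" "inj_on fo (Obj C)" "inj_on fa (Arr C)"
  shows "is_functor C (enc_cat C fo fa) fo fa"
    and "is_functor (enc_cat C fo fa) C (inv_into (Obj C) fo) (inv_into (Arr C) fa)"
proof -
  interpret cate C by unfold_locales fact
  note s [simp] = enc_cat_simps[OF assms(2,3)]
  have [simp]: "fo x = fo y \<longleftrightarrow> x = y" if "x \<in> Obj C" "y \<in> Obj C" for x y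
    using assms(2) that by (meson inj_on_contraD)
  note [simp] = inv_into_f_f[OF assms(2)] inv_into_f_f[OF assms(3)]
  show "is_functor C (enc_cat C fo fa) fo fa"
    by (rule is_functorI) auto
  show "is_functor (enc_cat C fo fa) C (inv_into (Obj C) fo) (inv_into (Arr C) fa)"
    by (rule is_functorI) auto
qed

lemma is_functor_comp':
  assumes "is_functor C D Fo Fa" "is_functor D E Go Ga" "category C"
  shows "is_functor C E (Go \<circ> Fo) (Ga \<circ> Fa)"
  using assms unfolding is_functor_def category_def by simp

section \<open>Double categories with squares pulled back along functors\<close>

text \<open>Objects and morphisms come from \<open>H\<close> and \<open>V\<close>, which map to the
  two edge categories of \<open>D\<close>; squares are those of \<open>D\<close> with a boundary
  chosen upstairs. The projection to \<open>D\<close> is then fully faithful on squares by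
  construction, and becomes a canonical trivial fibration as soon as the given functors are
  surjective on objects and full.\<close>

locale pull = univ ty + D: dcat D + H: cate H + V: cate V
  for ty :: "'a itself" and D :: "'a dblcat" and H V :: "('a, 'a) cat" +
  fixes e eh ev :: "'a \<Rightarrow> 'a"
  assumes OV: "Obj V = Obj H"
    and fh: "is_functor H (HC D) e eh" and fv: "is_functor V (VC D) e ev"
begin

lemmas OV' [simp] = OV
lemmas fh_rules [simp] = is_functorD[OF fh]
lemmas fv_rules = is_functorD[OF fv]

lemma fv_rules' [simp]:
  "x \<in> Obj H \<Longrightarrow> ev (Idt V x) = Idt (VC D) (e x)"
  "f \<in> Arr V \<Longrightarrow> ev f \<in> Ver D"
  "f \<in> Arr V \<Longrightarrow> Dom (VC D) (ev f) = e (Dom V f)"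
  "f \<in> Arr V \<Longrightarrow> Cod (VC D) (ev f) = e (Cod V f)"
  "f \<in> Arr V \<Longrightarrow> g \<in> Arr V \<Longrightarrow> Cod V f = Dom V g \<Longrightarrow> ev (Comp V g f) = Comp (VC D) (ev g) (ev f)"
  using fv_rules by simp_all

lemma V_rules [simp]:
  "f \<in> Arr V \<Longrightarrow> Dom V f \<in> Obj H" "f \<in> Arr V \<Longrightarrow> Cod V f \<in> Obj H" "x \<in> Obj H \<Longrightarrow> Idt V x \<in> Arr V"
  "x \<in> Obj H \<Longrightarrow> Dom V (Idt V x) = x" "x \<in> Obj H \<Longrightarrow> Cod V (Idt V x) = x"
  using V.dom_in V.cod_in V.idt_in V.dom_idt V.cod_idt by simp_all

text \<open>The first equation admits only values of \<open>sqc\<close>, so that a square is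
  determined by its boundary and its component in \<open>D\<close>.\<close>

definition psq :: "'a set" where
  "psq = {s. s = sqc (stp s) (sbt s) (slf s) (srt s) (sba s) \<and>
     stp s \<in> Arr H \<and> sbt s \<in> Arr H \<and> slf s \<in> Arr V \<and> srt s \<in> Arr V \<and>
     Dom H (stp s) = Dom V (slf s) \<and> Cod H (stp s) = Dom V (srt s) \<and>
     Dom H (sbt s) = Cod V (slf s) \<and> Cod H (sbt s) = Cod V (srt s) \<and>
     sba s \<in> squares D (eh (stp s)) (eh (sbt s)) (ev (slf s)) (ev (srt s))}"

definition P :: "'a dblcat" where
  "P = \<lparr>HC = H, VC = V,
    HS = \<lparr>Obj = Arr V, Arr = psq, Dom = slf, Cod = srt,
      Idt = (\<lambda>u. sqc (Idt H (Dom V u)) (Idt H (Cod V u)) u u (Idt (HS D) (ev u))),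
      Comp = (\<lambda>b a. sqc (Comp H (stp b) (stp a)) (Comp H (sbt b) (sbt a)) (slf a) (srt b)
        (Comp (HS D) (sba b) (sba a)))\<rparr>,
    VS = \<lparr>Obj = Arr H, Arr = psq, Dom = stp, Cod = sbt,
      Idt = (\<lambda>f. sqc f f (Idt V (Dom H f)) (Idt V (Cod H f)) (Idt (VS D) (eh f))),
      Comp = (\<lambda>b a. sqc (stp a) (sbt b) (Comp V (slf b) (slf a)) (Comp V (srt b) (srt a))
        (Comp (VS D) (sba b) (sba a)))\<rparr>\<rparr>"

lemma psqE:
  assumes "s \<in> psq"
  obtains f g u v a where "s = sqc f g u v a" "f \<in> Arr H" "g \<in> Arr H" "u \<in> Arr V" "v \<in> Arr V"
    "Dom H f = Dom V u" "Cod H f = Dom V v" "Dom H g = Cod V u" "Cod H g = Cod V v" "a \<in> Sq D"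
    "tp D a = eh f" "bt D a = eh g" "lf D a = ev u" "rt D a = ev v"
  using assms unfolding psq_def squares_def by blast

lemma sqc_psq: "sqc f g u v a \<in> psq \<longleftrightarrow> f \<in> Arr H \<and> g \<in> Arr H \<and> u \<in> Arr V \<and> v \<in> Arr V \<and>
     Dom H f = Dom V u \<and> Cod H f = Dom V v \<and> Dom H g = Cod V u \<and> Cod H g = Cod V v \<and>
     a \<in> Sq D \<and> tp D a = eh f \<and> bt D a = eh g \<and> lf D a = ev u \<and> rt D a = ev v"
  by (simp add: psq_def squares_def)

lemma P_simps [simp]:
  "HC P = H" "VC P = V" "Sq P = psq" "lf P = slf" "rt P = srt" "tp P = stp" "bt P = sbt"
  "Obj (HS P) = Arr V" "Obj (VS P) = Arr H" "Arr (VS P) = psq"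
  "Idt (HS P) u = sqc (Idt H (Dom V u)) (Idt H (Cod V u)) u u (Idt (HS D) (ev u))"
  "Idt (VS P) f = sqc f f (Idt V (Dom H f)) (Idt V (Cod H f)) (Idt (VS D) (eh f))"
  "Comp (HS P) b a = sqc (Comp H (stp b) (stp a)) (Comp H (sbt b) (sbt a)) (slf a) (srt b)
        (Comp (HS D) (sba b) (sba a))"
  "Comp (VS P) b a = sqc (stp a) (sbt b) (Comp V (slf b) (slf a)) (Comp V (srt b) (srt a))
        (Comp (VS D) (sba b) (sba a))"
  by (simp_all add: P_def)

lemma dc_P: "double_category P"
proof (rule double_categoryI)
  show "category (HC P)" "category (VC P)" using H.cat V.cat by simp_all
  show "category (HS P)"
  proof (rule categoryI)
    fix a b c assume "a \<in> Arr (HS P)" "b \<in> Arr (HS P)" "c \<in> Arr (HS P)"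
      "Cod (HS P) a = Dom (HS P) b" "Cod (HS P) b = Dom (HS P) c"
    then show "Comp (HS P) c (Comp (HS P) b a) = Comp (HS P) (Comp (HS P) c b) a"
      by (auto elim!: psqE simp: H.assoc D.HS.assoc)
  qed (auto elim!: psqE simp: sqc_psq)
  show "category (VS P)"
  proof (rule categoryI)
    fix a b c assume "a \<in> Arr (VS P)" "b \<in> Arr (VS P)" "c \<in> Arr (VS P)"
      "Cod (VS P) a = Dom (VS P) b" "Cod (VS P) b = Dom (VS P) c"
    then show "Comp (VS P) c (Comp (VS P) b a) = Comp (VS P) (Comp (VS P) c b) a"
      by (auto elim!: psqE simp: V.assoc D.vs_assoc)
  qed (auto elim!: psqE simp: sqc_psq)
qed (auto elim!: psqE simp: sqc_psq D.hs_idt D.hs_idt_idt D.vs_idt D.interchange)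

lemma dfun_P: "dfun P D e eh ev sba"
  by (rule dfunI) (use dc_P D.dc in \<open>auto elim!: psqE\<close>)

lemma small_P:
  assumes "small (Obj H)" "small (Arr H)" "small (Arr V)" "small (Sq D)"
  shows "small_dblcat P"
proof -
  let ?f = "\<lambda>(f, g, u, v, a). sqc f g u v a"
  have "sml ty (Arr H \<times> Arr H \<times> Arr V \<times> Arr V \<times> Sq D)"
    using assms unfolding small_iff_sml by (intro sml_Times)
  then have "sml ty (?f ` (Arr H \<times> Arr H \<times> Arr V \<times> Arr V \<times> Sq D))" by (rule sml_image)
  moreover have "psq \<subseteq> ?f ` (Arr H \<times> Arr H \<times> Arr V \<times> Arr V \<times> Sq D)"
  proof
    fix s assume "s \<in> psq"
    then show "s \<in> ?f ` (Arr H \<times> Arr H \<times> Arr V \<times> Arr V \<times> Sq D)"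
      by (rule psqE) (rule image_eqI[of _ _ "(stp s, sbt s, slf s, srt s, sba s)"]; simp)
  qed
  ultimately have "sml ty psq" using sml_subset by blast
  then show ?thesis unfolding small_dblcat_def using assms dc_P by (simp add: small_iff_sml)
qed

lemma sq_ff_P:
  assumes "small_dblcat P" "small_dblcat D"
  shows "sq_ff (mk P D e eh ev sba)"
proof (rule sq_ffI)
  show "mk P D e eh ev sba \<in> DArr" by (rule mk_DArr[OF dfun_P assms])
next
  fix f g u v b
  assume 1: "square_boundary (Src (mk P D e eh ev sba)) f g u v"
    and 2: "b \<in> squares (Trg (mk P D e eh ev sba)) (onHor (mk P D e eh ev sba) f)
      (onHor (mk P D e eh ev sba) g) (onVer (mk P D e eh ev sba) u) (onVer (mk P D e eh ev sba) v)"
  have "sqc f g u v b \<in> psq" using 1 2 unfolding sqc_psq by (simp add: square_boundary_def squares_def)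
  then show "\<exists>a\<in>squares (Src (mk P D e eh ev sba)) f g u v. onSq (mk P D e eh ev sba) a = b"
    by (intro bexI[of _ "sqc f g u v b"]) (simp_all add: squares_def)
qed (auto elim!: psqE)

end

text \<open>Only the edge functors have to be supplied. The image of a square has a prescribed
  boundary and lies over a prescribed square, so it exists and is unique; every law for squares
  holds because both sides agree in boundary and in image under \<open>F\<close>.\<close>

lemma (in sq_fib) lift_functor:
  assumes G: "G \<in> DArr" "Trg G = Trg F"
    and Lh: "is_functor (HC (Src G)) (HC (Src F)) Lo Lh" and Lv: "is_functor (VC (Src G)) (VC (Src F)) Lo Lv"
    and o: "\<And>x. x \<in> Ob (Src G) \<Longrightarrow> onOb F (Lo x) = onOb G x"
    and h: "\<And>x. x \<in> Hor (Src G) \<Longrightarrow> onHor F (Lh x) = onHor G x"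
    and v: "\<And>x. x \<in> Ver (Src G) \<Longrightarrow> onVer F (Lv x) = onVer G x"
  obtains K where "K \<in> DArr" "Src K = Src G" "Trg K = Src F" "dblfun_comp F K = G"
    "\<And>x. x \<in> Ob (Src G) \<Longrightarrow> onOb K x = Lo x" "\<And>x. x \<in> Hor (Src G) \<Longrightarrow> onHor K x = Lh x"
    "\<And>x. x \<in> Ver (Src G) \<Longrightarrow> onVer K x = Lv x"
proof -
  interpret G: dfun "Src G" "Trg F" "onOb G" "onHor G" "onVer G" "onSq G"
    using DArr_dfun[OF G(1)] unfolding G(2) .
  note [simp] = is_functorD[OF Lh] o h v
  note Lv = is_functorD[OF Lv]
  have [simp]: "\<And>x. x \<in> Ob (Src G) \<Longrightarrow> Lv (Idt (VC (Src G)) x) = Idt (VC (Src F)) (Lo x)" using Lv(2) by simp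
  note [simp] = Lv(3-6)
  define P where "P a b \<longleftrightarrow> b \<in> Sq (Src F) \<and> tp (Src F) b = Lh (tp (Src G) a) \<and>
      bt (Src F) b = Lh (bt (Src G) a) \<and> lf (Src F) b = Lv (lf (Src G) a) \<and>
      rt (Src F) b = Lv (rt (Src G) a) \<and> onSq F b = onSq G a" for a b
  define Ls where "Ls a = (SOME b. P a b)" for a
  have "\<exists>b. P a b" if "a \<in> Sq (Src G)" for a
  proof -
    have "square_boundary (Src F) (Lh (tp (Src G) a)) (Lh (bt (Src G) a)) (Lv (lf (Src G) a)) (Lv (rt (Src G) a))"
      using that by (simp add: square_boundary_def)
    then show ?thesis
    proof (rule sq_full)
      show "onSq G a \<in> Sq (Trg F)" "tp (Trg F) (onSq G a) = onHor F (Lh (tp (Src G) a))"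
        "bt (Trg F) (onSq G a) = onHor F (Lh (bt (Src G) a))" "lf (Trg F) (onSq G a) = onVer F (Lv (lf (Src G) a))"
        "rt (Trg F) (onSq G a) = onVer F (Lv (rt (Src G) a))"
        using that by simp_all
    next
      fix b assume "b \<in> Sq (Src F)" "tp (Src F) b = Lh (tp (Src G) a)"
       "bt (Src F) b = Lh (bt (Src G) a)" "lf (Src F) b = Lv (lf (Src G) a)"
        "rt (Src F) b = Lv (rt (Src G) a)" "onSq F b = onSq G a"
      then show "\<exists>b. P a b" unfolding P_def by (intro exI[of _ b] conjI)
    qed
  qed
  then have P: "P a (Ls a)" if "a \<in> Sq (Src G)" for a unfolding Ls_def by (rule someI_ex) (rule that)
  then have [simp]: "Ls a \<in> Sq (Src F)" "tp (Src F) (Ls a) = Lh (tp (Src G) a)"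
    "bt (Src F) (Ls a) = Lh (bt (Src G) a)" "lf (Src F) (Ls a) = Lv (lf (Src G) a)"
    "rt (Src F) (Ls a) = Lv (rt (Src G) a)" "onSq F (Ls a) = onSq G a" if "a \<in> Sq (Src G)" for a
    using that unfolding P_def by simp_all
  have K: "dfun (Src G) (Src F) Lo Lh Lv Ls"
  proof (rule dfunI)
    show "double_category (Src G)" "double_category (Src F)" using D.dc G.D.dc by simp_all
  next
    fix u assume "u \<in> Ver (Src G)"
    then show "Ls (Idt (HS (Src G)) u) = Idt (HS (Src F)) (Lv u)"
      by - (rule sq_faithful; simp)
  next
    fix f assume "f \<in> Hor (Src G)"
    then show "Ls (Idt (VS (Src G)) f) = Idt (VS (Src F)) (Lh f)"
      by - (rule sq_faithful; simp)
  next
    fix a b assume "a \<in> Sq (Src G)" "b \<in> Sq (Src G)" "rt (Src G) a = lf (Src G) b"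
    then show "Ls (Comp (HS (Src G)) b a) = Comp (HS (Src F)) (Ls b) (Ls a)"
      by - (rule sq_faithful; simp)
  next
    fix a b assume "a \<in> Sq (Src G)" "b \<in> Sq (Src G)" "bt (Src G) a = tp (Src G) b"
    then show "Ls (Comp (VS (Src G)) b a) = Comp (VS (Src F)) (Ls b) (Ls a)"
      by - (rule sq_faithful; simp)
  qed simp_all
  let ?K = "mk (Src G) (Src F) Lo Lh Lv Ls"
  have K_in: "?K \<in> DArr" using K G F_in by (simp add: mk_DArr)
  have "dblfun_comp F ?K = G"
    by (rule DArr_eqI) (use K_in F_in G in simp_all)
  then show thesis using K_in that[of ?K] by simp
qed

text \<open>A square of \<open>Src F\<close> is pushed down to \<open>Trg F\<close>, lifted through
  the composite, and recognized by faithfulness of \<open>F\<close>.\<close>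

lemma (in sq_fib) sq_ff_cancel:
  assumes K: "K \<in> DArr" "Trg K = Src F" and FK: "sq_ff (dblfun_comp F K)"
  shows "sq_ff K"
proof -
  interpret K: dfun "Src K" "Src F" "onOb K" "onHor K" "onVer K" "onSq K"
    using DArr_dfun[OF K(1)] unfolding K(2) .
  interpret FK: sq_fib "dblfun_comp F K" using FK K F_in by unfold_locales simp_all
  show ?thesis
  proof (rule sq_ffI[OF K(1)])
    fix f g u v b
    assume 1: "square_boundary (Src K) f g u v"
      and 2: "b \<in> squares (Trg K) (onHor K f) (onHor K g) (onVer K u) (onVer K v)"
    have m: "f \<in> Hor (Src K)" "g \<in> Hor (Src K)" "u \<in> Ver (Src K)" "v \<in> Ver (Src K)"
      using 1 by (simp_all add: square_boundary_def)
    have b: "b \<in> Sq (Src F)" "tp (Src F) b = onHor K f" "bt (Src F) b = onHor K g"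
      "lf (Src F) b = onVer K u" "rt (Src F) b = onVer K v"
      using 2 K(2) by (simp_all add: squares_def)
    obtain a where a: "a \<in> Sq (Src K)" "tp (Src K) a = f" "bt (Src K) a = g" "lf (Src K) a = u"
      "rt (Src K) a = v" "onSq (dblfun_comp F K) a = onSq F b"
      using FK.sq_full[of f g u v "onSq F b"] 1 b m by auto
    have "onSq K a = b"
      by (rule sq_faithful) (use a b in simp_all)
    then show "\<exists>a\<in>squares (Src K) f g u v. onSq K a = b"
      using a by (auto simp: squares_def)
  next
    fix a b
    assume a: "a \<in> Sq (Src K)" "b \<in> Sq (Src K)" "tp (Src K) a = tp (Src K) b"
      "bt (Src K) a = bt (Src K) b" "lf (Src K) a = lf (Src K) b" "rt (Src K) a = rt (Src K) b"
      "onSq K a = onSq K b"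
    show "a = b" by (rule FK.sq_faithful) (use a in simp_all)
  qed
qed

text \<open>Interface to a double category with pulled back squares after encoding in
  \<open>'a\<close>: \<open>go\<close>, \<open>gh\<close> and \<open>gv\<close> decode its objects
  and morphisms, so that later arguments take place in \<open>H\<close> and \<open>V\<close>, whose
  elements may be words or triples.\<close>

locale pulled = sq_fib q for q :: "'a dblfun" +
  fixes H :: "('o, 'h) cat" and V :: "('o, 'v) cat" and e eh ev go gh gv
  assumes fgh: "is_functor (HC (Src q)) H go gh" and fgv: "is_functor (VC (Src q)) V go gv"
    and go: "bij_betw go (Ob (Src q)) (Obj H)" and gh: "bij_betw gh (Hor (Src q)) (Arr H)"
    and gv: "bij_betw gv (Ver (Src q)) (Arr V)"
    and OV: "Obj V = Obj H"
    and qo: "\<And>x. x \<in> Ob (Src q) \<Longrightarrow> onOb q x = e (go x)"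
    and qh: "\<And>x. x \<in> Hor (Src q) \<Longrightarrow> onHor q x = eh (gh x)"
    and qv: "\<And>x. x \<in> Ver (Src q) \<Longrightarrow> onVer q x = ev (gv x)"

text \<open>Smallness allows the carriers of \<open>H\<close> and \<open>V\<close> to be encoded in
  \<open>'a\<close>; the squares are pulled back over the encoded categories, and the inverse
  encodings become \<open>go\<close>, \<open>gh\<close> and \<open>gv\<close>.\<close>

lemma (in univ) pull_exists:
  fixes D :: "'a dblcat" and H :: "('o, 'h) cat" and V :: "('o, 'v) cat"
  assumes D: "small_dblcat D" and H: "category H" and V: "category V"
    and OV: "Obj V = Obj H"
    and fh: "is_functor H (HC D) e eh" and fv: "is_functor V (VC D) e ev"
    and sm: "sml ty (Obj H)" "sml ty (Arr H)" "sml ty (Arr V)"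
  obtains q go gh gv where "pulled q H V e eh ev go gh gv" "Trg q = D"
proof -
  obtain fo :: "'o \<Rightarrow> 'a" where fo: "inj_on fo (Obj H)" using sml_encode[OF sm(1)] .
  obtain fa :: "'h \<Rightarrow> 'a" where fa: "inj_on fa (Arr H)" using sml_encode[OF sm(2)] .
  obtain fb :: "'v \<Rightarrow> 'a" where fb: "inj_on fb (Arr V)" using sml_encode[OF sm(3)] .
  have fo': "inj_on fo (Obj V)" using fo OV by simp
  let ?H = "enc_cat H fo fa" and ?V = "enc_cat V fo fb"
  let ?go = "inv_into (Obj H) fo" and ?gh = "inv_into (Arr H) fa" and ?gv = "inv_into (Arr V) fb"
  note H' = enc_cat_functors[OF H fo fa] and V' = enc_cat_functors[OF V fo' fb]
  note sH = enc_cat_simps[OF fo fa] and sV = enc_cat_simps[OF fo' fb]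
  have cH: "category ?H" and cV: "category ?V"
    using category_enc_cat H V fo fo' fa fb by blast+
  interpret p: pull ty D ?H ?V "e \<circ> ?go" "eh \<circ> ?gh" "ev \<circ> ?gv"
  proof (intro pull.intro pull_axioms.intro)
    show "univ ty" by unfold_locales
    show "dcat D" "cate ?H" "cate ?V" using small_dblcatD[OF D] cH cV by unfold_locales simp_all
    show "Obj ?V = Obj ?H" using OV sH sV by simp
    show "is_functor ?H (HC D) (e \<circ> ?go) (eh \<circ> ?gh)" by (rule is_functor_comp'[OF H'(2) fh cH])
    show "is_functor ?V (VC D) (e \<circ> ?go) (ev \<circ> ?gv)"
      using is_functor_comp'[OF V'(2) fv cV] OV by simp
  qed
  have s: "small_dblcat p.P"
    using p.small_P sml_image[OF sm(1), of fo] sml_image[OF sm(2), of fa] sml_image[OF sm(3), of fb] D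
    by (simp add: small_dblcat_def small_iff_sml sH sV)
  let ?q = "mk p.P D (e \<circ> ?go) (eh \<circ> ?gh) (ev \<circ> ?gv) sba"
  have "pulled ?q H V e eh ev ?go ?gh ?gv"
  proof (intro pulled.intro pulled_axioms.intro)
    show "sq_fib ?q"
      by unfold_locales (rule mk_DArr[OF p.dfun_P s D], rule p.sq_ff_P[OF s D])
    show "is_functor (HC (Src ?q)) H ?go ?gh" "is_functor (VC (Src ?q)) V ?go ?gv"
      using H'(2) V'(2) OV by simp_all
    show "bij_betw ?go (Ob (Src ?q)) (Obj H)" "bij_betw ?gh (Hor (Src ?q)) (Arr H)"
      "bij_betw ?gv (Ver (Src ?q)) (Arr V)"
      using fo fa fb by (simp_all add: sH sV bij_betw_inv_into inj_on_imp_bij_betw)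
  qed (simp_all add: OV)
  then show thesis using that[of ?q ?go ?gh ?gv] by simp
qed

text \<open>A functor that is bijective on objects and on arrows is an isomorphism; the claim
  composes with its inverse.\<close>

lemma is_functor_through:
  assumes "is_functor A H Ko Kh" "is_functor C H go gh" "category C"
    and "bij_betw go (Obj C) (Obj H)" "bij_betw gh (Arr C) (Arr H)"
    and A: "category A"
  shows "is_functor A C (inv_into (Obj C) go \<circ> Ko) (inv_into (Arr C) gh \<circ> Kh)"
proof -
  interpret C: cate C by unfold_locales fact
  interpret A: cate A by unfold_locales fact
  note [simp] = is_functorD[OF assms(1)]
  note g [simp] = is_functorD[OF assms(2)]
  have o: "inv_into (Obj C) go y \<in> Obj C" "go (inv_into (Obj C) go y) = y" if "y \<in> Obj H" for y
    using assms(4) that by (auto simp: bij_betw_def inv_into_into f_inv_into_f)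
  have h: "inv_into (Arr C) gh y \<in> Arr C" "gh (inv_into (Arr C) gh y) = y" if "y \<in> Arr H" for y
    using assms(5) that by (auto simp: bij_betw_def inv_into_into f_inv_into_f)
  note [simp] = o h
  have io: "inv_into (Obj C) go y = x" if "x \<in> Obj C" "go x = y" for x y
    using assms(4) that by (auto simp: bij_betw_def)
  have ih: "inv_into (Arr C) gh y = x" if "x \<in> Arr C" "gh x = y" for x y
    using assms(5) that by (auto simp: bij_betw_def)
  have d: "Dom C (inv_into (Arr C) gh (Kh f)) = inv_into (Obj C) go (Ko (Dom A f))"
    "Cod C (inv_into (Arr C) gh (Kh f)) = inv_into (Obj C) go (Ko (Cod A f))" if "f \<in> Arr A" for f
  proof -
    have "go (Dom C (inv_into (Arr C) gh (Kh f))) = Dom H (gh (inv_into (Arr C) gh (Kh f)))"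
      "go (Cod C (inv_into (Arr C) gh (Kh f))) = Cod H (gh (inv_into (Arr C) gh (Kh f)))"
      by (rule g(4)[symmetric] g(5)[symmetric]; use that in simp)+
    then show "Dom C (inv_into (Arr C) gh (Kh f)) = inv_into (Obj C) go (Ko (Dom A f))"
      "Cod C (inv_into (Arr C) gh (Kh f)) = inv_into (Obj C) go (Ko (Cod A f))"
      using that by (auto intro!: io[symmetric])
  qed
  show ?thesis
  proof (rule is_functorI)
    fix x assume "x \<in> Obj A"
    then show "(inv_into (Arr C) gh \<circ> Kh) (Idt A x) = Idt C ((inv_into (Obj C) go \<circ> Ko) x)"
      by (auto intro!: ih)
  next
    fix f g assume "f \<in> Arr A" "g \<in> Arr A" "Cod A f = Dom A g"
    then show "(inv_into (Arr C) gh \<circ> Kh) (Comp A g f) =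
        Comp C ((inv_into (Arr C) gh \<circ> Kh) g) ((inv_into (Arr C) gh \<circ> Kh) f)"
      by (auto intro!: ih simp: d)
  qed (simp_all add: d)
qed

context pulled
begin

lemma go_in [simp]: "x \<in> Ob (Src q) \<Longrightarrow> go x \<in> Obj H" and gh_in [simp]: "x \<in> Hor (Src q) \<Longrightarrow> gh x \<in> Arr H"
  and gv_in [simp]: "x \<in> Ver (Src q) \<Longrightarrow> gv x \<in> Arr V"
  using go gh gv by (auto simp: bij_betw_def)

lemma lift:
  assumes G: "G \<in> DArr" "Trg G = Trg q"
    and Kh: "is_functor (HC (Src G)) H Ko Kh" and Kv: "is_functor (VC (Src G)) V Ko Kv"
    and o: "\<And>x. x \<in> Ob (Src G) \<Longrightarrow> e (Ko x) = onOb G x"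
    and h: "\<And>x. x \<in> Hor (Src G) \<Longrightarrow> eh (Kh x) = onHor G x"
    and v: "\<And>x. x \<in> Ver (Src G) \<Longrightarrow> ev (Kv x) = onVer G x"
  obtains K where "K \<in> DArr" "Src K = Src G" "Trg K = Src q" "dblfun_comp q K = G"
    "\<And>x. x \<in> Ob (Src G) \<Longrightarrow> go (onOb K x) = Ko x" "\<And>x. x \<in> Hor (Src G) \<Longrightarrow> gh (onHor K x) = Kh x"
    "\<And>x. x \<in> Ver (Src G) \<Longrightarrow> gv (onVer K x) = Kv x"
proof -
  interpret G: dfun "Src G" "Trg q" "onOb G" "onHor G" "onVer G" "onSq G"
    using DArr_dfun[OF G(1)] unfolding G(2) .
  have go': "bij_betw go (Obj (VC (Src q))) (Obj V)" using go OV by simp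
  have 1: "is_functor (HC (Src G)) (HC (Src q)) (inv_into (Ob (Src q)) go \<circ> Ko) (inv_into (Hor (Src q)) gh \<circ> Kh)"
    by (rule is_functor_through[OF Kh fgh D.H.cat go gh G.D.H.cat])
  have 2: "is_functor (VC (Src G)) (VC (Src q)) (inv_into (Ob (Src q)) go \<circ> Ko) (inv_into (Ver (Src q)) gv \<circ> Kv)"
    using is_functor_through[OF Kv fgv D.V.cat go' gv G.D.V.cat] by simp
  have o': "inv_into (Ob (Src q)) go y \<in> Ob (Src q)" "go (inv_into (Ob (Src q)) go y) = y"
    if "y \<in> Obj H" for y
    using go that by (auto simp: bij_betw_def inv_into_into f_inv_into_f)
  have h': "inv_into (Hor (Src q)) gh y \<in> Hor (Src q)" "gh (inv_into (Hor (Src q)) gh y) = y"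
    if "y \<in> Arr H" for y
    using gh that by (auto simp: bij_betw_def inv_into_into f_inv_into_f)
  have v': "inv_into (Ver (Src q)) gv y \<in> Ver (Src q)" "gv (inv_into (Ver (Src q)) gv y) = y"
    if "y \<in> Arr V" for y
    using gv that by (auto simp: bij_betw_def inv_into_into f_inv_into_f)
  note k = is_functorD(1,3)[OF Kh] is_functorD(3)[OF Kv]
  have 3: "onOb q ((inv_into (Ob (Src q)) go \<circ> Ko) x) = onOb G x" if "x \<in> Ob (Src G)" for x
    using that k o' by (simp add: qo o)
  have 4: "onHor q ((inv_into (Hor (Src q)) gh \<circ> Kh) x) = onHor G x" if "x \<in> Hor (Src G)" for x
    using that k h' by (simp add: qh h)
  have 5: "onVer q ((inv_into (Ver (Src q)) gv \<circ> Kv) x) = onVer G x" if "x \<in> Ver (Src G)" for x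
    using that k v' by (simp add: qv v)
  obtain K where K: "K \<in> DArr" "Src K = Src G" "Trg K = Src q" "dblfun_comp q K = G"
    "\<And>x. x \<in> Ob (Src G) \<Longrightarrow> onOb K x = (inv_into (Ob (Src q)) go \<circ> Ko) x"
    "\<And>x. x \<in> Hor (Src G) \<Longrightarrow> onHor K x = (inv_into (Hor (Src q)) gh \<circ> Kh) x"
    "\<And>x. x \<in> Ver (Src G) \<Longrightarrow> onVer K x = (inv_into (Ver (Src q)) gv \<circ> Kv) x"
    using lift_functor[OF G 1 2 3 4 5] by metis
  show thesis
    by (rule that[OF K(1-4)]) (use K(5-7) k o' h' v' in simp_all)
qed

lemma ctf:
  assumes o: "\<And>y. y \<in> Ob (Trg q) \<Longrightarrow> \<exists>x\<in>Obj H. e x = y"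
    and h: "\<And>x y f. x \<in> Obj H \<Longrightarrow> y \<in> Obj H \<Longrightarrow> f \<in> Hor (Trg q) \<Longrightarrow> Dom (HC (Trg q)) f = e x \<Longrightarrow>
      Cod (HC (Trg q)) f = e y \<Longrightarrow> \<exists>g\<in>Arr H. Dom H g = x \<and> Cod H g = y \<and> eh g = f"
    and v: "\<And>x y f. x \<in> Obj H \<Longrightarrow> y \<in> Obj H \<Longrightarrow> f \<in> Ver (Trg q) \<Longrightarrow> Dom (VC (Trg q)) f = e x \<Longrightarrow>
      Cod (VC (Trg q)) f = e y \<Longrightarrow> \<exists>g\<in>Arr V. Dom V g = x \<and> Cod V g = y \<and> ev g = f"
  shows "ctf q"
proof (rule ctfI[OF F_in])
  fix y assume "y \<in> Ob (Trg q)"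
  then obtain x where "x \<in> Obj H" "e x = y" using o by blast
  moreover then obtain z where "z \<in> Ob (Src q)" "go z = x" using go unfolding bij_betw_def by (metis imageE)
  ultimately show "\<exists>x\<in>Ob (Src q). onOb q x = y" using qo by auto
next
  have inj: "x = y" if "x \<in> Ob (Src q)" "y \<in> Ob (Src q)" "go x = go y" for x y
    using go that by (auto simp: bij_betw_def inj_on_def)
  fix x y f
  assume x: "x \<in> Ob (Src q)" "y \<in> Ob (Src q)"
  {
    assume "f \<in> Hor (Trg q)" "Dom (HC (Trg q)) f = onOb q x" "Cod (HC (Trg q)) f = onOb q y"
    then obtain g where g: "g \<in> Arr H" "Dom H g = go x" "Cod H g = go y" "eh g = f"
      using h[of "go x" "go y" f] x by (auto simp: qo)
    then obtain k where k: "k \<in> Hor (Src q)" "gh k = g" using gh unfolding bij_betw_def by (metis imageE)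
    have "go (Dom (HC (Src q)) k) = go x" "go (Cod (HC (Src q)) k) = go y"
      using is_functorD(4,5)[OF fgh, of k] k g by simp_all
    then have "Dom (HC (Src q)) k = x" "Cod (HC (Src q)) k = y" using k x by (auto intro: inj)
    then show "\<exists>g\<in>Hor (Src q). Dom (HC (Src q)) g = x \<and> Cod (HC (Src q)) g = y \<and> onHor q g = f"
      using k g qh by auto
  }
  {
    assume "f \<in> Ver (Trg q)" "Dom (VC (Trg q)) f = onOb q x" "Cod (VC (Trg q)) f = onOb q y"
    then obtain g where g: "g \<in> Arr V" "Dom V g = go x" "Cod V g = go y" "ev g = f"
      using v[of "go x" "go y" f] x by (auto simp: qo)
    then obtain k where k: "k \<in> Ver (Src q)" "gv k = g" using gv unfolding bij_betw_def by (metis imageE)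
    have "go (Dom (VC (Src q)) k) = go x" "go (Cod (VC (Src q)) k) = go y"
      using is_functorD(4,5)[OF fgv, of k] k g by simp_all
    then have "Dom (VC (Src q)) k = x" "Cod (VC (Src q)) k = y" using k x by (auto intro: inj)
    then show "\<exists>g\<in>Ver (Src q). Dom (VC (Src q)) g = x \<and> Cod (VC (Src q)) g = y \<and> onVer q g = f"
      using k g qv by auto
  }
qed (rule F_ff)

end

section \<open>Categories pulled back along maps of objects\<close>

text \<open>The outer components record which preimages the endpoints are. This makes the projection
  to \<open>C\<close> fully faithful, however many elements of \<open>X\<close> lie over one
  object.\<close>

definition pbcat :: "('p, 'm) cat \<Rightarrow> 'o set \<Rightarrow> ('o \<Rightarrow> 'p) \<Rightarrow> ('o, 'o \<times> 'm \<times> 'o) cat" where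
  "pbcat C X e = \<lparr>Obj = X, Arr = {(x, f, y). x \<in> X \<and> y \<in> X \<and> f \<in> Arr C \<and> Dom C f = e x \<and> Cod C f = e y},
     Dom = fst, Cod = snd \<circ> snd, Idt = (\<lambda>x. (x, Idt C (e x), x)),
     Comp = (\<lambda>(_, g, z) (x, f, _). (x, Comp C g f, z))\<rparr>"

lemma pbcat_simps [simp]:
  "Obj (pbcat C X e) = X" "Dom (pbcat C X e) t = fst t" "Cod (pbcat C X e) t = snd (snd t)"
  "Idt (pbcat C X e) x = (x, Idt C (e x), x)" "Comp (pbcat C X e) (a, g, z) (x, f, b) = (x, Comp C g f, z)"
  "(x, f, y) \<in> Arr (pbcat C X e) \<longleftrightarrow> x \<in> X \<and> y \<in> X \<and> f \<in> Arr C \<and> Dom C f = e x \<and> Cod C f = e y"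
  by (simp_all add: pbcat_def)

lemma category_pbcat:
  assumes "category C" "\<And>x. x \<in> X \<Longrightarrow> e x \<in> Obj C"
  shows "category (pbcat C X e)"
proof -
  interpret cate C by unfold_locales fact
  show ?thesis
    by (rule categoryI) (auto simp: assms(2) assoc)
qed

lemma is_functor_pbcat:
  assumes "category C" "\<And>x. x \<in> X \<Longrightarrow> e x \<in> Obj C"
  shows "is_functor (pbcat C X e) C e (\<lambda>t. fst (snd t))"
  by (rule is_functorI) (auto simp: assms(2))

text \<open>By full faithfulness of the projection, a lift on objects is all that is needed to lift
  a functor.\<close>

lemma is_functor_into_pbcat:
  assumes "is_functor A C Fo Fa" "category A" "\<And>x. x \<in> Obj A \<Longrightarrow> Ko x \<in> X" "\<And>x. x \<in> Obj A \<Longrightarrow> e (Ko x) = Fo x"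
  shows "is_functor A (pbcat C X e) Ko (\<lambda>f. (Ko (Dom A f), Fa f, Ko (Cod A f)))"
proof -
  interpret cate A by unfold_locales fact
  note [simp] = is_functorD[OF assms(1)] assms(3,4)
  show ?thesis by (rule is_functorI) auto
qed

lemma (in univ) sml_pbcat:
  assumes "sml ty X" "sml ty (Arr C)" shows "sml ty (Arr (pbcat C X e))"
  by (rule sml_subset[OF _ sml_Times[OF assms(1) sml_Times[OF assms(2,1)]]]) auto

section \<open>Free products of categories\<close>

text \<open>Normal forms for the category obtained from \<open>K\<close> by freely adjoining an arrow
  \<open>x \<rightarrow> y\<close> for every arrow \<open>jo x \<rightarrow> jo y\<close> of the target of a functor \<open>(jo, ja)\<close>: paths are read
  from left to right, and an arrow of \<open>K\<close> sits before, between and after the adjoined arrows.\<close>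

datatype ('k, 'h) word = End 'k | Step 'k 'h "('k, 'h) word"

text \<open>Only the two arrows of \<open>K\<close> that meet at the junction are multiplied; an
  adjoined letter never merges with anything. Words thus stay in normal form, and no quotient has to
  be taken.\<close>

fun app :: "('o, 'k) cat \<Rightarrow> ('k, 'h) word \<Rightarrow> ('k, 'h) word \<Rightarrow> ('k, 'h) word" where
  "app K (End k) (End l) = End (Comp K l k)"
| "app K (End k) (Step l h w) = Step (Comp K l k) h w"
| "app K (Step k h v) w = Step k h (app K v w)"

fun wdom :: "('o, 'k) cat \<Rightarrow> ('k, 'h) word \<Rightarrow> 'o" where
  "wdom K (End k) = Dom K k"
| "wdom K (Step k h w) = Dom K k"

fun wcod :: "('o, 'k) cat \<Rightarrow> ('k, 'h) word \<Rightarrow> 'o" where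
  "wcod K (End k) = Cod K k"
| "wcod K (Step k h w) = wcod K w"

fun valid :: "('o, 'k) cat \<Rightarrow> ('p, 'h) cat \<Rightarrow> ('o \<Rightarrow> 'p) \<Rightarrow> ('k, 'h) word \<Rightarrow> bool" where
  "valid K C jo (End k) \<longleftrightarrow> k \<in> Arr K"
| "valid K C jo (Step k h w) \<longleftrightarrow> k \<in> Arr K \<and> h \<in> Arr C \<and> Dom C h = jo (Cod K k) \<and>
     Cod C h = jo (wdom K w) \<and> valid K C jo w"

fun wev :: "('p, 'h) cat \<Rightarrow> ('k \<Rightarrow> 'h) \<Rightarrow> ('k, 'h) word \<Rightarrow> 'h" where
  "wev C ja (End k) = ja k"
| "wev C ja (Step k h w) = Comp C (wev C ja w) (Comp C h (ja k))"

definition freeprod :: "('o, 'k) cat \<Rightarrow> ('p, 'h) cat \<Rightarrow> ('o \<Rightarrow> 'p) \<Rightarrow> ('o, ('k, 'h) word) cat" where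
  "freeprod K C jo = \<lparr>Obj = Obj K, Arr = Collect (valid K C jo), Dom = wdom K, Cod = wcod K,
     Idt = End \<circ> Idt K, Comp = (\<lambda>w v. app K v w)\<rparr>"

lemma freeprod_simps [simp]:
  "Obj (freeprod K C jo) = Obj K" "w \<in> Arr (freeprod K C jo) \<longleftrightarrow> valid K C jo w"
  "Dom (freeprod K C jo) = wdom K" "Cod (freeprod K C jo) = wcod K"
  "Idt (freeprod K C jo) x = End (Idt K x)" "Comp (freeprod K C jo) w v = app K v w"
  by (simp_all add: freeprod_def)

locale over_cat = K: cate K + C: cate C for K :: "('o, 'k) cat" and C :: "('p, 'h) cat" +
  fixes jo ja
  assumes j: "is_functor K C jo ja"
begin

lemmas j_rules [simp] = is_functorD[OF j]

lemma wdom_in [simp]: "valid K C jo w \<Longrightarrow> wdom K w \<in> Obj K"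
  by (cases w) auto

lemma wcod_in [simp]: "valid K C jo w \<Longrightarrow> wcod K w \<in> Obj K"
  by (induction w) auto

lemma app_valid [simp]:
  "valid K C jo v \<Longrightarrow> valid K C jo w \<Longrightarrow> wcod K v = wdom K w \<Longrightarrow>
    valid K C jo (app K v w) \<and> wdom K (app K v w) = wdom K v \<and> wcod K (app K v w) = wcod K w"
  by (induction v; cases w; auto)

lemma wev_in [simp]:
  "valid K C jo w \<Longrightarrow> wev C ja w \<in> Arr C \<and> Dom C (wev C ja w) = jo (wdom K w) \<and> Cod C (wev C ja w) = jo (wcod K w)"
  by (induction w) auto

lemma wev_app [simp]:
  "valid K C jo v \<Longrightarrow> valid K C jo w \<Longrightarrow> wcod K v = wdom K w \<Longrightarrow>
    wev C ja (app K v w) = Comp C (wev C ja w) (wev C ja v)"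
  by (induction v; cases w; auto simp: C.assoc)

lemma app_assoc:
  "valid K C jo u \<Longrightarrow> valid K C jo v \<Longrightarrow> valid K C jo w \<Longrightarrow> wcod K u = wdom K v \<Longrightarrow> wcod K v = wdom K w \<Longrightarrow>
    app K (app K u v) w = app K u (app K v w)"
proof (induction u)
  case (End k)
  show ?case
  proof (cases v)
    case (End l) then show ?thesis using End.prems by (cases w) (auto simp: K.assoc \<open>v = End l\<close>)
  next
    case (Step l h v') then show ?thesis using End.prems by (cases w) auto
  qed
qed auto

lemma category_freeprod: "category (freeprod K C jo)"
proof (rule categoryI)
  fix w assume "w \<in> Arr (freeprod K C jo)"
  then have w: "valid K C jo w" by simp
  show "Comp (freeprod K C jo) w (Idt (freeprod K C jo) (Dom (freeprod K C jo) w)) = w"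
    using w by (cases w) auto
  show "Comp (freeprod K C jo) (Idt (freeprod K C jo) (Cod (freeprod K C jo) w)) w = w"
    using w by (induction w) auto
qed (auto simp: app_assoc)

lemma is_functor_wev: "is_functor (freeprod K C jo) C jo (wev C ja)"
  by (rule is_functorI) auto

lemma is_functor_End: "is_functor K (freeprod K C jo) (\<lambda>x. x) End"
  by (rule is_functorI) auto

text \<open>The letter adjoined for \<open>h\<close>, between two identities, evaluates to
  \<open>h\<close>. Letters for all arrows of \<open>C\<close> between images of objects of
  \<open>K\<close> are adjoined for this reason.\<close>

lemma wev_full:
  assumes "x \<in> Obj K" "y \<in> Obj K" "h \<in> Arr C" "Dom C h = jo x" "Cod C h = jo y"
  shows "\<exists>w\<in>Arr (freeprod K C jo). Dom (freeprod K C jo) w = x \<and> Cod (freeprod K C jo) w = y \<and> wev C ja w = h"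
  by (rule bexI[of _ "Step (Idt K x) h (End (Idt K y))"]) (use assms in auto)

end

lemma (in univ) sml_freeprod:
  fixes K :: "('o, 'k) cat" and C :: "('p, 'h) cat"
  assumes K: "sml ty (Arr K)" and C: "sml ty (Arr C)"
  shows "sml ty (Arr (freeprod K C jo))"
proof -
  \<comment> \<open>Stages that contain the valid words with at most \<open>n\<close> adjoined
    letters; matching of endpoints is dropped, since a small superset is enough.\<close>
  define L :: "nat \<Rightarrow> ('k, 'h) word set" where
    "L = rec_nat (End ` Arr K) (\<lambda>_ S. S \<union> (\<lambda>(k, h, w). Step k h w) ` (Arr K \<times> Arr C \<times> S))"
  have L0: "L 0 = End ` Arr K" and LS: "L (Suc n) = L n \<union> (\<lambda>(k, h, w). Step k h w) ` (Arr K \<times> Arr C \<times> L n)" for n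
    by (simp_all add: L_def)
  have "sml ty (L n)" for n
    by (induction n) (simp_all add: L0 LS sml_image sml_Un sml_Times K C)
  then have "sml ty (\<Union>n. L n)" by (rule sml_nat_UNION)
  moreover have "w \<in> (\<Union>n. L n)" if "valid K C jo w" for w
    using that
  proof (induction w)
    case (End k) then show ?case using L0 by auto
  next
    case (Step k h w)
    then obtain n where "w \<in> L n" by auto
    then have "Step k h w \<in> L (Suc n)" using Step.prems unfolding LS by force
    then show ?case by blast
  qed
  ultimately show ?thesis by (metis sml_subset subsetI freeprod_simps(2))
qed

text \<open>With the objects of \<open>B\<close> as a discrete summand, the map to \<open>B\<close>
  becomes surjective on objects, while the only new arrows are identities.\<close>

definition plus_disc :: "('o, 'm) cat \<Rightarrow> 'x set \<Rightarrow> ('o + 'x, 'm + 'x) cat" where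
  "plus_disc C X = \<lparr>Obj = Inl ` Obj C \<union> Inr ` X, Arr = Inl ` Arr C \<union> Inr ` X,
     Dom = case_sum (Inl \<circ> Dom C) Inr, Cod = case_sum (Inl \<circ> Cod C) Inr,
     Idt = case_sum (Inl \<circ> Idt C) Inr,
     Comp = (\<lambda>g f. case f of Inl f' \<Rightarrow> Inl (Comp C (projl g) f') | Inr x \<Rightarrow> Inr x)\<rparr>"

lemma plus_disc_simps [simp]:
  "Obj (plus_disc C X) = Inl ` Obj C \<union> Inr ` X" "Arr (plus_disc C X) = Inl ` Arr C \<union> Inr ` X"
  "Dom (plus_disc C X) (Inl f) = Inl (Dom C f)" "Dom (plus_disc C X) (Inr x) = Inr x"
  "Cod (plus_disc C X) (Inl f) = Inl (Cod C f)" "Cod (plus_disc C X) (Inr x) = Inr x"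
  "Idt (plus_disc C X) (Inl a) = Inl (Idt C a)" "Idt (plus_disc C X) (Inr x) = Inr x"
  "Comp (plus_disc C X) (Inl g) (Inl f) = Inl (Comp C g f)" "Comp (plus_disc C X) l (Inr x) = Inr x"
  by (simp_all add: plus_disc_def)

lemma category_plus_disc:
  assumes "category C" shows "category (plus_disc C X)"
proof -
  interpret cate C by unfold_locales fact
  show ?thesis by (rule categoryI) (auto simp: assoc)
qed

lemma is_functor_plus_disc:
  assumes "is_functor C D Fo Fa" "category C" "category D" "X \<subseteq> Obj D"
  shows "is_functor (plus_disc C X) D (case_sum Fo id) (case_sum Fa (Idt D))"
proof -
  interpret C: cate C by unfold_locales fact
  interpret D: cate D by unfold_locales fact
  note [simp] = is_functorD[OF assms(1)]
  show ?thesis by (rule is_functorI) (use assms(4) in \<open>auto simp: subset_iff\<close>)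
qed

lemma is_functor_Inl: "category C \<Longrightarrow> is_functor C (plus_disc C X) Inl Inl"
  by (rule is_functorI) auto

section \<open>Coherent systems of globular squares\<close>

text \<open>A functorial identification of parallel arrows of \<open>K\<close> up to specified globular squares of
  \<open>B\<close>. The square depends only on the two arrows, so that the only square from an arrow
  to itself in the system is an identity.\<close>

locale coherent = B: dcat B + over_cat K "HC B" jo ja
  for B :: "'a dblcat" and K :: "('o, 'k) cat" and jo ja +
  fixes R :: "'k \<Rightarrow> 'k \<Rightarrow> bool" and t :: "'k \<Rightarrow> 'k \<Rightarrow> 'a"
  assumes R_refl: "k \<in> Arr K \<Longrightarrow> R k k" and R_sym: "R k l \<Longrightarrow> R l k"
    and R_trans: "R k l \<Longrightarrow> R l m \<Longrightarrow> R k m"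
    and R_in: "R k l \<Longrightarrow> k \<in> Arr K \<and> l \<in> Arr K \<and> Dom K k = Dom K l \<and> Cod K k = Cod K l"
    and t_sq: "R k l \<Longrightarrow> t k l \<in> Sq B \<and> tp B (t k l) = ja k \<and> bt B (t k l) = ja l \<and>
      lf B (t k l) = Idt (VC B) (jo (Dom K k)) \<and> rt B (t k l) = Idt (VC B) (jo (Cod K k))"
    and t_refl: "k \<in> Arr K \<Longrightarrow> t k k = Idt (VS B) (ja k)"
    and t_trans: "R k l \<Longrightarrow> R l m \<Longrightarrow> Comp (VS B) (t l m) (t k l) = t k m"
    and t_comp: "R f f' \<Longrightarrow> R g g' \<Longrightarrow> Cod K f = Dom K g \<Longrightarrow>
      R (Comp K g f) (Comp K g' f') \<and> t (Comp K g f) (Comp K g' f') = Comp (HS B) (t g g') (t f f')"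

text \<open>Comparison of bottom boundaries in this equation also gives
  \<open>onHor G (ja k) = onHor G (ja l)\<close>: related arrows become equal, and the cell between
  them becomes trivial.\<close>

definition kills :: "'a dblfun \<Rightarrow> ('k \<Rightarrow> 'a) \<Rightarrow> ('k \<Rightarrow> 'k \<Rightarrow> bool) \<Rightarrow> ('k \<Rightarrow> 'k \<Rightarrow> 'a) \<Rightarrow> bool" where
  "kills G ja R t \<longleftrightarrow> (\<forall>k l. R k l \<longrightarrow> onSq G (t k l) = Idt (VS (Trg G)) (onHor G (ja k)))"

text \<open>A system is pulled back along a functor over \<open>B\<close>. Parallelism is imposed
  anew, because \<open>lo\<close> may send different objects to the same one. This carries the
  system from words to the morphisms of \<open>B\<close> by way of a section.\<close>

lemma coherent_restrict:
  assumes "coherent B K jo ja R t" and C: "category C" and l: "is_functor C K lo la"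
    and eq: "\<And>x. x \<in> Obj C \<Longrightarrow> Fo x = jo (lo x)" "\<And>f. f \<in> Arr C \<Longrightarrow> Fa f = ja (la f)"
  shows "coherent B C Fo Fa
    (\<lambda>f g. f \<in> Arr C \<and> g \<in> Arr C \<and> Dom C f = Dom C g \<and> Cod C f = Cod C g \<and> R (la f) (la g))
    (\<lambda>f g. t (la f) (la g))"
proof -
  interpret coherent B K jo ja R t by fact
  interpret C: cate C by unfold_locales fact
  note [simp] = is_functorD[OF l] eq
  have F: "is_functor C (HC B) Fo Fa" by (rule is_functorI) auto
  show ?thesis
  proof (intro coherent.intro coherent_axioms.intro over_cat.intro over_cat_axioms.intro)
    show "dcat B" "cate C" "cate (HC B)" by unfold_locales
    fix f f' g g'
    assume f: "f \<in> Arr C \<and> f' \<in> Arr C \<and> Dom C f = Dom C f' \<and> Cod C f = Cod C f' \<and> R (la f) (la f')"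
      and g: "g \<in> Arr C \<and> g' \<in> Arr C \<and> Dom C g = Dom C g' \<and> Cod C g = Cod C g' \<and> R (la g) (la g')"
      and fg: "Cod C f = Dom C g"
    show "(Comp C g f \<in> Arr C \<and> Comp C g' f' \<in> Arr C \<and> Dom C (Comp C g f) = Dom C (Comp C g' f') \<and>
        Cod C (Comp C g f) = Cod C (Comp C g' f') \<and> R (la (Comp C g f)) (la (Comp C g' f'))) \<and>
      t (la (Comp C g f)) (la (Comp C g' f')) = Comp (HS B) (t (la g) (la g')) (t (la f) (la f'))"
      using f g fg t_comp[of "la f" "la f'" "la g" "la g'"] by simp
  next
    fix f g
    assume fg: "f \<in> Arr C \<and> g \<in> Arr C \<and> Dom C f = Dom C g \<and> Cod C f = Cod C g \<and> R (la f) (la g)"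
    show "t (la f) (la g) \<in> Sq B \<and> tp B (t (la f) (la g)) = Fa f \<and> bt B (t (la f) (la g)) = Fa g \<and>
        lf B (t (la f) (la g)) = Idt (VC B) (Fo (Dom C f)) \<and> rt B (t (la f) (la g)) = Idt (VC B) (Fo (Cod C f))"
      using fg t_sq[of "la f" "la g"] by simp
    show "g \<in> Arr C \<and> f \<in> Arr C \<and> Dom C g = Dom C f \<and> Cod C g = Cod C f \<and> R (la g) (la f)"
      using fg R_sym[of "la f" "la g"] by simp
    fix h
    assume gh: "g \<in> Arr C \<and> h \<in> Arr C \<and> Dom C g = Dom C h \<and> Cod C g = Cod C h \<and> R (la g) (la h)"
    show "f \<in> Arr C \<and> h \<in> Arr C \<and> Dom C f = Dom C h \<and> Cod C f = Cod C h \<and> R (la f) (la h)"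
      using fg gh R_trans[of "la f" "la g" "la h"] by simp
    show "Comp (VS B) (t (la g) (la h)) (t (la f) (la g)) = t (la f) (la h)"
      using fg gh t_trans[of "la f" "la g" "la h"] by simp
  qed (use F R_refl t_refl in simp_all)
qed

text \<open>Each new arrow is an identity related to itself only, with the double identity as its
  cell, so no further identification arises.\<close>

lemma coherent_plus_disc:
  assumes "coherent B K jo ja R t" and X: "X \<subseteq> Ob B"
  shows "coherent B (plus_disc K X) (case_sum jo id) (case_sum ja (Idt (HC B)))
    (\<lambda>k l. (\<exists>k' l'. k = Inl k' \<and> l = Inl l' \<and> R k' l') \<or> (\<exists>x\<in>X. k = Inr x \<and> l = Inr x))
    (\<lambda>k l. case k of Inl k' \<Rightarrow> t k' (projl l) | Inr x \<Rightarrow> Idt (VS B) (Idt (HC B) x))"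
proof -
  interpret coherent B K jo ja R t by fact
  have F: "is_functor (plus_disc K X) (HC B) (case_sum jo id) (case_sum ja (Idt (HC B)))"
    by (rule is_functor_plus_disc[OF j K.cat B.H.cat X])
  have [simp]: "Comp (HS B) (Idt (VS B) (Idt (HC B) x)) (Idt (VS B) (Idt (HC B) x)) = Idt (VS B) (Idt (HC B) x)"
    if "x \<in> Ob B" for x
    using that B.vs_idt[of "Idt (HC B) x" "Idt (HC B) x"] by simp
  show ?thesis
  proof (intro coherent.intro coherent_axioms.intro over_cat.intro over_cat_axioms.intro)
    show "dcat B" "cate (HC B)" by unfold_locales
    show "cate (plus_disc K X)" by unfold_locales (rule category_plus_disc[OF K.cat])
  qed (use F X in \<open>auto simp: subset_iff R_refl t_sq t_refl t_trans t_comp dest: R_sym R_in intro: R_trans\<close>)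
qed

context coherent
begin

text \<open>Arrows of \<open>K\<close> may be exchanged letter by letter, adjoined letters are kept.
  As a word has only one decomposition, two related words are joined by one horizontal pasting of
  cells, which is \<open>wt\<close>.\<close>

fun wR :: "('k, 'a) word \<Rightarrow> ('k, 'a) word \<Rightarrow> bool" where
  "wR (End k) (End l) \<longleftrightarrow> R k l"
| "wR (Step k h v) (Step l h' w) \<longleftrightarrow> R k l \<and> h = h' \<and> wR v w"
| "wR _ _ \<longleftrightarrow> False"

text \<open>The value \<open>undefined\<close> concerns words of different shape only, which are
  never related by \<open>wR\<close>.\<close>

fun wt :: "('k, 'a) word \<Rightarrow> ('k, 'a) word \<Rightarrow> 'a" where
  "wt (End k) (End l) = t k l"
| "wt (Step k h v) (Step l h' w) = Comp (HS B) (wt v w) (Comp (HS B) (Idt (VS B) h) (t k l))"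
| "wt _ _ = undefined"

abbreviation "val \<equiv> valid K (HC B) jo"
abbreviation "ev \<equiv> wev (HC B) ja"

lemma wR_refl: "val w \<Longrightarrow> wR w w"
  by (induction w) (auto simp: R_refl)

lemma wR_sym: "wR v w \<Longrightarrow> wR w v"
  by (induction v w rule: wR.induct) (auto simp: R_sym)

lemma wR_trans: "wR u v \<Longrightarrow> wR v w \<Longrightarrow> wR u w"
proof (induction u v arbitrary: w rule: wR.induct)
  case (1 k l) then show ?case using R_trans by (cases w) auto
next
  case (2 k h u l h' v) then show ?case using R_trans by (cases w) auto
qed auto

lemma wR_dom: "wR v w \<Longrightarrow> wdom K v = wdom K w \<and> wcod K v = wcod K w"
  by (induction v w rule: wR.induct) (auto dest: R_in)

lemma wt_sq: "wR v w \<Longrightarrow> val v \<Longrightarrow> val w \<Longrightarrow>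
    wt v w \<in> Sq B \<and> tp B (wt v w) = ev v \<and> bt B (wt v w) = ev w \<and>
      lf B (wt v w) = Idt (VC B) (jo (wdom K v)) \<and> rt B (wt v w) = Idt (VC B) (jo (wcod K v))"
proof (induction v w rule: wR.induct)
  case (1 k l) then show ?case using t_sq by auto
next
  case (2 k h v l h' w)
  then show ?case using t_sq[of k l] R_in[of k l] by (auto dest: wR_dom)
qed auto

lemma wt_refl: "val w \<Longrightarrow> wt w w = Idt (VS B) (ev w)"
proof (induction w)
  case (Step k h w) then show ?case by (auto simp: t_refl B.vs_idt)
qed (auto simp: t_refl)

text \<open>Interchange turns the vertical composite of two pastings into the pasting of vertical
  composites; over an adjoined letter both factors are the same identity square.\<close>

lemma wt_trans: "wR u v \<Longrightarrow> wR v w \<Longrightarrow> val u \<Longrightarrow> val v \<Longrightarrow> val w \<Longrightarrow>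
    Comp (VS B) (wt v w) (wt u v) = wt u w"
proof (induction u v arbitrary: w rule: wR.induct)
  case (1 k l) then show ?case using t_trans by (cases w) auto
next
  case (2 k h u l h' v)
  then obtain m w' where w: "w = Step m h w'" "R l m" "wR v w'" by (cases w) auto
  have r: "R k l" "h' = h" "wR u v" using 2(2) by auto
  have v: "val u" "val v" "val w'" "h \<in> Hor B" "Dom (HC B) h = jo (Cod K k)" "Dom (HC B) h = jo (Cod K l)"
    "Cod (HC B) h = jo (wdom K u)" "Cod (HC B) h = jo (wdom K v)" "Cod K m = Cod K l" "wdom K w' = wdom K v"
    using 2(4-6) w R_in[OF r(1)] R_in[OF w(2)] wR_dom[OF r(3)] wR_dom[OF w(3)] r(2) by simp_all
  note s = wt_sq[OF r(3) v(1,2)] wt_sq[OF w(3) v(2,3)] t_sq[OF r(1)] t_sq[OF w(2)] R_in[OF r(1)] R_in[OF w(2)]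
  have "Comp (VS B) (wt (Step l h v) w) (wt (Step k h u) (Step l h v)) =
      Comp (HS B) (Comp (VS B) (wt v w') (wt u v))
        (Comp (HS B) (Comp (VS B) (Idt (VS B) h) (Idt (VS B) h)) (Comp (VS B) (t l m) (t k l)))"
    using s v(1-8,10) wR_dom[OF r(3)] by (simp add: w B.interchange)
  also have "\<dots> = wt (Step k h u) w"
    using 2(1)[OF r(3) w(3) v(1-3)] t_trans[OF r(1) w(2)] v by (simp add: w)
  finally show ?case using r by simp
qed auto

text \<open>Away from the junction only associativity of pasting is involved. At the junction two
  arrows of \<open>K\<close> are multiplied, and \<open>t_comp\<close> says that the cell of the
  product is the product of the cells.\<close>

lemma wR_app: "wR u u' \<Longrightarrow> wR v v' \<Longrightarrow> val u \<Longrightarrow> val u' \<Longrightarrow> val v \<Longrightarrow> val v' \<Longrightarrow> wcod K u = wdom K v \<Longrightarrow>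
    wR (app K u v) (app K u' v') \<and> wt (app K u v) (app K u' v') = Comp (HS B) (wt v v') (wt u u')"
proof (induction u u' rule: wR.induct)
  case (1 k l)
  show ?case
  proof (cases v)
    case (End m)
    then obtain n where "v' = End n" using 1 by (cases v') auto
    then show ?thesis using End 1 t_comp[of k l m n] by auto
  next
    case (Step m h w)
    then obtain n w' where v': "v' = Step n h w'" "R m n" "wR w w'" using 1 by (cases v') auto
    have r: "R k l" "Cod K k = Dom K m" using 1 Step by auto
    have v: "val w" "val w'" "h \<in> Hor B" "Dom (HC B) h = jo (Cod K m)" "Cod (HC B) h = jo (wdom K w)"
      using 1 Step v' by auto
    note s = t_sq[OF r(1)] t_sq[OF v'(2)] R_in[OF r(1)] R_in[OF v'(2)] wt_sq[OF v'(3) v(1,2)]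
    show ?thesis using Step v' t_comp[OF r(1) v'(2) r(2)] s r v by (simp add: B.HS.assoc)
  qed
next
  case (2 k h u l h' u')
  have r: "R k l" "h' = h" "wR u u'" using 2(2) by auto
  have v: "val u" "val u'" "h \<in> Hor B" "Dom (HC B) h = jo (Cod K k)" "Cod (HC B) h = jo (wdom K u)"
      "wcod K u = wdom K v"
    using 2(4,5,8) by auto
  note s = t_sq[OF r(1)] R_in[OF r(1)] wt_sq[OF r(3) v(1,2)] wt_sq[OF 2(3) 2(6,7)]
  show ?case using 2(1)[OF r(3) 2(3) v(1,2) 2(6,7) v(6)] s r v by (simp add: B.HS.assoc)
qed auto

lemma coherent_freeprod:
  "coherent B (freeprod K (HC B) jo) jo ev (\<lambda>v w. val v \<and> val w \<and> wR v w) wt"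
proof (intro coherent.intro coherent_axioms.intro over_cat.intro over_cat_axioms.intro)
  show "dcat B" "cate (HC B)" by unfold_locales
  show "cate (freeprod K (HC B) jo)" by unfold_locales (rule category_freeprod)
  show "is_functor (freeprod K (HC B) jo) (HC B) jo ev" by (rule is_functor_wev)
  fix u u' v v'
  assume "val u \<and> val u' \<and> wR u u'" "val v \<and> val v' \<and> wR v v'"
    "Cod (freeprod K (HC B) jo) u = Dom (freeprod K (HC B) jo) v"
  then show "(val (Comp (freeprod K (HC B) jo) v u) \<and> val (Comp (freeprod K (HC B) jo) v' u') \<and>
      wR (Comp (freeprod K (HC B) jo) v u) (Comp (freeprod K (HC B) jo) v' u')) \<and>
      wt (Comp (freeprod K (HC B) jo) v u) (Comp (freeprod K (HC B) jo) v' u') = Comp (HS B) (wt v v') (wt u u')"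
    using wR_app[of u u' v v'] wR_dom[of u u'] wR_dom[of v v'] by simp
qed (auto simp: wR_refl wR_sym wt_sq wt_refl wt_trans dest: wR_dom wR_trans)

text \<open>\<open>G\<close> sends each factor of the pasting \<open>wt\<close> to an identity
  square, and a horizontal composite of identity squares is one.\<close>

lemma kills_freeprod:
  assumes G: "G \<in> DArr" "Src G = B" and k: "kills G ja R t"
  shows "kills G ev (\<lambda>v w. val v \<and> val w \<and> wR v w) wt"
proof -
  interpret G: dfun B "Trg G" "onOb G" "onHor G" "onVer G" "onSq G"
    using DArr_dfun[OF G(1)] unfolding G(2) .
  have "onSq G (wt v w) = Idt (VS (Trg G)) (onHor G (ev v))" if "wR v w" "val v" "val w" for v w
    using that
  proof (induction v w rule: wR.induct)
    case (1 k l) then show ?case using assms unfolding kills_def by auto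
  next
    case (2 k h v l h' w)
    have r: "R k l" "h' = h" "wR v w" using 2(2) by auto
    have v: "val v" "val w" "h \<in> Hor B" "Dom (HC B) h = jo (Cod K k)" "Cod (HC B) h = jo (wdom K v)"
      using 2(3,4) by auto
    note s = t_sq[OF r(1)] R_in[OF r(1)] wt_sq[OF r(3) v(1,2)]
    have "onSq G (t k l) = Idt (VS (Trg G)) (onHor G (ja k))" using k r(1) unfolding kills_def by blast
    then show ?case using 2(1)[OF r(3) v(1,2)] s r v by (simp add: G.E.vs_idt)
  qed auto
  then show ?thesis unfolding kills_def by blast
qed

end

section \<open>The quotient by a coherent system\<close>

locale quot = coherent B "HC B" jo ja R t
  for B :: "'a dblcat" and jo ja R t +
  assumes jo_id [simp]: "x \<in> Ob B \<Longrightarrow> jo x = x" and ja_id [simp]: "f \<in> Hor B \<Longrightarrow> ja f = f"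
begin

lemma R_inD [simp]:
  "R f g \<Longrightarrow> f \<in> Hor B" "R f g \<Longrightarrow> g \<in> Hor B" "R f g \<Longrightarrow> Dom (HC B) g = Dom (HC B) f"
  "R f g \<Longrightarrow> Cod (HC B) g = Cod (HC B) f"
  using R_in by simp_all

lemma t_rules [simp]:
  assumes "R f g"
  shows "t f g \<in> Sq B" "tp B (t f g) = f" "bt B (t f g) = g"
    "lf B (t f g) = Idt (VC B) (Dom (HC B) f)" "rt B (t f g) = Idt (VC B) (Cod (HC B) f)"
  using t_sq[OF assms] R_in[OF assms] by simp_all

text \<open>The choice depends on the predicate \<open>R f\<close> alone, hence on the class of
  \<open>f\<close> alone; \<open>rep_eq\<close> rests on this.\<close>

definition rep :: "'a \<Rightarrow> 'a" where "rep f = (SOME g. R f g)"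

lemma R_rep [simp]: "f \<in> Hor B \<Longrightarrow> R f (rep f)"
  unfolding rep_def using R_refl by (rule someI)

lemma R_rep' [simp]: "f \<in> Hor B \<Longrightarrow> R (rep f) f"
  by (rule R_sym) simp

lemma rep_eq: "R f g \<Longrightarrow> rep f = rep g"
proof -
  assume "R f g"
  then have "R f = R g" using R_sym R_trans by blast
  then show ?thesis unfolding rep_def by simp
qed

lemma rep_in [simp]:
  "f \<in> Hor B \<Longrightarrow> rep f \<in> Hor B" "f \<in> Hor B \<Longrightarrow> Dom (HC B) (rep f) = Dom (HC B) f"
  "f \<in> Hor B \<Longrightarrow> Cod (HC B) (rep f) = Cod (HC B) f"
  using R_inD[OF R_rep] by simp_all

lemma rep_rep [simp]: "f \<in> Hor B \<Longrightarrow> rep (rep f) = rep f"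
  using rep_eq[OF R_rep'] by simp

lemma R_comp: "R f f' \<Longrightarrow> R g g' \<Longrightarrow> Cod (HC B) f = Dom (HC B) g \<Longrightarrow> R (Comp (HC B) g f) (Comp (HC B) g' f')"
  using t_comp by blast

lemma rep_comp [simp]:
  assumes "f \<in> Hor B" "g \<in> Hor B" "Cod (HC B) f = Dom (HC B) g"
  shows "rep (Comp (HC B) g (rep f)) = rep (Comp (HC B) g f)" "rep (Comp (HC B) (rep g) f) = rep (Comp (HC B) g f)"
  using assms by (auto intro!: rep_eq R_comp R_refl)

text \<open>Conjugation by the specified cells moves top and bottom to their representatives. The
  cells are globular, so the vertical sides stay unchanged.\<close>

definition cj :: "'a \<Rightarrow> 'a" where
  "cj a = Comp (VS B) (t (bt B a) (rep (bt B a))) (Comp (VS B) a (t (rep (tp B a)) (tp B a)))"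

lemma cj_rules [simp]:
  assumes "a \<in> Sq B"
  shows "cj a \<in> Sq B" "tp B (cj a) = rep (tp B a)" "bt B (cj a) = rep (bt B a)" "lf B (cj a) = lf B a" "rt B (cj a) = rt B a"
  using assms unfolding cj_def by simp_all

text \<open>By \<open>t_trans\<close> a specified cell pasted on top is absorbed by the one that
  leads to the representative. Together with the same fact for bottoms, \<open>cj\<close> is
  constant on squares that differ by specified cells.\<close>

lemma cj_top:
  assumes "a \<in> Sq B" "R f (tp B a)"
  shows "cj (Comp (VS B) a (t f (tp B a))) = cj a"
proof -
  have e: "rep f = rep (tp B a)" by (rule rep_eq[OF assms(2)])
  have r: "R (rep f) f" using assms(2) by simp
  have "Comp (VS B) (Comp (VS B) a (t f (tp B a))) (t (rep f) f) =
      Comp (VS B) a (Comp (VS B) (t f (tp B a)) (t (rep f) f))"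
    using assms r by (simp add: B.vs_assoc)
  also have "\<dots> = Comp (VS B) a (t (rep (tp B a)) (tp B a))"
    using t_trans[OF r assms(2)] e by simp
  finally show ?thesis using assms unfolding cj_def by simp
qed

lemma cj_bot:
  assumes "a \<in> Sq B" "R (bt B a) g"
  shows "cj (Comp (VS B) (t (bt B a) g) a) = cj a"
proof -
  have e: "rep g = rep (bt B a)" using rep_eq[OF assms(2)] by simp
  have r: "R g (rep g)" using assms(2) by simp
  have "cj (Comp (VS B) (t (bt B a) g) a) =
      Comp (VS B) (t g (rep g)) (Comp (VS B) (t (bt B a) g) (Comp (VS B) a (t (rep (tp B a)) (tp B a))))"
    using assms by (simp add: cj_def B.vs_assoc)
  also have "\<dots> = Comp (VS B) (Comp (VS B) (t g (rep g)) (t (bt B a) g)) (Comp (VS B) a (t (rep (tp B a)) (tp B a)))"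
    using assms r by (intro B.vs_assoc) simp_all
  also have "Comp (VS B) (t g (rep g)) (t (bt B a) g) = t (bt B a) (rep (bt B a))"
    using t_trans[OF assms(2) r] e by simp
  finally show ?thesis unfolding cj_def .
qed

lemma cj_tb:
  assumes "a \<in> Sq B" "R f (tp B a)" "R (bt B a) g"
  shows "cj (Comp (VS B) (t (bt B a) g) (Comp (VS B) a (t f (tp B a)))) = cj a"
  using cj_bot[of "Comp (VS B) a (t f (tp B a))" g] cj_top[of a f] assms by simp

lemma cj_id: "a \<in> Sq B \<Longrightarrow> rep (tp B a) = tp B a \<Longrightarrow> rep (bt B a) = bt B a \<Longrightarrow> cj a = a"
  by (simp add: cj_def t_refl)

lemma cj_idem [simp]: "a \<in> Sq B \<Longrightarrow> cj (cj a) = cj a"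
  by (rule cj_id) simp_all

text \<open>In the middle the cells to the representative and back compose to
  \<open>t ?m ?m\<close>, which is an identity by \<open>t_refl\<close>.\<close>

lemma cj_vs:
  assumes "a \<in> Sq B" "b \<in> Sq B" "bt B a = tp B b"
  shows "cj (Comp (VS B) b a) = Comp (VS B) (cj b) (cj a)"
proof -
  let ?m = "tp B b"
  have m: "?m \<in> Hor B" using assms by simp
  let ?x = "Comp (VS B) a (t (rep (tp B a)) (tp B a))"
  have x: "?x \<in> Sq B" "bt B ?x = ?m" using assms by simp_all
  let ?y = "t (bt B b) (rep (bt B b))"
  have y: "?y \<in> Sq B" "tp B ?y = bt B b" using assms by simp_all
  have "Comp (VS B) (Comp (VS B) b (t (rep ?m) ?m)) (Comp (VS B) (t ?m (rep ?m)) ?x) =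
      Comp (VS B) b (Comp (VS B) (t (rep ?m) ?m) (Comp (VS B) (t ?m (rep ?m)) ?x))"
    using assms x m by (intro B.vs_assoc[symmetric]) simp_all
  also have "Comp (VS B) (t (rep ?m) ?m) (Comp (VS B) (t ?m (rep ?m)) ?x) =
      Comp (VS B) (Comp (VS B) (t (rep ?m) ?m) (t ?m (rep ?m))) ?x"
    using assms x m by (intro B.vs_assoc) simp_all
  also have "\<dots> = ?x" using t_trans[of ?m "rep ?m" ?m] x m by (simp add: t_refl)
  finally have 1: "Comp (VS B) (Comp (VS B) b (t (rep ?m) ?m)) (Comp (VS B) (t ?m (rep ?m)) ?x) = Comp (VS B) b ?x" .
  have "Comp (VS B) (cj b) (cj a) =
      Comp (VS B) (Comp (VS B) ?y (Comp (VS B) b (t (rep ?m) ?m))) (Comp (VS B) (t ?m (rep ?m)) ?x)"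
    using assms by (simp add: cj_def)
  also have "\<dots> = Comp (VS B) ?y (Comp (VS B) (Comp (VS B) b (t (rep ?m) ?m)) (Comp (VS B) (t ?m (rep ?m)) ?x))"
    using assms x y m by (intro B.vs_assoc[symmetric]) simp_all
  also have "\<dots> = Comp (VS B) ?y (Comp (VS B) b ?x)" unfolding 1 ..
  also have "Comp (VS B) b ?x = Comp (VS B) (Comp (VS B) b a) (t (rep (tp B a)) (tp B a))"
    using assms by (intro B.vs_assoc) simp_all
  finally show ?thesis using assms by (simp add: cj_def)
qed

text \<open>A composite of representatives is merely related to the representative of the composite,
  so one more \<open>cj\<close> is required. By \<open>t_comp\<close> and interchange, the two sides
  before this last conjugation differ by specified cells, which \<open>cj_tb\<close>
  absorbs.\<close>

lemma cj_hs:
  assumes "a \<in> Sq B" "b \<in> Sq B" "rt B a = lf B b"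
  shows "cj (Comp (HS B) (cj b) (cj a)) = cj (Comp (HS B) b a)"
proof -
  have h: "Cod (HC B) (tp B a) = Dom (HC B) (tp B b)" "Cod (HC B) (bt B a) = Dom (HC B) (bt B b)"
    using assms by simp_all
  let ?T = "t (rep (tp B a)) (tp B a)" and ?T' = "t (rep (tp B b)) (tp B b)"
  let ?S = "t (bt B a) (rep (bt B a))" and ?S' = "t (bt B b) (rep (bt B b))"
  let ?f = "Comp (HC B) (rep (tp B b)) (rep (tp B a))" and ?g = "Comp (HC B) (rep (bt B b)) (rep (bt B a))"
  have T: "R ?f (Comp (HC B) (tp B b) (tp B a)) \<and> t ?f (Comp (HC B) (tp B b) (tp B a)) = Comp (HS B) ?T' ?T"
    using assms h by (intro t_comp) simp_all
  have S: "R (Comp (HC B) (bt B b) (bt B a)) ?g \<and> t (Comp (HC B) (bt B b) (bt B a)) ?g = Comp (HS B) ?S' ?S"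
    using assms h by (intro t_comp) simp_all
  have "Comp (HS B) (cj b) (cj a) = Comp (VS B) (Comp (HS B) ?S' ?S) (Comp (HS B) (Comp (VS B) b ?T') (Comp (VS B) a ?T))"
    using assms by (simp add: cj_def B.interchange)
  also have "Comp (HS B) (Comp (VS B) b ?T') (Comp (VS B) a ?T) = Comp (VS B) (Comp (HS B) b a) (Comp (HS B) ?T' ?T)"
    using assms by (simp add: B.interchange)
  finally have e: "Comp (HS B) (cj b) (cj a) = Comp (VS B) (Comp (HS B) ?S' ?S)
      (Comp (VS B) (Comp (HS B) b a) (Comp (HS B) ?T' ?T))" .
  show ?thesis
    using cj_tb[of "Comp (HS B) b a" ?f ?g] T S assms unfolding e by simp
qed

lemma cj_hs1:
  assumes "a \<in> Sq B" "b \<in> Sq B" "rt B a = lf B b"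
  shows "cj (Comp (HS B) b (cj a)) = cj (Comp (HS B) b a)" "cj (Comp (HS B) (cj b) a) = cj (Comp (HS B) b a)"
  using cj_hs[of a b] cj_hs[of "cj a" b] cj_hs[of a "cj b"] assms by simp_all

lemma cj_vid: "f \<in> Hor B \<Longrightarrow> cj (Idt (VS B) f) = Idt (VS B) (rep f)"
  using t_trans[of "rep f" f "rep f"] by (simp add: cj_def t_refl)

definition YH :: "'a set" where "YH = {f \<in> Hor B. rep f = f}"
definition YS :: "'a set" where "YS = {a \<in> Sq B. rep (tp B a) = tp B a \<and> rep (bt B a) = bt B a}"

text \<open>The quotient is realized on representatives. Vertical composites of such squares already
  have representatives as top and bottom and are left alone; horizontal composites and identities
  are renormalized by \<open>rep\<close> and \<open>cj\<close>.\<close>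

definition Y :: "'a dblcat" where
  "Y = \<lparr>HC = \<lparr>Obj = Ob B, Arr = YH, Dom = Dom (HC B), Cod = Cod (HC B),
         Idt = rep \<circ> Idt (HC B), Comp = (\<lambda>g f. rep (Comp (HC B) g f))\<rparr>,
    VC = VC B,
    HS = \<lparr>Obj = Ver B, Arr = YS, Dom = lf B, Cod = rt B,
         Idt = cj \<circ> Idt (HS B), Comp = (\<lambda>b a. cj (Comp (HS B) b a))\<rparr>,
    VS = \<lparr>Obj = YH, Arr = YS, Dom = tp B, Cod = bt B, Idt = Idt (VS B), Comp = Comp (VS B)\<rparr>\<rparr>"

lemma Y_simps [simp]:
  "Ob Y = Ob B" "Hor Y = YH" "Dom (HC Y) = Dom (HC B)" "Cod (HC Y) = Cod (HC B)"
  "Idt (HC Y) x = rep (Idt (HC B) x)" "Comp (HC Y) g f = rep (Comp (HC B) g f)" "VC Y = VC B"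
  "Obj (HS Y) = Ver B" "Sq Y = YS" "lf Y = lf B" "rt Y = rt B" "Idt (HS Y) u = cj (Idt (HS B) u)"
  "Comp (HS Y) b a = cj (Comp (HS B) b a)" "Obj (VS Y) = YH" "Arr (VS Y) = YS" "tp Y = tp B" "bt Y = bt B"
  "Idt (VS Y) = Idt (VS B)" "Comp (VS Y) = Comp (VS B)"
  by (simp_all add: Y_def)

lemma YH [simp]: "f \<in> YH \<longleftrightarrow> f \<in> Hor B \<and> rep f = f" by (simp add: YH_def)
lemma YS [simp]: "a \<in> YS \<longleftrightarrow> a \<in> Sq B \<and> rep (tp B a) = tp B a \<and> rep (bt B a) = bt B a" by (simp add: YS_def)

text \<open>Each law is that of \<open>B\<close> under an outer \<open>rep\<close> or
  \<open>cj\<close>: inner conjugations inside horizontal composites are removed by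
  \<open>rep_comp\<close> and \<open>cj_hs1\<close>, and compatibility of \<open>cj\<close> with
  vertical composition gives interchange.\<close>

lemma dc_Y: "double_category Y"
proof (rule double_categoryI)
  show "category (HC Y)"
  proof (rule categoryI)
    fix f g h assume "f \<in> Hor Y" "g \<in> Hor Y" "h \<in> Hor Y" "Cod (HC Y) f = Dom (HC Y) g" "Cod (HC Y) g = Dom (HC Y) h"
    then show "Comp (HC Y) h (Comp (HC Y) g f) = Comp (HC Y) (Comp (HC Y) h g) f"
      by (simp add: B.H.assoc)
  qed simp_all
  show "category (VC Y)" using B.V.cat by simp
  show "category (HS Y)"
  proof (rule categoryI)
    fix a b c assume "a \<in> Sq Y" "b \<in> Sq Y" "c \<in> Sq Y" "rt Y a = lf Y b" "rt Y b = lf Y c"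
    then show "Comp (HS Y) c (Comp (HS Y) b a) = Comp (HS Y) (Comp (HS Y) c b) a"
      by (simp add: cj_hs1 B.HS.assoc)
  qed (simp_all add: cj_hs1 cj_id)
  show "category (VS Y)"
    by (rule categoryI) (simp_all add: B.vs_assoc)
next
  fix u v assume "u \<in> Ver Y" "v \<in> Ver Y" "Cod (VC Y) u = Dom (VC Y) v"
  then show "Idt (HS Y) (Comp (VC Y) v u) = Comp (VS Y) (Idt (HS Y) v) (Idt (HS Y) u)"
    by (simp add: B.hs_idt cj_vs)
next
  fix x assume "x \<in> Ob Y"
  then show "Idt (HS Y) (Idt (VC Y) x) = Idt (VS Y) (Idt (HC Y) x)"
    by (simp add: B.hs_idt_idt cj_vid)
next
  fix f g assume "f \<in> Hor Y" "g \<in> Hor Y" "Cod (HC Y) f = Dom (HC Y) g"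
  then show "Idt (VS Y) (Comp (HC Y) g f) = Comp (HS Y) (Idt (VS Y) g) (Idt (VS Y) f)"
    by (simp add: B.vs_idt[symmetric] cj_vid)
next
  fix a b c d assume "a \<in> Sq Y" "b \<in> Sq Y" "c \<in> Sq Y" "d \<in> Sq Y" "rt Y a = lf Y b" "rt Y c = lf Y d"
    "bt Y a = tp Y c" "bt Y b = tp Y d"
  then show "Comp (VS Y) (Comp (HS Y) d c) (Comp (HS Y) b a) = Comp (HS Y) (Comp (VS Y) d b) (Comp (VS Y) c a)"
    by (simp add: B.interchange cj_vs[symmetric])
qed simp_all

lemma dfun_Y: "dfun B Y (\<lambda>x. x) rep (\<lambda>x. x) cj"
proof (rule dfunI)
  fix a b assume "a \<in> Sq B" "b \<in> Sq B" "rt B a = lf B b"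
  then show "cj (Comp (HS B) b a) = Comp (HS Y) (cj b) (cj a)" by (simp add: cj_hs)
next
  fix f g assume "f \<in> Hor B" "g \<in> Hor B" "Cod (HC B) f = Dom (HC B) g"
  then show "rep (Comp (HC B) g f) = Comp (HC Y) (rep g) (rep f)" by simp
qed (simp_all add: B.dc dc_Y cj_vid cj_vs)

definition r :: "'a dblfun" where "r = mk B Y (\<lambda>x. x) rep (\<lambda>x. x) cj"

lemma r_simps [simp]: "Src r = B" "Trg r = Y" "x \<in> Ob B \<Longrightarrow> onOb r x = x" "f \<in> Hor B \<Longrightarrow> onHor r f = rep f"
  "u \<in> Ver B \<Longrightarrow> onVer r u = u" "a \<in> Sq B \<Longrightarrow> onSq r a = cj a"
  by (simp_all add: r_def)

text \<open>Conjugation is undone by the reverse cells, which depend on top and bottom of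
  \<open>a\<close> alone. A square is therefore determined by its boundary and its image, which is
  faithfulness of \<open>r\<close> on squares.\<close>

lemma cj_inv:
  assumes "a \<in> Sq B"
  shows "Comp (VS B) (t (rep (bt B a)) (bt B a)) (Comp (VS B) (cj a) (t (tp B a) (rep (tp B a)))) = a"
proof -
  have "Comp (VS B) (cj a) (t (tp B a) (rep (tp B a))) = Comp (VS B) (t (bt B a) (rep (bt B a))) a"
  proof -
    have "Comp (VS B) (cj a) (t (tp B a) (rep (tp B a))) = Comp (VS B) (t (bt B a) (rep (bt B a)))
        (Comp (VS B) (Comp (VS B) a (t (rep (tp B a)) (tp B a))) (t (tp B a) (rep (tp B a))))"
      unfolding cj_def using assms by (intro B.vs_assoc[symmetric]) simp_all
    also have "Comp (VS B) (Comp (VS B) a (t (rep (tp B a)) (tp B a))) (t (tp B a) (rep (tp B a))) =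
      Comp (VS B) a (Comp (VS B) (t (rep (tp B a)) (tp B a)) (t (tp B a) (rep (tp B a))))"
      using assms by (intro B.vs_assoc[symmetric]) simp_all
    also have "\<dots> = a" using assms t_trans[of "tp B a" "rep (tp B a)" "tp B a"] by (simp add: t_refl)
    finally show ?thesis .
  qed
  moreover have "Comp (VS B) (t (rep (bt B a)) (bt B a)) (Comp (VS B) (t (bt B a) (rep (bt B a))) a) =
      Comp (VS B) (Comp (VS B) (t (rep (bt B a)) (bt B a)) (t (bt B a) (rep (bt B a)))) a"
    using assms by (intro B.vs_assoc) simp_all
  moreover have "\<dots> = a" using assms t_trans[of "bt B a" "rep (bt B a)" "bt B a"] by (simp add: t_refl)
  ultimately show ?thesis by simp
qed

text \<open>Objects and vertical morphisms are untouched, and each morphism of \<open>Y\<close> is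
  its own preimage. A square over a boundary of \<open>B\<close> is lifted by pasting the specified
  cells back on.\<close>

lemma r_ctf:
  assumes s: "small_dblcat B"
  shows "r \<in> DArr" "ctf r"
proof -
  have "|YH| \<le>o |Hor B|" "|YS| \<le>o |Sq B|" by (rule card_of_mono1; auto)+
  then have "small_dblcat Y"
    using s dc_Y unfolding small_dblcat_def small_def by (auto intro: ordLeq_ordLess_trans)
  then show r: "r \<in> DArr" unfolding r_def by (intro mk_DArr dfun_Y s)
  show "ctf r"
  proof (rule ctfI[OF r])
    show "sq_ff r"
    proof (rule sq_ffI[OF r])
      fix f g u v b
      assume "square_boundary (Src r) f g u v" "b \<in> squares (Trg r) (onHor r f) (onHor r g) (onVer r u) (onVer r v)"
      then have f: "f \<in> Hor B" "g \<in> Hor B" "u \<in> Ver B" "v \<in> Ver B" "b \<in> Sq B" "tp B b = rep f" "bt B b = rep g"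
        "lf B b = u" "rt B b = v" "Dom (HC B) f = Dom (VC B) u" "Cod (HC B) f = Dom (VC B) v"
        "Dom (HC B) g = Cod (VC B) u" "Cod (HC B) g = Cod (VC B) v"
        by (simp_all add: square_boundary_def squares_def)
      let ?a = "Comp (VS B) (t (rep g) g) (Comp (VS B) b (t f (rep f)))"
      have "cj ?a = cj b" using cj_tb[of b f g] f by simp
      also have "cj b = b" using f by (intro cj_id) simp_all
      finally have "onSq r ?a = b" using f by simp
      moreover have "?a \<in> squares (Src r) f g u v" using f by (simp add: squares_def)
      ultimately show "\<exists>a\<in>squares (Src r) f g u v. onSq r a = b" by blast
    next
      fix a b assume "a \<in> Sq (Src r)" "b \<in> Sq (Src r)" "tp (Src r) a = tp (Src r) b"
        "bt (Src r) a = bt (Src r) b" "onSq r a = onSq r b"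
      then have e: "a \<in> Sq B" "b \<in> Sq B" "tp B a = tp B b" "bt B a = bt B b" "cj a = cj b" by simp_all
      show "a = b" using cj_inv[OF e(1)] cj_inv[OF e(2)] unfolding e(3-5) by (rule trans[OF sym])
    qed
  qed auto
qed

text \<open>If \<open>G\<close> trivializes all cells, then \<open>f\<close> and
  \<open>rep f\<close>, and likewise \<open>a\<close> and \<open>cj a\<close>, have the same image
  under \<open>G\<close>; equal images under \<open>r\<close> then force equal images under
  \<open>G\<close>.\<close>

lemma r_ker_le:
  assumes G: "G \<in> DArr" "Src G = B" and k: "kills G ja R t"
  shows "ker_le r G"
proof -
  interpret G: dfun B "Trg G" "onOb G" "onHor G" "onVer G" "onSq G"
    using DArr_dfun[OF G(1)] unfolding G(2) .
  have t: "onSq G (t f g) = Idt (VS (Trg G)) (onHor G f)" if "R f g" for f g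
    using k that unfolding kills_def by auto
  have e: "onHor G f = onHor G g" if "R f g" for f g
    using arg_cong[OF t[OF that], of "bt (Trg G)"] that by simp
  have h: "onHor G f = onHor G (rep f)" if "f \<in> Hor B" for f
    using e[OF R_rep[OF that]] .
  have s: "onSq G a = onSq G (cj a)" if "a \<in> Sq B" for a
  proof -
    have T: "onSq G (t (rep (tp B a)) (tp B a)) = Idt (VS (Trg G)) (onHor G (tp B a))"
      using t[OF R_rep'[of "tp B a"]] h[of "tp B a"] that by (metis B.sq_rules(3))
    have S: "onSq G (t (bt B a) (rep (bt B a))) = Idt (VS (Trg G)) (onHor G (bt B a))"
      using t[OF R_rep[of "bt B a"]] that by simp
    show ?thesis unfolding cj_def using that by (simp add: T S)
  qed
  have E1: "onHor G x = onHor G y" if "x \<in> Hor B" "y \<in> Hor B" "rep x = rep y" for x y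
    using h[OF that(1)] h[OF that(2)] that(3) by metis
  have E2: "onSq G x = onSq G y" if "x \<in> Sq B" "y \<in> Sq B" "cj x = cj y" for x y
    using s[OF that(1)] s[OF that(2)] that(3) by metis
  show ?thesis
    unfolding ker_le_def r_simps(1)
  proof (intro conjI ballI impI)
    show "onHor G x = onHor G y" if "x \<in> Hor B" "y \<in> Hor B" "onHor r x = onHor r y" for x y
      by (rule E1) (use that in simp_all)
    show "onSq G x = onSq G y" if "x \<in> Sq B" "y \<in> Sq B" "onSq r x = onSq r y" for x y
      by (rule E2) (use that in simp_all)
  qed simp_all
qed

lemma r_Hor_eq: "R f g \<Longrightarrow> onHor r f = onHor r g"
  using rep_eq by simp

lemma r_Sq_eq:
  assumes "a \<in> Sq B" "R f (tp B a)" "R (bt B a) g"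
    "b = Comp (VS B) (t (bt B a) g) (Comp (VS B) a (t f (tp B a)))"
  shows "onSq r a = onSq r b"
proof -
  have "b \<in> Sq B" using assms by simp
  then show ?thesis using cj_tb[OF assms(1-3)] assms(1) by (simp add: assms(4))
qed

end

section \<open>Pushouts of trivial fibrations that only identify horizontal morphisms\<close>

text \<open>All that is used of a cofibration. Unlike membership in \<open>Cof\<close>, this
  property passes to transposes directly, because canonical trivial fibrations are self-dual under
  transposition; it also passes to pushouts.\<close>

definition llp_ctf :: "'a dblfun \<Rightarrow> bool" where
  "llp_ctf i \<longleftrightarrow> i \<in> DArr \<and> (\<forall>q\<in>DArr. ctf q \<longrightarrow> has_lifting DblCat i q)"

lemma llp_ctf_lift:
  assumes "llp_ctf i" "q \<in> DArr" "ctf q" "u \<in> DArr" "v \<in> DArr" "Src u = Src i" "Trg u = Src q"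
    "Src v = Trg i" "Trg v = Trg q" "dblfun_comp q u = dblfun_comp v i"
  obtains l where "l \<in> DArr" "Src l = Trg i" "Trg l = Src q" "dblfun_comp l i = u" "dblfun_comp q l = v"
proof -
  have "commutative_square DblCat u i q v"
    using assms by (simp add: commutative_square_def llp_ctf_def)
  then have "\<exists>l\<in>arr_betw DblCat (Trg i) (Src q). dblfun_comp l i = u \<and> dblfun_comp q l = v"
    using assms unfolding llp_ctf_def has_lifting_def by simp
  then show thesis using that by (auto simp: arr_betw_def)
qed

lemma coherent_image:
  assumes "coherent B K jo ja R t" "dfun B X Fo Fh Fv Fs"
  shows "coherent X K (Fo \<circ> jo) (Fh \<circ> ja) R (\<lambda>k l. Fs (t k l))"
proof -
  interpret coherent B K jo ja R t by fact
  interpret F: dfun B X Fo Fh Fv Fs by fact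
  have 1: "is_functor K (HC X) (Fo \<circ> jo) (Fh \<circ> ja)" by (rule is_functor_comp'[OF j F.fh K.cat])
  show ?thesis
  proof (intro coherent.intro coherent_axioms.intro over_cat.intro over_cat_axioms.intro)
    show "dcat X" "cate K" "cate (HC X)" by unfold_locales
    fix k l assume kl: "R k l"
    show "R l k" by (rule R_sym[OF kl])
    show "k \<in> Arr K \<and> l \<in> Arr K \<and> Dom K k = Dom K l \<and> Cod K k = Cod K l" by (rule R_in[OF kl])
    note s = t_sq[OF kl] R_in[OF kl]
    show "Fs (t k l) \<in> Sq X \<and> tp X (Fs (t k l)) = (Fh \<circ> ja) k \<and> bt X (Fs (t k l)) = (Fh \<circ> ja) l \<and>
      lf X (Fs (t k l)) = Idt (VC X) ((Fo \<circ> jo) (Dom K k)) \<and> rt X (Fs (t k l)) = Idt (VC X) ((Fo \<circ> jo) (Cod K k))"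
      using s by simp
    fix m assume lm: "R l m"
    show "Comp (VS X) (Fs (t l m)) (Fs (t k l)) = Fs (t k m)"
      using F.s_rules(9)[of "t k l" "t l m"] s t_sq[OF lm] t_trans[OF kl lm] by simp
    show "R k m" by (rule R_trans[OF kl lm])
  next
    fix f f' g g' assume f: "R f f'" and g: "R g g'" and fg: "Cod K f = Dom K g"
    show "R (Comp K g f) (Comp K g' f') \<and> Fs (t (Comp K g f) (Comp K g' f')) = Comp (HS X) (Fs (t g g')) (Fs (t f f'))"
      using t_comp[OF f g fg] t_sq[OF f] t_sq[OF g] fg by simp
  qed (use 1 R_refl t_refl in simp_all)
qed

lemma kills_plus_disc:
  assumes "kills G ja R t" and G: "G \<in> DArr" "Src G = B" and X: "X \<subseteq> Ob B"
  shows "kills G (case_sum ja (Idt (HC B)))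
    (\<lambda>k l. (\<exists>k' l'. k = Inl k' \<and> l = Inl l' \<and> R k' l') \<or> (\<exists>x\<in>X. k = Inr x \<and> l = Inr x))
    (\<lambda>k l. case k of Inl k' \<Rightarrow> t k' (projl l) | Inr x \<Rightarrow> Idt (VS B) (Idt (HC B) x))"
proof -
  interpret G: dfun B "Trg G" "onOb G" "onHor G" "onVer G" "onSq G"
    using DArr_dfun[OF G(1)] unfolding G(2) .
  show ?thesis using assms(1) X unfolding kills_def by (auto simp: subset_iff)
qed

section \<open>The kernel of a trivial fibration that is injective on objects\<close>

context ctfib
begin

definition kerR :: "'a \<Rightarrow> 'a \<Rightarrow> bool" where
  "kerR a b \<longleftrightarrow> a \<in> Hor (Src F) \<and> b \<in> Hor (Src F) \<and> onHor F a = onHor F b"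

text \<open>Injectivity on objects makes morphisms with equal image parallel, so the identity square
  of their common image has exactly one lift with top \<open>a\<close>, bottom \<open>b\<close> and
  identity sides.\<close>

definition theta :: "'a \<Rightarrow> 'a \<Rightarrow> 'a" where
  "theta a b = (SOME s. s \<in> Sq (Src F) \<and> tp (Src F) s = a \<and> bt (Src F) s = b \<and>
     lf (Src F) s = Idt (VC (Src F)) (Dom (HC (Src F)) a) \<and> rt (Src F) s = Idt (VC (Src F)) (Cod (HC (Src F)) a) \<and>
     onSq F s = Idt (VS (Trg F)) (onHor F a))"

context
  assumes inj: "inj_on (onOb F) (Ob (Src F))"
begin

lemma kerR_in:
  assumes "kerR a b"
  shows "a \<in> Hor (Src F)" "b \<in> Hor (Src F)" "Dom (HC (Src F)) b = Dom (HC (Src F)) a"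
    "Cod (HC (Src F)) b = Cod (HC (Src F)) a" "onHor F b = onHor F a"
proof -
  show 1: "a \<in> Hor (Src F)" "b \<in> Hor (Src F)" "onHor F b = onHor F a" using assms by (simp_all add: kerR_def)
  have "onOb F (Dom (HC (Src F)) b) = onOb F (Dom (HC (Src F)) a)"
    "onOb F (Cod (HC (Src F)) b) = onOb F (Cod (HC (Src F)) a)"
    using 1 by (metis h_rules(2) h_rules(3))+
  then show "Dom (HC (Src F)) b = Dom (HC (Src F)) a" "Cod (HC (Src F)) b = Cod (HC (Src F)) a"
    using inj 1(1,2) by (auto dest: inj_onD)
qed

lemma theta:
  assumes ab: "kerR a b"
  shows "theta a b \<in> Sq (Src F)" "tp (Src F) (theta a b) = a" "bt (Src F) (theta a b) = b"
     "lf (Src F) (theta a b) = Idt (VC (Src F)) (Dom (HC (Src F)) a)"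
     "rt (Src F) (theta a b) = Idt (VC (Src F)) (Cod (HC (Src F)) a)"
     "onSq F (theta a b) = Idt (VS (Trg F)) (onHor F a)"
proof -
  note k = kerR_in[OF ab]
  have "square_boundary (Src F) a b (Idt (VC (Src F)) (Dom (HC (Src F)) a)) (Idt (VC (Src F)) (Cod (HC (Src F)) a))"
    using k by (simp add: square_boundary_def)
  then have "\<exists>s. s \<in> Sq (Src F) \<and> tp (Src F) s = a \<and> bt (Src F) s = b \<and>
     lf (Src F) s = Idt (VC (Src F)) (Dom (HC (Src F)) a) \<and> rt (Src F) s = Idt (VC (Src F)) (Cod (HC (Src F)) a) \<and>
     onSq F s = Idt (VS (Trg F)) (onHor F a)"
  proof (rule sq_full)
    show "Idt (VS (Trg F)) (onHor F a) \<in> Sq (Trg F)" using k by simp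
  qed (use k in auto)
  from someI_ex[OF this, folded theta_def]
  show "theta a b \<in> Sq (Src F)" "tp (Src F) (theta a b) = a" "bt (Src F) (theta a b) = b"
     "lf (Src F) (theta a b) = Idt (VC (Src F)) (Dom (HC (Src F)) a)"
     "rt (Src F) (theta a b) = Idt (VC (Src F)) (Cod (HC (Src F)) a)"
     "onSq F (theta a b) = Idt (VS (Trg F)) (onHor F a)"
    by simp_all
qed

text \<open>Each coherence law compares squares with equal boundary over the same identity square,
  and such squares coincide by faithfulness.\<close>

lemma coherent_theta: "coherent (Src F) (HC (Src F)) (\<lambda>x. x) (\<lambda>x. x) kerR theta"
proof (intro coherent.intro coherent_axioms.intro over_cat.intro over_cat_axioms.intro)
  show "dcat (Src F)" "cate (HC (Src F))" "cate (HC (Src F))" by unfold_locales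
  show "is_functor (HC (Src F)) (HC (Src F)) (\<lambda>x. x) (\<lambda>x. x)" by (rule is_functorI) simp_all
next
  fix k assume k: "k \<in> Hor (Src F)"
  then show "kerR k k" by (simp add: kerR_def)
  from theta[OF this] show "theta k k = Idt (VS (Src F)) k"
    using k by - (rule sq_faithful; simp)
next
  fix k l assume kl: "kerR k l"
  then show "kerR l k" by (simp add: kerR_def)
  show "k \<in> Hor (Src F) \<and> l \<in> Hor (Src F) \<and> Dom (HC (Src F)) k = Dom (HC (Src F)) l \<and>
      Cod (HC (Src F)) k = Cod (HC (Src F)) l"
    using kerR_in[OF kl] by simp
  show "theta k l \<in> Sq (Src F) \<and> tp (Src F) (theta k l) = k \<and> bt (Src F) (theta k l) = l \<and>
      lf (Src F) (theta k l) = Idt (VC (Src F)) (Dom (HC (Src F)) k) \<and>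
      rt (Src F) (theta k l) = Idt (VC (Src F)) (Cod (HC (Src F)) k)"
    using theta[OF kl] by simp
  fix m assume lm: "kerR l m"
  from kl lm show km: "kerR k m" by (simp add: kerR_def)
  show "Comp (VS (Src F)) (theta l m) (theta k l) = theta k m"
    using theta[OF kl] theta[OF lm] theta[OF km] kerR_in[OF kl] kerR_in[OF lm]
    by - (rule sq_faithful; simp)
next
  fix f f' g g' assume f: "kerR f f'" and g: "kerR g g'" and fg: "Cod (HC (Src F)) f = Dom (HC (Src F)) g"
  have c: "kerR (Comp (HC (Src F)) g f) (Comp (HC (Src F)) g' f')"
    using kerR_in[OF f] kerR_in[OF g] fg by (simp add: kerR_def)
  have "theta (Comp (HC (Src F)) g f) (Comp (HC (Src F)) g' f') = Comp (HS (Src F)) (theta g g') (theta f f')"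
    using theta[OF c] theta[OF f] theta[OF g] kerR_in[OF f] kerR_in[OF g] fg
    by - (rule sq_faithful; simp add: E.vs_idt)
  with c show "kerR (Comp (HC (Src F)) g f) (Comp (HC (Src F)) g' f') \<and>
      theta (Comp (HC (Src F)) g f) (Comp (HC (Src F)) g' f') = Comp (HS (Src F)) (theta g g') (theta f f')"
    by simp
qed

end

end

text \<open>The quotient without mention of representatives: it identifies whatever the cells
  connect, and nothing that is kept apart by a double functor killing them.\<close>

lemma quotient_exists:
  assumes c: "coherent B (HC B) (\<lambda>x. x) (\<lambda>x. x) R t" and B: "small_dblcat B"
  obtains r where "r \<in> DArr" "ctf r" "Src r = B"
    "\<forall>f g. R f g \<longrightarrow> onHor r f = onHor r g"
    "\<forall>a\<in>Sq B. \<forall>f g. R f (tp B a) \<longrightarrow> R (bt B a) g \<longrightarrow>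
      onSq r a = onSq r (Comp (VS B) (t (bt B a) g) (Comp (VS B) a (t f (tp B a))))"
    "\<forall>G\<in>DArr. Src G = B \<longrightarrow> kills G (\<lambda>x. x) R t \<longrightarrow> ker_le r G"
proof -
  have Q: "quot B (\<lambda>x. x) (\<lambda>x. x) R t"
    by (rule quot.intro[OF c], rule quot_axioms.intro) (rule refl)+
  show thesis
    by (rule that[OF quot.r_ctf[OF Q B] quot.r_simps(1)[OF Q]])
      (intro ballI allI impI, rule quot.r_simps[OF Q] quot.r_Hor_eq[OF Q] quot.r_Sq_eq[OF Q] quot.r_ker_le[OF Q];
        (assumption | rule refl)?)+
qed

text \<open>A quotient \<open>r\<close> of \<open>B\<close> is needed that identifies the images of
  whatever \<open>p\<close> identifies (\<open>ker1\<close>) and no more than \<open>p'\<close> does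
  (\<open>k2\<close>); \<open>pushout_retract\<close> turns these two bounds into a
  retraction.\<close>

lemma (in univ) retract_type1:
  fixes p i i' p' :: "'a dblfun"
  assumes po: "pushout_square DblCat p i i' p'" and p_ctf: "ctf p"
    and io: "inj_on (onOb p) (Ob (Src p))" and iv: "inj_on (onVer p) (Ver (Src p))"
    and L: "llp_ctf i"
  shows "\<exists>r. r \<in> DArr \<and> ctf r \<and> retract_of DblCat p' r"
proof -
  note d = pushout_squareD[OF po]
  interpret p: ctfib p using d(1) p_ctf by unfold_locales
  interpret B: dcat "Src p'"
    using d(4) by unfold_locales (simp add: small_dblcatD)
  interpret i: dfun "Src p" "Src p'" "onOb i" "onHor i" "onVer i" "onSq i"
    using DArr_dfun[OF d(2)] d by simp
  interpret p': dfun "Src p'" "Trg p'" "onOb p'" "onHor p'" "onVer p'" "onSq p'"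
    using DArr_dfun[OF d(4)] .
  interpret i': dfun "Trg p" "Trg p'" "onOb i'" "onHor i'" "onVer i'" "onSq i'"
    using DArr_dfun[OF d(3)] d by simp
  have smB: "small_dblcat (Src p')" and smA: "small_dblcat (Src p)" using d by simp_all
  have sq_comm: "onSq p' (onSq i a) = onSq i' (onSq p a)" if "a \<in> Sq (Src p)" for a
    using arg_cong[OF d(9), of "\<lambda>M. onSq M a"] that d(5) by simp
  have h_comm: "onHor p' (onHor i a) = onHor i' (onHor p a)" if "a \<in> Hor (Src p)" for a
    using arg_cong[OF d(9), of "\<lambda>M. onHor M a"] that d(5) by simp
  let ?A = "Src p" and ?B = "Src p'" and ?X = "Ob (Src p')"
  note cA = p.coherent_theta[OF io]
  have c0: "coherent ?B (HC ?A) (onOb i) (onHor i) p.kerR (\<lambda>k l. onSq i (p.theta k l))"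
    using coherent_image[OF cA i.dfun_axioms] by (simp add: comp_def)
  \<comment> \<open>The kernel cells lie over identities under \<open>p\<close>, so by
    \<open>p' i = i' p\<close> their images in \<open>B\<close> lie over identities under
    \<open>p'\<close>.\<close>
  have k0: "kills p' (onHor i) p.kerR (\<lambda>k l. onSq i (p.theta k l))"
    unfolding kills_def
  proof (intro allI impI)
    fix k l assume kl: "p.kerR k l"
    show "onSq p' (onSq i (p.theta k l)) = Idt (VS (Trg p')) (onHor p' (onHor i k))"
      using p.theta[OF io kl] p.kerR_in[OF io kl] by (simp add: sq_comm h_comm)
  qed
  define K where "K = plus_disc (HC ?A) ?X"
  define jo where "jo = case_sum (onOb i) (id :: 'a \<Rightarrow> 'a)"
  define ja where "ja = case_sum (onHor i) (Idt (HC ?B))"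
  define R where "R = (\<lambda>k l. (\<exists>k' l'. k = Inl k' \<and> l = Inl l' \<and> p.kerR k' l') \<or> (\<exists>x\<in>?X. k = Inr x \<and> l = (Inr x :: 'a + 'a)))"
  define t :: "'a + 'a \<Rightarrow> 'a + 'a \<Rightarrow> 'a" where "t = (\<lambda>k l. case k of Inl k' \<Rightarrow> onSq i (p.theta k' (projl l)) | Inr x \<Rightarrow> Idt (VS ?B) (Idt (HC ?B) x))"
  have c1: "coherent ?B K jo ja R t"
    using coherent_plus_disc[OF c0, of ?X] unfolding K_def jo_def ja_def R_def t_def by simp
  have k1: "kills p' ja R t"
    using kills_plus_disc[OF k0 d(4), of ?B ?X] unfolding ja_def R_def t_def by simp
  interpret c1: coherent ?B K jo ja R t by (rule c1)
  let ?FP = "freeprod K (HC ?B) jo" and ?V = "pbcat (VC ?B) (Obj K) jo"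
  have jo_in: "jo x \<in> Ob ?B" if "x \<in> Obj K" for x using that by simp
  have sm: "sml ty (Ob ?A)" "sml ty (Hor ?A)" "sml ty (Ob ?B)" "sml ty (Hor ?B)" "sml ty (Ver ?B)"
    using smA smB unfolding small_dblcat_def small_iff_sml by simp_all
  have smK: "sml ty (Obj K)" "sml ty (Arr K)"
    unfolding K_def plus_disc_simps by (intro sml_Un sml_image sm)+
  have jo_in': "jo x \<in> Obj (VC ?B)" if "x \<in> Obj K" for x using that by simp
  \<comment> \<open>Words are the horizontal morphisms over \<open>B\<close>; vertical morphisms and
    squares are all pulled back from \<open>B\<close>.\<close>
  obtain q go gh gv where q: "pulled q ?FP ?V jo c1.ev (\<lambda>t. fst (snd t)) go gh gv" and Tq: "Trg q = ?B"
    by (rule pull_exists[OF smB c1.category_freeprod category_pbcat[OF B.V.cat jo_in'] _ c1.is_functor_wev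
        is_functor_pbcat[OF B.V.cat jo_in'] _ sml_freeprod[OF smK(2) sm(4)] sml_pbcat[OF smK(1) sm(5)]])
      (assumption | simp add: smK)+
  interpret q: pulled q ?FP ?V jo c1.ev "\<lambda>t. fst (snd t)" go gh gv by (rule q)
  have q_ctf: "ctf q"
  proof (rule q.ctf)
    fix y assume "y \<in> Ob (Trg q)"
    then show "\<exists>x\<in>Obj ?FP. jo x = y"
      using Tq by (intro bexI[of _ "Inr y"]) (auto simp: jo_def K_def)
  next
    fix x y f
    assume "x \<in> Obj ?FP" "y \<in> Obj ?FP" "f \<in> Hor (Trg q)" "Dom (HC (Trg q)) f = jo x" "Cod (HC (Trg q)) f = jo y"
    then show "\<exists>g\<in>Arr ?FP. Dom ?FP g = x \<and> Cod ?FP g = y \<and> c1.ev g = f"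
      using c1.wev_full[of x y f] Tq by simp
  next
    fix x y f
    assume "x \<in> Obj ?FP" "y \<in> Obj ?FP" "f \<in> Ver (Trg q)" "Dom (VC (Trg q)) f = jo x" "Cod (VC (Trg q)) f = jo y"
    then show "\<exists>g\<in>Arr ?V. Dom ?V g = x \<and> Cod ?V g = y \<and> fst (snd g) = f"
      using Tq by (intro bexI[of _ "(x, f, y)"]) simp_all
  qed
  have f1: "is_functor (HC ?A) ?FP Inl (\<lambda>a. End (Inl a))"
    using is_functor_comp'[OF is_functor_Inl[OF p.D.H.cat, of ?X] c1.is_functor_End[unfolded K_def] p.D.H.cat]
    unfolding K_def by (simp add: comp_def)
  have f2: "is_functor (VC ?A) ?V Inl (\<lambda>u. (Inl (Dom (VC ?A) u), onVer i u, Inl (Cod (VC ?A) u)))"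
    by (rule is_functor_into_pbcat[OF i.fv p.D.V.cat]) (simp_all add: K_def jo_def)
  \<comment> \<open>A lift of \<open>i\<close> through \<open>q\<close> that sends a morphism of
    \<open>A\<close> to the word without adjoined letters; on squares the lift is forced.\<close>
  obtain u where u: "u \<in> DArr" "Src u = Src i" "Trg u = Src q" "dblfun_comp q u = i"
    "\<And>x. x \<in> Hor ?A \<Longrightarrow> gh (onHor u x) = End (Inl x)"
  proof (rule q.lift[of i Inl "\<lambda>a. End (Inl a)" "\<lambda>u. (Inl (Dom (VC ?A) u), onVer i u, Inl (Cod (VC ?A) u))"])
    show "is_functor (HC (Src i)) ?FP Inl (\<lambda>a. End (Inl a))" using f1 d by simp
    show "is_functor (VC (Src i)) ?V Inl (\<lambda>u. (Inl (Dom (VC ?A) u), onVer i u, Inl (Cod (VC ?A) u)))"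
      using f2 d by simp
  qed (use d Tq that in \<open>simp_all add: jo_def ja_def\<close>)
  \<comment> \<open>The lifting property extends \<open>u\<close> to a section of \<open>q\<close>.
    It attaches to each morphism of \<open>B\<close> one word that evaluates to it.\<close>
  obtain l where l: "l \<in> DArr" "Src l = ?B" "Trg l = Src q" "dblfun_comp l i = u" "dblfun_comp q l = dblfun_id ?B"
    using llp_ctf_lift[OF L q.F_in q_ctf u(1), of "dblfun_id ?B"] u(2-4) d Tq smB by auto
  interpret l: dfun ?B "Src q" "onOb l" "onHor l" "onVer l" "onSq l"
    using DArr_dfun[OF l(1)] l by simp
  define lo where "lo = go \<circ> onOb l"
  define la where "la = gh \<circ> onHor l"
  have fl: "is_functor (HC ?B) ?FP lo la"
    unfolding lo_def la_def by (rule is_functor_comp'[OF l.fh q.fgh B.H.cat])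
  have lo: "x = jo (lo x)" if "x \<in> Ob ?B" for x
    using arg_cong[OF l(5), of "\<lambda>M. onOb M x"] that l(2) by (simp add: lo_def q.qo)
  have la: "f = c1.ev (la f)" if "f \<in> Hor ?B" for f
    using arg_cong[OF l(5), of "\<lambda>M. onHor M f"] that l(2) by (simp add: la_def q.qh)
  \<comment> \<open>By \<open>l i = u\<close> the word of \<open>onHor i a\<close> is the
    exchangeable letter \<open>Inl a\<close>, and not a letter adjoined for
    \<open>onHor i a\<close>, which \<open>wR\<close> would keep fixed.\<close>
  have la_i: "la (onHor i a) = End (Inl a)" if "a \<in> Hor ?A" for a
    using arg_cong[OF l(4), of "\<lambda>M. onHor M a"] that u(5)[OF that] d(5) by (simp add: la_def)
  define S where "S = (\<lambda>f g. f \<in> Hor ?B \<and> g \<in> Hor ?B \<and> Dom (HC ?B) f = Dom (HC ?B) g \<and>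
      Cod (HC ?B) f = Cod (HC ?B) g \<and> (c1.val (la f) \<and> c1.val (la g) \<and> c1.wR (la f) (la g)))"
  define s where "s = (\<lambda>f g. c1.wt (la f) (la g))"
  have c2: "coherent ?B (HC ?B) (\<lambda>x. x) (\<lambda>x. x) S s"
    unfolding S_def s_def by (rule coherent_restrict[OF c1.coherent_freeprod B.H.cat fl lo la])
  have kF: "kills p' c1.ev (\<lambda>v w. c1.val v \<and> c1.val w \<and> c1.wR v w) c1.wt"
    by (rule c1.kills_freeprod[OF d(4) refl k1])
  have k2: "kills p' (\<lambda>x. x) S s"
    unfolding kills_def
  proof (intro allI impI)
    fix f g assume fg: "S f g"
    then have "f \<in> Hor ?B" and v: "c1.val (la f) \<and> c1.val (la g) \<and> c1.wR (la f) (la g)"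
      unfolding S_def by simp_all
    then have "c1.ev (la f) = f" by (intro la[symmetric])
    moreover have "onSq p' (c1.wt (la f) (la g)) = Idt (VS (Trg p')) (onHor p' (c1.ev (la f)))"
      using kF[unfolded kills_def] v by iprover
    ultimately show "onSq p' (s f g) = Idt (VS (Trg p')) (onHor p' f)" unfolding s_def by simp
  qed
  \<comment> \<open>On morphisms from \<open>A\<close> the words consist of one arrow of
    \<open>K\<close>, so there the system on \<open>B\<close> is the image of the kernel cells of
    \<open>p\<close>.\<close>
  have S_i: "S (onHor i a) (onHor i b) \<and> s (onHor i a) (onHor i b) = onSq i (p.theta a b)" if ab: "p.kerR a b" for a b
  proof -
    have "R (Inl a) (Inl b)" "t (Inl a) (Inl b) = onSq i (p.theta a b)"
      using ab by (simp_all add: R_def t_def)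
    moreover have "Inl a \<in> Arr K" "Inl b \<in> Arr K" using p.kerR_in[OF io ab] by (simp_all add: K_def)
    ultimately show ?thesis using p.kerR_in[OF io ab] unfolding S_def s_def by (simp add: la_i)
  qed
  obtain r where r: "r \<in> DArr" "ctf r" "Src r = ?B"
    "\<forall>f g. S f g \<longrightarrow> onHor r f = onHor r g"
    "\<forall>a\<in>Sq ?B. \<forall>f g. S f (tp ?B a) \<longrightarrow> S (bt ?B a) g \<longrightarrow>
      onSq r a = onSq r (Comp (VS ?B) (s (bt ?B a) g) (Comp (VS ?B) a (s f (tp ?B a))))"
    "\<forall>G\<in>DArr. Src G = ?B \<longrightarrow> kills G (\<lambda>x. x) S s \<longrightarrow> ker_le r G"
    by (rule quotient_exists[OF c2 smB])
  note r_Hor_eq = r(4)[rule_format] and r_Sq_eq = r(5)[rule_format] and r_ker_le = r(6)[rule_format]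
  have ker1: "ker_le p (dblfun_comp r i)"
    unfolding ker_le_def
  proof (intro conjI ballI impI)
    fix x y assume "x \<in> Ob ?A" "y \<in> Ob ?A" "onOb p x = onOb p y"
    then have "x = y" by (rule inj_onD[OF io, rotated 1]) 
    then show "onOb (dblfun_comp r i) x = onOb (dblfun_comp r i) y" by simp
  next
    fix x y assume "x \<in> Ver ?A" "y \<in> Ver ?A" "onVer p x = onVer p y"
    then have "x = y" using iv by (auto dest: inj_onD)
    then show "onVer (dblfun_comp r i) x = onVer (dblfun_comp r i) y" by simp
  next
    fix x y assume "x \<in> Hor ?A" "y \<in> Hor ?A" "onHor p x = onHor p y"
    then show "onHor (dblfun_comp r i) x = onHor (dblfun_comp r i) y"
      using S_i[of x y] r_Hor_eq[of "onHor i x" "onHor i y"] d by (simp add: p.kerR_def)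
  next
    fix a b assume a: "a \<in> Sq ?A" and b: "b \<in> Sq ?A" and e: "onSq p a = onSq p b"
    have "onVer p (lf ?A a) = onVer p (lf ?A b)" "onVer p (rt ?A a) = onVer p (rt ?A b)"
      using e a b by (metis p.s_rules(2) p.s_rules(3))+
    then have v: "lf ?A a = lf ?A b" "rt ?A a = rt ?A b" using iv a b by (auto dest: inj_onD)
    have R1: "p.kerR (tp ?A b) (tp ?A a)" and R2: "p.kerR (bt ?A a) (bt ?A b)"
      using e a b unfolding p.kerR_def by (metis p.s_rules(4) p.s_rules(5) p.D.sq_rules(3,4))+
    note T1 = p.theta[OF io R1] p.kerR_in[OF io R1] and T2 = p.theta[OF io R2] p.kerR_in[OF io R2]
    \<comment> \<open>Squares with the same image under \<open>p\<close> have the same vertical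
      sides and differ by kernel cells at top and bottom: the right side has the boundary of
      \<open>b\<close> and the image of \<open>b\<close>, as kernel cells lie over
      identities.\<close>
    have be: "b = Comp (VS ?A) (p.theta (bt ?A a) (bt ?A b)) (Comp (VS ?A) a (p.theta (tp ?A b) (tp ?A a)))"
      by (rule p.sq_faithful) (use T1 T2 a b v e in simp_all)
    have e1: "onSq i b = Comp (VS ?B) (s (bt ?B (onSq i a)) (onHor i (bt ?A b)))
        (Comp (VS ?B) (onSq i a) (s (onHor i (tp ?A b)) (tp ?B (onSq i a))))"
      using T1 T2 a b S_i[OF R1] S_i[OF R2] by (subst be) simp
    have "onSq r (onSq i a) = onSq r (onSq i b)"
      unfolding e1 by (rule r_Sq_eq) (use a b S_i[OF R1] S_i[OF R2] in simp_all)
    then show "onSq (dblfun_comp r i) a = onSq (dblfun_comp r i) b" using a b d by simp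
  qed
  have "retract_of DblCat p' r"
    by (rule pushout_retract[OF po p_ctf r(1,2) _ ker1 r_ker_le[OF d(4) refl k2]]) (use d r in simp)
  with r show ?thesis by blast
qed

section \<open>Transposition\<close>

definition transpose_dbl :: "'a dblcat \<Rightarrow> 'a dblcat" where
  "transpose_dbl D = \<lparr>HC = VC D, VC = HC D, HS = VS D, VS = HS D\<rparr>"

lemma transpose_dbl_simps [simp]: "HC (transpose_dbl D) = VC D" "VC (transpose_dbl D) = HC D" "HS (transpose_dbl D) = VS D" "VS (transpose_dbl D) = HS D"
  by (simp_all add: transpose_dbl_def)

lemma transpose_dbl_transpose_dbl [simp]: "transpose_dbl (transpose_dbl D) = D"
  by (cases D) (simp add: transpose_dbl_def)

text \<open>The axioms are self-dual: interchange for the transpose is interchange read from right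
  to left with the two middle squares exchanged.\<close>

lemma (in dcat) dc_transpose_dbl: "double_category (transpose_dbl D)"
  by (rule double_categoryI)
    (use H.cat V.cat HS.cat VS.cat in \<open>simp_all add: vs_idt hs_idt_idt hs_idt interchange\<close>)

definition transpose_fun :: "'a dblfun \<Rightarrow> 'a dblfun" where
  "transpose_fun F = \<lparr>Src = transpose_dbl (Src F), Trg = transpose_dbl (Trg F), onOb = onOb F, onHor = onVer F, onVer = onHor F, onSq = onSq F\<rparr>"

lemma transpose_fun_simps [simp]: "Src (transpose_fun F) = transpose_dbl (Src F)" "Trg (transpose_fun F) = transpose_dbl (Trg F)" "onOb (transpose_fun F) = onOb F"
  "onHor (transpose_fun F) = onVer F" "onVer (transpose_fun F) = onHor F" "onSq (transpose_fun F) = onSq F"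
  by (simp_all add: transpose_fun_def)

lemma transpose_fun_transpose_fun [simp]: "transpose_fun (transpose_fun F) = F"
  by (cases F) (simp add: transpose_fun_def)

lemma small_transpose_dbl: "small_dblcat D \<Longrightarrow> small_dblcat (transpose_dbl D)"
proof -
  assume s: "small_dblcat D"
  then interpret dcat D by unfold_locales (rule small_dblcatD)
  show ?thesis using s dc_transpose_dbl by (simp add: small_dblcat_def)
qed

lemma transpose_fun_DArr:
  assumes "F \<in> DArr" shows "transpose_fun F \<in> DArr"
proof -
  interpret dfun "Src F" "Trg F" "onOb F" "onHor F" "onVer F" "onSq F" using DArr_dfun[OF assms] .
  have "dfun (transpose_dbl (Src F)) (transpose_dbl (Trg F)) (onOb F) (onVer F) (onHor F) (onSq F)"
    by (rule dfunI) (use D.dc_transpose_dbl E.dc_transpose_dbl in simp_all)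
  then show ?thesis
    using DArr_extensional[OF assms] assms by (intro DArrI) (simp_all add: small_transpose_dbl)
qed

lemma transpose_fun_DArr_iff [simp]: "transpose_fun F \<in> DArr \<longleftrightarrow> F \<in> DArr"
  using transpose_fun_DArr[of F] transpose_fun_DArr[of "transpose_fun F"] by auto

lemma transpose_fun_comp:
  assumes "F \<in> DArr" "G \<in> DArr" "Trg F = Src G"
  shows "transpose_fun (dblfun_comp G F) = dblfun_comp (transpose_fun G) (transpose_fun F)"
proof (rule DArr_eqI)
  interpret dfun "Src F" "Trg F" "onOb F" "onHor F" "onVer F" "onSq F" using DArr_dfun[OF assms(1)] .
  show "transpose_fun (dblfun_comp G F) \<in> DArr" "dblfun_comp (transpose_fun G) (transpose_fun F) \<in> DArr" using assms by simp_all
qed (use DArr_dfun[OF assms(1)] in \<open>simp_all add: dcat.carriers[OF dfun.axioms(1)]\<close>)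

lemma transpose_fun_id:
  assumes "small_dblcat D" shows "transpose_fun (dblfun_id D) = dblfun_id (transpose_dbl D)"
proof -
  interpret dcat D by unfold_locales (rule small_dblcatD[OF assms])
  have "small_dblcat (transpose_dbl D)" by (rule small_transpose_dbl[OF assms])
  with assms show ?thesis by - (rule DArr_eqI; simp)
qed

lemma commutative_square_transpose_fun:
  assumes "commutative_square DblCat f g h k"
  shows "commutative_square DblCat (transpose_fun f) (transpose_fun g) (transpose_fun h) (transpose_fun k)"
proof -
  have d: "f \<in> DArr" "g \<in> DArr" "h \<in> DArr" "k \<in> DArr" "Src f = Src g" "Trg f = Src h" "Trg g = Src k"
    "Trg h = Trg k" and e: "dblfun_comp h f = dblfun_comp k g"
    using assms by (simp_all add: commutative_square_def)
  have "dblfun_comp (transpose_fun h) (transpose_fun f) = dblfun_comp (transpose_fun k) (transpose_fun g)"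
    using arg_cong[OF e, of transpose_fun] d by (simp add: transpose_fun_comp)
  then show ?thesis
    unfolding commutative_square_def using d by simp
qed

lemma pushout_square_transpose_fun:
  assumes "pushout_square DblCat f g h k"
  shows "pushout_square DblCat (transpose_fun f) (transpose_fun g) (transpose_fun h) (transpose_fun k)"
  unfolding pushout_square_def
proof (intro conjI allI impI)
  note d = pushout_squareD[OF assms]
  show "commutative_square DblCat (transpose_fun f) (transpose_fun g) (transpose_fun h) (transpose_fun k)"
    by (rule commutative_square_transpose_fun) (use assms in \<open>simp add: pushout_square_def\<close>)
  fix h' k' assume "commutative_square DblCat (transpose_fun f) (transpose_fun g) h' k'"
  from commutative_square_transpose_fun[OF this] have c: "commutative_square DblCat f g (transpose_fun h') (transpose_fun k')" by simp
  then have hk: "h' \<in> DArr" "k' \<in> DArr" "Trg f = transpose_dbl (Src h')" "Trg g = transpose_dbl (Src k')" "transpose_dbl (Trg h') = transpose_dbl (Trg k')"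
    "dblfun_comp (transpose_fun h') f = dblfun_comp (transpose_fun k') g"
    by (simp_all add: commutative_square_def)
  obtain u where u: "u \<in> DArr" "Src u = Trg h" "Trg u = transpose_dbl (Trg h')" "dblfun_comp u h = transpose_fun h'" "dblfun_comp u k = transpose_fun k'"
    using pushout_square_ex[OF assms, of "transpose_fun h'" "transpose_fun k'"] hk by auto
  show "\<exists>!u. u \<in> arr_betw DblCat (Cod DblCat (transpose_fun h)) (Cod DblCat h') \<and> Comp DblCat u (transpose_fun h) = h' \<and>
      Comp DblCat u (transpose_fun k) = k'"
  proof (rule ex1I)
    show "transpose_fun u \<in> arr_betw DblCat (Cod DblCat (transpose_fun h)) (Cod DblCat h') \<and> Comp DblCat (transpose_fun u) (transpose_fun h) = h' \<and>
      Comp DblCat (transpose_fun u) (transpose_fun k) = k'"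
      using u d transpose_fun_comp[of h u] transpose_fun_comp[of k u] by (simp add: arr_betw_def)
  next
    fix v assume v: "v \<in> arr_betw DblCat (Cod DblCat (transpose_fun h)) (Cod DblCat h') \<and> Comp DblCat v (transpose_fun h) = h' \<and>
      Comp DblCat v (transpose_fun k) = k'"
    then have v1: "v \<in> DArr" "Src v = transpose_dbl (Trg h)" "Trg v = Trg h'" "dblfun_comp v (transpose_fun h) = h'" "dblfun_comp v (transpose_fun k) = k'"
      by (simp_all add: arr_betw_def)
    have "transpose_fun v = u"
    proof (rule pushout_square_uniq[OF assms])
      show "dblfun_comp (transpose_fun v) h = dblfun_comp u h"
        using transpose_fun_comp[of "transpose_fun h" v] v1(1-3) d u(4) by (simp add: v1(4))
      show "dblfun_comp (transpose_fun v) k = dblfun_comp u k"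
        using transpose_fun_comp[of "transpose_fun k" v] v1(1-3) d u(5) by (simp add: v1(5))
    qed (use u v1 in simp_all)
    then show "v = transpose_fun u" by auto
  qed
qed

lemma ctf_transpose_fun:
  assumes "F \<in> DArr" "ctf F" shows "ctf (transpose_fun F)"
proof -
  interpret ctfib F using assms by unfold_locales
  show ?thesis
  proof (rule ctfI)
    show "sq_ff (transpose_fun F)"
    proof (rule sq_ffI)
      fix f g u v b
      assume 1: "square_boundary (Src (transpose_fun F)) f g u v"
        and 2: "b \<in> squares (Trg (transpose_fun F)) (onHor (transpose_fun F) f) (onHor (transpose_fun F) g) (onVer (transpose_fun F) u) (onVer (transpose_fun F) v)"
      have b: "square_boundary (Src F) u v f g" using 1 by (simp add: square_boundary_def)
      have b2: "b \<in> Sq (Trg F)" "tp (Trg F) b = onHor F u" "bt (Trg F) b = onHor F v" "lf (Trg F) b = onVer F f"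
        "rt (Trg F) b = onVer F g"
        using 2 by (simp_all add: squares_def)
      obtain a where "a \<in> Sq (Src F)" "tp (Src F) a = u" "bt (Src F) a = v" "lf (Src F) a = f"
        "rt (Src F) a = g" "onSq F a = b"
        by (rule sq_full[OF b b2])
      then show "\<exists>a\<in>squares (Src (transpose_fun F)) f g u v. onSq (transpose_fun F) a = b" by (auto simp: squares_def)
    next
      fix a b
      assume "a \<in> Sq (Src (transpose_fun F))" "b \<in> Sq (Src (transpose_fun F))" "tp (Src (transpose_fun F)) a = tp (Src (transpose_fun F)) b"
        "bt (Src (transpose_fun F)) a = bt (Src (transpose_fun F)) b" "lf (Src (transpose_fun F)) a = lf (Src (transpose_fun F)) b"
        "rt (Src (transpose_fun F)) a = rt (Src (transpose_fun F)) b" "onSq (transpose_fun F) a = onSq (transpose_fun F) b"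
      then show "a = b" by - (rule sq_faithful; simp)
    qed (use assms in simp)
  next
    fix y assume "y \<in> Ob (Trg (transpose_fun F))"
    then have "y \<in> Ob (Trg F)" by simp
    then obtain x where "x \<in> Ob (Src F)" "onOb F x = y" by (rule ob_surj)
    then show "\<exists>x\<in>Ob (Src (transpose_fun F)). onOb (transpose_fun F) x = y" by auto
  next
    fix x y f assume "x \<in> Ob (Src (transpose_fun F))" "y \<in> Ob (Src (transpose_fun F))" "f \<in> Hor (Trg (transpose_fun F))"
      "Dom (HC (Trg (transpose_fun F))) f = onOb (transpose_fun F) x" "Cod (HC (Trg (transpose_fun F))) f = onOb (transpose_fun F) y"
    then have "x \<in> Ob (Src F)" "y \<in> Ob (Src F)" "f \<in> Ver (Trg F)" "Dom (VC (Trg F)) f = onOb F x"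
      "Cod (VC (Trg F)) f = onOb F y" by simp_all
    then obtain g where "g \<in> Ver (Src F)" "Dom (VC (Src F)) g = x" "Cod (VC (Src F)) g = y" "onVer F g = f"
      by (rule ver_full)
    then show "\<exists>g\<in>Hor (Src (transpose_fun F)). Dom (HC (Src (transpose_fun F))) g = x \<and> Cod (HC (Src (transpose_fun F))) g = y \<and> onHor (transpose_fun F) g = f"
      by auto
  next
    fix x y f assume "x \<in> Ob (Src (transpose_fun F))" "y \<in> Ob (Src (transpose_fun F))" "f \<in> Ver (Trg (transpose_fun F))"
      "Dom (VC (Trg (transpose_fun F))) f = onOb (transpose_fun F) x" "Cod (VC (Trg (transpose_fun F))) f = onOb (transpose_fun F) y"
    then have "x \<in> Ob (Src F)" "y \<in> Ob (Src F)" "f \<in> Hor (Trg F)" "Dom (HC (Trg F)) f = onOb F x"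
      "Cod (HC (Trg F)) f = onOb F y" by simp_all
    then obtain g where "g \<in> Hor (Src F)" "Dom (HC (Src F)) g = x" "Cod (HC (Src F)) g = y" "onHor F g = f"
      by (rule hor_full)
    then show "\<exists>g\<in>Ver (Src (transpose_fun F)). Dom (VC (Src (transpose_fun F))) g = x \<and> Cod (VC (Src (transpose_fun F))) g = y \<and> onVer (transpose_fun F) g = f"
      by auto
  qed (use assms in simp)
qed

text \<open>A lifting problem against \<open>q\<close> is transposed into one for \<open>i\<close>
  against the transpose of \<open>q\<close>, and the solution is transposed back.\<close>

lemma llp_ctf_transpose_fun:
  assumes "llp_ctf i" shows "llp_ctf (transpose_fun i)"
  unfolding llp_ctf_def
proof (intro conjI ballI impI)
  have i: "i \<in> DArr" using assms by (simp add: llp_ctf_def)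
  then show "transpose_fun i \<in> DArr" by simp
  fix q :: "'a dblfun" assume q: "q \<in> DArr" "ctf q"
  have q': "transpose_fun q \<in> DArr" "ctf (transpose_fun q)" using q ctf_transpose_fun by auto
  show "has_lifting DblCat (transpose_fun i) q"
    unfolding has_lifting_def
  proof (intro allI impI)
    fix u v assume "commutative_square DblCat u (transpose_fun i) q v"
    then have c: "commutative_square DblCat (transpose_fun u) i (transpose_fun q) (transpose_fun v)" using commutative_square_transpose_fun by fastforce
    then have uv: "u \<in> DArr" "v \<in> DArr" "transpose_dbl (Src u) = Src i" "transpose_dbl (Trg u) = transpose_dbl (Src q)" "transpose_dbl (Src v) = Trg i"
      "transpose_dbl (Trg v) = transpose_dbl (Trg q)" "dblfun_comp (transpose_fun q) (transpose_fun u) = dblfun_comp (transpose_fun v) i"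
      by (simp_all add: commutative_square_def)
    obtain l where l: "l \<in> DArr" "Src l = Trg i" "Trg l = transpose_dbl (Src q)" "dblfun_comp l i = transpose_fun u" "dblfun_comp (transpose_fun q) l = transpose_fun v"
      using llp_ctf_lift[OF assms q', of "transpose_fun u" "transpose_fun v"] uv by auto
    have "dblfun_comp (transpose_fun l) (transpose_fun i) = u" "dblfun_comp q (transpose_fun l) = v"
      using transpose_fun_comp[of i l] transpose_fun_comp[of l "transpose_fun q"] l(1-3) i q by (simp_all add: l(4,5))
    moreover have "transpose_fun l \<in> arr_betw DblCat (Cod DblCat (transpose_fun i)) (Dom DblCat q)" using l by (simp add: arr_betw_def)
    ultimately show "\<exists>l\<in>arr_betw DblCat (Cod DblCat (transpose_fun i)) (Dom DblCat q). Comp DblCat l (transpose_fun i) = u \<and> Comp DblCat q l = v"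
      by auto
  qed
qed

lemma retract_of_transpose_fun:
  assumes "retract_of DblCat f g" shows "retract_of DblCat (transpose_fun f) (transpose_fun g)"
proof -
  obtain s r s' r' where c: "commutative_square DblCat s f g s'" "commutative_square DblCat r g f r'"
    and e: "dblfun_comp r s = dblfun_id (Src f)" "dblfun_comp r' s' = dblfun_id (Trg f)"
    using assms unfolding retract_of_def by auto
  have d: "s \<in> DArr" "r \<in> DArr" "s' \<in> DArr" "r' \<in> DArr" "Trg s = Src r" "Trg s' = Src r'" "f \<in> DArr"
    using c by (simp_all add: commutative_square_def)
  have "dblfun_comp (transpose_fun r) (transpose_fun s) = dblfun_id (transpose_dbl (Src f))" "dblfun_comp (transpose_fun r') (transpose_fun s') = dblfun_id (transpose_dbl (Trg f))"
    using d by (simp_all add: transpose_fun_comp[symmetric] e transpose_fun_id)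
  then show ?thesis
    unfolding retract_of_def using commutative_square_transpose_fun[OF c(1)] commutative_square_transpose_fun[OF c(2)]
    by - (rule exI[of _ "transpose_fun s"], rule exI[of _ "transpose_fun r"], rule exI[of _ "transpose_fun s'"], rule exI[of _ "transpose_fun r'"], simp)
qed

lemma (in univ) retract_type2:
  fixes p i i' p' :: "'a dblfun"
  assumes po: "pushout_square DblCat p i i' p'" and p_ctf: "ctf p"
    and io: "inj_on (onOb p) (Ob (Src p))" and ih: "inj_on (onHor p) (Hor (Src p))"
    and L: "llp_ctf i"
  shows "\<exists>r. r \<in> DArr \<and> ctf r \<and> retract_of DblCat p' r"
proof -
  have p: "p \<in> DArr" using pushout_squareD[OF po] by simp
  then interpret dfun "Src p" "Trg p" "onOb p" "onHor p" "onVer p" "onSq p" by (rule DArr_dfun)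
  have "\<exists>r. r \<in> DArr \<and> ctf r \<and> retract_of DblCat (transpose_fun p') r"
    by (rule retract_type1[OF pushout_square_transpose_fun[OF po] ctf_transpose_fun[OF p p_ctf] _ _ llp_ctf_transpose_fun[OF L]])
      (use io ih in simp_all)
  then obtain r where r: "r \<in> DArr" "ctf r" "retract_of DblCat (transpose_fun p') r" by blast
  have "transpose_fun r \<in> DArr" "ctf (transpose_fun r)" using r(1,2) ctf_transpose_fun by auto
  moreover have "retract_of DblCat p' (transpose_fun r)" using retract_of_transpose_fun[OF r(3)] by simp
  ultimately show ?thesis by blast
qed

section \<open>Coherent choices of connecting cells\<close>

text \<open>\<open>P b False\<close> is \<open>b\<close> and \<open>P b True\<close> is a representative of the class of \<open>b\<close>; the cells
  \<open>h b w x\<close>, \<open>v b w x\<close> and \<open>k b w x y z\<close> connect these objects and depend only on their corners.\<close>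

locale conn = dcat D for D :: "'a dblcat" +
  fixes P :: "'a \<Rightarrow> bool \<Rightarrow> 'a" and h v :: "'a \<Rightarrow> bool \<Rightarrow> bool \<Rightarrow> 'a"
    and k :: "'a \<Rightarrow> bool \<Rightarrow> bool \<Rightarrow> bool \<Rightarrow> bool \<Rightarrow> 'a"
  assumes P_in [simp]: "b \<in> Ob D \<Longrightarrow> P b w \<in> Ob D" and P_False [simp]: "b \<in> Ob D \<Longrightarrow> P b False = b"
    and h_in [simp]: "b \<in> Ob D \<Longrightarrow> h b w x \<in> Hor D" "b \<in> Ob D \<Longrightarrow> Dom (HC D) (h b w x) = P b w"
      "b \<in> Ob D \<Longrightarrow> Cod (HC D) (h b w x) = P b x"
    and v_in [simp]: "b \<in> Ob D \<Longrightarrow> v b w x \<in> Ver D" "b \<in> Ob D \<Longrightarrow> Dom (VC D) (v b w x) = P b w"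
      "b \<in> Ob D \<Longrightarrow> Cod (VC D) (v b w x) = P b x"
    and h_refl [simp]: "b \<in> Ob D \<Longrightarrow> h b w w = Idt (HC D) (P b w)"
    and v_refl [simp]: "b \<in> Ob D \<Longrightarrow> v b w w = Idt (VC D) (P b w)"
    and h_comp [simp]: "b \<in> Ob D \<Longrightarrow> Comp (HC D) (h b x y) (h b w x) = h b w y"
    and v_comp [simp]: "b \<in> Ob D \<Longrightarrow> Comp (VC D) (v b x y) (v b w x) = v b w y"
    and k_in [simp]: "b \<in> Ob D \<Longrightarrow> k b w x y z \<in> Sq D" "b \<in> Ob D \<Longrightarrow> tp D (k b w x y z) = h b w x"
      "b \<in> Ob D \<Longrightarrow> bt D (k b w x y z) = h b y z" "b \<in> Ob D \<Longrightarrow> lf D (k b w x y z) = v b w y"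
      "b \<in> Ob D \<Longrightarrow> rt D (k b w x y z) = v b x z"
    and k_h [simp]: "b \<in> Ob D \<Longrightarrow> k b w w y y = Idt (HS D) (v b w y)"
    and k_v [simp]: "b \<in> Ob D \<Longrightarrow> k b w x w x = Idt (VS D) (h b w x)"
    and k_hcomp [simp]: "b \<in> Ob D \<Longrightarrow> Comp (HS D) (k b x x' z z') (k b w x y z) = k b w x' y z'"
    and k_vcomp [simp]: "b \<in> Ob D \<Longrightarrow> Comp (VS D) (k b y z y' z') (k b w x y z) = k b w x y' z'"
begin

text \<open>Conjugation with the connecting arrows: \<open>h b True False\<close> runs from the
  representative of \<open>b\<close> to \<open>b\<close>, and \<open>h b False True\<close> runs
  back.\<close>

definition ch :: "'a \<Rightarrow> 'a" where
  "ch f = Comp (HC D) (h (Cod (HC D) f) False True) (Comp (HC D) f (h (Dom (HC D) f) True False))"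

definition cv :: "'a \<Rightarrow> 'a" where
  "cv u = Comp (VC D) (v (Cod (VC D) u) False True) (Comp (VC D) u (v (Dom (VC D) u) True False))"

text \<open>A square from \<open>ch f\<close> on top to \<open>f\<close> at the bottom, with
  connecting vertical arrows as sides. It is the component at \<open>f\<close> of an isomorphism
  between conjugation and the identity; \<open>T'\<close> is its vertical inverse.\<close>

definition T :: "'a \<Rightarrow> 'a" where
  "T f = Comp (HS D) (k (Cod (HC D) f) False True False False)
     (Comp (HS D) (Idt (VS D) f) (k (Dom (HC D) f) True False False False))"

definition T' :: "'a \<Rightarrow> 'a" where
  "T' f = Comp (HS D) (k (Cod (HC D) f) False False False True)
     (Comp (HS D) (Idt (VS D) f) (k (Dom (HC D) f) False False True False))"

definition cs :: "'a \<Rightarrow> 'a" where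
  "cs a = Comp (VS D) (T' (bt D a)) (Comp (VS D) a (T (tp D a)))"

lemma ch_rules [simp]:
  "f \<in> Hor D \<Longrightarrow> ch f \<in> Hor D" "f \<in> Hor D \<Longrightarrow> Dom (HC D) (ch f) = P (Dom (HC D) f) True"
  "f \<in> Hor D \<Longrightarrow> Cod (HC D) (ch f) = P (Cod (HC D) f) True"
  by (simp_all add: ch_def)

lemma cv_rules [simp]:
  "u \<in> Ver D \<Longrightarrow> cv u \<in> Ver D" "u \<in> Ver D \<Longrightarrow> Dom (VC D) (cv u) = P (Dom (VC D) u) True"
  "u \<in> Ver D \<Longrightarrow> Cod (VC D) (cv u) = P (Cod (VC D) u) True"
  by (simp_all add: cv_def)

lemma T_rules [simp]:
  assumes "f \<in> Hor D"
  shows "T f \<in> Sq D" "tp D (T f) = ch f" "bt D (T f) = f" "lf D (T f) = v (Dom (HC D) f) True False"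
    "rt D (T f) = v (Cod (HC D) f) True False"
  using assms by (simp_all add: T_def ch_def)

lemma T'_rules [simp]:
  assumes "f \<in> Hor D"
  shows "T' f \<in> Sq D" "tp D (T' f) = f" "bt D (T' f) = ch f" "lf D (T' f) = v (Dom (HC D) f) False True"
    "rt D (T' f) = v (Cod (HC D) f) False True"
  using assms by (simp_all add: T'_def ch_def)

text \<open>With its three analogues, this removes the connecting cells that meet at a common
  boundary when two conjugates are composed; it underlies multiplicativity of \<open>ch\<close>,
  \<open>cv\<close>, \<open>T\<close> and \<open>cs\<close>.\<close>

lemma H_cancel:
  assumes "f \<in> Hor D" "g \<in> Hor D" "a \<in> Hor D" "b \<in> Hor D" "Cod (HC D) f = Dom (HC D) a"
    "Cod (HC D) a = Dom (HC D) b" "Cod (HC D) b = Dom (HC D) g" "Comp (HC D) b a = Idt (HC D) (Dom (HC D) a)"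
  shows "Comp (HC D) (Comp (HC D) g b) (Comp (HC D) a f) = Comp (HC D) g f"
proof -
  have "Cod (HC D) b = Dom (HC D) a" using assms by (metis H.cod_comp H.cod_idt H.dom_in)
  moreover have "Comp (HC D) (Comp (HC D) g b) (Comp (HC D) a f) = Comp (HC D) g (Comp (HC D) b (Comp (HC D) a f))"
    using assms by (intro H.assoc[symmetric]) simp_all
  moreover have "Comp (HC D) b (Comp (HC D) a f) = Comp (HC D) (Comp (HC D) b a) f"
    using assms by (intro H.assoc) simp_all
  ultimately show ?thesis using assms by simp
qed

lemma V_cancel:
  assumes "f \<in> Ver D" "g \<in> Ver D" "a \<in> Ver D" "b \<in> Ver D" "Cod (VC D) f = Dom (VC D) a"
    "Cod (VC D) a = Dom (VC D) b" "Cod (VC D) b = Dom (VC D) g" "Comp (VC D) b a = Idt (VC D) (Dom (VC D) a)"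
  shows "Comp (VC D) (Comp (VC D) g b) (Comp (VC D) a f) = Comp (VC D) g f"
proof -
  have "Cod (VC D) b = Dom (VC D) a" using assms by (metis V.cod_comp V.cod_idt V.dom_in)
  moreover have "Comp (VC D) (Comp (VC D) g b) (Comp (VC D) a f) = Comp (VC D) g (Comp (VC D) b (Comp (VC D) a f))"
    using assms by (intro V.assoc[symmetric]) simp_all
  moreover have "Comp (VC D) b (Comp (VC D) a f) = Comp (VC D) (Comp (VC D) b a) f"
    using assms by (intro V.assoc) simp_all
  ultimately show ?thesis using assms by simp
qed

lemma S_cancel:
  assumes "f \<in> Sq D" "g \<in> Sq D" "a \<in> Sq D" "b \<in> Sq D" "rt D f = lf D a"
    "rt D a = lf D b" "rt D b = lf D g" "Comp (HS D) b a = Idt (HS D) (lf D a)"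
  shows "Comp (HS D) (Comp (HS D) g b) (Comp (HS D) a f) = Comp (HS D) g f"
proof -
  have "rt D b = lf D a" using arg_cong[OF assms(8), of "rt D"] assms(3,4,6) by simp
  moreover have "Comp (HS D) (Comp (HS D) g b) (Comp (HS D) a f) = Comp (HS D) g (Comp (HS D) b (Comp (HS D) a f))"
    using assms by (intro HS.assoc[symmetric]) simp_all
  moreover have "Comp (HS D) b (Comp (HS D) a f) = Comp (HS D) (Comp (HS D) b a) f"
    using assms by (intro HS.assoc) simp_all
  ultimately show ?thesis using assms by simp
qed

lemma VS_cancel:
  assumes "f \<in> Sq D" "g \<in> Sq D" "a \<in> Sq D" "b \<in> Sq D" "bt D f = tp D a"
    "bt D a = tp D b" "bt D b = tp D g" "Comp (VS D) b a = Idt (VS D) (tp D a)"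
  shows "Comp (VS D) (Comp (VS D) g b) (Comp (VS D) a f) = Comp (VS D) g f"
proof -
  have "bt D b = tp D a" using arg_cong[OF assms(8), of "bt D"] assms(3,4,6) by simp
  moreover have "Comp (VS D) (Comp (VS D) g b) (Comp (VS D) a f) = Comp (VS D) g (Comp (VS D) b (Comp (VS D) a f))"
    using assms by (intro vs_assoc[symmetric]) simp_all
  moreover have "Comp (VS D) b (Comp (VS D) a f) = Comp (VS D) (Comp (VS D) b a) f"
    using assms by (intro vs_assoc) simp_all
  ultimately show ?thesis using assms by simp
qed

lemma ch_comp:
  assumes "f \<in> Hor D" "g \<in> Hor D" "Cod (HC D) f = Dom (HC D) g"
  shows "ch (Comp (HC D) g f) = Comp (HC D) (ch g) (ch f)"
proof -
  let ?x = "Dom (HC D) f" and ?y = "Dom (HC D) g" and ?z = "Cod (HC D) g"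
  have "Comp (HC D) (ch g) (ch f) =
    Comp (HC D) (Comp (HC D) (Comp (HC D) (h ?z False True) g) (h ?y True False))
      (Comp (HC D) (h ?y False True) (Comp (HC D) f (h ?x True False)))"
    using assms by (simp add: ch_def H.assoc)
  also have "\<dots> = Comp (HC D) (Comp (HC D) (h ?z False True) g) (Comp (HC D) f (h ?x True False))"
    using assms by (intro H_cancel) simp_all
  also have "\<dots> = ch (Comp (HC D) g f)" using assms by (simp add: ch_def H.assoc)
  finally show ?thesis by simp
qed

lemma cv_comp:
  assumes "f \<in> Ver D" "g \<in> Ver D" "Cod (VC D) f = Dom (VC D) g"
  shows "cv (Comp (VC D) g f) = Comp (VC D) (cv g) (cv f)"
proof -
  let ?x = "Dom (VC D) f" and ?y = "Dom (VC D) g" and ?z = "Cod (VC D) g"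
  have "Comp (VC D) (cv g) (cv f) =
    Comp (VC D) (Comp (VC D) (Comp (VC D) (v ?z False True) g) (v ?y True False))
      (Comp (VC D) (v ?y False True) (Comp (VC D) f (v ?x True False)))"
    using assms by (simp add: cv_def V.assoc)
  also have "\<dots> = Comp (VC D) (Comp (VC D) (v ?z False True) g) (Comp (VC D) f (v ?x True False))"
    using assms by (intro V_cancel) simp_all
  also have "\<dots> = cv (Comp (VC D) g f)" using assms by (simp add: cv_def V.assoc)
  finally show ?thesis by simp
qed

lemma T_comp:
  assumes "f \<in> Hor D" "g \<in> Hor D" "Cod (HC D) f = Dom (HC D) g"
  shows "T (Comp (HC D) g f) = Comp (HS D) (T g) (T f)"
    and "T' (Comp (HC D) g f) = Comp (HS D) (T' g) (T' f)"
proof -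
  let ?x = "Dom (HC D) f" and ?y = "Dom (HC D) g" and ?z = "Cod (HC D) g"
  have "Comp (HS D) (T g) (T f) =
    Comp (HS D) (Comp (HS D) (Comp (HS D) (k ?z False True False False) (Idt (VS D) g)) (k ?y True False False False))
      (Comp (HS D) (k ?y False True False False) (Comp (HS D) (Idt (VS D) f) (k ?x True False False False)))"
    using assms by (simp add: T_def HS.assoc del: k_hcomp k_h k_v)
  also have "\<dots> = Comp (HS D) (Comp (HS D) (k ?z False True False False) (Idt (VS D) g))
      (Comp (HS D) (Idt (VS D) f) (k ?x True False False False))"
    using assms by (intro S_cancel) (simp_all add: hs_idt_idt)
  also have "\<dots> = T (Comp (HC D) g f)" using assms by (simp add: T_def HS.assoc vs_idt)
  finally show "T (Comp (HC D) g f) = Comp (HS D) (T g) (T f)" by simp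
  have "Comp (HS D) (T' g) (T' f) =
    Comp (HS D) (Comp (HS D) (Comp (HS D) (k ?z False False False True) (Idt (VS D) g)) (k ?y False False True False))
      (Comp (HS D) (k ?y False False False True) (Comp (HS D) (Idt (VS D) f) (k ?x False False True False)))"
    using assms by (simp add: T'_def HS.assoc del: k_hcomp k_h k_v)
  also have "\<dots> = Comp (HS D) (Comp (HS D) (k ?z False False False True) (Idt (VS D) g))
      (Comp (HS D) (Idt (VS D) f) (k ?x False False True False))"
    using assms by (intro S_cancel) (simp_all add: hs_idt_idt)
  also have "\<dots> = T' (Comp (HC D) g f)" using assms by (simp add: T'_def HS.assoc vs_idt)
  finally show "T' (Comp (HC D) g f) = Comp (HS D) (T' g) (T' f)" by simp
qed

lemma T_idt:
  assumes "x \<in> Ob D"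
  shows "T (Idt (HC D) x) = Idt (HS D) (v x True False)" "T' (Idt (HC D) x) = Idt (HS D) (v x False True)"
proof -
  \<comment> \<open>Written as a connecting cell, the double identity can be composed with its
    neighbours by \<open>k_hcomp\<close>; \<open>k_h\<close> and \<open>k_v\<close> are withheld
    meanwhile, as they would turn it back into an identity.\<close>
  have 1: "Idt (VS D) (Idt (HC D) x) = k x False False False False"
    using assms k_v[of x False False] by (simp del: k_h k_v)
  show "T (Idt (HC D) x) = Idt (HS D) (v x True False)" "T' (Idt (HC D) x) = Idt (HS D) (v x False True)"
    unfolding T_def T'_def 1 using assms by (simp_all del: k_h k_v) (simp_all)
qed

lemma T_inv:
  assumes "f \<in> Hor D"
  shows "Comp (VS D) (T' f) (T f) = Idt (VS D) (ch f)" "Comp (VS D) (T f) (T' f) = Idt (VS D) f"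
  using assms unfolding T_def T'_def ch_def by (simp_all add: interchange vs_idt)

lemma cs_rules [simp]:
  assumes "a \<in> Sq D"
  shows "cs a \<in> Sq D" "tp D (cs a) = ch (tp D a)" "bt D (cs a) = ch (bt D a)" "lf D (cs a) = cv (lf D a)"
    "rt D (cs a) = cv (rt D a)"
  using assms by (simp_all add: cs_def cv_def)

text \<open>Horizontal composites are respected because \<open>T\<close> and \<open>T'\<close> are
  multiplicative, vertical ones because \<open>T\<close> after \<open>T'\<close> is an identity at
  the middle boundary.\<close>

lemma dfun_c: "dfun D D (\<lambda>b. P b True) ch cv cs"
proof (rule dfunI)
  fix a b assume ab: "a \<in> Sq D" "b \<in> Sq D" "rt D a = lf D b"
  then have "Cod (HC D) (tp D a) = Dom (HC D) (tp D b)" "Cod (HC D) (bt D a) = Dom (HC D) (bt D b)" by simp_all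
  then show "cs (Comp (HS D) b a) = Comp (HS D) (cs b) (cs a)"
    using ab by (simp add: cs_def T_comp interchange)
next
  fix a b assume ab: "a \<in> Sq D" "b \<in> Sq D" "bt D a = tp D b"
  have "Comp (VS D) (cs b) (cs a) = Comp (VS D) (Comp (VS D) (Comp (VS D) (T' (bt D b)) b) (T (tp D b)))
      (Comp (VS D) (T' (tp D b)) (Comp (VS D) a (T (tp D a))))"
    using ab by (simp add: cs_def vs_assoc)
  also have "\<dots> = Comp (VS D) (Comp (VS D) (T' (bt D b)) b) (Comp (VS D) a (T (tp D a)))"
    using ab by (intro VS_cancel) (simp_all add: T_inv)
  also have "\<dots> = cs (Comp (VS D) b a)" using ab by (simp add: cs_def vs_assoc)
  finally show "cs (Comp (VS D) b a) = Comp (VS D) (cs b) (cs a)" by simp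
next
  fix u assume "u \<in> Ver D"
  then show "cs (Idt (HS D) u) = Idt (HS D) (cv u)"
    by (simp add: cs_def cv_def T_idt hs_idt)
qed (simp_all add: dc ch_comp cv_comp, simp_all add: ch_def cv_def cs_def T_inv)

text \<open>As for \<open>cj_inv\<close>: a square is recovered from its conjugate by cells that
  depend on its top and bottom alone.\<close>

lemma cs_inv:
  assumes "a \<in> Sq D"
  shows "Comp (VS D) (T (bt D a)) (Comp (VS D) (cs a) (T' (tp D a))) = a"
proof -
  have 1: "Comp (VS D) (cs a) (T' (tp D a)) = Comp (VS D) (T' (bt D a)) a"
  proof -
    have "Comp (VS D) (cs a) (T' (tp D a)) =
        Comp (VS D) (Comp (VS D) (Comp (VS D) (T' (bt D a)) a) (T (tp D a))) (Comp (VS D) (T' (tp D a)) (Idt (VS D) (tp D a)))"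
      using assms by (simp add: cs_def vs_assoc)
    also have "\<dots> = Comp (VS D) (Comp (VS D) (T' (bt D a)) a) (Idt (VS D) (tp D a))"
      using assms by (intro VS_cancel) (simp_all add: T_inv)
    finally show ?thesis using assms by simp
  qed
  have "Comp (VS D) (T (bt D a)) (Comp (VS D) (T' (bt D a)) a) = Comp (VS D) (Comp (VS D) (T (bt D a)) (T' (bt D a))) a"
    using assms by (intro vs_assoc) simp_all
  then show ?thesis using assms unfolding 1 by (simp add: T_inv)
qed

end

text \<open>Applied to \<open>i\<close>, which carries the cells of \<open>A\<close> to those of
  \<open>B\<close>, and to \<open>p\<close> and \<open>p'\<close> with the trivial system
  \<open>conn_trivial\<close> on the target, where conjugation does nothing.\<close>

lemma conn_natural:
  assumes "conn D P h v k" "conn E P' h' v' k'" "dfun D E Fo Fh Fv Fs"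
    and "\<And>b w. b \<in> Ob D \<Longrightarrow> Fo (P b w) = P' (Fo b) w"
    and hh: "\<And>b w x. b \<in> Ob D \<Longrightarrow> Fh (h b w x) = h' (Fo b) w x"
    and vv: "\<And>b w x. b \<in> Ob D \<Longrightarrow> Fv (v b w x) = v' (Fo b) w x"
    and kk: "\<And>b w x y z. b \<in> Ob D \<Longrightarrow> Fs (k b w x y z) = k' (Fo b) w x y z"
  shows "f \<in> Hor D \<Longrightarrow> Fh (conn.ch D h f) = conn.ch E h' (Fh f)"
    "u \<in> Ver D \<Longrightarrow> Fv (conn.cv D v u) = conn.cv E v' (Fv u)"
    "f \<in> Hor D \<Longrightarrow> Fs (conn.T D k f) = conn.T E k' (Fh f)"
    "f \<in> Hor D \<Longrightarrow> Fs (conn.T' D k f) = conn.T' E k' (Fh f)"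
    "a \<in> Sq D \<Longrightarrow> Fs (conn.cs D k a) = conn.cs E k' (Fs a)"
proof -
  interpret D: conn D P h v k by fact
  interpret E: conn E P' h' v' k' by fact
  interpret F: dfun D E Fo Fh Fv Fs by fact
  show "f \<in> Hor D \<Longrightarrow> Fh (D.ch f) = E.ch (Fh f)"
    by (simp add: D.ch_def E.ch_def hh)
  show "u \<in> Ver D \<Longrightarrow> Fv (D.cv u) = E.cv (Fv u)"
    by (simp add: D.cv_def E.cv_def vv)
  show T: "f \<in> Hor D \<Longrightarrow> Fs (D.T f) = E.T (Fh f)" for f
    by (simp add: D.T_def E.T_def kk del: D.k_h D.k_v E.k_h E.k_v)
  show T': "f \<in> Hor D \<Longrightarrow> Fs (D.T' f) = E.T' (Fh f)" for f
    by (simp add: D.T'_def E.T'_def kk del: D.k_h D.k_v E.k_h E.k_v)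
  show "a \<in> Sq D \<Longrightarrow> Fs (D.cs a) = E.cs (Fs a)"
    by (simp add: D.cs_def E.cs_def T T')
qed

lemma conn_trivial:
  assumes "double_category D"
  shows "conn D (\<lambda>b w. b) (\<lambda>b w x. Idt (HC D) b) (\<lambda>b w x. Idt (VC D) b) (\<lambda>b w x y z. Idt (VS D) (Idt (HC D) b))"
proof -
  interpret dcat D by unfold_locales fact
  show ?thesis by unfold_locales (simp_all add: hs_idt_idt vs_idt[symmetric])
qed

lemma conn_trivial_simps:
  assumes "double_category D"
  shows "f \<in> Hor D \<Longrightarrow> conn.ch D (\<lambda>b w x. Idt (HC D) b) f = f"
    "u \<in> Ver D \<Longrightarrow> conn.cv D (\<lambda>b w x. Idt (VC D) b) u = u"
    "f \<in> Hor D \<Longrightarrow> conn.T D (\<lambda>b w x y z. Idt (VS D) (Idt (HC D) b)) f = Idt (VS D) f"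
    "f \<in> Hor D \<Longrightarrow> conn.T' D (\<lambda>b w x y z. Idt (VS D) (Idt (HC D) b)) f = Idt (VS D) f"
    "a \<in> Sq D \<Longrightarrow> conn.cs D (\<lambda>b w x y z. Idt (VS D) (Idt (HC D) b)) a = a"
proof -
  interpret dcat D by unfold_locales fact
  note c = conn_trivial[OF assms]
  have e: "x \<in> Ob D \<Longrightarrow> Idt (VS D) (Idt (HC D) x) = Idt (HS D) (Idt (VC D) x)" for x
    using hs_idt_idt by simp
  show "f \<in> Hor D \<Longrightarrow> conn.ch D (\<lambda>b w x. Idt (HC D) b) f = f"
    "u \<in> Ver D \<Longrightarrow> conn.cv D (\<lambda>b w x. Idt (VC D) b) u = u"
    by (simp_all add: conn.ch_def[OF c] conn.cv_def[OF c])
  show 1: "f \<in> Hor D \<Longrightarrow> conn.T D (\<lambda>b w x y z. Idt (VS D) (Idt (HC D) b)) f = Idt (VS D) f"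
    "f \<in> Hor D \<Longrightarrow> conn.T' D (\<lambda>b w x y z. Idt (VS D) (Idt (HC D) b)) f = Idt (VS D) f" for f
    by (simp_all add: conn.T_def[OF c] conn.T'_def[OF c] e)
  show "a \<in> Sq D \<Longrightarrow> conn.cs D (\<lambda>b w x y z. Idt (VS D) (Idt (HC D) b)) a = a"
    by (simp add: conn.cs_def[OF c] 1)
qed

section \<open>Pushouts of trivial fibrations that are faithful on morphisms\<close>

text \<open>\<open>l\<close> labels an object of \<open>B\<close> either by an object of
  \<open>A\<close> above it or as new. Objects of the first kind inherit their cells from
  \<open>A\<close>, the others get identities. The axioms of \<open>conn\<close> relate cells at one
  object only, so nothing has to be matched between different objects.\<close>

lemma conn_glue:
  assumes "conn A P h v k" "dfun A B Fo Fh Fv Fs"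
    and l: "\<And>b a. b \<in> Ob B \<Longrightarrow> l b = Inl a \<Longrightarrow> a \<in> Ob A \<and> Fo a = b"
  shows "conn B (\<lambda>b w. case l b of Inl a \<Rightarrow> Fo (P a w) | Inr (_ :: 'x) \<Rightarrow> b)
    (\<lambda>b w x. case l b of Inl a \<Rightarrow> Fh (h a w x) | Inr _ \<Rightarrow> Idt (HC B) b)
    (\<lambda>b w x. case l b of Inl a \<Rightarrow> Fv (v a w x) | Inr _ \<Rightarrow> Idt (VC B) b)
    (\<lambda>b w x y z. case l b of Inl a \<Rightarrow> Fs (k a w x y z) | Inr _ \<Rightarrow> Idt (VS B) (Idt (HC B) b))"
proof -
  interpret A: conn A P h v k by fact
  interpret F: dfun A B Fo Fh Fv Fs by fact
  note t = conn_trivial[OF F.E.dc, unfolded conn_def conn_axioms_def, THEN conjunct2]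
  have Fh_comp: "Comp (HC B) (Fh (h a x y)) (Fh (h a w x)) = Fh (h a w y)" if "a \<in> Ob A" for a w x y
    using F.h_rules(5)[of "h a w x" "h a x y"] that by simp
  have Fv_comp: "Comp (VC B) (Fv (v a x y)) (Fv (v a w x)) = Fv (v a w y)" if "a \<in> Ob A" for a w x y
    using F.v_rules(5)[of "v a w x" "v a x y"] that by simp
  have Fs_h: "Comp (HS B) (Fs (k a x x' z z')) (Fs (k a w x y z)) = Fs (k a w x' y z')" if "a \<in> Ob A" for a w x y z x' z'
    using F.s_rules(8)[of "k a w x y z" "k a x x' z z'"] that by simp
  have Fs_v: "Comp (VS B) (Fs (k a y z y' z')) (Fs (k a w x y z)) = Fs (k a w x y' z')" if "a \<in> Ob A" for a w x y z y' z'
    using F.s_rules(9)[of "k a w x y z" "k a y z y' z'"] that by simp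
  show ?thesis
    by unfold_locales
      (auto split: sum.split dest: l simp: Fh_comp Fv_comp Fs_h Fs_v F.E.hs_idt_idt F.E.vs_idt[symmetric])
qed

section \<open>Connecting cells in the fibres of a trivial fibration\<close>

context ctfib
begin

text \<open>The choice depends on \<open>onOb F a\<close> alone, so objects with equal image get the
  same representative.\<close>

definition sec :: "'a \<Rightarrow> 'a" where "sec a = (SOME z. z \<in> Ob (Src F) \<and> onOb F z = onOb F a)"

definition pt :: "'a \<Rightarrow> bool \<Rightarrow> 'a" where "pt a w = (if w then sec a else a)"

text \<open>\<open>hh\<close>, \<open>vv\<close> and \<open>kk\<close> are lifts of identities
  between objects of one fibre. Under \<open>ff1\<close> such lifts are unique, which is why
  arbitrary choices compose strictly.\<close>

definition hh :: "'a \<Rightarrow> 'a \<Rightarrow> 'a" where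
  "hh a b = (SOME g. g \<in> Hor (Src F) \<and> Dom (HC (Src F)) g = a \<and> Cod (HC (Src F)) g = b \<and>
     onHor F g = Idt (HC (Trg F)) (onOb F a))"

definition vv :: "'a \<Rightarrow> 'a \<Rightarrow> 'a" where
  "vv a b = (SOME g. g \<in> Ver (Src F) \<and> Dom (VC (Src F)) g = a \<and> Cod (VC (Src F)) g = b \<and>
     onVer F g = Idt (VC (Trg F)) (onOb F a))"

definition kk :: "'a \<Rightarrow> 'a \<Rightarrow> 'a \<Rightarrow> 'a \<Rightarrow> 'a" where
  "kk a b c d = (SOME s. s \<in> Sq (Src F) \<and> tp (Src F) s = hh a b \<and> bt (Src F) s = hh c d \<and>
     lf (Src F) s = vv a c \<and> rt (Src F) s = vv b d \<and> onSq F s = Idt (VS (Trg F)) (Idt (HC (Trg F)) (onOb F a)))"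

lemma sec: "a \<in> Ob (Src F) \<Longrightarrow> sec a \<in> Ob (Src F) \<and> onOb F (sec a) = onOb F a"
  unfolding sec_def by (rule someI[of _ a]) simp

lemma sec_cong: "onOb F a = onOb F b \<Longrightarrow> sec a = sec b"
  unfolding sec_def by simp

lemma pt_in: "a \<in> Ob (Src F) \<Longrightarrow> pt a w \<in> Ob (Src F)" and F_pt: "a \<in> Ob (Src F) \<Longrightarrow> onOb F (pt a w) = onOb F a"
  using sec by (simp_all add: pt_def)

lemma pt_False: "pt a False = a"
  by (simp add: pt_def)

lemma hh:
  assumes "a \<in> Ob (Src F)" "b \<in> Ob (Src F)" "onOb F a = onOb F b"
  shows "hh a b \<in> Hor (Src F) \<and> Dom (HC (Src F)) (hh a b) = a \<and> Cod (HC (Src F)) (hh a b) = b \<and>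
     onHor F (hh a b) = Idt (HC (Trg F)) (onOb F a)"
proof -
  obtain g where "g \<in> Hor (Src F)" "Dom (HC (Src F)) g = a" "Cod (HC (Src F)) g = b"
     "onHor F g = Idt (HC (Trg F)) (onOb F a)"
    by (rule hor_full[OF assms(1,2), of "Idt (HC (Trg F)) (onOb F a)"]) (use assms in simp_all)
  then have "\<exists>g. g \<in> Hor (Src F) \<and> Dom (HC (Src F)) g = a \<and> Cod (HC (Src F)) g = b \<and>
     onHor F g = Idt (HC (Trg F)) (onOb F a)" by (intro exI[of _ g] conjI)
  from someI_ex[OF this, folded hh_def] show ?thesis .
qed

lemma vv:
  assumes "a \<in> Ob (Src F)" "b \<in> Ob (Src F)" "onOb F a = onOb F b"
  shows "vv a b \<in> Ver (Src F) \<and> Dom (VC (Src F)) (vv a b) = a \<and> Cod (VC (Src F)) (vv a b) = b \<and>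
     onVer F (vv a b) = Idt (VC (Trg F)) (onOb F a)"
proof -
  obtain g where "g \<in> Ver (Src F)" "Dom (VC (Src F)) g = a" "Cod (VC (Src F)) g = b"
     "onVer F g = Idt (VC (Trg F)) (onOb F a)"
    by (rule ver_full[OF assms(1,2), of "Idt (VC (Trg F)) (onOb F a)"]) (use assms in simp_all)
  then have "\<exists>g. g \<in> Ver (Src F) \<and> Dom (VC (Src F)) g = a \<and> Cod (VC (Src F)) g = b \<and>
     onVer F g = Idt (VC (Trg F)) (onOb F a)" by (intro exI[of _ g] conjI)
  from someI_ex[OF this, folded vv_def] show ?thesis .
qed

lemma kk:
  assumes "a \<in> Ob (Src F)" "b \<in> Ob (Src F)" "c \<in> Ob (Src F)" "d \<in> Ob (Src F)"
    "onOb F b = onOb F a" "onOb F c = onOb F a" "onOb F d = onOb F a"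
  shows "kk a b c d \<in> Sq (Src F) \<and> tp (Src F) (kk a b c d) = hh a b \<and> bt (Src F) (kk a b c d) = hh c d \<and>
     lf (Src F) (kk a b c d) = vv a c \<and> rt (Src F) (kk a b c d) = vv b d \<and>
     onSq F (kk a b c d) = Idt (VS (Trg F)) (Idt (HC (Trg F)) (onOb F a))"
proof -
  note h = hh[of a b] hh[of c d] vv[of a c] vv[of b d]
  obtain s where "s \<in> Sq (Src F)" "tp (Src F) s = hh a b" "bt (Src F) s = hh c d" "lf (Src F) s = vv a c"
    "rt (Src F) s = vv b d" "onSq F s = Idt (VS (Trg F)) (Idt (HC (Trg F)) (onOb F a))"
    by (rule sq_full[of "hh a b" "hh c d" "vv a c" "vv b d" "Idt (VS (Trg F)) (Idt (HC (Trg F)) (onOb F a))"])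
      (use h assms in \<open>simp_all add: square_boundary_def\<close>)
  then have "\<exists>s. s \<in> Sq (Src F) \<and> tp (Src F) s = hh a b \<and> bt (Src F) s = hh c d \<and>
     lf (Src F) s = vv a c \<and> rt (Src F) s = vv b d \<and> onSq F s = Idt (VS (Trg F)) (Idt (HC (Trg F)) (onOb F a))"
    by (intro exI[of _ s] conjI)
  from someI_ex[OF this, folded kk_def] show ?thesis .
qed

text \<open>Faithfulness compares parallel morphisms only; morphisms with different endpoints in the
  same fibres may still be identified.\<close>

definition ff1 :: bool where
  "ff1 \<longleftrightarrow> (\<forall>f\<in>Hor (Src F). \<forall>g\<in>Hor (Src F). Dom (HC (Src F)) f = Dom (HC (Src F)) g \<longrightarrow>
      Cod (HC (Src F)) f = Cod (HC (Src F)) g \<longrightarrow> onHor F f = onHor F g \<longrightarrow> f = g) \<and>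
    (\<forall>f\<in>Ver (Src F). \<forall>g\<in>Ver (Src F). Dom (VC (Src F)) f = Dom (VC (Src F)) g \<longrightarrow>
      Cod (VC (Src F)) f = Cod (VC (Src F)) g \<longrightarrow> onVer F f = onVer F g \<longrightarrow> f = g)"

lemma ff1_h: "ff1 \<Longrightarrow> f \<in> Hor (Src F) \<Longrightarrow> g \<in> Hor (Src F) \<Longrightarrow> Dom (HC (Src F)) f = Dom (HC (Src F)) g \<Longrightarrow>
      Cod (HC (Src F)) f = Cod (HC (Src F)) g \<Longrightarrow> onHor F f = onHor F g \<Longrightarrow> f = g"
  and ff1_v: "ff1 \<Longrightarrow> f \<in> Ver (Src F) \<Longrightarrow> g \<in> Ver (Src F) \<Longrightarrow> Dom (VC (Src F)) f = Dom (VC (Src F)) g \<Longrightarrow>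
      Cod (VC (Src F)) f = Cod (VC (Src F)) g \<Longrightarrow> onVer F f = onVer F g \<Longrightarrow> f = g"
  unfolding ff1_def by simp_all

definition "ph a w x = hh (pt a w) (pt a x)"
definition "pv a w x = vv (pt a w) (pt a x)"
definition "pk a w x y z = kk (pt a w) (pt a x) (pt a y) (pt a z)"

lemma ph: "a \<in> Ob (Src F) \<Longrightarrow> ph a w x \<in> Hor (Src F)" "a \<in> Ob (Src F) \<Longrightarrow> Dom (HC (Src F)) (ph a w x) = pt a w"
    "a \<in> Ob (Src F) \<Longrightarrow> Cod (HC (Src F)) (ph a w x) = pt a x"
    "a \<in> Ob (Src F) \<Longrightarrow> onHor F (ph a w x) = Idt (HC (Trg F)) (onOb F a)"
  using hh[of "pt a w" "pt a x"] by (simp_all add: ph_def pt_in F_pt)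

lemma pv: "a \<in> Ob (Src F) \<Longrightarrow> pv a w x \<in> Ver (Src F)" "a \<in> Ob (Src F) \<Longrightarrow> Dom (VC (Src F)) (pv a w x) = pt a w"
    "a \<in> Ob (Src F) \<Longrightarrow> Cod (VC (Src F)) (pv a w x) = pt a x"
    "a \<in> Ob (Src F) \<Longrightarrow> onVer F (pv a w x) = Idt (VC (Trg F)) (onOb F a)"
  using vv[of "pt a w" "pt a x"] by (simp_all add: pv_def pt_in F_pt)

lemma pk:
  assumes "a \<in> Ob (Src F)"
  shows "pk a w x y z \<in> Sq (Src F)" "tp (Src F) (pk a w x y z) = ph a w x" "bt (Src F) (pk a w x y z) = ph a y z"
    "lf (Src F) (pk a w x y z) = pv a w y" "rt (Src F) (pk a w x y z) = pv a x z"
    "onSq F (pk a w x y z) = Idt (VS (Trg F)) (Idt (HC (Trg F)) (onOb F a))"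
  using kk[of "pt a w" "pt a x" "pt a y" "pt a z"] assms by (simp_all add: pk_def ph_def pv_def pt_in F_pt)

text \<open>Both sides of each law are lifts of the same identity between the same endpoints or with
  the same boundary, hence equal by faithfulness on morphisms and on squares.\<close>

lemma conn_fibres:
  assumes ff: ff1
  shows "conn (Src F) pt ph pv pk"
proof -
  have hc: "Comp (HC (Src F)) (ph b x y) (ph b w x) = ph b w y" and hr: "ph b w w = Idt (HC (Src F)) (pt b w)"
    and vc: "Comp (VC (Src F)) (pv b x y) (pv b w x) = pv b w y" and vr: "pv b w w = Idt (VC (Src F)) (pt b w)"
    if "b \<in> Ob (Src F)" for b w x y
    using that by (rule_tac ff1_h[OF ff] ff1_v[OF ff]; simp add: ph pv pt_in F_pt)+
  have ii: "Idt (HS (Trg F)) (Idt (VC (Trg F)) y) = Idt (VS (Trg F)) (Idt (HC (Trg F)) y)" if "y \<in> Ob (Trg F)" for y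
    using that by (rule E.hs_idt_idt)
  show ?thesis
  proof unfold_locales
    fix b assume b: "b \<in> Ob (Src F)"
    show "pk b w w y y = Idt (HS (Src F)) (pv b w y)" for w y
      by (rule sq_faithful) (use b in \<open>simp_all add: pk pv ph hr ii\<close>)
    show "pk b w x w x = Idt (VS (Src F)) (ph b w x)" for w x
      by (rule sq_faithful) (use b in \<open>simp_all add: pk pv ph vr\<close>)
    show "Comp (HS (Src F)) (pk b x x' z z') (pk b w x y z) = pk b w x' y z'" for w x y z x' z'
      by (rule sq_faithful) (use b in \<open>simp_all add: pk pv ph hc E.vs_idt[symmetric]\<close>)
    show "Comp (VS (Src F)) (pk b y z y' z') (pk b w x y z) = pk b w x y' z'" for w x y z y' z'
      by (rule sq_faithful) (use b in \<open>simp_all add: pk pv ph vc\<close>)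
  qed (simp_all only: pt_in pt_False ph pv pk hc hr vc vr)
qed

text \<open>\<open>F\<close> sends connecting cells to identities, so conjugation preserves images
  under \<open>F\<close>. It also moves endpoints to representatives that depend on their images
  only; conjugates of elements with equal image are thus parallel over the same image and
  coincide.\<close>

lemma fibres_kernel:
  assumes ff: ff1
  shows "f \<in> Hor (Src F) \<Longrightarrow> g \<in> Hor (Src F) \<Longrightarrow> onHor F f = onHor F g \<Longrightarrow>
      conn.ch (Src F) ph f = conn.ch (Src F) ph g"
    and "u \<in> Ver (Src F) \<Longrightarrow> t \<in> Ver (Src F) \<Longrightarrow> onVer F u = onVer F t \<Longrightarrow>
      conn.cv (Src F) pv u = conn.cv (Src F) pv t"
    and "a \<in> Sq (Src F) \<Longrightarrow> b \<in> Sq (Src F) \<Longrightarrow> onSq F a = onSq F b \<Longrightarrow>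
      conn.cs (Src F) pk a = conn.cs (Src F) pk b"
proof -
  interpret c: conn "Src F" pt ph pv pk by (rule conn_fibres[OF ff])
  have n: "f \<in> Hor (Src F) \<Longrightarrow> onHor F (c.ch f) = conn.ch (Trg F) (\<lambda>b w x. Idt (HC (Trg F)) b) (onHor F f)"
    "u \<in> Ver (Src F) \<Longrightarrow> onVer F (c.cv u) = conn.cv (Trg F) (\<lambda>b w x. Idt (VC (Trg F)) b) (onVer F u)"
    "a \<in> Sq (Src F) \<Longrightarrow> onSq F (c.cs a) = conn.cs (Trg F) (\<lambda>b w x y z. Idt (VS (Trg F)) (Idt (HC (Trg F)) b)) (onSq F a)"
    for f u a
    by (rule conn_natural[OF c.conn_axioms conn_trivial[OF E.dc] dfun_axioms]; simp only: F_pt ph pv pk)+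
  have n1: "onHor F (c.ch f) = onHor F f" if "f \<in> Hor (Src F)" for f
    using n(1)[OF that] conn_trivial_simps(1)[OF E.dc h_rules(1)[OF that]] by (rule trans)
  have n2: "onVer F (c.cv f) = onVer F f" if "f \<in> Ver (Src F)" for f
    using n(2)[OF that] conn_trivial_simps(2)[OF E.dc v_rules(1)[OF that]] by (rule trans)
  have n3: "onSq F (c.cs f) = onSq F f" if "f \<in> Sq (Src F)" for f
    using n(3)[OF that] conn_trivial_simps(5)[OF E.dc s_rules(1)[OF that]] by (rule trans)
  show H: "c.ch f = c.ch g" if f: "f \<in> Hor (Src F)" and g: "g \<in> Hor (Src F)" and e: "onHor F f = onHor F g" for f g
  proof -
    have "onOb F (Dom (HC (Src F)) f) = onOb F (Dom (HC (Src F)) g)" "onOb F (Cod (HC (Src F)) f) = onOb F (Cod (HC (Src F)) g)"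
      using f g e by (metis h_rules(2) h_rules(3))+
    then have "pt (Dom (HC (Src F)) f) True = pt (Dom (HC (Src F)) g) True"
      "pt (Cod (HC (Src F)) f) True = pt (Cod (HC (Src F)) g) True"
      by (simp_all add: pt_def sec_def)
    with f g e show ?thesis by - (rule ff1_h[OF ff]; simp add: n1)
  qed
  show V: "c.cv f = c.cv g" if f: "f \<in> Ver (Src F)" and g: "g \<in> Ver (Src F)" and e: "onVer F f = onVer F g" for f g
  proof -
    have "onOb F (Dom (VC (Src F)) f) = onOb F (Dom (VC (Src F)) g)" "onOb F (Cod (VC (Src F)) f) = onOb F (Cod (VC (Src F)) g)"
      using f g e by (metis v_rules(2) v_rules(3))+
    then have "pt (Dom (VC (Src F)) f) True = pt (Dom (VC (Src F)) g) True"
      "pt (Cod (VC (Src F)) f) True = pt (Cod (VC (Src F)) g) True"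
      by (simp_all add: pt_def sec_def)
    with f g e show ?thesis by - (rule ff1_v[OF ff]; simp add: n2)
  qed
  show "c.cs a = c.cs b" if a: "a \<in> Sq (Src F)" and b: "b \<in> Sq (Src F)" and e: "onSq F a = onSq F b"
  proof (rule sq_faithful)
    have "onHor F (tp (Src F) a) = onHor F (tp (Src F) b)" "onHor F (bt (Src F) a) = onHor F (bt (Src F) b)"
      "onVer F (lf (Src F) a) = onVer F (lf (Src F) b)" "onVer F (rt (Src F) a) = onVer F (rt (Src F) b)"
      using a b e by (metis s_rules(2-5))+
    then show "tp (Src F) (c.cs a) = tp (Src F) (c.cs b)" "bt (Src F) (c.cs a) = bt (Src F) (c.cs b)"
      "lf (Src F) (c.cs a) = lf (Src F) (c.cs b)" "rt (Src F) (c.cs a) = rt (Src F) (c.cs b)"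
      using a b by (simp_all add: H[of "tp (Src F) a" "tp (Src F) b"] H[of "bt (Src F) a" "bt (Src F) b"]
          V[of "lf (Src F) a" "lf (Src F) b"] V[of "rt (Src F) a" "rt (Src F) b"])
  qed (use a b e in \<open>simp_all add: n3\<close>)
qed

end

text \<open>Lift against the trivial fibration obtained by pulling back everything along
  \<open>Ob A + Ob B \<rightarrow> Ob B\<close>.\<close>

lemma (in univ) llp_ctf_label:
  assumes L: "llp_ctf (i :: 'a dblfun)"
  obtains l :: "'a \<Rightarrow> 'a + 'a" where "\<And>b. b \<in> Ob (Trg i) \<Longrightarrow> l b \<in> Inl ` Ob (Src i) \<union> Inr ` Ob (Trg i)"
    "\<And>b. b \<in> Ob (Trg i) \<Longrightarrow> case_sum (onOb i) id (l b) = b" "\<And>a. a \<in> Ob (Src i) \<Longrightarrow> l (onOb i a) = Inl a"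
proof -
  have i_in: "i \<in> DArr" using L by (simp add: llp_ctf_def)
  have smB: "small_dblcat (Trg i)" and smA: "small_dblcat (Src i)" using i_in by simp_all
  interpret A: dcat "Src i" by unfold_locales (rule small_dblcatD[OF smA])
  interpret B: dcat "Trg i" by unfold_locales (rule small_dblcatD[OF smB])
  interpret i: dfun "Src i" "Trg i" "onOb i" "onHor i" "onVer i" "onSq i" by (rule DArr_dfun[OF i_in])
  let ?A = "Src i" and ?B = "Trg i"
  define X where "X = (Inl ` Ob ?A \<union> Inr ` Ob ?B :: ('a + 'a) set)"
  define e where "e = case_sum (onOb i) (id :: 'a \<Rightarrow> 'a)"
  let ?H = "pbcat (HC ?B) X e" and ?V = "pbcat (VC ?B) X e"
  have e_in: "e x \<in> Ob ?B" if "x \<in> X" for x using that by (auto simp: X_def e_def)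
  have e_in': "e x \<in> Obj (VC ?B)" if "x \<in> X" for x using e_in[OF that] by simp
  have sm: "sml ty (Ob ?A)" "sml ty (Ob ?B)" "sml ty (Hor ?B)" "sml ty (Ver ?B)"
    using smA smB unfolding small_dblcat_def small_iff_sml by simp_all
  have smX: "sml ty X" unfolding X_def by (intro sml_Un sml_image sm)
  obtain q go gh gv where q: "pulled q ?H ?V e (\<lambda>t. fst (snd t)) (\<lambda>t. fst (snd t)) go gh gv" and Tq: "Trg q = ?B"
    by (rule pull_exists[OF smB category_pbcat[OF B.H.cat e_in] category_pbcat[OF B.V.cat e_in'] _
        is_functor_pbcat[OF B.H.cat e_in] is_functor_pbcat[OF B.V.cat e_in'] _
        sml_pbcat[OF smX sm(3)] sml_pbcat[OF smX sm(4)]])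
      (assumption | simp add: smX)+
  interpret q: pulled q ?H ?V e "\<lambda>t. fst (snd t)" "\<lambda>t. fst (snd t)" go gh gv by (rule q)
  have q_ctf: "ctf q"
  proof (rule q.ctf)
    fix y assume "y \<in> Ob (Trg q)"
    then show "\<exists>x\<in>Obj ?H. e x = y"
      using Tq by (intro bexI[of _ "Inr y"]) (auto simp: e_def X_def)
  next
    fix x y f
    assume "x \<in> Obj ?H" "y \<in> Obj ?H" "f \<in> Hor (Trg q)" "Dom (HC (Trg q)) f = e x" "Cod (HC (Trg q)) f = e y"
    then show "\<exists>g\<in>Arr ?H. Dom ?H g = x \<and> Cod ?H g = y \<and> fst (snd g) = f"
      using Tq by (intro bexI[of _ "(x, f, y)"]) simp_all
  next
    fix x y f
    assume "x \<in> Obj ?H" "y \<in> Obj ?H" "f \<in> Ver (Trg q)" "Dom (VC (Trg q)) f = e x" "Cod (VC (Trg q)) f = e y"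
    then show "\<exists>g\<in>Arr ?V. Dom ?V g = x \<and> Cod ?V g = y \<and> fst (snd g) = f"
      using Tq by (intro bexI[of _ "(x, f, y)"]) simp_all
  qed
  have f1: "is_functor (HC ?A) ?H Inl (\<lambda>f. (Inl (Dom (HC ?A) f), onHor i f, Inl (Cod (HC ?A) f)))"
    by (rule is_functor_into_pbcat[OF i.fh A.H.cat]) (simp_all add: X_def e_def)
  have f2: "is_functor (VC ?A) ?V Inl (\<lambda>f. (Inl (Dom (VC ?A) f), onVer i f, Inl (Cod (VC ?A) f)))"
    by (rule is_functor_into_pbcat[OF i.fv A.V.cat]) (simp_all add: X_def e_def)
  obtain u where u: "u \<in> DArr" "Src u = Src i" "Trg u = Src q" "dblfun_comp q u = i"
    "\<forall>x\<in>Ob ?A. go (onOb u x) = Inl x"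
    by (rule q.lift[OF i_in Tq[symmetric] f1 f2]) (auto simp: e_def)
  obtain l where l: "l \<in> DArr" "Src l = ?B" "Trg l = Src q" "dblfun_comp l i = u" "dblfun_comp q l = dblfun_id ?B"
    using llp_ctf_lift[OF L q.F_in q_ctf u(1), of "dblfun_id ?B"] u(2-4) i_in Tq smB by auto
  interpret l: dfun ?B "Src q" "onOb l" "onHor l" "onVer l" "onSq l"
    using DArr_dfun[OF l(1)] l by simp
  show thesis
  \<comment> \<open>Decoding the section \<open>l\<close> on objects gives the labels; the label
    \<open>Inl a\<close> at \<open>onOb i a\<close> shows that \<open>i\<close> is injective on
    objects.\<close>
  proof (rule that[of "\<lambda>b. go (onOb l b)"])
    fix b assume b: "b \<in> Ob (Trg i)"
    show "go (onOb l b) \<in> Inl ` Ob (Src i) \<union> Inr ` Ob (Trg i)"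
      using q.go_in[of "onOb l b"] b unfolding X_def by simp
    show "case_sum (onOb i) id (go (onOb l b)) = b"
      using arg_cong[OF l(5), of "\<lambda>M. onOb M b"] b l(2) by (simp add: q.qo e_def)
  next
    fix a assume a: "a \<in> Ob (Src i)"
    then show "go (onOb l (onOb i a)) = Inl a"
      using arg_cong[OF l(4), of "\<lambda>M. onOb M a"] u(5) by simp
  qed
qed

text \<open>Conjugation \<open>phi\<close> on \<open>B\<close> satisfies \<open>p' phi = p'\<close>,
  and \<open>phi i\<close> factors through \<open>p\<close>. The pushout therefore maps back to
  \<open>B\<close> by \<open>ps\<close> with \<open>ps p' = phi\<close> and
  \<open>p' ps = id\<close>. Lifts along \<open>p'\<close> are obtained by applying
  \<open>ps\<close> and correcting the boundary by connecting cells.\<close>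

lemma (in univ) pushout_type3:
  fixes p i i' p' :: "'a dblfun"
  assumes po: "pushout_square DblCat p i i' p'" and p_ctf: "ctf p" and ff: "ctfib.ff1 p"
    and L: "llp_ctf i"
  shows "ctf p'"
proof -
  note d = pushout_squareD[OF po]
  interpret p: ctfib p using d(1) p_ctf by unfold_locales
  note ff = ff[unfolded p.ff1_def, folded p.ff1_def]
  interpret B: dcat "Src p'"
    using d(4) by unfold_locales (simp add: small_dblcatD)
  interpret i: dfun "Src p" "Src p'" "onOb i" "onHor i" "onVer i" "onSq i"
    using DArr_dfun[OF d(2)] d by simp
  interpret p': dfun "Src p'" "Trg p'" "onOb p'" "onHor p'" "onVer p'" "onSq p'"
    using DArr_dfun[OF d(4)] .
  interpret i': dfun "Trg p" "Trg p'" "onOb i'" "onHor i'" "onVer i'" "onSq i'"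
    using DArr_dfun[OF d(3)] d by simp
  have smB: "small_dblcat (Src p')" using d by simp
  have comm: "x \<in> Ob (Src p) \<Longrightarrow> onOb p' (onOb i x) = onOb i' (onOb p x)"
    "f \<in> Hor (Src p) \<Longrightarrow> onHor p' (onHor i f) = onHor i' (onHor p f)"
    "u \<in> Ver (Src p) \<Longrightarrow> onVer p' (onVer i u) = onVer i' (onVer p u)"
    "a \<in> Sq (Src p) \<Longrightarrow> onSq p' (onSq i a) = onSq i' (onSq p a)" for x f u a
    using arg_cong[OF d(9), of "\<lambda>M. onOb M x"] arg_cong[OF d(9), of "\<lambda>M. onHor M f"]
      arg_cong[OF d(9), of "\<lambda>M. onVer M u"] arg_cong[OF d(9), of "\<lambda>M. onSq M a"] d(5) by simp_all
  let ?A = "Src p" and ?B = "Src p'"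
  obtain l where l: "\<And>b. b \<in> Ob (Trg i) \<Longrightarrow> l b \<in> Inl ` Ob (Src i) \<union> Inr ` Ob (Trg i)"
    "\<And>b. b \<in> Ob (Trg i) \<Longrightarrow> case_sum (onOb i) id (l b) = b" "\<And>a. a \<in> Ob (Src i) \<Longrightarrow> l (onOb i a) = Inl a"
    using llp_ctf_label[OF L] by metis
  have lA: "a \<in> Ob ?A \<and> onOb i a = b" if "b \<in> Ob ?B" "l b = Inl a" for a b
    using l(1)[of b] l(2)[of b] that d by auto
  have li: "l (onOb i a) = Inl a" if "a \<in> Ob ?A" for a using l(3) that d by simp
  define P where "P = (\<lambda>b w. case l b of Inl a \<Rightarrow> onOb i (p.pt a w) | Inr (_ :: 'a) \<Rightarrow> b)"
  define h where "h = (\<lambda>b w x. case l b of Inl a \<Rightarrow> onHor i (p.ph a w x) | Inr (_ :: 'a) \<Rightarrow> Idt (HC ?B) b)"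
  define v where "v = (\<lambda>b w x. case l b of Inl a \<Rightarrow> onVer i (p.pv a w x) | Inr (_ :: 'a) \<Rightarrow> Idt (VC ?B) b)"
  define k where "k = (\<lambda>b w x y z. case l b of Inl a \<Rightarrow> onSq i (p.pk a w x y z) | Inr (_ :: 'a) \<Rightarrow> Idt (VS ?B) (Idt (HC ?B) b))"
  note cA = p.conn_fibres[OF ff]
  have cB: "conn ?B P h v k"
    unfolding P_def h_def v_def k_def by (rule conn_glue[OF cA i.dfun_axioms lA])
  interpret B: conn ?B P h v k by (rule cB)
  \<comment> \<open>The label of \<open>onOb i a\<close> is \<open>Inl a\<close>, so
    \<open>i\<close> carries the cells at \<open>a\<close> exactly to the cells at its
    image.\<close>
  have nA: "f \<in> Hor ?A \<Longrightarrow> onHor i (conn.ch ?A p.ph f) = B.ch (onHor i f)"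
    "u \<in> Ver ?A \<Longrightarrow> onVer i (conn.cv ?A p.pv u) = B.cv (onVer i u)"
    "a \<in> Sq ?A \<Longrightarrow> onSq i (conn.cs ?A p.pk a) = B.cs (onSq i a)" for f u a
    by (rule conn_natural[OF cA cB i.dfun_axioms]; simp add: P_def h_def v_def k_def li)+
  \<comment> \<open>Cells from \<open>A\<close> become identities under \<open>p\<close>, hence
    under \<open>i' p = p' i\<close>; the remaining cells are identities already in
    \<open>B\<close>.\<close>
  have p'_h: "onHor p' (h b w x) = Idt (HC (Trg p')) (onOb p' b)"
    and p'_v: "onVer p' (v b w x) = Idt (VC (Trg p')) (onOb p' b)"
    and p'_P: "onOb p' (P b w) = onOb p' b"
    and p'_k: "onSq p' (k b w x y z) = Idt (VS (Trg p')) (Idt (HC (Trg p')) (onOb p' b))" if "b \<in> Ob ?B" for b w x y z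
    using that lA[OF that] unfolding h_def v_def P_def k_def
    by (auto split: sum.split simp: comm p.pt_in p.F_pt p.ph p.pv p.pk)
  have B': "double_category (Trg p')" using d(4) by (simp add: small_dblcatD)
  let ?h = "\<lambda>b w x. Idt (HC (Trg p')) b" and ?v = "\<lambda>b w x. Idt (VC (Trg p')) b"
    and ?k = "\<lambda>b w x y z. Idt (VS (Trg p')) (Idt (HC (Trg p')) b)"
  have nB: "f \<in> Hor ?B \<Longrightarrow> onHor p' (B.ch f) = conn.ch (Trg p') ?h (onHor p' f)"
    "u \<in> Ver ?B \<Longrightarrow> onVer p' (B.cv u) = conn.cv (Trg p') ?v (onVer p' u)"
    "f \<in> Hor ?B \<Longrightarrow> onSq p' (B.T f) = conn.T (Trg p') ?k (onHor p' f)"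
    "f \<in> Hor ?B \<Longrightarrow> onSq p' (B.T' f) = conn.T' (Trg p') ?k (onHor p' f)"
    "a \<in> Sq ?B \<Longrightarrow> onSq p' (B.cs a) = conn.cs (Trg p') ?k (onSq p' a)" for f u a
    by (rule conn_natural[OF cB conn_trivial[OF B'] p'.dfun_axioms]; simp only: p'_P p'_h p'_v p'_k)+
  have p'_ch: "onHor p' (B.ch f) = onHor p' f" and p'_T: "onSq p' (B.T f) = Idt (VS (Trg p')) (onHor p' f)"
    and p'_T': "onSq p' (B.T' f) = Idt (VS (Trg p')) (onHor p' f)" if "f \<in> Hor ?B" for f
    using nB(1,3,4)[OF that] conn_trivial_simps(1,3,4)[OF B' p'.h_rules(1)[OF that]] by simp_all
  have p'_cv: "onVer p' (B.cv f) = onVer p' f" if "f \<in> Ver ?B" for f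
    using nB(2)[OF that] conn_trivial_simps(2)[OF B' p'.v_rules(1)[OF that]] by (rule trans)
  have p'_cs: "onSq p' (B.cs f) = onSq p' f" if "f \<in> Sq ?B" for f
    using nB(5)[OF that] conn_trivial_simps(5)[OF B' p'.s_rules(1)[OF that]] by (rule trans)
  define phi where "phi = mk ?B ?B (\<lambda>b. P b True) B.ch B.cv B.cs"
  have phi: "phi \<in> DArr" "Src phi = ?B" "Trg phi = ?B" unfolding phi_def by (simp_all add: mk_DArr B.dfun_c smB)
  have phi_s [simp]: "b \<in> Ob ?B \<Longrightarrow> onOb phi b = P b True" "f \<in> Hor ?B \<Longrightarrow> onHor phi f = B.ch f"
    "u \<in> Ver ?B \<Longrightarrow> onVer phi u = B.cv u" "a \<in> Sq ?B \<Longrightarrow> onSq phi a = B.cs a" for b f u a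
    unfolding phi_def by simp_all
  have p'phi: "dblfun_comp p' phi = p'"
    by (rule DArr_eqI) (use phi d(4) in \<open>simp_all add: p'_ch p'_cv p'_cs p'_P\<close>)
  have ker: "ker_le p (dblfun_comp phi i)"
    unfolding ker_le_def
  proof (intro conjI ballI impI)
    fix x y assume "x \<in> Ob ?A" "y \<in> Ob ?A" "onOb p x = onOb p y"
    then show "onOb (dblfun_comp phi i) x = onOb (dblfun_comp phi i) y"
      using d(5) p.sec_cong[of x y] by (simp add: P_def li p.pt_def)
  next
    fix x y assume "x \<in> Hor ?A" "y \<in> Hor ?A" "onHor p x = onHor p y"
    then show "onHor (dblfun_comp phi i) x = onHor (dblfun_comp phi i) y"
      using d(5) p.fibres_kernel(1)[OF ff, of x y] by (simp add: nA(1)[symmetric])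
  next
    fix x y assume "x \<in> Ver ?A" "y \<in> Ver ?A" "onVer p x = onVer p y"
    then show "onVer (dblfun_comp phi i) x = onVer (dblfun_comp phi i) y"
      using d(5) p.fibres_kernel(2)[OF ff, of x y] by (simp add: nA(2)[symmetric])
  next
    fix x y assume "x \<in> Sq ?A" "y \<in> Sq ?A" "onSq p x = onSq p y"
    then show "onSq (dblfun_comp phi i) x = onSq (dblfun_comp phi i) y"
      using d(5) p.fibres_kernel(3)[OF ff, of x y] by (simp add: nA(3)[symmetric])
  qed
  \<comment> \<open>\<open>ka\<close> and \<open>phi\<close> form a cocone, whose comparison map is
    \<open>ps\<close>. That \<open>p' ps\<close> is the identity is tested on both legs, using that
    \<open>p\<close> is an epimorphism.\<close>
  obtain ka where ka: "ka \<in> DArr" "Src ka = Trg p" "Trg ka = ?B" "dblfun_comp ka p = dblfun_comp phi i"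
    using p.factor_ker[of "dblfun_comp phi i"] ker phi d by auto
  obtain ps where ps: "ps \<in> DArr" "Src ps = Trg i'" "Trg ps = ?B" "dblfun_comp ps i' = ka" "dblfun_comp ps p' = phi"
    using pushout_square_ex[OF po, of ka phi] ka phi d by auto
  interpret ps: dfun "Trg p'" ?B "onOb ps" "onHor ps" "onVer ps" "onSq ps"
    using DArr_dfun[OF ps(1)] ps(2,3) d(8) by simp
  have "dblfun_comp (dblfun_comp p' ka) p = dblfun_comp (dblfun_comp p' phi) i"
    using comp_assoc[of p ka p'] comp_assoc[of i phi p'] ka d phi by simp
  also have "\<dots> = dblfun_comp i' p" using p'phi d(9) by simp
  finally have p'ka: "dblfun_comp p' ka = i'"
    by (rule p.epi[rotated -1]) (use ka d in simp_all)
  have "dblfun_comp (dblfun_comp p' ps) i' = i'" "dblfun_comp (dblfun_comp p' ps) p' = p'"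
    using comp_assoc[of i' ps p'] comp_assoc[of p' ps p'] ps d p'ka p'phi by simp_all
  then have p'ps: "dblfun_comp p' ps = dblfun_id (Trg i')"
    using pushout_square_uniq[OF po, of "dblfun_comp p' ps" "dblfun_id (Trg i')"] ps d by simp
  have s [simp]: "x \<in> Ob (Trg p') \<Longrightarrow> onOb p' (onOb ps x) = x" "f \<in> Hor (Trg p') \<Longrightarrow> onHor p' (onHor ps f) = f"
    "u \<in> Ver (Trg p') \<Longrightarrow> onVer p' (onVer ps u) = u" "a \<in> Sq (Trg p') \<Longrightarrow> onSq p' (onSq ps a) = a" for x f u a
    using arg_cong[OF p'ps, of "\<lambda>M. onOb M x"] arg_cong[OF p'ps, of "\<lambda>M. onHor M f"]
      arg_cong[OF p'ps, of "\<lambda>M. onVer M u"] arg_cong[OF p'ps, of "\<lambda>M. onSq M a"] ps(2) d(8) by simp_all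
  have r: "x \<in> Ob ?B \<Longrightarrow> onOb ps (onOb p' x) = P x True" "f \<in> Hor ?B \<Longrightarrow> onHor ps (onHor p' f) = B.ch f"
    "u \<in> Ver ?B \<Longrightarrow> onVer ps (onVer p' u) = B.cv u" "a \<in> Sq ?B \<Longrightarrow> onSq ps (onSq p' a) = B.cs a" for x f u a
    using arg_cong[OF ps(5), of "\<lambda>M. onOb M x"] arg_cong[OF ps(5), of "\<lambda>M. onHor M f"]
      arg_cong[OF ps(5), of "\<lambda>M. onVer M u"] arg_cong[OF ps(5), of "\<lambda>M. onSq M a"] by simp_all
  show ?thesis
  proof (rule ctfI[OF d(4)])
    show "\<exists>x\<in>Ob ?B. onOb p' x = y" if "y \<in> Ob (Trg p')" for y
      by (rule bexI[of _ "onOb ps y"]) (use that in simp_all)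
  next
    fix x y f assume x: "x \<in> Ob ?B" "y \<in> Ob ?B" and f: "f \<in> Hor (Trg p')" "Dom (HC (Trg p')) f = onOb p' x"
      "Cod (HC (Trg p')) f = onOb p' y"
    \<comment> \<open>\<open>onHor ps f\<close> runs between the representatives of \<open>x\<close>
      and \<open>y\<close>; the connecting arrows lead to the prescribed endpoints and disappear
      under \<open>p'\<close>.\<close>
    let ?g = "Comp (HC ?B) (h y True False) (Comp (HC ?B) (onHor ps f) (h x False True))"
    have "onHor p' ?g = f" using x f by (simp add: r p'_h p'_P)
    moreover have "?g \<in> Hor ?B" "Dom (HC ?B) ?g = x" "Cod (HC ?B) ?g = y" using x f by (simp_all add: r)
    ultimately show "\<exists>g\<in>Hor ?B. Dom (HC ?B) g = x \<and> Cod (HC ?B) g = y \<and> onHor p' g = f" by blast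
  next
    fix x y f assume x: "x \<in> Ob ?B" "y \<in> Ob ?B" and f: "f \<in> Ver (Trg p')" "Dom (VC (Trg p')) f = onOb p' x"
      "Cod (VC (Trg p')) f = onOb p' y"
    let ?g = "Comp (VC ?B) (v y True False) (Comp (VC ?B) (onVer ps f) (v x False True))"
    have "onVer p' ?g = f" using x f by (simp add: r p'_v p'_P)
    moreover have "?g \<in> Ver ?B" "Dom (VC ?B) ?g = x" "Cod (VC ?B) ?g = y" using x f by (simp_all add: r)
    ultimately show "\<exists>g\<in>Ver ?B. Dom (VC ?B) g = x \<and> Cod (VC ?B) g = y \<and> onVer p' g = f" by blast
  next
    show "sq_ff p'"
    proof (rule sq_ffI[OF d(4)])
      fix f g u w b assume "square_boundary ?B f g u w" "b \<in> squares (Trg p') (onHor p' f) (onHor p' g) (onVer p' u) (onVer p' w)"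
      then have b: "f \<in> Hor ?B" "g \<in> Hor ?B" "u \<in> Ver ?B" "w \<in> Ver ?B" "Dom (HC ?B) f = Dom (VC ?B) u"
        "Cod (HC ?B) f = Dom (VC ?B) w" "Dom (HC ?B) g = Cod (VC ?B) u" "Cod (HC ?B) g = Cod (VC ?B) w"
        "b \<in> Sq (Trg p')" "tp (Trg p') b = onHor p' f" "bt (Trg p') b = onHor p' g"
        "lf (Trg p') b = onVer p' u" "rt (Trg p') b = onVer p' w"
        by (simp_all add: square_boundary_def squares_def)
      \<comment> \<open>Undoing the conjugation of a vertical morphism, so that the square
        \<open>?a\<close> below has exactly the sides \<open>u\<close> and \<open>w\<close>.\<close>
      have c: "Comp (VC ?B) (v (Cod (VC ?B) t) True False) (Comp (VC ?B) (B.cv t) (v (Dom (VC ?B) t) False True)) = t"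
        if "t \<in> Ver ?B" for t
      proof -
        have "Comp (VC ?B) (B.cv t) (v (Dom (VC ?B) t) False True) = Comp (VC ?B) (v (Cod (VC ?B) t) False True) t"
          using B.V_cancel[of "v (Dom (VC ?B) t) False True" "Comp (VC ?B) (v (Cod (VC ?B) t) False True) t"
              "Idt (VC ?B) (P (Dom (VC ?B) t) True)" "v (Dom (VC ?B) t) True False"]
          using that unfolding B.cv_def by (simp add: B.V.assoc[symmetric])
        then show ?thesis using that by (simp add: B.V.assoc)
      qed
      let ?a = "Comp (VS ?B) (B.T g) (Comp (VS ?B) (onSq ps b) (B.T' f))"
      have "?a \<in> squares ?B f g u w" using b c[of u] c[of w] by (simp add: squares_def r)
      moreover have "onSq p' ?a = b" using b by (simp add: r p'_T p'_T' p'_ch)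
      ultimately show "\<exists>a\<in>squares ?B f g u w. onSq p' a = b" by blast
    next
      fix a b assume a: "a \<in> Sq ?B" "b \<in> Sq ?B" "tp ?B a = tp ?B b" "bt ?B a = bt ?B b" "onSq p' a = onSq p' b"
      \<comment> \<open>Both conjugates are \<open>onSq ps\<close> of the common image under
        \<open>p'\<close>; with equal top and bottom, \<open>cs_inv\<close> recovers the
        squares.\<close>
      have "B.cs a = B.cs b" using r(4)[OF a(1)] r(4)[OF a(2)] unfolding a(5) by (rule trans[OF sym])
      with B.cs_inv[OF a(1)] B.cs_inv[OF a(2)] show "a = b" unfolding a(3,4) by metis
    qed
  qed
qed

section \<open>Existence of pushouts\<close>

lemma restrict_eq_iff: "restrict f I = restrict g I \<longleftrightarrow> (\<forall>j\<in>I. f j = g j)"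
  by (metis restrict_apply' restrict_ext)

lemma restrict_eq_iff2: "g \<in> extensional I \<Longrightarrow> restrict f I = g \<longleftrightarrow> (\<forall>j\<in>I. f j = g j)"
  by (metis extensional_restrict restrict_eq_iff)

section \<open>Products of double categories and generated sub-double categories\<close>

definition pcat :: "'j set \<Rightarrow> ('j \<Rightarrow> ('o, 'm) cat) \<Rightarrow> ('j \<Rightarrow> 'o, 'j \<Rightarrow> 'm) cat" where
  "pcat I C = \<lparr>Obj = (\<Pi>\<^sub>E j\<in>I. Obj (C j)), Arr = (\<Pi>\<^sub>E j\<in>I. Arr (C j)),
     Dom = (\<lambda>x. \<lambda>j\<in>I. Dom (C j) (x j)), Cod = (\<lambda>x. \<lambda>j\<in>I. Cod (C j) (x j)),
     Idt = (\<lambda>x. \<lambda>j\<in>I. Idt (C j) (x j)), Comp = (\<lambda>g f. \<lambda>j\<in>I. Comp (C j) (g j) (f j))\<rparr>"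

lemma pcat_simps [simp]:
  "Obj (pcat I C) = (\<Pi>\<^sub>E j\<in>I. Obj (C j))" "Arr (pcat I C) = (\<Pi>\<^sub>E j\<in>I. Arr (C j))"
  "Dom (pcat I C) x = (\<lambda>j\<in>I. Dom (C j) (x j))" "Cod (pcat I C) x = (\<lambda>j\<in>I. Cod (C j) (x j))"
  "Idt (pcat I C) y = (\<lambda>j\<in>I. Idt (C j) (y j))" "Comp (pcat I C) g f = (\<lambda>j\<in>I. Comp (C j) (g j) (f j))"
  by (simp_all add: pcat_def)

lemma category_pcat:
  assumes "\<And>j. j \<in> I \<Longrightarrow> category (C j)" shows "category (pcat I C)"
proof -
  have c: "cate (C j)" if "j \<in> I" for j using assms[OF that] by unfold_locales
  show ?thesis
    by (rule categoryI)
      (auto simp: restrict_eq_iff restrict_eq_iff2 PiE_iff cate.dom_in[OF c] cate.cod_in[OF c] cate.idt_in[OF c]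
        cate.dom_idt[OF c] cate.cod_idt[OF c] cate.comp_in[OF c] cate.dom_comp[OF c] cate.cod_comp[OF c]
        cate.comp_idt[OF c] cate.idt_comp[OF c] cate.assoc[OF c])
qed

definition pdbl :: "'j set \<Rightarrow> ('j \<Rightarrow> 'a dblcat) \<Rightarrow> ('j \<Rightarrow> 'a) dblcat" where
  "pdbl I X = \<lparr>HC = pcat I (\<lambda>j. HC (X j)), VC = pcat I (\<lambda>j. VC (X j)), HS = pcat I (\<lambda>j. HS (X j)),
     VS = pcat I (\<lambda>j. VS (X j))\<rparr>"

lemma pdbl_simps [simp]:
  "HC (pdbl I X) = pcat I (\<lambda>j. HC (X j))" "VC (pdbl I X) = pcat I (\<lambda>j. VC (X j))"
  "HS (pdbl I X) = pcat I (\<lambda>j. HS (X j))" "VS (pdbl I X) = pcat I (\<lambda>j. VS (X j))"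
  by (simp_all add: pdbl_def)

lemma dc_pdbl:
  assumes "\<And>j. j \<in> I \<Longrightarrow> double_category (X j)" shows "double_category (pdbl I X)"
proof -
  have d: "dcat (X j)" if "j \<in> I" for j using assms[OF that] by unfold_locales
  have c: "category (HC (X j))" "category (VC (X j))" "category (HS (X j))" "category (VS (X j))" if "j \<in> I" for j
    using assms[OF that] by (simp_all add: double_category_def)
  note r = dcat.corner_rules[OF d] dcat.idt_rules[OF d] dcat.comp_rules[OF d] dcat.hcomp_rules[OF d]
    dcat.hs_idt[OF d] dcat.hs_idt_idt[OF d] dcat.vs_idt[OF d]
  show ?thesis
  proof (rule double_categoryI)
    show "category (HC (pdbl I X))" "category (VC (pdbl I X))" "category (HS (pdbl I X))" "category (VS (pdbl I X))"
      using category_pcat c by (metis pdbl_simps)+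
    show "Obj (VC (pdbl I X)) = Ob (pdbl I X)" "Obj (HS (pdbl I X)) = Ver (pdbl I X)"
      "Obj (VS (pdbl I X)) = Hor (pdbl I X)" "Arr (VS (pdbl I X)) = Sq (pdbl I X)"
      by (auto intro!: PiE_cong simp: dcat.carriers[OF d])
    fix a b c d assume "a \<in> Sq (pdbl I X)" "b \<in> Sq (pdbl I X)" "c \<in> Sq (pdbl I X)" "d \<in> Sq (pdbl I X)"
      "rt (pdbl I X) a = lf (pdbl I X) b" "rt (pdbl I X) c = lf (pdbl I X) d"
      "bt (pdbl I X) a = tp (pdbl I X) c" "bt (pdbl I X) b = tp (pdbl I X) d"
    then show "Comp (VS (pdbl I X)) (Comp (HS (pdbl I X)) d c) (Comp (HS (pdbl I X)) b a) =
        Comp (HS (pdbl I X)) (Comp (VS (pdbl I X)) d b) (Comp (VS (pdbl I X)) c a)"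
      by (auto simp: restrict_eq_iff PiE_iff intro!: dcat.interchange[OF \<open>\<And>j. j \<in> I \<Longrightarrow> dcat (X j)\<close>])
  qed (auto simp: restrict_eq_iff PiE_iff r)
qed

lemma dfun_proj:
  assumes "\<And>j. j \<in> I \<Longrightarrow> double_category (X j)" "i \<in> I"
  shows "dfun (pdbl I X) (X i) (\<lambda>x. x i) (\<lambda>x. x i) (\<lambda>x. x i) (\<lambda>x. x i)"
  by (rule dfunI) (use assms in \<open>simp_all add: dc_pdbl PiE_iff\<close>)

definition subdbl :: "'b dblcat \<Rightarrow> 'b set \<Rightarrow> 'b set \<Rightarrow> 'b set \<Rightarrow> 'b set \<Rightarrow> 'b dblcat" where
  "subdbl D O' H V S = \<lparr>HC = (HC D)\<lparr>Obj := O', Arr := H\<rparr>, VC = (VC D)\<lparr>Obj := O', Arr := V\<rparr>,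
    HS = (HS D)\<lparr>Obj := V, Arr := S\<rparr>, VS = (VS D)\<lparr>Obj := H, Arr := S\<rparr>\<rparr>"

lemma subdbl_simps [simp]:
  "Ob (subdbl D O' H V S) = O'" "Hor (subdbl D O' H V S) = H" "Ver (subdbl D O' H V S) = V" "Sq (subdbl D O' H V S) = S"
  "Obj (VC (subdbl D O' H V S)) = O'" "Obj (HS (subdbl D O' H V S)) = V" "Obj (VS (subdbl D O' H V S)) = H"
  "Arr (VS (subdbl D O' H V S)) = S"
  "Dom (HC (subdbl D O' H V S)) = Dom (HC D)" "Cod (HC (subdbl D O' H V S)) = Cod (HC D)"
  "Idt (HC (subdbl D O' H V S)) = Idt (HC D)" "Comp (HC (subdbl D O' H V S)) = Comp (HC D)"
  "Dom (VC (subdbl D O' H V S)) = Dom (VC D)" "Cod (VC (subdbl D O' H V S)) = Cod (VC D)"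
  "Idt (VC (subdbl D O' H V S)) = Idt (VC D)" "Comp (VC (subdbl D O' H V S)) = Comp (VC D)"
  "lf (subdbl D O' H V S) = lf D" "rt (subdbl D O' H V S) = rt D"
  "Idt (HS (subdbl D O' H V S)) = Idt (HS D)" "Comp (HS (subdbl D O' H V S)) = Comp (HS D)"
  "tp (subdbl D O' H V S) = tp D" "bt (subdbl D O' H V S) = bt D"
  "Idt (VS (subdbl D O' H V S)) = Idt (VS D)" "Comp (VS (subdbl D O' H V S)) = Comp (VS D)"
  by (simp_all add: subdbl_def)

text \<open>Closure under two partial operations selected by the boolean, with \<open>P\<close> as
  composability: squares have to be closed under both compositions at once. For morphisms the
  boolean is ignored.\<close>

inductive_set gen :: "'b set \<Rightarrow> (bool \<Rightarrow> 'b \<Rightarrow> 'b \<Rightarrow> bool) \<Rightarrow> (bool \<Rightarrow> 'b \<Rightarrow> 'b \<Rightarrow> 'b) \<Rightarrow> 'b set"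
  for G :: "'b set" and P and c where
  base: "x \<in> G \<Longrightarrow> x \<in> gen G P c"
| step: "x \<in> gen G P c \<Longrightarrow> y \<in> gen G P c \<Longrightarrow> P e x y \<Longrightarrow> c e y x \<in> gen G P c"

text \<open>The stages \<open>L n\<close> drop the composability condition and so contain the
  closure; two elements of different stages meet at the larger index.\<close>

lemma (in univ) sml_gen:
  assumes "sml ty (G :: 'b set)" shows "sml ty (gen G P c)"
proof -
  define L :: "nat \<Rightarrow> 'b set" where
    "L = rec_nat G (\<lambda>_ S. S \<union> ((\<lambda>(y, x). c True y x) ` (S \<times> S) \<union> (\<lambda>(y, x). c False y x) ` (S \<times> S)))"
  have L0: "L 0 = G" and LS: "L (Suc n) = L n \<union> ((\<lambda>(y, x). c True y x) ` (L n \<times> L n) \<union>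
      (\<lambda>(y, x). c False y x) ` (L n \<times> L n))" for n
    by (simp_all add: L_def)
  have "sml ty (L n)" for n
    by (induction n) (simp_all add: L0 LS sml_image sml_Un sml_Times assms)
  then have "sml ty (\<Union>n. L n)" by (rule sml_nat_UNION)
  moreover have mono: "L m \<subseteq> L n" if "m \<le> n" for m n
    using that by (induction n) (auto simp: LS le_Suc_eq)
  have "x \<in> (\<Union>n. L n)" if "x \<in> gen G P c" for x
    using that
  proof induction
    case (base x) then show ?case using L0 by auto
  next
    case (step x y e)
    then obtain m n where "x \<in> L m" "y \<in> L n" by auto
    then have "x \<in> L (max m n)" "y \<in> L (max m n)" using mono[of m "max m n"] mono[of n "max m n"] by auto
    then have "c e y x \<in> L (Suc (max m n))" unfolding LS by (cases e) force+
    then show ?case by blast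
  qed
  ultimately show ?thesis by (meson sml_subset subsetI)
qed

text \<open>The generators contain all their boundaries and identities. No object has to be added,
  and closing morphisms and squares under composition already gives a double category.\<close>

locale gensub = dcat D for D :: "'b dblcat" +
  fixes GO GH GV GS :: "'b set"
  assumes GO: "GO \<subseteq> Ob D" and GH: "GH \<subseteq> Hor D" and GV: "GV \<subseteq> Ver D" and GS: "GS \<subseteq> Sq D"
    and GH_o: "f \<in> GH \<Longrightarrow> Dom (HC D) f \<in> GO \<and> Cod (HC D) f \<in> GO"
    and GV_o: "f \<in> GV \<Longrightarrow> Dom (VC D) f \<in> GO \<and> Cod (VC D) f \<in> GO"
    and GO_i: "x \<in> GO \<Longrightarrow> Idt (HC D) x \<in> GH \<and> Idt (VC D) x \<in> GV"
    and GS_b: "a \<in> GS \<Longrightarrow> tp D a \<in> GH \<and> bt D a \<in> GH \<and> lf D a \<in> GV \<and> rt D a \<in> GV"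
    and GH_i: "f \<in> GH \<Longrightarrow> Idt (VS D) f \<in> GS" and GV_i: "u \<in> GV \<Longrightarrow> Idt (HS D) u \<in> GS"
begin

definition "PH (e :: bool) f g \<longleftrightarrow> Cod (HC D) f = Dom (HC D) g"
definition "CH (e :: bool) g f = Comp (HC D) g f"
definition "PV (e :: bool) f g \<longleftrightarrow> Cod (VC D) f = Dom (VC D) g"
definition "CV (e :: bool) g f = Comp (VC D) g f"
definition "PS e a b \<longleftrightarrow> (if e then rt D a = lf D b else bt D a = tp D b)"
definition "CS e b a = (if e then Comp (HS D) b a else Comp (VS D) b a)"
lemmas PC = PH_def CH_def PV_def CV_def PS_def CS_def

definition "H = gen GH PH CH"
definition "V = gen GV PV CV"
definition "S = gen GS PS CS"

lemma H_in: "f \<in> H \<Longrightarrow> f \<in> Hor D \<and> Dom (HC D) f \<in> GO \<and> Cod (HC D) f \<in> GO"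
  unfolding H_def by (induction rule: gen.induct) (use GH GH_o in \<open>auto simp: PC\<close>)

lemma V_in: "f \<in> V \<Longrightarrow> f \<in> Ver D \<and> Dom (VC D) f \<in> GO \<and> Cod (VC D) f \<in> GO"
  unfolding V_def by (induction rule: gen.induct) (use GV GV_o in \<open>auto simp: PC\<close>)

lemma H_base: "f \<in> GH \<Longrightarrow> f \<in> H" and V_base: "u \<in> GV \<Longrightarrow> u \<in> V" and S_base: "a \<in> GS \<Longrightarrow> a \<in> S"
  unfolding H_def V_def S_def by (rule gen.base; assumption)+

lemma H_comp: "f \<in> H \<Longrightarrow> g \<in> H \<Longrightarrow> Cod (HC D) f = Dom (HC D) g \<Longrightarrow> Comp (HC D) g f \<in> H"
  unfolding H_def using gen.step[of f GH PH CH g True] by (simp add: PC)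

lemma V_comp: "f \<in> V \<Longrightarrow> g \<in> V \<Longrightarrow> Cod (VC D) f = Dom (VC D) g \<Longrightarrow> Comp (VC D) g f \<in> V"
  unfolding V_def using gen.step[of f GV PV CV g True] by (simp add: PC)

lemma S_hcomp: "a \<in> S \<Longrightarrow> b \<in> S \<Longrightarrow> rt D a = lf D b \<Longrightarrow> Comp (HS D) b a \<in> S"
  unfolding S_def using gen.step[of a GS PS CS b True] by (simp add: PC)

lemma S_vcomp: "a \<in> S \<Longrightarrow> b \<in> S \<Longrightarrow> bt D a = tp D b \<Longrightarrow> Comp (VS D) b a \<in> S"
  unfolding S_def using gen.step[of a GS PS CS b False] by (simp add: PC)

lemma S_in: "a \<in> S \<Longrightarrow> a \<in> Sq D \<and> tp D a \<in> H \<and> bt D a \<in> H \<and> lf D a \<in> V \<and> rt D a \<in> V"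
proof (unfold S_def, induction rule: gen.induct)
  case (base a) then show ?case using GS GS_b H_base V_base by blast
next
  case (step a b e)
  then show ?case by (cases e) (auto simp: PC intro!: H_comp V_comp)
qed

text \<open>The identity square of a composite is the composite of identity squares, so the property
  spreads from generators; the dual fact \<open>V_i\<close> uses \<open>hs_idt\<close>.\<close>

lemma H_i: "f \<in> H \<Longrightarrow> Idt (VS D) f \<in> S"
proof -
  assume "f \<in> H"
  from this[unfolded H_def] have "f \<in> H \<and> Idt (VS D) f \<in> S"
  proof (induction rule: gen.induct)
    case (base f) then show ?case using GH_i S_base H_base by blast
  next
    case (step f g e)
    then have fg: "f \<in> H" "g \<in> H" "Cod (HC D) f = Dom (HC D) g" "Idt (VS D) f \<in> S" "Idt (VS D) g \<in> S"
      by (simp_all add: H_def PC)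
    then show ?case using H_in[of f] H_in[of g] by (simp add: PC vs_idt S_hcomp H_comp)
  qed
  then show ?thesis by blast
qed

lemma V_i: "f \<in> V \<Longrightarrow> Idt (HS D) f \<in> S"
proof -
  assume "f \<in> V"
  from this[unfolded V_def] have "f \<in> V \<and> Idt (HS D) f \<in> S"
  proof (induction rule: gen.induct)
    case (base f) then show ?case using GV_i S_base V_base by blast
  next
    case (step f g e)
    then have fg: "f \<in> V" "g \<in> V" "Cod (VC D) f = Dom (VC D) g" "Idt (HS D) f \<in> S" "Idt (HS D) g \<in> S"
      by (simp_all add: V_def PC)
    then show ?case using V_in[of f] V_in[of g] by (simp add: PC hs_idt S_vcomp V_comp)
  qed
  then show ?thesis by blast
qed

definition "E = subdbl D GO H V S"

lemmas mems [simp] = H_in V_in S_in H_comp V_comp S_hcomp S_vcomp H_i V_i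

lemma dc_E: "double_category E"
proof -
  have [simp]: "x \<in> Ob D" if "x \<in> GO" for x using GO that by blast
  have [simp]: "Idt (HC D) x \<in> H" "Idt (VC D) x \<in> V" if "x \<in> GO" for x
    using GO_i[OF that] H_base V_base by auto
  show ?thesis
    unfolding E_def
  proof (rule double_categoryI)
    show "category (HC (subdbl D GO H V S))" by (rule categoryI) (simp_all add: H.assoc)
    show "category (VC (subdbl D GO H V S))" by (rule categoryI) (simp_all add: V.assoc)
    show "category (HS (subdbl D GO H V S))" by (rule categoryI) (simp_all add: HS.assoc)
    show "category (VS (subdbl D GO H V S))" by (rule categoryI) (simp_all add: vs_assoc)
  qed (simp_all add: hs_idt hs_idt_idt vs_idt interchange)
qed

lemma dfun_incl: "dfun E D (\<lambda>x. x) (\<lambda>x. x) (\<lambda>x. x) (\<lambda>x. x)"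
proof (rule dfunI)
  show "double_category E" "double_category D" by (rule dc_E dc)+
  show "x \<in> Ob E \<Longrightarrow> x \<in> Ob D" for x using GO unfolding E_def by auto
qed (simp_all add: E_def)

end

text \<open>One injection on the union of the four carriers encodes all of them, and
  \<open>n\<close> decodes it.\<close>

lemma (in univ) encode_dblcat:
  assumes E: "double_category (E :: 'b dblcat)"
    and sm: "sml ty (Ob E)" "sml ty (Hor E)" "sml ty (Ver E)" "sml ty (Sq E)"
  obtains D :: "'a dblcat" and m n where "small_dblcat D" "dfun E D m m m m" "dfun D E n n n n"
    "\<forall>x\<in>Ob E \<union> Hor E \<union> Ver E \<union> Sq E. n (m x) = x"
    "Ob D = m ` Ob E" "Hor D = m ` Hor E" "Ver D = m ` Ver E" "Sq D = m ` Sq E"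
proof -
  interpret dcat E by unfold_locales fact
  let ?U = "Ob E \<union> Hor E \<union> Ver E \<union> Sq E"
  have "sml ty ?U" by (intro sml_Un sm)
  then obtain m :: "'b \<Rightarrow> 'a" where m: "inj_on m ?U" by (rule sml_encode)
  define n where "n = inv_into ?U m"
  have n: "n (m x) = x" if "x \<in> ?U" for x unfolding n_def by (rule inv_into_f_f[OF m that])
  have ij: "inj_on m (Ob E)" "inj_on m (Hor E)" "inj_on m (Ver E)" "inj_on m (Sq E)"
    by (rule inj_on_subset[OF m]; blast)+
  have ij': "inj_on m (Obj (VC E))" "inj_on m (Obj (HS E))" "inj_on m (Obj (VS E))" "inj_on m (Arr (VS E))"
    using ij by simp_all
  define D where "D = \<lparr>HC = enc_cat (HC E) m m, VC = enc_cat (VC E) m m, HS = enc_cat (HS E) m m, VS = enc_cat (VS E) m m\<rparr>"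
  have DC: "HC D = enc_cat (HC E) m m" "VC D = enc_cat (VC E) m m" "HS D = enc_cat (HS E) m m" "VS D = enc_cat (VS E) m m"
    by (simp_all add: D_def)
  note sH [simp] = enc_cat_simps[OF ij(1,2), folded DC] and sV [simp] = enc_cat_simps[OF ij'(1) ij(3), folded DC, unfolded carriers]
    and sS [simp] = enc_cat_simps[OF ij'(2) ij(4), folded DC, unfolded carriers]
    and sT [simp] = enc_cat_simps[OF ij'(3,4), folded DC, unfolded carriers]
  have [simp]: "m x = m y \<longleftrightarrow> x = y" if "x \<in> Ob E" "y \<in> Ob E" for x y using ij(1) that by (auto dest: inj_onD)
  have [simp]: "m x = m y \<longleftrightarrow> x = y" if "x \<in> Hor E" "y \<in> Hor E" for x y using ij(2) that by (auto dest: inj_onD)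
  have [simp]: "m x = m y \<longleftrightarrow> x = y" if "x \<in> Ver E" "y \<in> Ver E" for x y using ij(3) that by (auto dest: inj_onD)
  have D: "double_category D"
  proof (rule double_categoryI)
    show "category (HC D)" "category (VC D)" "category (HS D)" "category (VS D)"
      unfolding DC using category_enc_cat H.cat V.cat HS.cat VS.cat ij ij' by blast+
  qed (auto simp: hs_idt hs_idt_idt vs_idt interchange)
  have s: "small_dblcat D"
    using D sm unfolding small_dblcat_def by (simp add: small_iff_sml sml_image)
  have 1: "dfun E D m m m m" by (rule dfunI) (use E D in auto)
  have n' [simp]: "x \<in> Ob E \<Longrightarrow> n (m x) = x" "x \<in> Hor E \<Longrightarrow> n (m x) = x" "x \<in> Ver E \<Longrightarrow> n (m x) = x"
    "x \<in> Sq E \<Longrightarrow> n (m x) = x" for x using n by simp_all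
  have 2: "dfun D E n n n n" by (rule dfunI) (use E D in auto)
  show thesis by (rule that[OF s 1 2]) (use n in auto)
qed

text \<open>The small double category generated by the images of the two targets in the product over
  all cocones.\<close>

lemma (in univ) pushout_exists:
  fixes f g :: "'a dblfun"
  assumes f: "f \<in> DArr" and g: "g \<in> DArr" and fg: "Src f = Src g"
  shows "\<exists>h k. pushout_square DblCat f g h k"
proof -
  \<comment> \<open>All cocones with small vertex, indexed by pairs of double functors. The index
    set may be large, so the product need not be small; only the part generated by the two legs will
    be.\<close>
  define I where "I = {j. commutative_square DblCat f g (fst j) (snd j)}"
  define X where "X = (\<lambda>j :: 'a dblfun \<times> 'a dblfun. Trg (fst j))"
  have j: "fst j \<in> DArr" "snd j \<in> DArr" "Src (fst j) = Trg f" "Src (snd j) = Trg g" "Trg (fst j) = X j" "Trg (snd j) = X j"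
    "dblfun_comp (fst j) f = dblfun_comp (snd j) g" if "j \<in> I" for j
    using that by (simp_all add: I_def commutative_square_def X_def)
  have dj: "dfun (Trg f) (X j) (onOb (fst j)) (onHor (fst j)) (onVer (fst j)) (onSq (fst j))"
    "dfun (Trg g) (X j) (onOb (snd j)) (onHor (snd j)) (onVer (snd j)) (onSq (snd j))" if "j \<in> I" for j
    using DArr_dfun[of "fst j"] DArr_dfun[of "snd j"] j[OF that] by simp_all
  have dX: "double_category (X j)" if "j \<in> I" for j using dj(1)[OF that] by (simp add: dfun_def dcat_def)
  have dA: "double_category (Trg f)" and dB: "double_category (Trg g)" using f g by (simp_all add: small_dblcatD)
  interpret A: dcat "Trg f" by unfold_locales (rule dA)
  interpret B: dcat "Trg g" by unfold_locales (rule dB)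
  let ?D = "pdbl I X"
  interpret D: dcat ?D by unfold_locales (rule dc_pdbl[OF dX])
  \<comment> \<open>The family of values of all cocones at \<open>x\<close>: the canonical map from
    a leg into the product.\<close>
  define ev where "ev = (\<lambda>(F :: 'a dblfun \<Rightarrow> 'a \<Rightarrow> 'a) (s :: 'a dblfun \<times> 'a dblfun \<Rightarrow> 'a dblfun) (x :: 'a). \<lambda>j\<in>I. F (s j) x)"
  note j1 = dfun.o_in dfun.h_rules dfun.v_rules dfun.s_rules
  have FA: "dfun (Trg f) ?D (ev onOb fst) (ev onHor fst) (ev onVer fst) (ev onSq fst)"
    by (rule dfunI) (use dA D.dc in \<open>auto simp: ev_def restrict_eq_iff j1[OF dj(1)]\<close>)
  have FB: "dfun (Trg g) ?D (ev onOb snd) (ev onHor snd) (ev onVer snd) (ev onSq snd)"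
    by (rule dfunI) (use dB D.dc in \<open>auto simp: ev_def restrict_eq_iff j1[OF dj(2)]\<close>)
  interpret FA: dfun "Trg f" ?D "ev onOb fst" "ev onHor fst" "ev onVer fst" "ev onSq fst" by (rule FA)
  interpret FB: dfun "Trg g" ?D "ev onOb snd" "ev onHor snd" "ev onVer snd" "ev onSq snd" by (rule FB)
  define GO where "GO = ev onOb fst ` Ob (Trg f) \<union> ev onOb snd ` Ob (Trg g)"
  define GH where "GH = ev onHor fst ` Hor (Trg f) \<union> ev onHor snd ` Hor (Trg g)"
  define GV where "GV = ev onVer fst ` Ver (Trg f) \<union> ev onVer snd ` Ver (Trg g)"
  define GS where "GS = ev onSq fst ` Sq (Trg f) \<union> ev onSq snd ` Sq (Trg g)"
  have gs: "gensub ?D GO GH GV GS"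
  proof unfold_locales
    show "GO \<subseteq> Ob ?D" "GH \<subseteq> Hor ?D" "GV \<subseteq> Ver ?D" "GS \<subseteq> Sq ?D"
      unfolding GO_def GH_def GV_def GS_def
      using FA.o_in FB.o_in FA.h_rules(1) FB.h_rules(1) FA.v_rules(1) FB.v_rules(1) FA.s_rules(1) FB.s_rules(1) by blast+
  next
    fix x assume "x \<in> GO"
    then show "Idt (HC ?D) x \<in> GH \<and> Idt (VC ?D) x \<in> GV"
      unfolding GO_def GH_def GV_def
      by (auto simp: FA.h_rules(4)[symmetric] FB.h_rules(4)[symmetric] FA.v_rules(4)[symmetric] FB.v_rules(4)[symmetric]
          simp del: pdbl_simps pcat_simps FA.h_rules FB.h_rules FA.v_rules FB.v_rules)
  next
    fix x assume "x \<in> GH"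
    then show "Dom (HC ?D) x \<in> GO \<and> Cod (HC ?D) x \<in> GO" "Idt (VS ?D) x \<in> GS"
      unfolding GO_def GH_def GS_def
      by (auto simp: FA.h_rules(2,3) FB.h_rules(2,3) FA.s_rules(7)[symmetric] FB.s_rules(7)[symmetric]
          simp del: pdbl_simps pcat_simps FA.s_rules FB.s_rules)
  next
    fix x assume "x \<in> GV"
    then show "Dom (VC ?D) x \<in> GO \<and> Cod (VC ?D) x \<in> GO" "Idt (HS ?D) x \<in> GS"
      unfolding GO_def GV_def GS_def
      by (auto simp: FA.v_rules(2,3) FB.v_rules(2,3) FA.s_rules(6)[symmetric] FB.s_rules(6)[symmetric]
          simp del: pdbl_simps pcat_simps FA.s_rules FB.s_rules)
  next
    fix x assume "x \<in> GS"
    then show "tp ?D x \<in> GH \<and> bt ?D x \<in> GH \<and> lf ?D x \<in> GV \<and> rt ?D x \<in> GV"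
      unfolding GH_def GV_def GS_def by (auto simp del: pdbl_simps pcat_simps)
  qed
  interpret G: gensub ?D GO GH GV GS by (rule gs)
  have smA: "sml ty (Ob (Trg f))" "sml ty (Hor (Trg f))" "sml ty (Ver (Trg f))" "sml ty (Sq (Trg f))"
    and smB: "sml ty (Ob (Trg g))" "sml ty (Hor (Trg g))" "sml ty (Ver (Trg g))" "sml ty (Sq (Trg g))"
    using DArr_small(2)[OF f] DArr_small(2)[OF g] unfolding small_dblcat_def small_iff_sml by simp_all
  have "sml ty GO" "sml ty GH" "sml ty GV" "sml ty GS"
    unfolding GO_def GH_def GV_def GS_def by (intro sml_Un sml_image smA smB)+
  then have sm: "sml ty (Ob G.E)" "sml ty (Hor G.E)" "sml ty (Ver G.E)" "sml ty (Sq G.E)"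
    unfolding G.E_def subdbl_simps G.H_def G.V_def G.S_def by (simp_all add: sml_gen)
  obtain C :: "'a dblcat" and m n where C: "small_dblcat C" "dfun G.E C m m m m" "dfun C G.E n n n n"
    "\<forall>x\<in>Ob G.E \<union> Hor G.E \<union> Ver G.E \<union> Sq G.E. n (m x) = x"
    "Ob C = m ` Ob G.E" "Hor C = m ` Hor G.E" "Ver C = m ` Ver G.E" "Sq C = m ` Sq G.E"
    by (rule encode_dblcat[OF G.dc_E sm])
  have Ec: "Ob G.E = GO" "Hor G.E = G.H" "Ver G.E = G.V" "Sq G.E = G.S" unfolding G.E_def by simp_all
  have eA: "x \<in> Ob (Trg f) \<Longrightarrow> ev onOb fst x \<in> GO" "x \<in> Hor (Trg f) \<Longrightarrow> ev onHor fst x \<in> G.H"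
    "x \<in> Ver (Trg f) \<Longrightarrow> ev onVer fst x \<in> G.V" "x \<in> Sq (Trg f) \<Longrightarrow> ev onSq fst x \<in> G.S" for x
    by (simp add: GO_def, rule G.H_base, simp add: GH_def, rule G.V_base, simp add: GV_def, rule G.S_base, simp add: GS_def)
  have eB: "x \<in> Ob (Trg g) \<Longrightarrow> ev onOb snd x \<in> GO" "x \<in> Hor (Trg g) \<Longrightarrow> ev onHor snd x \<in> G.H"
    "x \<in> Ver (Trg g) \<Longrightarrow> ev onVer snd x \<in> G.V" "x \<in> Sq (Trg g) \<Longrightarrow> ev onSq snd x \<in> G.S" for x
    by (simp add: GO_def, rule G.H_base, simp add: GH_def, rule G.V_base, simp add: GV_def, rule G.S_base, simp add: GS_def)
  have FA': "dfun (Trg f) G.E (ev onOb fst) (ev onHor fst) (ev onVer fst) (ev onSq fst)"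
    by (rule dfunI) (use dA G.dc_E in \<open>simp_all only: Ec eA, simp_all add: G.E_def del: pdbl_simps pcat_simps\<close>)
  have FB': "dfun (Trg g) G.E (ev onOb snd) (ev onHor snd) (ev onVer snd) (ev onSq snd)"
    by (rule dfunI) (use dB G.dc_E in \<open>simp_all only: Ec eB, simp_all add: G.E_def del: pdbl_simps pcat_simps\<close>)
  define h where "h = mk (Trg f) C (m \<circ> ev onOb fst) (m \<circ> ev onHor fst) (m \<circ> ev onVer fst) (m \<circ> ev onSq fst)"
  define k where "k = mk (Trg g) C (m \<circ> ev onOb snd) (m \<circ> ev onHor snd) (m \<circ> ev onVer snd) (m \<circ> ev onSq snd)"
  have h: "h \<in> DArr" "Src h = Trg f" "Trg h = C"
    unfolding h_def using mk_DArr[OF dfun_comp[OF FA' C(2)] _ C(1)] f by simp_all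
  have k: "k \<in> DArr" "Src k = Trg g" "Trg k = C"
    unfolding k_def using mk_DArr[OF dfun_comp[OF FB' C(2)] _ C(1)] g by simp_all
  interpret f: dfun "Src f" "Trg f" "onOb f" "onHor f" "onVer f" "onSq f" by (rule DArr_dfun[OF f])
  interpret g: dfun "Src f" "Trg g" "onOb g" "onHor g" "onVer g" "onSq g" using DArr_dfun[OF g] fg by simp
  \<comment> \<open>In coordinate \<open>j\<close> this is commutativity of the cocone
    \<open>j\<close>.\<close>
  have cm: "x \<in> Ob (Src f) \<Longrightarrow> ev onOb fst (onOb f x) = ev onOb snd (onOb g x)"
    "x \<in> Hor (Src f) \<Longrightarrow> ev onHor fst (onHor f x) = ev onHor snd (onHor g x)"
    "x \<in> Ver (Src f) \<Longrightarrow> ev onVer fst (onVer f x) = ev onVer snd (onVer g x)"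
    "x \<in> Sq (Src f) \<Longrightarrow> ev onSq fst (onSq f x) = ev onSq snd (onSq g x)" for x
    unfolding ev_def using arg_cong[OF j(7), of _ "\<lambda>M. onOb M x"] arg_cong[OF j(7), of _ "\<lambda>M. onHor M x"]
      arg_cong[OF j(7), of _ "\<lambda>M. onVer M x"] arg_cong[OF j(7), of _ "\<lambda>M. onSq M x"] fg
    by (auto intro!: restrict_ext)
  have comm: "dblfun_comp h f = dblfun_comp k g"
    by (rule DArr_eqI) (use h k f g fg in \<open>simp_all, simp_all add: h_def k_def cm\<close>)
  have "pushout_square DblCat f g h k"
    unfolding pushout_square_def
  proof (intro conjI allI impI)
    show "commutative_square DblCat f g h k"
      unfolding commutative_square_def using f g h k fg comm by simp
    fix h' k' assume hk: "commutative_square DblCat f g h' k'"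
    let ?j = "(h', k')"
    have jI: "?j \<in> I" using hk by (simp add: I_def)
    have jj: "h' \<in> DArr" "k' \<in> DArr" "Src h' = Trg f" "Src k' = Trg g" "Trg k' = Trg h'"
      using hk by (simp_all add: commutative_square_def)
    have X: "X ?j = Trg h'" by (simp add: X_def)
    have pr: "dfun G.E (X ?j) (\<lambda>x. x ?j) (\<lambda>x. x ?j) (\<lambda>x. x ?j) (\<lambda>x. x ?j)"
      using dfun_comp[OF G.dfun_incl dfun_proj[OF dX jI]] unfolding comp_def .
    \<comment> \<open>Decoding followed by projection to the coordinate of the given cocone.\<close>
    define u where "u = mk C (X ?j) (\<lambda>x. n x ?j) (\<lambda>x. n x ?j) (\<lambda>x. n x ?j) (\<lambda>x. n x ?j)"
    have u: "u \<in> DArr" "Src u = C" "Trg u = Trg h'"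
      unfolding u_def using mk_DArr[OF dfun_comp[OF C(3) pr, unfolded comp_def] C(1)] jj(1) by (simp_all add: X)
    have mC: "x \<in> Ob G.E \<Longrightarrow> m x \<in> Ob C" "x \<in> Hor G.E \<Longrightarrow> m x \<in> Hor C" "x \<in> Ver G.E \<Longrightarrow> m x \<in> Ver C"
      "x \<in> Sq G.E \<Longrightarrow> m x \<in> Sq C" for x
      unfolding C(5-8) by blast+
    note mC = mC[unfolded Ec]
    have nm: "n (m x) = x" if "x \<in> GO \<or> x \<in> G.H \<or> x \<in> G.V \<or> x \<in> G.S" for x
      using C(4) that unfolding Ec by blast
    have uh: "dblfun_comp u h = h'"
      by (rule DArr_eqI) (use u h jj in \<open>simp_all\<close>, simp_all add: h_def u_def mC nm eA, simp_all add: ev_def jI)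
    have uk: "dblfun_comp u k = k'"
      by (rule DArr_eqI) (use u k h jj in \<open>simp_all\<close>, simp_all add: k_def u_def mC nm eB, simp_all add: ev_def jI)
    show "\<exists>!u. u \<in> arr_betw DblCat (Cod DblCat h) (Cod DblCat h') \<and> Comp DblCat u h = h' \<and> Comp DblCat u k = k'"
    proof (rule ex1I[of _ u])
      show "u \<in> arr_betw DblCat (Cod DblCat h) (Cod DblCat h') \<and> Comp DblCat u h = h' \<and> Comp DblCat u k = k'"
        using u h uh uk by (simp add: arr_betw_def)
      fix w assume "w \<in> arr_betw DblCat (Cod DblCat h) (Cod DblCat h') \<and> Comp DblCat w h = h' \<and> Comp DblCat w k = k'"
      then have w: "w \<in> DArr" "Src w = C" "Trg w = Trg h'" and wh: "dblfun_comp w h = dblfun_comp u h"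
        and wk: "dblfun_comp w k = dblfun_comp u k"
        using h uh uk by (simp_all add: arr_betw_def)
      interpret w: dfun C "X ?j" "onOb w" "onHor w" "onVer w" "onSq w" using DArr_dfun[OF w(1)] w X by simp
      interpret u: dfun C "X ?j" "onOb u" "onHor u" "onVer u" "onSq u" using DArr_dfun[OF u(1)] u X by simp
      interpret m: dfun G.E C m m m m by (rule C(2))
      \<comment> \<open>Two comparison maps agree on the images of both legs. These generate the
        vertex, so agreement spreads to all composites by induction over \<open>gen\<close>.\<close>
      have wA: "x \<in> Ob (Trg f) \<Longrightarrow> onOb w (m (ev onOb fst x)) = onOb u (m (ev onOb fst x))"
        "x \<in> Hor (Trg f) \<Longrightarrow> onHor w (m (ev onHor fst x)) = onHor u (m (ev onHor fst x))"
        "x \<in> Ver (Trg f) \<Longrightarrow> onVer w (m (ev onVer fst x)) = onVer u (m (ev onVer fst x))"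
        "x \<in> Sq (Trg f) \<Longrightarrow> onSq w (m (ev onSq fst x)) = onSq u (m (ev onSq fst x))" for x
        using arg_cong[OF wh, of "\<lambda>M. onOb M x"] arg_cong[OF wh, of "\<lambda>M. onHor M x"]
          arg_cong[OF wh, of "\<lambda>M. onVer M x"] arg_cong[OF wh, of "\<lambda>M. onSq M x"] h(2) by (simp_all add: h_def)
      have wB: "x \<in> Ob (Trg g) \<Longrightarrow> onOb w (m (ev onOb snd x)) = onOb u (m (ev onOb snd x))"
        "x \<in> Hor (Trg g) \<Longrightarrow> onHor w (m (ev onHor snd x)) = onHor u (m (ev onHor snd x))"
        "x \<in> Ver (Trg g) \<Longrightarrow> onVer w (m (ev onVer snd x)) = onVer u (m (ev onVer snd x))"
        "x \<in> Sq (Trg g) \<Longrightarrow> onSq w (m (ev onSq snd x)) = onSq u (m (ev onSq snd x))" for x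
        using arg_cong[OF wk, of "\<lambda>M. onOb M x"] arg_cong[OF wk, of "\<lambda>M. onHor M x"]
          arg_cong[OF wk, of "\<lambda>M. onVer M x"] arg_cong[OF wk, of "\<lambda>M. onSq M x"] k(2) by (simp_all add: k_def)
      have o: "onOb w (m x) = onOb u (m x)" if "x \<in> GO" for x
        using that wA(1) wB(1) unfolding GO_def by blast
      note mr = m.h_rules m.v_rules m.s_rules
      note mr' = mr[unfolded Ec, unfolded G.E_def, unfolded subdbl_simps]
      have hh: "onHor w (m x) = onHor u (m x)" if "x \<in> G.H" for x
      proof -
        have "x \<in> G.H \<and> onHor w (m x) = onHor u (m x)"
          using that[unfolded G.H_def]
        proof (induction rule: gen.induct)
          case (base x) then show ?case using wA(2) wB(2) G.H_base[OF base] unfolding GH_def by blast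
        next
          case (step x y e)
          have xy: "x \<in> G.H" "y \<in> G.H" "Cod (HC ?D) x = Dom (HC ?D) y" using step unfolding G.PC by (simp_all only: G.H_def)
          have "Cod (HC C) (m x) = Dom (HC C) (m y)" using mr'(2,3) xy by metis
          then have "onHor w (m (Comp (HC ?D) y x)) = onHor u (m (Comp (HC ?D) y x))"
            using mr'(5)[OF xy] w.h_rules(5)[of "m x" "m y"] u.h_rules(5)[of "m x" "m y"] mC(2) xy(1,2) step.IH by metis
          then show ?case using G.H_comp[OF xy] unfolding G.CH_def by (rule conjI[rotated])
        qed
        then show ?thesis by blast
      qed
      have vv: "onVer w (m x) = onVer u (m x)" if "x \<in> G.V" for x
      proof -
        have "x \<in> G.V \<and> onVer w (m x) = onVer u (m x)"
          using that[unfolded G.V_def]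
        proof (induction rule: gen.induct)
          case (base x) then show ?case using wA(3) wB(3) G.V_base[OF base] unfolding GV_def by blast
        next
          case (step x y e)
          have xy: "x \<in> G.V" "y \<in> G.V" "Cod (VC ?D) x = Dom (VC ?D) y" using step unfolding G.PC by (simp_all only: G.V_def)
          have "Cod (VC C) (m x) = Dom (VC C) (m y)" using mr'(7,8) xy by metis
          then have "onVer w (m (Comp (VC ?D) y x)) = onVer u (m (Comp (VC ?D) y x))"
            using mr'(10)[OF xy] w.v_rules(5)[of "m x" "m y"] u.v_rules(5)[of "m x" "m y"] mC(3) xy(1,2) step.IH by metis
          then show ?case using G.V_comp[OF xy] unfolding G.CV_def by (rule conjI[rotated])
        qed
        then show ?thesis by blast
      qed
      have ss: "onSq w (m x) = onSq u (m x)" if "x \<in> G.S" for x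
      proof -
        have "x \<in> G.S \<and> onSq w (m x) = onSq u (m x)"
          using that[unfolded G.S_def]
        proof (induction rule: gen.induct)
          case (base x) then show ?case using wA(4) wB(4) G.S_base[OF base] unfolding GS_def by blast
        next
          case (step x y e)
          have xy: "x \<in> G.S" "y \<in> G.S" using step by (simp_all only: G.S_def)
          show ?case
          proof (cases e)
            case True
            then have r: "rt ?D x = lf ?D y" using step(3) unfolding G.PS_def by (simp only: if_True)
            have "rt C (m x) = lf C (m y)" using mr'(12,13) xy r by metis
            then have "onSq w (m (Comp (HS ?D) y x)) = onSq u (m (Comp (HS ?D) y x))"
              using mr'(18)[OF xy r] w.s_rules(8)[of "m x" "m y"] u.s_rules(8)[of "m x" "m y"] mC(4) xy step.IH by metis
            then show ?thesis using G.S_hcomp[OF xy r] True unfolding G.CS_def by (simp only: if_True)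
          next
            case False
            then have r: "bt ?D x = tp ?D y" using step(3) unfolding G.PS_def by (simp only: if_False)
            have "bt C (m x) = tp C (m y)" using mr'(14,15) xy r by metis
            then have "onSq w (m (Comp (VS ?D) y x)) = onSq u (m (Comp (VS ?D) y x))"
              using mr'(19)[OF xy r] w.s_rules(9)[of "m x" "m y"] u.s_rules(9)[of "m x" "m y"] mC(4) xy step.IH by metis
            then show ?thesis using G.S_vcomp[OF xy r] False unfolding G.CS_def by (simp only: if_False)
          qed
        qed
        then show ?thesis by blast
      qed
      show "w = u"
        by (rule DArr_eqI[OF w(1) u(1)]) (use w u o hh vv ss in \<open>auto simp: C(5-8) Ec\<close>)
    qed
  qed
  then show ?thesis by blast
qed

section \<open>Factorization of trivial fibrations\<close>

lemma ctf_comp: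
  assumes F: "F \<in> DArr" "ctf F" and G: "G \<in> DArr" "ctf G" and FG: "Trg F = Src G"
  shows "ctf (dblfun_comp G F)"
proof -
  interpret F: ctfib F using F by unfold_locales
  interpret G: ctfib G using G by unfold_locales
  show ?thesis
  proof (rule ctfI)
    show "dblfun_comp G F \<in> DArr" using F G FG by simp
    show "sq_ff (dblfun_comp G F)"
    proof (rule sq_ffI)
      show "dblfun_comp G F \<in> DArr" using F G FG by simp
      fix f g u v b
      assume 1: "square_boundary (Src (dblfun_comp G F)) f g u v"
        and "b \<in> squares (Trg (dblfun_comp G F)) (onHor (dblfun_comp G F) f) (onHor (dblfun_comp G F) g)
          (onVer (dblfun_comp G F) u) (onVer (dblfun_comp G F) v)"
      then have m: "square_boundary (Src F) f g u v" "b \<in> Sq (Trg G)" "tp (Trg G) b = onHor G (onHor F f)"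
        "bt (Trg G) b = onHor G (onHor F g)" "lf (Trg G) b = onVer G (onVer F u)" "rt (Trg G) b = onVer G (onVer F v)"
        by (simp_all add: square_boundary_def squares_def)
      have m1: "square_boundary (Src G) (onHor F f) (onHor F g) (onVer F u) (onVer F v)"
        using m(1) F.h_rules F.v_rules unfolding square_boundary_def FG[symmetric] by simp
      obtain c where c: "c \<in> Sq (Src G)" "tp (Src G) c = onHor F f" "bt (Src G) c = onHor F g"
        "lf (Src G) c = onVer F u" "rt (Src G) c = onVer F v" "onSq G c = b"
        by (rule G.sq_full[OF m1 m(2-6)])
      obtain a where "a \<in> Sq (Src F)" "tp (Src F) a = f" "bt (Src F) a = g" "lf (Src F) a = u" "rt (Src F) a = v" "onSq F a = c"
        by (rule F.sq_full[OF m(1) c(1-5)[folded FG]])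
      with c(6) show "\<exists>a\<in>squares (Src (dblfun_comp G F)) f g u v. onSq (dblfun_comp G F) a = b"
        by (auto simp: squares_def)
    next
      fix a b assume "a \<in> Sq (Src (dblfun_comp G F))" "b \<in> Sq (Src (dblfun_comp G F))"
        "tp (Src (dblfun_comp G F)) a = tp (Src (dblfun_comp G F)) b" "bt (Src (dblfun_comp G F)) a = bt (Src (dblfun_comp G F)) b"
        "lf (Src (dblfun_comp G F)) a = lf (Src (dblfun_comp G F)) b" "rt (Src (dblfun_comp G F)) a = rt (Src (dblfun_comp G F)) b"
        "onSq (dblfun_comp G F) a = onSq (dblfun_comp G F) b"
      then have a: "a \<in> Sq (Src F)" "b \<in> Sq (Src F)" "tp (Src F) a = tp (Src F) b" "bt (Src F) a = bt (Src F) b"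
        "lf (Src F) a = lf (Src F) b" "rt (Src F) a = rt (Src F) b" "onSq G (onSq F a) = onSq G (onSq F b)"
        by simp_all
      have "onSq F a = onSq F b"
        by (rule G.sq_faithful) (use a F.s_rules(1-5)[of a] F.s_rules(1-5)[of b] in \<open>simp_all add: FG\<close>)
      with a show "a = b" by - (rule F.sq_faithful)
    qed
  next
    fix y assume "y \<in> Ob (Trg (dblfun_comp G F))"
    then have "y \<in> Ob (Trg G)" by simp
    then obtain z where z: "z \<in> Ob (Src G)" "onOb G z = y" by (rule G.ob_surj)
    obtain x where "x \<in> Ob (Src F)" "onOb F x = z" by (rule F.ob_surj[OF z(1)[folded FG]])
    with z(2) show "\<exists>x\<in>Ob (Src (dblfun_comp G F)). onOb (dblfun_comp G F) x = y" by auto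
  next
    fix x y f assume x: "x \<in> Ob (Src (dblfun_comp G F))" "y \<in> Ob (Src (dblfun_comp G F))"
    then have xy: "x \<in> Ob (Src F)" "y \<in> Ob (Src F)" by simp_all
    note o = F.o_in[OF xy(1), unfolded FG] F.o_in[OF xy(2), unfolded FG]
    {
      assume "f \<in> Hor (Trg (dblfun_comp G F))" "Dom (HC (Trg (dblfun_comp G F))) f = onOb (dblfun_comp G F) x"
        "Cod (HC (Trg (dblfun_comp G F))) f = onOb (dblfun_comp G F) y"
      then have f: "f \<in> Hor (Trg G)" "Dom (HC (Trg G)) f = onOb G (onOb F x)" "Cod (HC (Trg G)) f = onOb G (onOb F y)"
        using xy by simp_all
      obtain k where k: "k \<in> Hor (Src G)" "Dom (HC (Src G)) k = onOb F x" "Cod (HC (Src G)) k = onOb F y" "onHor G k = f"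
        by (rule G.hor_full[OF o f])
      obtain g where "g \<in> Hor (Src F)" "Dom (HC (Src F)) g = x" "Cod (HC (Src F)) g = y" "onHor F g = k"
        by (rule F.hor_full[OF xy k(1-3)[folded FG]])
      with k(4) show "\<exists>g\<in>Hor (Src (dblfun_comp G F)). Dom (HC (Src (dblfun_comp G F))) g = x \<and>
          Cod (HC (Src (dblfun_comp G F))) g = y \<and> onHor (dblfun_comp G F) g = f" by auto
    }
    {
      assume "f \<in> Ver (Trg (dblfun_comp G F))" "Dom (VC (Trg (dblfun_comp G F))) f = onOb (dblfun_comp G F) x"
        "Cod (VC (Trg (dblfun_comp G F))) f = onOb (dblfun_comp G F) y"
      then have f: "f \<in> Ver (Trg G)" "Dom (VC (Trg G)) f = onOb G (onOb F x)" "Cod (VC (Trg G)) f = onOb G (onOb F y)"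
        using xy by simp_all
      obtain k where k: "k \<in> Ver (Src G)" "Dom (VC (Src G)) k = onOb F x" "Cod (VC (Src G)) k = onOb F y" "onVer G k = f"
        by (rule G.ver_full[OF o f])
      obtain g where "g \<in> Ver (Src F)" "Dom (VC (Src F)) g = x" "Cod (VC (Src F)) g = y" "onVer F g = k"
        by (rule F.ver_full[OF xy k(1-3)[folded FG]])
      with k(4) show "\<exists>g\<in>Ver (Src (dblfun_comp G F)). Dom (VC (Src (dblfun_comp G F))) g = x \<and>
          Cod (VC (Src (dblfun_comp G F))) g = y \<and> onVer (dblfun_comp G F) g = f" by auto
    }
  qed
qed

text \<open>Squares are settled by cancellation of \<open>q\<close>; what remains are surjectivity
  and fullness, stated after decoding in \<open>H\<close> and \<open>V\<close>.\<close>

lemma (in pulled) lift_ctf: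
  assumes K: "K \<in> DArr" "Trg K = Src q" and ff: "sq_ff (dblfun_comp q K)"
    and o: "\<And>y. y \<in> Obj H \<Longrightarrow> \<exists>x\<in>Ob (Src K). go (onOb K x) = y"
    and h: "\<And>x y t. x \<in> Ob (Src K) \<Longrightarrow> y \<in> Ob (Src K) \<Longrightarrow> t \<in> Arr H \<Longrightarrow> Dom H t = go (onOb K x) \<Longrightarrow>
      Cod H t = go (onOb K y) \<Longrightarrow>
      \<exists>f\<in>Hor (Src K). Dom (HC (Src K)) f = x \<and> Cod (HC (Src K)) f = y \<and> gh (onHor K f) = t"
    and v: "\<And>x y t. x \<in> Ob (Src K) \<Longrightarrow> y \<in> Ob (Src K) \<Longrightarrow> t \<in> Arr V \<Longrightarrow> Dom V t = go (onOb K x) \<Longrightarrow>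
      Cod V t = go (onOb K y) \<Longrightarrow>
      \<exists>f\<in>Ver (Src K). Dom (VC (Src K)) f = x \<and> Cod (VC (Src K)) f = y \<and> gv (onVer K f) = t"
  shows "ctf K"
proof -
  interpret K: dfun "Src K" "Src q" "onOb K" "onHor K" "onVer K" "onSq K"
    using DArr_dfun[OF K(1)] unfolding K(2) .
  have jo: "x = y" if "x \<in> Ob (Src q)" "y \<in> Ob (Src q)" "go x = go y" for x y
    using go that by (auto simp: bij_betw_def dest: inj_onD)
  have jh: "x = y" if "x \<in> Hor (Src q)" "y \<in> Hor (Src q)" "gh x = gh y" for x y
    using gh that by (auto simp: bij_betw_def dest: inj_onD)
  have jv: "x = y" if "x \<in> Ver (Src q)" "y \<in> Ver (Src q)" "gv x = gv y" for x y
    using gv that by (auto simp: bij_betw_def dest: inj_onD)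
  show ?thesis
  proof (rule ctfI[OF K(1)])
    show "sq_ff K" by (rule sq_ff_cancel[OF K ff])
    fix y assume "y \<in> Ob (Trg K)"
    then have y: "y \<in> Ob (Src q)" using K by simp
    obtain x where x: "x \<in> Ob (Src K)" "go (onOb K x) = go y" using o[OF go_in[OF y]] by blast
    then have "onOb K x = y" using y by (intro jo) simp_all
    with x show "\<exists>x\<in>Ob (Src K). onOb K x = y" by blast
  next
    fix x y t assume xy: "x \<in> Ob (Src K)" "y \<in> Ob (Src K)"
    {
      assume t: "t \<in> Hor (Trg K)" "Dom (HC (Trg K)) t = onOb K x" "Cod (HC (Trg K)) t = onOb K y"
      then have t': "t \<in> Hor (Src q)" "Dom (HC (Src q)) t = onOb K x" "Cod (HC (Src q)) t = onOb K y" using K by simp_all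
      obtain f where f: "f \<in> Hor (Src K)" "Dom (HC (Src K)) f = x" "Cod (HC (Src K)) f = y" "gh (onHor K f) = gh t"
        using h[OF xy gh_in[OF t'(1)]] is_functorD(4,5)[OF fgh t'(1)] t' by auto
      then have "onHor K f = t" using t' by (intro jh) simp_all
      with f show "\<exists>f\<in>Hor (Src K). Dom (HC (Src K)) f = x \<and> Cod (HC (Src K)) f = y \<and> onHor K f = t" by blast
    }
    {
      assume t: "t \<in> Ver (Trg K)" "Dom (VC (Trg K)) t = onOb K x" "Cod (VC (Trg K)) t = onOb K y"
      then have t': "t \<in> Ver (Src q)" "Dom (VC (Src q)) t = onOb K x" "Cod (VC (Src q)) t = onOb K y" using K by simp_all
      obtain f where f: "f \<in> Ver (Src K)" "Dom (VC (Src K)) f = x" "Cod (VC (Src K)) f = y" "gv (onVer K f) = gv t"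
        using v[OF xy gv_in[OF t'(1)]] is_functorD(4,5)[OF fgv t'(1)] t' by auto
      then have "onVer K f = t" using t' by (intro jv) simp_all
      with f show "\<exists>f\<in>Ver (Src K). Dom (VC (Src K)) f = x \<and> Cod (VC (Src K)) f = y \<and> onVer K f = t" by blast
    }
  qed
qed

text \<open>All four double categories have squares pulled back from the target. They differ in
  whether morphisms between objects of the source are kept, or replaced by those of the target with
  remembered endpoints.\<close>

lemma (in univ) ctf_factorization:
  fixes p :: "'a dblfun"
  assumes p_in: "p \<in> DArr" and p_ctf: "ctf p"
  obtains p1 p2 p3 where "p1 \<in> DArr" "p2 \<in> DArr" "p3 \<in> DArr" "Trg p1 = Src p2" "Trg p2 = Src p3"
    "dblfun_comp (dblfun_comp p3 p2) p1 = p" "ctf p1" "ctf p2" "ctf p3"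
    "inj_on (onOb p1) (Ob (Src p1))" "inj_on (onVer p1) (Ver (Src p1))"
    "inj_on (onOb p2) (Ob (Src p2))" "inj_on (onHor p2) (Hor (Src p2))" "ctfib.ff1 p3"
proof -
  interpret p: ctfib p using p_in p_ctf by unfold_locales
  let ?A = "Src p" and ?A' = "Trg p" and ?e = "onOb p" and ?fs = "\<lambda>t. fst (snd t)"
  let ?H = "pbcat (HC ?A') (Ob ?A) ?e" and ?V = "pbcat (VC ?A') (Ob ?A) ?e"
  have e: "?e x \<in> Ob ?A'" "?e x \<in> Obj (VC ?A')" if "x \<in> Ob ?A" for x using that by simp_all
  have s: "small_dblcat ?A" "small_dblcat ?A'" using p_in by simp_all
  have sm: "sml ty (Ob ?A)" "sml ty (Ver ?A)" "sml ty (Hor ?A')" "sml ty (Ver ?A')"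
    using s unfolding small_dblcat_def small_iff_sml by simp_all
  note H = category_pbcat[OF p.E.H.cat e(1)] and V = category_pbcat[OF p.E.V.cat e(2)]
    and fH = is_functor_pbcat[OF p.E.H.cat e(1)] and fV = is_functor_pbcat[OF p.E.V.cat e(2)]
  \<comment> \<open>Horizontal morphisms are those of the target with endpoints in
    \<open>Src p\<close>, vertical ones those of \<open>Src p\<close>; hence \<open>p1\<close> is
    injective on objects and vertical morphisms.\<close>
  obtain q1 go1 gh1 gv1 where q1: "pulled q1 ?H (VC ?A) ?e ?fs (onVer p) go1 gh1 gv1" and T1: "Trg q1 = ?A'"
    by (rule pull_exists[OF s(2) H p.D.V.cat _ fH p.fv _ sml_pbcat[OF sm(1,3)] sm(2)])
      (assumption | simp add: sm)+
  interpret q1: pulled q1 ?H "VC ?A" ?e ?fs "onVer p" go1 gh1 gv1 by (rule q1)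
  \<comment> \<open>Here both kinds of morphisms come from the target. \<open>q2\<close> will serve
    as \<open>p3\<close>, and the passage from \<open>Src q1\<close> to \<open>Src q2\<close>, which
    changes vertical morphisms only, as \<open>p2\<close>.\<close>
  obtain q2 go2 gh2 gv2 where q2: "pulled q2 ?H ?V ?e ?fs ?fs go2 gh2 gv2" and T2: "Trg q2 = ?A'"
    by (rule pull_exists[OF s(2) H V _ fH fV _ sml_pbcat[OF sm(1,3)] sml_pbcat[OF sm(1,4)]])
      (assumption | simp add: sm)+
  interpret q2: pulled q2 ?H ?V ?e ?fs ?fs go2 gh2 gv2 by (rule q2)
  have surj: "\<exists>x\<in>Ob ?A. ?e x = y" if "y \<in> Ob ?A'" for y using p.ob_surj[OF that] by blast
  have fullh: "\<exists>g\<in>Arr ?H. Dom ?H g = x \<and> Cod ?H g = y \<and> ?fs g = f"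
    if "x \<in> Ob ?A" "y \<in> Ob ?A" "f \<in> Hor ?A'" "Dom (HC ?A') f = ?e x" "Cod (HC ?A') f = ?e y" for x y f
    by (rule bexI[of _ "(x, f, y)"]) (use that in simp_all)
  have fullv: "\<exists>g\<in>Arr ?V. Dom ?V g = x \<and> Cod ?V g = y \<and> ?fs g = f"
    if "x \<in> Ob ?A" "y \<in> Ob ?A" "f \<in> Ver ?A'" "Dom (VC ?A') f = ?e x" "Cod (VC ?A') f = ?e y" for x y f
    by (rule bexI[of _ "(x, f, y)"]) (use that in simp_all)
  have c1: "ctf q1"
  proof (rule q1.ctf)
    show "\<exists>g\<in>Ver ?A. Dom (VC ?A) g = x \<and> Cod (VC ?A) g = y \<and> onVer p g = f"
      if "x \<in> Obj ?H" "y \<in> Obj ?H" "f \<in> Ver (Trg q1)" "Dom (VC (Trg q1)) f = ?e x" "Cod (VC (Trg q1)) f = ?e y" for x y f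
      using p.ver_full[of x y f] that unfolding T1 pbcat_simps by metis
  qed (use surj fullh T1 in simp_all)
  have c2: "ctf q2"
    by (rule q2.ctf) (use surj fullh fullv T2 in simp_all)
  have g1: "is_functor (HC ?A) ?H (\<lambda>x. x) (\<lambda>f. (Dom (HC ?A) f, onHor p f, Cod (HC ?A) f))"
    by (rule is_functor_into_pbcat[OF p.fh p.D.H.cat]) simp_all
  have g2: "is_functor (VC ?A) (VC ?A) (\<lambda>x. x) (\<lambda>f. f)" by (rule is_functorI) simp_all
  obtain p1 where p1: "p1 \<in> DArr" "Src p1 = ?A" "Trg p1 = Src q1" "dblfun_comp q1 p1 = p"
    "\<forall>x\<in>Ob ?A. go1 (onOb p1 x) = x" "\<forall>x\<in>Hor ?A. gh1 (onHor p1 x) = (Dom (HC ?A) x, onHor p x, Cod (HC ?A) x)"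
    "\<forall>x\<in>Ver ?A. gv1 (onVer p1 x) = x"
    by (rule q1.lift[OF p_in T1[symmetric] g1 g2]) simp_all
  have q1_in: "q1 \<in> DArr" and q2_in: "q2 \<in> DArr" by (rule q1.F_in q2.F_in)+
  have cp1: "ctf p1"
  proof (rule q1.lift_ctf[OF p1(1,3)])
    show "sq_ff (dblfun_comp q1 p1)" using p.F_ff p1(4) by simp
    show "\<exists>x\<in>Ob (Src p1). go1 (onOb p1 x) = y" if "y \<in> Obj ?H" for y
      using that p1(2,5) by auto
  next
    fix x y t assume x: "x \<in> Ob (Src p1)" "y \<in> Ob (Src p1)"
    {
      assume "t \<in> Arr ?H" "Dom ?H t = go1 (onOb p1 x)" "Cod ?H t = go1 (onOb p1 y)"
      then obtain t' where t': "t = (x, t', y)" "t' \<in> Hor ?A'" "Dom (HC ?A') t' = ?e x" "Cod (HC ?A') t' = ?e y"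
        using x p1(2,5) by (cases t) auto
      obtain f where f: "f \<in> Hor ?A" "Dom (HC ?A) f = x" "Cod (HC ?A) f = y" "onHor p f = t'"
        by (rule p.hor_full[OF x[unfolded p1(2)] t'(2-4)])
      then have "gh1 (onHor p1 f) = t" using p1(6) t'(1) by simp
      with f show "\<exists>f\<in>Hor (Src p1). Dom (HC (Src p1)) f = x \<and> Cod (HC (Src p1)) f = y \<and> gh1 (onHor p1 f) = t"
        unfolding p1(2) by blast
    }
    {
      assume "t \<in> Ver ?A" "Dom (VC ?A) t = go1 (onOb p1 x)" "Cod (VC ?A) t = go1 (onOb p1 y)"
      then show "\<exists>f\<in>Ver (Src p1). Dom (VC (Src p1)) f = x \<and> Cod (VC (Src p1)) f = y \<and> gv1 (onVer p1 f) = t"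
        using x p1(5,7) unfolding p1(2) by (intro bexI[of _ t]) simp_all
    }
  qed
  interpret q1c: ctfib q1 using q1_in c1 by unfold_locales
  have o1: "?e (go1 x) = onOb q1 x" if "x \<in> Ob (Src q1)" for x using q1.qo[OF that] by simp
  have go1: "go1 x \<in> Ob ?A" if "x \<in> Ob (Src q1)" for x using q1.go_in[OF that] by simp
  have g3: "is_functor (VC (Src q1)) ?V go1 (\<lambda>f. (go1 (Dom (VC (Src q1)) f), onVer q1 f, go1 (Cod (VC (Src q1)) f)))"
    using is_functor_into_pbcat[OF q1.fv q1.D.V.cat, of go1 "Ob ?A" ?e] go1 o1 unfolding T1 by simp
  obtain p2 where p2: "p2 \<in> DArr" "Src p2 = Src q1" "Trg p2 = Src q2" "dblfun_comp q2 p2 = q1"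
    "\<forall>x\<in>Ob (Src q1). go2 (onOb p2 x) = go1 x" "\<forall>x\<in>Hor (Src q1). gh2 (onHor p2 x) = gh1 x"
    "\<forall>x\<in>Ver (Src q1). gv2 (onVer p2 x) = (go1 (Dom (VC (Src q1)) x), onVer q1 x, go1 (Cod (VC (Src q1)) x))"
    by (rule q2.lift[OF q1_in _ q1.fgh g3]) (simp_all add: T1 T2 o1 q1.qh)
  have jo1: "x = y" if "x \<in> Ob (Src q1)" "y \<in> Ob (Src q1)" "go1 x = go1 y" for x y
    using q1.go that by (auto simp: bij_betw_def dest: inj_onD)
  have cp2: "ctf p2"
  proof (rule q2.lift_ctf[OF p2(1,3)])
    show "sq_ff (dblfun_comp q2 p2)" using q1.F_ff p2(4) by simp
    show "\<exists>x\<in>Ob (Src p2). go2 (onOb p2 x) = y" if "y \<in> Obj ?H" for y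
    proof -
      have "y \<in> go1 ` Ob (Src q1)" using bij_betw_imp_surj_on[OF q1.go] that by simp
      then obtain x where x: "x \<in> Ob (Src q1)" "y = go1 x" by (rule imageE)
      then have "go2 (onOb p2 x) = y" using p2(5) by simp
      with x(1) show ?thesis unfolding p2(2) by (rule bexI[rotated])
    qed
  next
    fix x y t assume x: "x \<in> Ob (Src p2)" "y \<in> Ob (Src p2)"
    then have x': "x \<in> Ob (Src q1)" "y \<in> Ob (Src q1)" using p2(2) by simp_all
    {
      assume t: "t \<in> Arr ?H" "Dom ?H t = go2 (onOb p2 x)" "Cod ?H t = go2 (onOb p2 y)"
      have "t \<in> gh1 ` Hor (Src q1)" using bij_betw_imp_surj_on[OF q1.gh] t(1) by simp
      then obtain f where f: "f \<in> Hor (Src q1)" "gh1 f = t" by (rule imageE) simp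
      have "go1 (Dom (HC (Src q1)) f) = go1 x" "go1 (Cod (HC (Src q1)) f) = go1 y"
        using is_functorD(4,5)[OF q1.fgh f(1)] f(2) t(2,3) p2(5) x' by auto
      then have "Dom (HC (Src q1)) f = x" "Cod (HC (Src q1)) f = y" using f x' by (simp_all add: jo1)
      then show "\<exists>f\<in>Hor (Src p2). Dom (HC (Src p2)) f = x \<and> Cod (HC (Src p2)) f = y \<and> gh2 (onHor p2 f) = t"
        using f p2(6) unfolding p2(2) by auto
    }
    {
      assume t: "t \<in> Arr ?V" "Dom ?V t = go2 (onOb p2 x)" "Cod ?V t = go2 (onOb p2 y)"
      then obtain t' where t': "t = (go1 x, t', go1 y)" "t' \<in> Ver ?A'" "Dom (VC ?A') t' = ?e (go1 x)" "Cod (VC ?A') t' = ?e (go1 y)"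
        using x' p2(5) by (cases t) auto
      obtain f where f: "f \<in> Ver (Src q1)" "Dom (VC (Src q1)) f = x" "Cod (VC (Src q1)) f = y" "onVer q1 f = t'"
        by (rule q1c.ver_full[OF x', of t']) (use t' o1 x' T1 in simp_all)
      then have "gv2 (onVer p2 f) = t" using p2(7) t'(1) by simp
      with f show "\<exists>f\<in>Ver (Src p2). Dom (VC (Src p2)) f = x \<and> Cod (VC (Src p2)) f = y \<and> gv2 (onVer p2 f) = t"
        unfolding p2(2) by blast
    }
  qed
  interpret q2c: ctfib q2 using q2_in c2 by unfold_locales
  \<comment> \<open>A triple is determined by its endpoints together with its middle component, the
    image under \<open>q2\<close>.\<close>
  have ff: "q2c.ff1"
    unfolding q2c.ff1_def
  proof (intro conjI ballI impI)
    fix f g assume f: "f \<in> Hor (Src q2)" "g \<in> Hor (Src q2)" "Dom (HC (Src q2)) f = Dom (HC (Src q2)) g"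
      "Cod (HC (Src q2)) f = Cod (HC (Src q2)) g" "onHor q2 f = onHor q2 g"
    have "fst (gh2 f) = fst (gh2 g)" "snd (snd (gh2 f)) = snd (snd (gh2 g))"
      using is_functorD(4,5)[OF q2.fgh f(1)] is_functorD(4,5)[OF q2.fgh f(2)] f(3,4) by simp_all
    moreover have "?fs (gh2 f) = ?fs (gh2 g)" using f(5) q2.qh[OF f(1)] q2.qh[OF f(2)] by simp
    ultimately have "gh2 f = gh2 g" by (simp add: prod_eq_iff)
    then show "f = g" using q2.gh f(1,2) by (auto simp: bij_betw_def dest: inj_onD)
  next
    fix f g assume f: "f \<in> Ver (Src q2)" "g \<in> Ver (Src q2)" "Dom (VC (Src q2)) f = Dom (VC (Src q2)) g"
      "Cod (VC (Src q2)) f = Cod (VC (Src q2)) g" "onVer q2 f = onVer q2 g"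
    have "fst (gv2 f) = fst (gv2 g)" "snd (snd (gv2 f)) = snd (snd (gv2 g))"
      using is_functorD(4,5)[OF q2.fgv f(1)] is_functorD(4,5)[OF q2.fgv f(2)] f(3,4) by simp_all
    moreover have "?fs (gv2 f) = ?fs (gv2 g)" using f(5) q2.qv[OF f(1)] q2.qv[OF f(2)] by simp
    ultimately have "gv2 f = gv2 g" by (simp add: prod_eq_iff)
    then show "f = g" using q2.gv f(1,2) by (auto simp: bij_betw_def dest: inj_onD)
  qed
  show thesis
  proof (rule that[OF p1(1) p2(1) q2_in _ p2(3) _ cp1 cp2 c2 _ _ _ _ ff])
    show "Trg p1 = Src p2" using p1(3) p2(2) by simp
    show "dblfun_comp (dblfun_comp q2 p2) p1 = p" using p2(4) p1(4) by simp
    show "inj_on (onOb p1) (Ob (Src p1))" by (rule inj_on_inverseI[of _ go1]) (use p1(2,5) in simp)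
    show "inj_on (onVer p1) (Ver (Src p1))" by (rule inj_on_inverseI[of _ gv1]) (use p1(2,7) in simp)
    show "inj_on (onOb p2) (Ob (Src p2))"
      by (rule inj_onI, rule jo1) (use p2(2,5) in \<open>simp_all, metis\<close>)
    show "inj_on (onHor p2) (Hor (Src p2))"
      by (rule inj_onI, rule inj_onD[OF bij_betw_imp_inj_on[OF q1.gh]]) (use p2(2,6) in \<open>simp_all, metis\<close>)
  qed
qed

section \<open>Left properness\<close>

lemma pushout_square_sym: "pushout_square DblCat f g h k \<Longrightarrow> pushout_square DblCat g f k h"
  unfolding pushout_square_def commutative_square_def by (metis (no_types, lifting))

lemma has_lifting_pushout:
  assumes po: "pushout_square DblCat f g h k" and L: "has_lifting DblCat g q" and q: "q \<in> DArr"
  shows "has_lifting DblCat h q"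
  unfolding has_lifting_def
proof (intro allI impI)
  note d = pushout_squareD[OF po]
  fix u v assume "commutative_square DblCat u h q v"
  then have c: "u \<in> DArr" "v \<in> DArr" "Src u = Src h" "Trg u = Src q" "Trg h = Src v" "Trg q = Trg v"
    "dblfun_comp q u = dblfun_comp v h"
    by (simp_all add: commutative_square_def)
  have "dblfun_comp q (dblfun_comp u f) = dblfun_comp (dblfun_comp v h) f"
    using comp_assoc[of f u q] c d q by simp
  also have "\<dots> = dblfun_comp v (dblfun_comp k g)"
    unfolding d(9)[symmetric] by (rule comp_assoc[OF d(1,3) c(2) d(6) c(5), symmetric])
  also have "\<dots> = dblfun_comp (dblfun_comp v k) g"
    by (rule comp_assoc[OF d(2,4) c(2) d(7)]) (use d(8) c(5) in simp)
  finally have "commutative_square DblCat (dblfun_comp u f) g q (dblfun_comp v k)"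
    using c d q by (simp add: commutative_square_def)
  from L[unfolded has_lifting_def, rule_format, OF this]
  obtain l where l: "l \<in> DArr" "Src l = Trg g" "Trg l = Src q" "dblfun_comp l g = dblfun_comp u f"
    "dblfun_comp q l = dblfun_comp v k"
    by (auto simp: arr_betw_def)
  obtain w where w: "w \<in> DArr" "Src w = Trg h" "Trg w = Src q" "dblfun_comp w h = u" "dblfun_comp w k = l"
  proof (rule pushout_square_ex[OF po c(1) l(1)])
    show "Trg f = Src u" "Trg g = Src l" "Trg u = Trg l" "dblfun_comp u f = dblfun_comp l g"
      using c(3,4) d(6) l(2-4) by simp_all
    fix w assume "w \<in> DArr" "Src w = Trg h" "Trg w = Trg u" "dblfun_comp w h = u" "dblfun_comp w k = l"
    then show thesis using that c(4) by simp
  qed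
  have "dblfun_comp q w = v"
  proof (rule pushout_square_uniq[OF po])
    show "dblfun_comp (dblfun_comp q w) h = dblfun_comp v h" using comp_assoc[of h w q] w c d q by simp
    show "dblfun_comp (dblfun_comp q w) k = dblfun_comp v k" using comp_assoc[of k w q] w l d q by simp
  qed (use w c q in simp_all)
  then show "\<exists>l\<in>arr_betw DblCat (Cod DblCat h) (Dom DblCat q). Comp DblCat l h = u \<and> Comp DblCat q l = v"
    using w by (auto simp: arr_betw_def)
qed

text \<open>When the outer rectangle and its first square are pushouts, so is the second square. The
  given pushout of a composite is cut in this way into pushouts of the factors.\<close>

lemma pushout_paste:
  assumes po: "pushout_square DblCat (dblfun_comp f2 f1) g h k" and f: "f1 \<in> DArr" "f2 \<in> DArr" "Trg f1 = Src f2"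
    and po1: "pushout_square DblCat f1 g h1 k1"
  obtains u where "pushout_square DblCat f2 h1 h u" "dblfun_comp u k1 = k"
proof -
  note d = pushout_squareD[OF po] and d1 = pushout_squareD[OF po1]
  have e: "dblfun_comp (dblfun_comp h f2) f1 = dblfun_comp k g" using comp_assoc[of f1 f2 h] f d by simp
  obtain u where u: "u \<in> DArr" "Src u = Trg h1" "Trg u = Trg h" "dblfun_comp u h1 = dblfun_comp h f2" "dblfun_comp u k1 = k"
    using pushout_square_ex[OF po1, of "dblfun_comp h f2" k] e d f by auto
  have "pushout_square DblCat f2 h1 h u"
    unfolding pushout_square_def
  proof (intro conjI allI impI)
    show "commutative_square DblCat f2 h1 h u"
      using u d d1 f by (simp add: commutative_square_def)
    fix h' k' assume "commutative_square DblCat f2 h1 h' k'"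
    then have c: "h' \<in> DArr" "k' \<in> DArr" "Trg f2 = Src h'" "Trg h1 = Src k'" "Trg h' = Trg k'"
      "dblfun_comp h' f2 = dblfun_comp k' h1"
      by (simp_all add: commutative_square_def)
    have k1: "Trg k1 = Src k'" using d1(8) c(4) by simp
    have "dblfun_comp h' (dblfun_comp f2 f1) = dblfun_comp (dblfun_comp h' f2) f1"
      by (rule comp_assoc[OF f(1,2) c(1) f(3) c(3)])
    also have "\<dots> = dblfun_comp k' (dblfun_comp h1 f1)"
      unfolding c(6) by (rule comp_assoc[OF d1(1,3) c(2) d1(6) c(4), symmetric])
    also have "\<dots> = dblfun_comp (dblfun_comp k' k1) g"
      unfolding d1(9) by (rule comp_assoc[OF d1(2,4) c(2) d1(7) k1])
    finally have e1: "dblfun_comp h' (dblfun_comp f2 f1) = dblfun_comp (dblfun_comp k' k1) g" .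
    obtain w where w: "w \<in> DArr" "Src w = Trg h" "Trg w = Trg h'" "dblfun_comp w h = h'"
      "dblfun_comp w k = dblfun_comp k' k1"
      by (rule pushout_square_ex[OF po c(1) comp_DArr[OF d1(4) c(2) k1] _ _ _ e1])
        (use c(3,5) d1(7) in simp_all)
    have hw: "Trg h = Src w" "Trg u = Src w" using w(2) u(3) by simp_all
    have wu: "dblfun_comp w u = k'"
    proof (rule pushout_square_uniq[OF po1])
      show "dblfun_comp (dblfun_comp w u) h1 = dblfun_comp k' h1"
      proof -
        have "dblfun_comp (dblfun_comp w u) h1 = dblfun_comp w (dblfun_comp h f2)"
          unfolding u(4)[symmetric] by (rule comp_assoc[OF d1(3) u(1) w(1) u(2)[symmetric] hw(2), symmetric])
        also have "\<dots> = dblfun_comp (dblfun_comp w h) f2"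
          by (rule comp_assoc[OF f(2) d(3) w(1) _ hw(1)]) (use d(6) in simp)
        finally show ?thesis unfolding w(4) c(6) .
      qed
      show "dblfun_comp (dblfun_comp w u) k1 = dblfun_comp k' k1"
        unfolding w(5)[symmetric] u(5)[symmetric]
        by (rule comp_assoc[OF d1(4) u(1) w(1) _ hw(2), symmetric]) (use d1(8) u(2) in simp)
    qed (use u w c in simp_all)
    show "\<exists>!w. w \<in> arr_betw DblCat (Cod DblCat h) (Cod DblCat h') \<and> Comp DblCat w h = h' \<and> Comp DblCat w u = k'"
    proof (rule ex1I[of _ w])
      show "w \<in> arr_betw DblCat (Cod DblCat h) (Cod DblCat h') \<and> Comp DblCat w h = h' \<and> Comp DblCat w u = k'"
        using w wu by (simp add: arr_betw_def)
      fix z assume "z \<in> arr_betw DblCat (Cod DblCat h) (Cod DblCat h') \<and> Comp DblCat z h = h' \<and> Comp DblCat z u = k'"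
      then have z: "z \<in> DArr" "Src z = Trg h" "Trg z = Trg h'" "dblfun_comp z h = h'" "dblfun_comp z u = k'"
        by (simp_all add: arr_betw_def)
      have "dblfun_comp z k = dblfun_comp k' k1"
        unfolding z(5)[symmetric] u(5)[symmetric]
        by (rule comp_assoc[OF d1(4) u(1) z(1)]) (use d1(8) u(2,3) z(2) in simp_all)
      then show "z = w"
        by (intro pushout_square_uniq[OF po z(1) w(1)]) (use z w in simp_all)
    qed
  qed
  with u show thesis using that by blast
qed

text \<open>The first two factors of \<open>p\<close> yield only retracts of canonical trivial
  fibrations, hence the assumption of closure under retracts. The cofibration is replaced at each
  stage by its pushout, which keeps the lifting property.\<close>

lemma (in univ) ctf_pushout:
  fixes p i i' p' :: "'a dblfun"
  assumes cr: "closed_under_retracts DblCat {F \<in> (DArr :: 'a dblfun set). ctf F}"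
    and po: "pushout_square DblCat p i i' p'" and p: "ctf p" and L: "llp_ctf i"
  shows "ctf p'"
proof -
  have p_in: "p \<in> DArr" by (rule pushout_squareD(1)[OF po])
  obtain p1 p2 p3 where f: "p1 \<in> DArr" "p2 \<in> DArr" "p3 \<in> DArr" "Trg p1 = Src p2" "Trg p2 = Src p3"
    "dblfun_comp (dblfun_comp p3 p2) p1 = p" "ctf p1" "ctf p2" "ctf p3"
    "inj_on (onOb p1) (Ob (Src p1))" "inj_on (onVer p1) (Ver (Src p1))"
    "inj_on (onOb p2) (Ob (Src p2))" "inj_on (onHor p2) (Hor (Src p2))" "ctfib.ff1 p3"
    by (rule ctf_factorization[OF p_in p])
  have llp: "llp_ctf h" if "pushout_square DblCat f g h k" "llp_ctf g" for f g h k :: "'a dblfun"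
    using has_lifting_pushout[OF that(1)] that(2) pushout_squareD(3)[OF that(1)] unfolding llp_ctf_def by blast
  have ret: "ctf k" if ex: "\<exists>r. r \<in> DArr \<and> ctf r \<and> retract_of DblCat k r" for k :: "'a dblfun"
  proof -
    obtain r where "r \<in> DArr" "ctf r" "retract_of DblCat k r" using ex by (elim exE conjE)
    then have "k \<in> {F \<in> DArr. ctf F}"
      using cr[unfolded closed_under_retracts_def, rule_format, of k r] by simp
    then show ?thesis by simp
  qed
  have i_in: "i \<in> DArr" using L by (simp add: llp_ctf_def)
  note d = pushout_squareD[OF po]
  have s1: "Src p1 = Src i" using f(6) d(5) by auto
  obtain i1 k1 where po1: "pushout_square DblCat p1 i i1 k1" using pushout_exists[OF f(1) i_in s1] by blast
  have c1: "ctf k1" by (rule ret[OF retract_type1[OF po1 f(7,10,11) L]])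
  have L1: "llp_ctf i1" by (rule llp[OF po1 L])
  obtain u1 where u1: "pushout_square DblCat (dblfun_comp p3 p2) i1 i' u1" "dblfun_comp u1 k1 = p'"
    by (rule pushout_paste[OF po[folded f(6)] f(1) _ _ po1]) (use f in simp_all)
  have i1_in: "i1 \<in> DArr" and s2: "Src p2 = Src i1" using pushout_squareD[OF po1] f(4) by simp_all
  obtain i2 k2 where po2: "pushout_square DblCat p2 i1 i2 k2" using pushout_exists[OF f(2) i1_in s2] by blast
  have c2: "ctf k2" by (rule ret[OF retract_type2[OF po2 f(8,12,13) L1]])
  have L2: "llp_ctf i2" by (rule llp[OF po2 L1])
  obtain u2 where u2: "pushout_square DblCat p3 i2 i' u2" "dblfun_comp u2 k2 = u1"
    by (rule pushout_paste[OF u1(1) f(2,3,5) po2])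
  have c3: "ctf u2" by (rule pushout_type3[OF u2(1) f(9,14) L2])
  note e1 = pushout_squareD[OF po1] and e2 = pushout_squareD[OF po2] and e3 = pushout_squareD[OF u2(1)] and e4 = pushout_squareD[OF u1(1)]
  have "ctf u1" unfolding u2(2)[symmetric] by (rule ctf_comp[OF e2(4) c2 e3(4) c3]) (use e2 e3 in simp)
  then show ?thesis unfolding u1(2)[symmetric] using ctf_comp[OF e1(4) c1 e4(4)] e1 e4 by simp
qed

theorem theorem4p10:
  fixes W Cof Fib :: "'a dblfun set"
  assumes "universe TYPE('a)"
    and "model_structure DblCat W Cof Fib"
    and "Fib \<inter> W = {F \<in> Arr DblCat. canonical_trivial_fibration F}"
  shows "left_proper DblCat W Cof"
proof -
  interpret univ "TYPE('a)" by unfold_locales (rule assms(1))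
  note ms = assms(2)[unfolded model_structure_def]
  have W: "W \<subseteq> DArr" and tot: "two_of_three DblCat W" and retW: "closed_under_retracts DblCat W"
    and retF: "closed_under_retracts DblCat Fib"
    and ca: "\<And>j q. j \<in> Cof \<inter> W \<Longrightarrow> q \<in> Fib \<Longrightarrow> has_lifting DblCat j q"
    and cb: "\<And>j q. j \<in> Cof \<Longrightarrow> q \<in> Fib \<inter> W \<Longrightarrow> has_lifting DblCat j q"
    and CF: "Cof \<subseteq> DArr" "Fib \<subseteq> DArr"
    and fac: "\<And>f. f \<in> DArr \<Longrightarrow> \<exists>j \<in> Cof \<inter> W. \<exists>q \<in> Fib. Cod DblCat j = Dom DblCat q \<and> Comp DblCat q j = f"
    using ms by simp_all
  \<comment> \<open>\<open>Fib\<close> and \<open>W\<close> are each closed under retracts, hence so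
    is their intersection.\<close>
  have cr: "closed_under_retracts DblCat {F \<in> (DArr :: 'a dblfun set). ctf F}"
    unfolding assms(3)[symmetric] using retW retF unfolding closed_under_retracts_def by blast
  have llp: "llp_ctf j" if "j \<in> Cof" for j
    using that cb[OF that] CF(1) assms(3) unfolding llp_ctf_def by blast
  have tt: "(f \<in> W \<and> g \<in> W \<longrightarrow> dblfun_comp g f \<in> W) \<and> (f \<in> W \<and> dblfun_comp g f \<in> W \<longrightarrow> g \<in> W)"
    if "f \<in> DArr" "g \<in> DArr" "Trg f = Src g" for f g
  proof -
    have "Cod DblCat f = Dom DblCat g" using that(3) by simp
    from mp[OF bspec[OF bspec[OF tot[unfolded two_of_three_def] that(1)] that(2)] this]
    show ?thesis unfolding DblCat_simps by (elim conjE) (rule conjI)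
  qed
  have tot': "dblfun_comp g f \<in> W" if "f \<in> W" "g \<in> W" "Trg f = Src g" for f g
    using tt[OF subsetD[OF W that(1)] subsetD[OF W that(2)] that(3)] that by simp
  have tot'': "g \<in> W" if "f \<in> W" "g \<in> DArr" "Trg f = Src g" "dblfun_comp g f \<in> W" for f g
    using tt[OF subsetD[OF W that(1)] that(2,3)] that by simp
  show ?thesis
    unfolding left_proper_def
  proof (intro allI impI)
    fix w i i' w' assume po: "pushout_square DblCat w i i' w'" and w: "w \<in> W" and i: "i \<in> Cof"
    note d = pushout_squareD[OF po]
    obtain j p where j: "j \<in> Cof" "j \<in> W" and p: "p \<in> Fib" and jp: "Trg j = Src p" "dblfun_comp p j = w"
      using fac[OF d(1)] by auto
    have j_in: "j \<in> DArr" and p_in: "p \<in> DArr" using j p CF by auto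
    \<comment> \<open>Two out of three for \<open>w = p j\<close>, which upgrades the fibration
      \<open>p\<close> to a canonical trivial fibration.\<close>
    have "p \<in> W" by (rule tot''[OF j(2) p_in jp(1)]) (use jp w in simp)
    then have p_ctf: "ctf p" using p assms(3) by blast
    have "Src j = Src i" using jp(2) d(5) by auto
    then obtain i1 j1 where po1: "pushout_square DblCat j i i1 j1"
      using pushout_exists[OF j_in d(2)] by blast
    note d1 = pushout_squareD[OF po1]
    obtain u where u: "pushout_square DblCat p i1 i' u" "dblfun_comp u j1 = w'"
      by (rule pushout_paste[OF po[folded jp(2)] j_in p_in jp(1) po1])
    have "llp_ctf i1"
      using has_lifting_pushout[OF po1] llp[OF i] d1(3) unfolding llp_ctf_def by blast
    then have "ctf u" by (rule ctf_pushout[OF cr u(1) p_ctf])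
    then have uW: "u \<in> W" using assms(3) pushout_squareD(4)[OF u(1)] by blast
    \<comment> \<open>Retract argument: \<open>j1\<close>, as a pushout of a trivial cofibration,
      lifts against the fibration \<open>q\<close> of its own factorization \<open>q c\<close>,
      which makes it a retract of the trivial cofibration \<open>c\<close>.\<close>
    obtain c q where c: "c \<in> Cof" "c \<in> W" and q: "q \<in> Fib" and cq: "Trg c = Src q" "dblfun_comp q c = j1"
      using fac[OF d1(4)] by auto
    have c_in: "c \<in> DArr" and q_in: "q \<in> DArr" using c q CF by auto
    have "has_lifting DblCat j q" using ca j q by blast
    then have "has_lifting DblCat j1 q" by (rule has_lifting_pushout[OF pushout_square_sym[OF po1] _ q_in])
    moreover have sc: "Src c = Src j1" "Trg q = Trg j1" using cq(2) by auto
    have "commutative_square DblCat c j1 q (dblfun_id (Trg j1))"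
      using c_in q_in d1(4) cq sc by (simp add: commutative_square_def)
    ultimately obtain l where l: "l \<in> DArr" "Src l = Trg j1" "Trg l = Src q" "dblfun_comp l j1 = c"
      "dblfun_comp q l = dblfun_id (Trg j1)"
      unfolding has_lifting_def arr_betw_def by auto
    have "retract_of DblCat j1 c"
      unfolding retract_of_def commutative_square_def
      by (rule exI[of _ "dblfun_id (Src j1)"], rule exI[of _ "dblfun_id (Src j1)"], rule exI[of _ l], rule exI[of _ q])
        (use l c_in q_in d1(4) cq sc in simp)
    then have "j1 \<in> W" using retW c(2) unfolding closed_under_retracts_def by blast
    then have "dblfun_comp u j1 \<in> W"
      by (rule tot'[OF _ uW]) (use d1 pushout_squareD[OF u(1)] in simp)
    then show "w' \<in> W" using u(2) by simp
  qed
qed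

end
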